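(* Let $\beta>0$ and $x>\beta$ be fixed, and let $p=p_n\ge n$. Let $\lambda_{(1)}$ be the largest eigenvalue of the $\beta$-Laguerre ensemble with parameters $(n,p,\beta)$. Define $$\begin{aligned} B_{n,p,\beta}(x)=\;& p\left(\frac{\beta}{2}-\frac{\beta}{2}\log\beta-\frac{x}{2}+\frac{\beta}{2}\log x\right)+\frac{\beta n}{2}\log \frac{p}{n} -\frac{\beta+1}{2}\log p\\ &+\beta n\left(-\frac{\log x}{2}+\log(x-\beta)-\frac{\log\beta}{2}+\frac{1}{2}\right)+\frac{1}{2}\log n-\frac{\beta^3n^{2}}{2(x-\beta)^2p}\\ &-(\beta+1)\log(x-\beta)+\frac{\beta}{2}\log (2x)-\log \pi+\log\Gamma\Big(1+\frac{\beta}{2}\Big). \end{aligned}$$ (a) If $p/n^{5/3}\to\infty$ as $n\to\infty$, then $$P(\lambda_{(1)}>px)\sim \exp\big(B_{n,p,\beta}(x)\big).$$ (b) More generally, if $n\to\infty$ and $p/n\to\infty$, then $$\log P(\lambda_{(1)}>px)=B_{n,p,\beta}(x)+O(1)\,\frac{n^{5/2}}{p^{3/2}}.$$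
   Context: The $\beta$-Laguerre ensemble with parameters $(n,p,\beta)$, $p\ge n$, $\beta>0$: random $(\lambda_1,\dots,\lambda_n)\in(0,\infty)^n$ with density $$f_{n,p,\beta}(\lambda_1,\dots,\lambda_n)=c_{n,p,\beta}\prod_{1\le i<j\le n}|\lambda_i-\lambda_j|^{\beta}\prod_{i=1}^n\lambda_i^{\frac{\beta(p-n+1)}{2}-1}e^{-\frac12\sum_{i=1}^n\lambda_i},\qquad c_{n,p,\beta}=2^{-\frac{\beta np}{2}}\prod_{j=1}^n\frac{\Gamma(1+\frac\beta2)}{\Gamma(1+\frac\beta2 j)\,\Gamma(\frac\beta2(p-n+j))}.$$ The order statistics are $\lambda_{(1)}>\cdots>\lambda_{(n)}$. Here $a_n\sim b_n$ means $a_n/b_n\to1$ as $n\to\infty$, and $O(1)$ denotes a sequence bounded as $n\to\infty$.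
   Formalization: In (b) the error is O(1)(n^{5/2}/p^{3/2} + 1/n): without 1/n the claim fails when p grows much faster than n^{7/3}, since B uses Stirling's formula for Γ(1+βn/2), whose remainder is about 1/(6βn); for p = O(n^{7/3}) the two bounds agree. *)

theory Defs
  imports "HOL-Probability.Probability" "HOL-Library.Landau_Symbols"
begin

text \<open>A point \<open>(\<lambda>\<^sub>1, \<dots>, \<lambda>\<^sub>n)\<close> is a function \<open>l :: nat \<Rightarrow> real\<close> in the
  extensional product space over the index set \<open>{1..n}\<close>. The parameter \<open>p\<close> is
  real: the density makes sense for every real \<open>p > n - 1\<close>.\<close>

definition laguerre_const :: "nat \<Rightarrow> real \<Rightarrow> real \<Rightarrow> real" where
  "laguerre_const n p \<beta> =
     2 powr (- (\<beta> * real n * p / 2)) *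
     (\<Prod>j=1..n. Gamma (1 + \<beta> / 2) /
        (Gamma (1 + \<beta> / 2 * real j) * Gamma (\<beta> / 2 * (p - real n + real j))))"

definition laguerre_density :: "nat \<Rightarrow> real \<Rightarrow> real \<Rightarrow> (nat \<Rightarrow> real) \<Rightarrow> real" where
  "laguerre_density n p \<beta> l =
     (if \<forall>i\<in>{1..n}. 0 < l i then
        laguerre_const n p \<beta> *
        (\<Prod>j=1..n. \<Prod>i=1..<j. \<bar>l i - l j\<bar> powr \<beta>) *
        (\<Prod>i=1..n. l i powr (\<beta> * (p - real n + 1) / 2 - 1)) *
        exp (- (1 / 2) * (\<Sum>i=1..n. l i))
      else 0)"

definition laguerre_ensemble :: "nat \<Rightarrow> real \<Rightarrow> real \<Rightarrow> (nat \<Rightarrow> real) measure" where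
  "laguerre_ensemble n p \<beta> =
     density (Pi\<^sub>M {1..n} (\<lambda>_. lborel)) (\<lambda>l. ennreal (laguerre_density n p \<beta> l))"

text \<open>The top order statistic \<open>\<lambda>\<^sub>(\<^sub>1\<^sub>)\<close>; meaningful for \<open>n \<ge> 1\<close>.\<close>

definition largest_eigenvalue :: "nat \<Rightarrow> (nat \<Rightarrow> real) \<Rightarrow> real" where
  "largest_eigenvalue n l = Max (l ` {1..n})"

text \<open>In \<open>B_fun\<close> the factor \<open>Gamma (1 + \<beta> n / 2)\<close> that arises from the normalising
  constants is replaced by its Stirling approximation. For fixed \<open>n\<close> and \<open>p \<rightarrow> \<infinity>\<close> the logarithm
  of the tail probability therefore differs from \<open>B_fun\<close> by minus the Stirling remainder,
  \<open>1 / (6 \<beta> n) + O(1 / n^3)\<close>, in the limit; an error bound uniform in \<open>p\<close> has to contain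
  a term of order \<open>1 / n\<close>.\<close>

definition B_fun :: "nat \<Rightarrow> real \<Rightarrow> real \<Rightarrow> real \<Rightarrow> real" where
  "B_fun n p \<beta> x =
     p * (\<beta> / 2 - \<beta> / 2 * ln \<beta> - x / 2 + \<beta> / 2 * ln x)
     + \<beta> * real n / 2 * ln (p / real n) - (\<beta> + 1) / 2 * ln p
     + \<beta> * real n * (- (ln x / 2) + ln (x - \<beta>) - ln \<beta> / 2 + 1 / 2)
     + 1 / 2 * ln (real n) - \<beta> ^ 3 * (real n)\<^sup>2 / (2 * (x - \<beta>)\<^sup>2 * p)
     - (\<beta> + 1) * ln (x - \<beta>) + \<beta> / 2 * ln (2 * x) - ln pi + ln (Gamma (1 + \<beta> / 2))"

end

theory Submission
  imports Defs
begin

text \<open>Conditionally on the largest particle sitting at \<open>y > p x\<close>, the other \<open>n - 1\<close> particles contribute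
  a Selberg-type integral with weight \<open>(y - \<lambda>)\<^sup>\<beta>\<close> times the Laguerre weight. As
  the particles concentrate around \<open>s\<^sub>0 = \<beta> p\<close>, write \<open>\<lambda> = s\<^sub>0 (1 + z)\<close>: up to a cubic remainder in
  \<open>z\<close>, the factor \<open>(y - \<lambda>)\<^sup>\<beta>\<close> coincides with a change of the two parameters of the Laguerre weight,
  so the integral is a Laguerre partition function with shifted parameters, known explicitly. That
  evaluation follows from integration by parts (an Aomoto-type recursion for moments) and
  log-convexity, as in the Bohr-Mollerup theorem. By Jensen's inequality the remainder costs the mean of
  \<open>\<Sum>\<bar>z\<bar>\<^sup>3 = O(n (n/p)\<^bsup>3/2\<^esup>)\<close>; this moment bound is obtained by comparing the ensemble with its image
  under a contraction of all particles. The remaining integral over \<open>y\<close> is dominated by its endpoint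
  \<open>y = p x\<close>, and Stirling's formula turns the Gamma functions into \<open>B_fun\<close>, with an error \<open>O(1/n)\<close>.\<close>

section \<open>Substitution in product Lebesgue measure\<close>

text \<open>For \<open>\<beta> \<le> 1\<close> the interaction is not differentiable at ties, so
  integration by parts is done with squared distances raised by a small \<delta>; the limit is taken
  once the interaction terms have been symmetrised. The resulting recursion fixes the partition
  function only up to a factor free of the weight exponent \<open>a\<close>. That factor comes from
  \<open>a\<close> tending to 0: the smallest particle collapses onto 0 and leaves one particle
  fewer, with exponent \<beta>. The tilt remainder is cubic, so a second-order moment bound is not
  enough. Halving all displacements controls a second-order statistic, a contraction moving
  \<open>z\<close> by about \<open>z^3 / 6\<close> controls a fourth-order one, and Young's
  inequality combines them. The scale is \<open>\<theta> = sqrt (n / p)\<close>, up to a constant,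
  whence \<open>n * \<theta>^3 = n^(5/2) / p^(3/2)\<close>. The lower bound needs a cut-off: the
  true weight vanishes above \<open>y\<close>, the shifted Laguerre weight does not, so
  configurations with particles far above \<open>s0\<close> must be shown negligible for the latter.
  All estimates are explicit inequalities for \<open>p \<ge> K * n\<close>, with constants depending
  on \<beta> and \<open>x\<close> only; they survive the integration over \<open>y\<close> and serve
  both parts of the theorem.\<close>

abbreviation lebP :: "nat set \<Rightarrow> (nat \<Rightarrow> real) measure" where
  "lebP I \<equiv> Pi\<^sub>M I (\<lambda>_. lborel)"

interpretation lborel_product: product_sigma_finite "\<lambda>_::nat. lborel :: real measure"
  by standard

text \<open>Boxes determine the product measure, and a swap only permutes the factors of the volume
  of a box. This exchangeability later symmetrises the interaction terms of the moment
  recursion.\<close>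

lemma distr_lebP_transpose:
  assumes "finite I" "i \<in> I" "j \<in> I"
  shows "distr (lebP I) (lebP I) (\<lambda>l. \<lambda>k\<in>I. l (Transposition.transpose i j k)) = lebP I"
proof (rule lborel_product.PiM_eqI)
  have tr: "Transposition.transpose i j k \<in> I" if "k \<in> I" for k
    using that assms by (auto simp: Transposition.transpose_def)
  have meas[measurable]: "(\<lambda>l. \<lambda>k\<in>I. l (Transposition.transpose i j k)) \<in> measurable (lebP I) (lebP I)"
    by (intro measurable_restrict measurable_component_singleton tr)
  fix A :: "nat \<Rightarrow> real set" assume A: "\<And>k. k \<in> I \<Longrightarrow> A k \<in> sets lborel"
  have "(\<lambda>l. \<lambda>k\<in>I. l (Transposition.transpose i j k)) -` Pi\<^sub>E I A \<inter> space (lebP I)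
      = Pi\<^sub>E I (\<lambda>k. A (Transposition.transpose i j k))"
  proof (intro set_eqI iffI)
    fix l assume l: "l \<in> (\<lambda>l. \<lambda>k\<in>I. l (Transposition.transpose i j k)) -` Pi\<^sub>E I A \<inter> space (lebP I)"
    have "l k \<in> A (Transposition.transpose i j k)" if "k \<in> I" for k
    proof -
      have "(\<lambda>k\<in>I. l (Transposition.transpose i j k)) (Transposition.transpose i j k) \<in> A (Transposition.transpose i j k)"
        using l tr[OF that] by (auto simp: PiE_iff)
      then show ?thesis using tr[OF that] by simp
    qed
    then show "l \<in> Pi\<^sub>E I (\<lambda>k. A (Transposition.transpose i j k))"
      using l by (auto simp: space_PiM PiE_iff)
  next
    fix l assume l: "l \<in> Pi\<^sub>E I (\<lambda>k. A (Transposition.transpose i j k))"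
    have "l (Transposition.transpose i j k) \<in> A k" if "k \<in> I" for k
      using l tr[OF that] by (force simp: PiE_iff)
    then show "l \<in> (\<lambda>l. \<lambda>k\<in>I. l (Transposition.transpose i j k)) -` Pi\<^sub>E I A \<inter> space (lebP I)"
      using l by (auto simp: space_PiM PiE_iff)
  qed
  then have "emeasure (distr (lebP I) (lebP I) (\<lambda>l. \<lambda>k\<in>I. l (Transposition.transpose i j k))) (Pi\<^sub>E I A)
      = emeasure (lebP I) (Pi\<^sub>E I (\<lambda>k. A (Transposition.transpose i j k)))"
    using A by (subst emeasure_distr) (auto intro!: sets_PiM_I_finite assms)
  also have "\<dots> = (\<Prod>k\<in>I. emeasure lborel (A (Transposition.transpose i j k)))"
    using A tr by (intro lborel_product.emeasure_PiM) (auto simp: assms)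
  also have "\<dots> = (\<Prod>k\<in>I. emeasure lborel (A k))"
    by (rule prod.reindex_bij_witness[of _ "Transposition.transpose i j" "Transposition.transpose i j"]) (auto simp: tr)
  finally show "emeasure (distr (lebP I) (lebP I) (\<lambda>l. \<lambda>k\<in>I. l (Transposition.transpose i j k))) (Pi\<^sub>E I A)
      = (\<Prod>k\<in>I. emeasure lborel (A k))" .
qed (auto simp: assms)

lemma integral_lebP_transpose:
  fixes f :: "(nat \<Rightarrow> real) \<Rightarrow> real"
  assumes "finite I" "i \<in> I" "j \<in> I" and f: "f \<in> borel_measurable (lebP I)"
  shows "(\<integral>l. f (\<lambda>k\<in>I. l (Transposition.transpose i j k)) \<partial>lebP I) = (\<integral>l. f l \<partial>lebP I)"
proof -
  have meas: "(\<lambda>l. \<lambda>k\<in>I. l (Transposition.transpose i j k)) \<in> measurable (lebP I) (lebP I)"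
    using assms by (intro measurable_restrict measurable_component_singleton) (auto simp: Transposition.transpose_def)
  have "(\<integral>l. f l \<partial>lebP I) = (\<integral>l. f l \<partial>distr (lebP I) (lebP I) (\<lambda>l. \<lambda>k\<in>I. l (Transposition.transpose i j k)))"
    using distr_lebP_transpose[OF assms(1-3)] by simp
  also have "\<dots> = (\<integral>l. f (\<lambda>k\<in>I. l (Transposition.transpose i j k)) \<partial>lebP I)"
    by (rule integral_distr[OF meas f])
  finally show ?thesis by simp
qed

text \<open>On \<open>{-n..n}\<close> the substitution is exact and covers the image interval; these
  intervals exhaust the line monotonically. Only an inequality can result because \<open>g\<close>
  need not be onto, and an inequality is all that the moment bounds use.\<close>

lemma nn_integral_substitution_le:
  fixes f :: "real \<Rightarrow> ennreal" and g g' :: "real \<Rightarrow> real"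
  assumes [measurable]: "f \<in> borel_measurable borel"
    and deriv: "\<And>x. (g has_real_derivative g' x) (at x)"
    and cont: "continuous_on UNIV g'" and nonneg: "\<And>x. 0 \<le> g' x"
  shows "(\<integral>\<^sup>+x. f (g x) * ennreal (g' x) \<partial>lborel) \<le> (\<integral>\<^sup>+x. f x \<partial>lborel)"
proof -
  have contg: "continuous_on UNIV g"
    using deriv by (intro DERIV_continuous_on) (auto intro: DERIV_subset)
  have [measurable]: "g \<in> borel_measurable borel" "g' \<in> borel_measurable borel"
    using contg cont by (auto intro: borel_measurable_continuous_onI)
  have sub: "(\<integral>\<^sup>+x. f (g x) * ennreal (g' x) * indicator {-real n..real n} x \<partial>lborel) \<le> (\<integral>\<^sup>+x. f x \<partial>lborel)" for n :: nat
  proof (cases "n = 0")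
    case True
    \<comment> \<open>For \<open>n = 0\<close> the interval is a single point, hence a null set; the
      interval rule is applied with distinct endpoints only.\<close>
    have "AE x in lborel. x \<noteq> (0::real)" by (rule AE_lborel_singleton)
    then have "(\<integral>\<^sup>+x. f (g x) * ennreal (g' x) * indicator {-real n..real n} x \<partial>lborel) = (\<integral>\<^sup>+(x::real). 0 \<partial>lborel)"
      using True by (intro nn_integral_cong_AE) auto
    then show ?thesis by simp
  next
    case False
    have "(\<integral>\<^sup>+x. f x * indicator {g (- real n)..g (real n)} x \<partial>lborel) =
             (\<integral>\<^sup>+x. f (g x) * ennreal (g' x) * indicator {-real n..real n} x \<partial>lborel)"
      using False by (intro nn_integral_substitution_aux deriv nonneg continuous_on_subset[OF cont]) auto
    then have "(\<integral>\<^sup>+x. f (g x) * ennreal (g' x) * indicator {-real n..real n} x \<partial>lborel) =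
       (\<integral>\<^sup>+x. f x * indicator {g (- real n)..g (real n)} x \<partial>lborel)" by simp
    also have "\<dots> \<le> (\<integral>\<^sup>+x. f x \<partial>lborel)"
      by (intro nn_integral_mono) (auto simp: indicator_def)
    finally show ?thesis .
  qed
  have "(\<integral>\<^sup>+x. f (g x) * ennreal (g' x) \<partial>lborel)
     = (\<integral>\<^sup>+x. (SUP n::nat. f (g x) * ennreal (g' x) * indicator {-real n..real n} x) \<partial>lborel)"
  proof (intro nn_integral_cong)
    fix x :: real
    obtain n :: nat where n: "\<bar>x\<bar> \<le> real n" using real_arch_simple by blast
    show "f (g x) * ennreal (g' x) = (SUP n::nat. f (g x) * ennreal (g' x) * indicator {-real n..real n} x)"
    proof (rule antisym)
      show "f (g x) * ennreal (g' x) \<le> (SUP n::nat. f (g x) * ennreal (g' x) * indicator {-real n..real n} x)"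
        using n by (intro SUP_upper2[of n]) (auto simp: indicator_def)
    qed (auto intro!: SUP_least simp: indicator_def)
  qed
  also have "\<dots> = (SUP n::nat. \<integral>\<^sup>+x. f (g x) * ennreal (g' x) * indicator {-real n..real n} x \<partial>lborel)"
    by (intro nn_integral_monotone_convergence_SUP)
       (auto simp: incseq_def le_fun_def indicator_def)
  also have "\<dots> \<le> (\<integral>\<^sup>+x. f x \<partial>lborel)"
    by (intro SUP_least sub)
  finally show ?thesis .
qed

text \<open>The same one-dimensional map acts on every coordinate, so the Jacobian is a product and
  no multivariate change of variables is required: Fubini peels off one coordinate per induction
  step.\<close>

lemma nn_integral_lebP_substitution_le:
  fixes f :: "(nat \<Rightarrow> real) \<Rightarrow> ennreal" and g g' :: "real \<Rightarrow> real"
  assumes I: "finite I" and f: "f \<in> borel_measurable (lebP I)"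
    and deriv: "\<And>x. (g has_real_derivative g' x) (at x)"
    and cont: "continuous_on UNIV g'" and nonneg: "\<And>x. 0 \<le> g' x"
  shows "(\<integral>\<^sup>+l. f (\<lambda>k\<in>I. g (l k)) * (\<Prod>k\<in>I. ennreal (g' (l k))) \<partial>lebP I) \<le> (\<integral>\<^sup>+l. f l \<partial>lebP I)"
  using I f
proof (induction I arbitrary: f)
  case empty
  have "(\<lambda>k\<in>{}. g (l k)) = l" if "l \<in> space (lebP {})" for l
    using that by (auto simp: space_PiM)
  then have "(\<integral>\<^sup>+l. f (\<lambda>k\<in>{}. g (l k)) * (\<Prod>k\<in>{}. ennreal (g' (l k))) \<partial>lebP {}) = (\<integral>\<^sup>+l. f l \<partial>lebP {})"
    by (intro nn_integral_cong) simp
  then show ?case by (rule eq_refl)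
next
  case (insert i I)
  note [measurable] = insert.prems
  have contg: "continuous_on UNIV g"
    using deriv by (intro DERIV_continuous_on) (auto intro: DERIV_subset)
  have [measurable]: "g \<in> borel_measurable borel" "g' \<in> borel_measurable borel"
    using contg cont by (auto intro: borel_measurable_continuous_onI)
  have upd: "(\<lambda>k\<in>insert i I. g ((x(i := y)) k)) = (\<lambda>k\<in>I. g (x k))(i := g y)" for x y
    using insert.hyps by (auto simp: fun_eq_iff)
  have pr: "(\<Prod>k\<in>insert i I. ennreal (g' ((x(i := y)) k))) = ennreal (g' y) * (\<Prod>k\<in>I. ennreal (g' (x k)))" for x y
    using insert.hyps by (simp, intro arg_cong[where f="\<lambda>z. _ * z"] prod.cong) auto
  have m1: "(\<lambda>l. f (\<lambda>k\<in>insert i I. g (l k)) * (\<Prod>k\<in>insert i I. ennreal (g' (l k)))) \<in> borel_measurable (lebP (insert i I))"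
  proof -
    have "(\<lambda>l. \<lambda>k\<in>insert i I. g (l k)) \<in> measurable (lebP (insert i I)) (lebP (insert i I))"
      by (intro measurable_restrict) measurable
    from measurable_compose[OF this insert.prems]
    have [measurable]: "(\<lambda>l. f (\<lambda>k\<in>insert i I. g (l k))) \<in> borel_measurable (lebP (insert i I))" .
    show ?thesis by measurable
  qed
  have m2: "(\<lambda>x. f (x(i := y))) \<in> borel_measurable (lebP I)" for y
    by (rule measurable_compose[OF _ insert.prems]) (measurable; simp)
  have m4: "(\<lambda>(x, y). f (x(i := y))) \<in> borel_measurable (lebP I \<Otimes>\<^sub>M lborel)"
    using measurable_compose[OF measurable_add_dim insert.prems] by (simp add: split_beta' case_prod_beta')
  interpret pair_sigma_finite "lebP I" lborel
    using lborel_product.sigma_finite[OF insert.hyps(1)]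
    by (simp add: pair_sigma_finite_def sigma_finite_lborel)
  have "(\<integral>\<^sup>+l. f (\<lambda>k\<in>insert i I. g (l k)) * (\<Prod>k\<in>insert i I. ennreal (g' (l k))) \<partial>lebP (insert i I))
     = (\<integral>\<^sup>+y. \<integral>\<^sup>+x. f ((\<lambda>k\<in>I. g (x k))(i := g y)) * (ennreal (g' y) * (\<Prod>k\<in>I. ennreal (g' (x k)))) \<partial>lebP I \<partial>lborel)"
    by (subst lborel_product.product_nn_integral_insert_rev[OF insert.hyps m1]) (simp only: upd pr)
  also have "\<dots> \<le> (\<integral>\<^sup>+y. (\<integral>\<^sup>+x. f (x(i := g y)) \<partial>lebP I) * ennreal (g' y) \<partial>lborel)"
  proof (intro nn_integral_mono)
    fix y :: real
    have "(\<lambda>x. \<lambda>k\<in>I. g (x k)) \<in> measurable (lebP I) (lebP I)"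
      by (intro measurable_restrict) measurable
    from measurable_compose[OF this m2]
    have [measurable]: "(\<lambda>x. f ((\<lambda>k\<in>I. g (x k))(i := g y))) \<in> borel_measurable (lebP I)" .
    have "(\<integral>\<^sup>+x. f ((\<lambda>k\<in>I. g (x k))(i := g y)) * (ennreal (g' y) * (\<Prod>k\<in>I. ennreal (g' (x k)))) \<partial>lebP I)
       = (\<integral>\<^sup>+x. ennreal (g' y) * (f ((\<lambda>k\<in>I. g (x k))(i := g y)) * (\<Prod>k\<in>I. ennreal (g' (x k)))) \<partial>lebP I)"
      by (simp add: mult_ac)
    also have "\<dots> = ennreal (g' y) * (\<integral>\<^sup>+x. f ((\<lambda>k\<in>I. g (x k))(i := g y)) * (\<Prod>k\<in>I. ennreal (g' (x k))) \<partial>lebP I)"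
      by (rule nn_integral_cmult) measurable
    also have "\<dots> \<le> ennreal (g' y) * (\<integral>\<^sup>+x. f (x(i := g y)) \<partial>lebP I)"
      by (intro mult_left_mono insert.IH[OF m2]) auto
    finally show "(\<integral>\<^sup>+x. f ((\<lambda>k\<in>I. g (x k))(i := g y)) * (ennreal (g' y) * (\<Prod>k\<in>I. ennreal (g' (x k)))) \<partial>lebP I)
       \<le> (\<integral>\<^sup>+x. f (x(i := g y)) \<partial>lebP I) * ennreal (g' y)" by (simp add: mult.commute)
  qed
  also have "\<dots> \<le> (\<integral>\<^sup>+y. (\<integral>\<^sup>+x. f (x(i := y)) \<partial>lebP I) \<partial>lborel)"
  proof (rule nn_integral_substitution_le[OF _ deriv cont nonneg])
    have "(\<lambda>y. \<integral>\<^sup>+x. f (x(i := y)) \<partial>lebP I) \<in> borel_measurable lborel"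
      using measurable_compose[OF measurable_pair_swap' m4]
      by (intro M1.borel_measurable_nn_integral) (simp add: case_prod_beta')
    then show "(\<lambda>y. \<integral>\<^sup>+x. f (x(i := y)) \<partial>lebP I) \<in> borel_measurable borel" by simp
  qed
  also have "\<dots> = (\<integral>\<^sup>+l. f l \<partial>lebP (insert i I))"
    by (rule lborel_product.product_nn_integral_insert_rev[OF insert.hyps insert.prems, symmetric])
  finally show ?case .
qed

section \<open>Selberg-type integrals\<close>

text \<open>The product runs over ordered pairs, so each unordered pair enters twice; the exponent
  \<open>\<beta> / 4\<close> of the squared distance therefore gives the power \<beta> of the
  distance when \<open>\<delta> = 0\<close>. A positive \<delta> makes the factor smooth across
  ties.\<close>

definition vdm :: "real \<Rightarrow> real \<Rightarrow> nat set \<Rightarrow> (nat \<Rightarrow> real) \<Rightarrow> real" where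
  "vdm \<delta> \<beta> I l = (\<Prod>i\<in>I. \<Prod>j\<in>I-{i}. ((l i - l j)\<^sup>2 + \<delta>) powr (\<beta> / 4))"

text \<open>Partition function with one-particle weight \<open>W\<close>. Values in
  \<open>ennreal\<close> allow comparison of weights, Fubini and truncation without integrability
  proofs.\<close>

definition sel :: "real \<Rightarrow> nat set \<Rightarrow> (real \<Rightarrow> real) \<Rightarrow> ennreal" where
  "sel \<beta> I W = (\<integral>\<^sup>+l. ennreal ((\<Prod>i\<in>I. W (l i)) * vdm 0 \<beta> I l) \<partial>lebP I)"

lemma vdm_nonneg [simp]: "0 \<le> vdm \<delta> \<beta> I l"
  by (auto simp: vdm_def intro!: prod_nonneg)

lemma vdm_empty [simp]: "vdm \<delta> \<beta> {} l = 1"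
  by (simp add: vdm_def)

lemma vdm_insert:
  assumes I: "finite I" and i: "i \<notin> I"
  shows "vdm \<delta> \<beta> (insert i I) l = vdm \<delta> \<beta> I l * (\<Prod>j\<in>I. ((l i - l j)\<^sup>2 + \<delta>) powr (\<beta> / 2))"
proof -
  let ?q = "\<lambda>i j. ((l i - l j)\<^sup>2 + \<delta>) powr (\<beta> / 4)"
  have "(\<Prod>k\<in>I. \<Prod>j\<in>insert i I - {k}. ?q k j) = (\<Prod>k\<in>I. ?q k i * (\<Prod>j\<in>I - {k}. ?q k j))"
  proof (rule prod.cong[OF refl])
    fix k assume k: "k \<in> I"
    have "insert i I - {k} = insert i (I - {k})" using k i by auto
    then show "(\<Prod>j\<in>insert i I - {k}. ?q k j) = ?q k i * (\<Prod>j\<in>I - {k}. ?q k j)"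
      using I i by simp
  qed
  moreover have "insert i I - {i} = I" using i by auto
  ultimately have "vdm \<delta> \<beta> (insert i I) l = (\<Prod>j\<in>I. ?q i j) * ((\<Prod>k\<in>I. ?q k i) * vdm \<delta> \<beta> I l)"
    using I i by (simp add: vdm_def prod.distrib)
  also have "\<dots> = vdm \<delta> \<beta> I l * (\<Prod>j\<in>I. ?q i j * ?q j i)"
    by (simp add: prod.distrib mult_ac)
  also have "(\<Prod>j\<in>I. ?q i j * ?q j i) = (\<Prod>j\<in>I. ((l i - l j)\<^sup>2 + \<delta>) powr (\<beta> / 2))"
    by (intro prod.cong refl) (simp add: power2_commute[of "l i"] flip: powr_add)
  finally show ?thesis .
qed

lemma sq_powr_half: "((x::real)\<^sup>2) powr (\<beta> / 2) = \<bar>x\<bar> powr \<beta>"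
proof (cases "x = 0")
  case False
  have "x\<^sup>2 = \<bar>x\<bar> powr 2" using False by simp
  then have "(x\<^sup>2) powr (\<beta> / 2) = (\<bar>x\<bar> powr 2) powr (\<beta> / 2)" by (rule arg_cong)
  then show ?thesis by (simp only: powr_powr) simp
qed simp

lemma vdm_0_insert:
  assumes "finite I" "i \<notin> I"
  shows "vdm 0 \<beta> (insert i I) l = vdm 0 \<beta> I l * (\<Prod>j\<in>I. \<bar>l i - l j\<bar> powr \<beta>)"
  by (simp add: vdm_insert[OF assms] sq_powr_half)

lemma vdm_0_lessThan:
  "vdm 0 \<beta> {1..n} l = (\<Prod>j=1..n. \<Prod>i=1..<j. \<bar>l i - l j\<bar> powr \<beta>)"
proof (induction n)
  case (Suc n)
  have "{1..Suc n} = insert (Suc n) {1..n}" by auto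
  moreover have "{1..<Suc n} = {1..n}" by auto
  ultimately show ?case
    using vdm_0_insert[of "{1..n}" "Suc n" \<beta> l] Suc.IH
    by (simp add: abs_minus_commute[of "l (Suc n)"] del: prod_zero_iff mult_eq_0_iff mult_cancel_left mult_cancel_right)
qed simp

lemma vdm_0_eq_0:
  assumes "finite I" "i \<in> I" "j \<in> I" "i \<noteq> j" "l i = l j"
  shows "vdm 0 \<beta> I l = 0"
proof -
  have "(\<Prod>k\<in>I-{i}. ((l i - l k)\<^sup>2 + 0) powr (\<beta> / 4)) = 0"
    using assms by (intro prod_zero) (auto intro!: bexI[of _ j])
  then show ?thesis
    using assms unfolding vdm_def by (intro prod_zero) auto
qed

lemma vdm_cong: "(\<And>i. i \<in> I \<Longrightarrow> l i = l' i) \<Longrightarrow> vdm \<delta> \<beta> I l = vdm \<delta> \<beta> I l'"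
  by (auto simp: vdm_def intro!: prod.cong)

lemma vdm_measurable [measurable]: "I \<subseteq> J \<Longrightarrow> vdm \<delta> \<beta> I \<in> borel_measurable (lebP J)"
proof -
  assume "I \<subseteq> J"
  then have "(\<lambda>l. \<Prod>i\<in>I. \<Prod>j\<in>I-{i}. ((l i - l j)\<^sup>2 + \<delta>) powr (\<beta> / 4)) \<in> borel_measurable (lebP J)"
    by (intro borel_measurable_prod powr_real_measurable borel_measurable_add borel_measurable_power borel_measurable_diff borel_measurable_const)
       (auto intro!: measurable_component_singleton simp: measurable_lborel1)
  then show ?thesis by (simp add: vdm_def[abs_def])
qed

lemma sel_mono:
  assumes "\<And>s. 0 \<le> W s" "\<And>s. W s \<le> W' s"
  shows "sel \<beta> I W \<le> sel \<beta> I W'"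
  unfolding sel_def using assms
  by (intro nn_integral_mono ennreal_leI mult_right_mono prod_mono) auto

lemma sel_cmult:
  assumes [measurable]: "W \<in> borel_measurable borel" and c: "0 \<le> c" and I: "finite I"
  shows "sel \<beta> I (\<lambda>s. c * W s) = ennreal (c ^ card I) * sel \<beta> I W"
proof -
  have "sel \<beta> I (\<lambda>s. c * W s) = (\<integral>\<^sup>+l. ennreal (c ^ card I) * ennreal ((\<Prod>i\<in>I. W (l i)) * vdm 0 \<beta> I l) \<partial>lebP I)"
    unfolding sel_def using c by (intro nn_integral_cong) (simp add: prod.distrib mult_ac flip: ennreal_mult')
  also have "\<dots> = ennreal (c ^ card I) * sel \<beta> I W"
    unfolding sel_def by (rule nn_integral_cmult) measurable
  finally show ?thesis .
qed

text \<open>Fubini in coordinate \<open>i\<close>: a particle held at \<open>y\<close> acts on the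
  others through one factor per particle, so it is absorbed into the one-particle weight and a
  \<open>sel\<close> remains. The free factors \<open>q\<close> and \<eta> later express the
  ordering of the particles and the range of \<open>y\<close>.\<close>

lemma nn_integral_insert_sel:
  assumes I: "finite I" "i \<notin> I"
    and [measurable]: "W \<in> borel_measurable borel" "\<eta> \<in> borel_measurable borel"
      "case_prod q \<in> borel_measurable (borel \<Otimes>\<^sub>M borel)"
    and nn: "\<And>s. 0 \<le> W s" "\<And>s. 0 \<le> \<eta> s" "\<And>s y. 0 \<le> q y s"
  shows "(\<integral>\<^sup>+l. ennreal (\<eta> (l i) * (\<Prod>j\<in>I. q (l i) (l j)) * ((\<Prod>k\<in>insert i I. W (l k)) * vdm 0 \<beta> (insert i I) l)) \<partial>lebP (insert i I))
    = (\<integral>\<^sup>+y. ennreal (\<eta> y * W y) * sel \<beta> I (\<lambda>s. W s * \<bar>y - s\<bar> powr \<beta> * q y s) \<partial>lborel)"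
proof -
  have [measurable]: "(\<lambda>l. q (l i) (l j)) \<in> borel_measurable (lebP (insert i I))" if "j \<in> I" for j
  proof -
    have "(\<lambda>l. (l i, l j)) \<in> measurable (lebP (insert i I)) (borel \<Otimes>\<^sub>M borel)"
      using that by (intro measurable_Pair) (auto intro: measurable_component_singleton simp: measurable_lborel1)
    from measurable_compose[OF this assms(5)] show ?thesis by simp
  qed
  have m: "(\<lambda>l. ennreal (\<eta> (l i) * (\<Prod>j\<in>I. q (l i) (l j)) * ((\<Prod>k\<in>insert i I. W (l k)) * vdm 0 \<beta> (insert i I) l))) \<in> borel_measurable (lebP (insert i I))"
    by measurable
  have qy: "(\<lambda>s. q y s) \<in> borel_measurable borel" for y
    using measurable_compose[OF measurable_Pair1'[of y borel borel] assms(5)] by simp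
  have eq: "\<eta> y * (\<Prod>j\<in>I. q y ((x(i := y)) j)) * ((\<Prod>k\<in>insert i I. W ((x(i := y)) k)) * vdm 0 \<beta> (insert i I) (x(i := y)))
      = (\<eta> y * W y) * ((\<Prod>k\<in>I. W (x k) * \<bar>y - x k\<bar> powr \<beta> * q y (x k)) * vdm 0 \<beta> I x)" for x y
  proof -
    have p: "(\<Prod>j\<in>I. F ((x(i := y)) j)) = (\<Prod>j\<in>I. F (x j))" for F :: "real \<Rightarrow> real"
      using I by (intro prod.cong) auto
    have "vdm 0 \<beta> I (x(i := y)) = vdm 0 \<beta> I x" using I by (intro vdm_cong) auto
    then show ?thesis
      using I p[of "\<lambda>s. q y s"] p[of W] p[of "\<lambda>s. \<bar>y - s\<bar> powr \<beta>"]
      by (simp add: vdm_0_insert prod.distrib mult_ac)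
  qed
  show ?thesis
  proof (subst lborel_product.product_nn_integral_insert_rev[OF I m], rule nn_integral_cong)
    fix y :: real
    note [measurable] = qy[of y]
    have "(\<integral>\<^sup>+x. ennreal (\<eta> ((x(i := y)) i) * (\<Prod>j\<in>I. q ((x(i := y)) i) ((x(i := y)) j)) * ((\<Prod>k\<in>insert i I. W ((x(i := y)) k)) * vdm 0 \<beta> (insert i I) (x(i := y)))) \<partial>lebP I)
      = (\<integral>\<^sup>+x. ennreal (\<eta> y * W y) * ennreal ((\<Prod>k\<in>I. W (x k) * \<bar>y - x k\<bar> powr \<beta> * q y (x k)) * vdm 0 \<beta> I x) \<partial>lebP I)"
      using nn by (intro nn_integral_cong) (simp only: fun_upd_same eq, subst ennreal_mult, auto intro!: mult_nonneg_nonneg prod_nonneg)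
    also have "\<dots> = ennreal (\<eta> y * W y) * sel \<beta> I (\<lambda>s. W s * \<bar>y - s\<bar> powr \<beta> * q y s)"
      unfolding sel_def by (rule nn_integral_cmult) measurable
    finally show "(\<integral>\<^sup>+x. ennreal (\<eta> ((x(i := y)) i) * (\<Prod>j\<in>I. q ((x(i := y)) i) ((x(i := y)) j)) * ((\<Prod>k\<in>insert i I. W ((x(i := y)) k)) * vdm 0 \<beta> (insert i I) (x(i := y)))) \<partial>lebP I)
      = ennreal (\<eta> y * W y) * sel \<beta> I (\<lambda>s. W s * \<bar>y - s\<bar> powr \<beta> * q y s)" .
  qed
qed

text \<open>Since the Vandermonde factor vanishes on ties, exactly one particle is extremal;
  the sign of \<open>\<sigma>\<close> decides whether it is the largest or the smallest one.\<close>

lemma nn_integral_extremal_split: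
  assumes I: "finite I" "I \<noteq> {}"
    and [measurable]: "W \<in> borel_measurable borel" "\<eta> \<in> borel_measurable borel"
    and nn: "\<And>s. 0 \<le> W s" "\<And>s. 0 \<le> \<eta> s" and \<sigma>: "\<sigma> \<noteq> (0::real)"
    and e: "\<And>l i. i \<in> I \<Longrightarrow> (\<And>j. j \<in> I \<Longrightarrow> \<sigma> * l j \<le> \<sigma> * l i) \<Longrightarrow> e l = \<eta> (l i)"
  shows "(\<integral>\<^sup>+l. ennreal (e l * ((\<Prod>k\<in>I. W (l k)) * vdm 0 \<beta> I l)) \<partial>lebP I)
    = (\<Sum>i\<in>I. \<integral>\<^sup>+y. ennreal (\<eta> y * W y) * sel \<beta> (I - {i}) (\<lambda>s. W s * \<bar>y - s\<bar> powr \<beta> * of_bool (\<sigma> * s < \<sigma> * y)) \<partial>lborel)"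
proof -
  let ?q = "\<lambda>y s::real. of_bool (\<sigma> * s < \<sigma> * y) :: real"
  let ?F = "\<lambda>i l. ennreal (\<eta> (l i) * (\<Prod>j\<in>I-{i}. ?q (l i) (l j)) * ((\<Prod>k\<in>I. W (l k)) * vdm 0 \<beta> I l))"
  have q[measurable]: "case_prod ?q \<in> borel_measurable (borel \<Otimes>\<^sub>M borel)" by measurable
  have "ennreal (e l * ((\<Prod>k\<in>I. W (l k)) * vdm 0 \<beta> I l)) = (\<Sum>i\<in>I. ?F i l)" for l
  proof (cases "inj_on l I")
    case False
    then obtain i j where "i \<in> I" "j \<in> I" "i \<noteq> j" "l i = l j" by (auto simp: inj_on_def)
    then have "vdm 0 \<beta> I l = 0" using I by (intro vdm_0_eq_0[of I i j]) auto
    then show ?thesis by simp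
  next
    case True
    have "Max ((\<lambda>k. \<sigma> * l k) ` I) \<in> (\<lambda>k. \<sigma> * l k) ` I" using I by (intro Max_in) auto
    then obtain i where i: "Max ((\<lambda>k. \<sigma> * l k) ` I) = \<sigma> * l i" "i \<in> I" by (rule imageE)
    have mx: "\<sigma> * l j \<le> \<sigma> * l i" if "j \<in> I" for j
      using I that Max_ge[of "(\<lambda>k. \<sigma> * l k) ` I" "\<sigma> * l j"] unfolding i(1) by auto
    have lt: "\<sigma> * l j < \<sigma> * l i" if "j \<in> I - {i}" for j
      using mx[of j] that True i \<sigma> by (auto simp: inj_on_def less_le)
    \<comment> \<open>Particle \<open>j\<close> is not extremal, so its ordering constraint against
      \<open>i\<close> contributes a zero factor.\<close>
    have z: "?F j l = 0" if "j \<in> I - {i}" for j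
    proof -
      have "?q (l j) (l i) = 0" using lt[OF that] by simp
      moreover have "i \<in> I - {j}" using that i by auto
      ultimately have "(\<Prod>k\<in>I-{j}. ?q (l j) (l k)) = 0"
        using I(1) by (intro prod_zero) auto
      then show ?thesis by (simp only: mult_zero_left mult_zero_right ennreal_0)
    qed
    have "(\<Sum>j\<in>I. ?F j l) = ?F i l"
      using I i z by (subst sum.remove[of I i]) auto
    moreover have "(\<Prod>j\<in>I-{i}. ?q (l i) (l j)) = 1"
      using lt by (intro prod.neutral) auto
    ultimately show ?thesis using e[of i l] i(2) mx by simp
  qed
  then have "(\<integral>\<^sup>+l. ennreal (e l * ((\<Prod>k\<in>I. W (l k)) * vdm 0 \<beta> I l)) \<partial>lebP I) = (\<integral>\<^sup>+l. (\<Sum>i\<in>I. ?F i l) \<partial>lebP I)"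
    by simp
  also have "\<dots> = (\<Sum>i\<in>I. \<integral>\<^sup>+l. ?F i l \<partial>lebP I)"
    by (rule nn_integral_sum) measurable
  also have "\<dots> = (\<Sum>i\<in>I. \<integral>\<^sup>+y. ennreal (\<eta> y * W y) * sel \<beta> (I - {i}) (\<lambda>s. W s * \<bar>y - s\<bar> powr \<beta> * ?q y s) \<partial>lborel)"
  proof (rule sum.cong[OF refl])
    fix i assume i: "i \<in> I"
    then have ins: "insert i (I - {i}) = I" by auto
    show "(\<integral>\<^sup>+l. ?F i l \<partial>lebP I) = (\<integral>\<^sup>+y. ennreal (\<eta> y * W y) * sel \<beta> (I - {i}) (\<lambda>s. W s * \<bar>y - s\<bar> powr \<beta> * ?q y s) \<partial>lborel)"
      using nn_integral_insert_sel[of "I - {i}" i W \<eta> ?q \<beta>, unfolded ins] I nn q by simp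
  qed
  finally show ?thesis .
qed

section \<open>Laguerre weights and moment recursion\<close>

text \<open>Unnormalised Gamma density. The ensemble itself has \<open>c = 1 / 2\<close> and
  \<open>a = \<beta> * (p - n + 1) / 2\<close>; the rate is kept general because the tilt changes
  it. The value 0 off the positive half-line replaces a restriction of the domain.\<close>

definition gw :: "real \<Rightarrow> real \<Rightarrow> real \<Rightarrow> real" where
  "gw a c s = (if 0 < s then s powr (a - 1) * exp (- c * s) else 0)"

lemma gw_nonneg [simp]: "0 \<le> gw a c s"
  by (simp add: gw_def)

lemma gw_measurable [measurable]: "gw a c \<in> borel_measurable borel"
  unfolding gw_def by measurable

lemma gw_mult_powr: "gw a c s * s powr b = gw (a + b) c s"
  by (auto simp: gw_def algebra_simps simp flip: powr_add)

lemma nn_integral_gw: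
  assumes "0 < a" "0 < c"
  shows "(\<integral>\<^sup>+s. ennreal (gw a c s) \<partial>lborel) = ennreal (Gamma a * c powr - a)"
proof -
  have "(\<integral>\<^sup>+s. ennreal (gw a c s) \<partial>lborel) = ennreal \<bar>1 / c\<bar> * (\<integral>\<^sup>+s. ennreal (gw a c (0 + 1 / c * s)) \<partial>lborel)"
    using assms by (intro nn_integral_real_affine) auto
  also have "(\<integral>\<^sup>+s. ennreal (gw a c (0 + 1 / c * s)) \<partial>lborel)
      = (\<integral>\<^sup>+s. ennreal (c powr (1 - a)) * ennreal (indicator {0..} s * s powr (a - 1) / exp s) \<partial>lborel)"
    by (intro nn_integral_cong_AE AE_I'[of "{0}"])
       (use assms in \<open>auto simp: gw_def indicator_def powr_divide powr_diff exp_minus field_simps zero_less_mult_iff simp flip: ennreal_mult'\<close>)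
  also have "\<dots> = ennreal (c powr (1 - a)) * ennreal (Gamma a)"
    by (subst nn_integral_cmult) (auto simp: Gamma_conv_nn_integral_real[OF assms(1)])
  also have "ennreal \<bar>1 / c\<bar> * \<dots> = ennreal (Gamma a * c powr - a)"
    using assms Gamma_real_pos[of a]
    by (simp add: powr_diff powr_minus field_simps flip: ennreal_mult')
  finally show ?thesis .
qed

lemma integrable_gw: "0 < a \<Longrightarrow> 0 < c \<Longrightarrow> integrable lborel (gw a c)"
  using nn_integral_gw[of a c] by (intro integrableI_nonneg) auto

section \<open>Integrable majorants, uniform in the smoothing parameter\<close>

definition qb :: "real \<Rightarrow> real" where
  "qb s = 2 + 2 * s\<^sup>2"

lemma qb_ge_1: "1 \<le> qb s" and qb_ge_abs: "\<bar>s\<bar> \<le> qb s"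
proof -
  show "1 \<le> qb s" by (simp add: qb_def add_increasing2)
  have "0 \<le> (\<bar>s\<bar> - 1)\<^sup>2" by simp
  then show "\<bar>s\<bar> \<le> qb s" by (simp add: qb_def power2_diff)
qed

lemma qb_measurable [measurable]: "qb \<in> borel_measurable borel"
  unfolding qb_def by measurable

text \<open>This is the reason for the shape of \<open>qb\<close>: every pair interaction is bounded
  by a product of one-particle functions, uniformly in \<delta>, so integrability reduces to
  one-dimensional Gamma integrals.\<close>

lemma dist_sq_le_qb:
  assumes "\<delta> \<le> 1"
  shows "(x - y)\<^sup>2 + \<delta> \<le> qb x * qb y"
proof -
  have "(x - y)\<^sup>2 + (x + y)\<^sup>2 = 2 * x\<^sup>2 + 2 * y\<^sup>2" by (simp add: power2_eq_square algebra_simps)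
  then have "(x - y)\<^sup>2 \<le> 2 * x\<^sup>2 + 2 * y\<^sup>2" by (smt (verit) zero_le_power2)
  moreover have "0 \<le> x\<^sup>2 * y\<^sup>2" "0 \<le> x\<^sup>2" "0 \<le> y\<^sup>2" by simp_all
  moreover have "qb x * qb y = 4 + 4 * x\<^sup>2 + 4 * y\<^sup>2 + 4 * (x\<^sup>2 * y\<^sup>2)" by (simp add: qb_def algebra_simps)
  ultimately show ?thesis using assms by linarith
qed

lemma integrable_qb_gw:
  assumes "0 < a" "0 < c" "0 \<le> M"
  shows "integrable lborel (\<lambda>s. qb s powr M * gw a c s)"
proof (rule Bochner_Integration.integrable_bound)
  show "integrable lborel (\<lambda>s. 4 powr M * (gw a c s + gw (a + 2 * M) c s))"
    using assms by (intro integrable_mult_right Bochner_Integration.integrable_add integrable_gw) auto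
  show "AE s in lborel. norm (qb s powr M * gw a c s) \<le> norm (4 powr M * (gw a c s + gw (a + 2 * M) c s))"
  proof (rule AE_I2)
    fix s :: real
    show "norm (qb s powr M * gw a c s) \<le> norm (4 powr M * (gw a c s + gw (a + 2 * M) c s))"
    proof (cases "0 < s")
      case True
      have "qb s powr M \<le> 4 powr M * (1 + s powr (2 * M))"
      proof (cases "s \<le> 1")
        case True
        then have "s\<^sup>2 \<le> 1" using \<open>0 < s\<close> by (simp add: power_le_one)
        then have "qb s powr M \<le> 4 powr M" using assms by (intro powr_mono2) (auto simp: qb_def)
        then show ?thesis by (simp add: algebra_simps add_increasing2)
      next
        case False
        then have "1 \<le> s\<^sup>2" by (simp add: one_le_power)
        then have "qb s powr M \<le> (4 * s\<^sup>2) powr M" using assms by (intro powr_mono2) (auto simp: qb_def)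
        also have "\<dots> = 4 powr M * (s powr 2) powr M" using True by (simp add: powr_mult)
        also have "\<dots> = 4 powr M * s powr (2 * M)" by (simp only: powr_powr)
        finally show ?thesis by (simp add: algebra_simps add_increasing)
      qed
      then have "qb s powr M * gw a c s \<le> 4 powr M * (1 + s powr (2 * M)) * gw a c s"
        by (intro mult_right_mono) auto
      also have "\<dots> = 4 powr M * (gw a c s + gw (a + 2 * M) c s)"
        by (simp add: algebra_simps flip: gw_mult_powr)
      finally show ?thesis using qb_ge_1[of s] by (simp add: abs_mult)
    qed (simp add: gw_def)
  qed
qed measurable

lemma vdm_le_qb:
  assumes I: "finite I" and "0 < \<beta>" "0 \<le> \<delta>" "\<delta> \<le> 1"
  shows "vdm \<delta> \<beta> I l \<le> (\<Prod>i\<in>I. qb (l i) powr (real (card I) * \<beta> / 2))"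
proof -
  let ?b = "\<lambda>i. qb (l i) powr (\<beta> / 4)"
  have b1: "1 \<le> ?b i" for i using qb_ge_1 assms by (intro ge_one_powr_ge_zero) auto
  have "vdm \<delta> \<beta> I l \<le> (\<Prod>i\<in>I. \<Prod>j\<in>I. ?b i * ?b j)"
    unfolding vdm_def
  proof (intro prod_mono conjI prod_nonneg)
    fix i assume i: "i \<in> I"
    have "(\<Prod>j\<in>I-{i}. ((l i - l j)\<^sup>2 + \<delta>) powr (\<beta> / 4)) \<le> (\<Prod>j\<in>I-{i}. ?b i * ?b j)"
    proof (intro prod_mono conjI)
      fix j
      have "((l i - l j)\<^sup>2 + \<delta>) powr (\<beta> / 4) \<le> (qb (l i) * qb (l j)) powr (\<beta> / 4)"
        using assms dist_sq_le_qb by (intro powr_mono2) auto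
      then show "((l i - l j)\<^sup>2 + \<delta>) powr (\<beta> / 4) \<le> ?b i * ?b j"
        using qb_ge_1[of "l i"] qb_ge_1[of "l j"] by (simp add: powr_mult)
    qed simp
    \<comment> \<open>The diagonal factor \<open>j = i\<close> is at least 1. Adding it makes both
      products run over all of \<open>I\<close>, which yields the uniform exponent
      \<open>card I * \<beta> / 2\<close>.\<close>
    also have "\<dots> \<le> (\<Prod>j\<in>I. ?b i * ?b j)"
    proof -
      have "1 \<le> ?b i * ?b i" using mult_mono[OF b1[of i] b1[of i]] by simp
      moreover have "0 \<le> (\<Prod>j\<in>I-{i}. ?b i * ?b j)" by (intro prod_nonneg) auto
      ultimately have "1 * (\<Prod>j\<in>I-{i}. ?b i * ?b j) \<le> ?b i * ?b i * (\<Prod>j\<in>I-{i}. ?b i * ?b j)"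
        by (rule mult_right_mono)
      then show ?thesis using I i by (simp only: prod.remove[OF I i] mult_1)
    qed
    finally show "(\<Prod>j\<in>I-{i}. ((l i - l j)\<^sup>2 + \<delta>) powr (\<beta> / 4)) \<le> (\<Prod>j\<in>I. ?b i * ?b j)" .
  qed auto
  also have "\<dots> = (\<Prod>i\<in>I. ?b i ^ card I) * (\<Prod>i\<in>I. ?b i) ^ card I"
    by (simp add: prod.distrib)
  also have "\<dots> = (\<Prod>i\<in>I. ?b i ^ card I * ?b i ^ card I)"
    by (simp add: prod.distrib prod_power_distrib)
  also have "\<dots> = (\<Prod>i\<in>I. qb (l i) powr (real (card I) * \<beta> / 2))"
  proof (intro prod.cong refl)
    fix i
    have "?b i ^ card I = qb (l i) powr (\<beta> / 4 * real (card I))"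
      using qb_ge_1[of "l i"] by (subst powr_realpow[symmetric]) (auto simp: powr_powr)
    then show "?b i ^ card I * ?b i ^ card I = qb (l i) powr (real (card I) * \<beta> / 2)"
      by (simp flip: powr_add) (simp add: mult_ac)
  qed
  finally show ?thesis .
qed

definition lag :: "real \<Rightarrow> real \<Rightarrow> real \<Rightarrow> real \<Rightarrow> nat set \<Rightarrow> (nat \<Rightarrow> real) \<Rightarrow> real" where
  "lag \<delta> \<beta> a c I l = (\<Prod>i\<in>I. gw a c (l i)) * vdm \<delta> \<beta> I l"

lemma lag_nonneg [simp]: "0 \<le> lag \<delta> \<beta> a c I l"
  by (auto simp: lag_def intro!: mult_nonneg_nonneg prod_nonneg)

lemma lag_measurable [measurable]: "lag \<delta> \<beta> a c I \<in> borel_measurable (lebP I)"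
  unfolding lag_def by measurable

text \<open>The interactions need the exponent \<open>card I * \<beta> / 2\<close>. Of the two
  additional powers of \<open>qb\<close>, one pays for a product of coordinates over
  \<open>S\<close>, the other for an observable growing like \<open>qb (l i)\<close>.\<close>

definition lag_dom :: "real \<Rightarrow> real \<Rightarrow> real \<Rightarrow> nat set \<Rightarrow> (nat \<Rightarrow> real) \<Rightarrow> real" where
  "lag_dom \<beta> a c I l = (\<Prod>i\<in>I. qb (l i) powr (real (card I) * \<beta> / 2 + 2) * gw a c (l i))"

lemma integrable_lag_dom:
  assumes "finite I" "0 < \<beta>" "0 < a" "0 < c"
  shows "integrable (lebP I) (lag_dom \<beta> a c I)"
  unfolding lag_dom_def using assms
  by (intro lborel_product.product_integrable_prod integrable_qb_gw) auto

lemma lag_le_lag_dom: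
  assumes "finite I" "0 < \<beta>" "0 \<le> \<delta>" "\<delta> \<le> 1"
  shows "(\<Prod>i\<in>I. (qb (l i))\<^sup>2) * lag \<delta> \<beta> a c I l \<le> lag_dom \<beta> a c I l"
proof -
  have "(\<Prod>i\<in>I. (qb (l i))\<^sup>2) * lag \<delta> \<beta> a c I l
      \<le> (\<Prod>i\<in>I. (qb (l i))\<^sup>2) * ((\<Prod>i\<in>I. gw a c (l i)) * (\<Prod>i\<in>I. qb (l i) powr (real (card I) * \<beta> / 2)))"
    unfolding lag_def by (intro mult_left_mono vdm_le_qb assms prod_nonneg) auto
  also have "\<dots> = lag_dom \<beta> a c I l"
    unfolding lag_dom_def prod.distrib[symmetric]
  proof (intro prod.cong refl)
    fix i
    have "qb (l i) powr 2 = (qb (l i))\<^sup>2" using qb_ge_1[of "l i"] by simp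
    then show "(qb (l i))\<^sup>2 * (gw a c (l i) * qb (l i) powr (real (card I) * \<beta> / 2))
        = qb (l i) powr (real (card I) * \<beta> / 2 + 2) * gw a c (l i)"
      by (simp add: powr_add)
  qed
  finally show ?thesis .
qed

lemma prod_qb_ge:
  assumes "finite I" "S \<subseteq> I"
  shows "\<bar>\<Prod>i\<in>S. l i\<bar> \<le> (\<Prod>i\<in>I. qb (l i))"
proof -
  have "\<bar>\<Prod>i\<in>S. l i\<bar> \<le> (\<Prod>i\<in>S. qb (l i))"
    unfolding abs_prod by (intro prod_mono) (auto simp: qb_ge_abs)
  also have "\<dots> \<le> (\<Prod>i\<in>I. qb (l i))"
    using assms qb_ge_1 by (intro prod_mono2) (auto intro: order_trans[OF zero_le_one])
  finally show ?thesis .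
qed

lemma qb_le_prod:
  assumes "finite I" "i \<in> I"
  shows "qb (l i) \<le> (\<Prod>i\<in>I. qb (l i))"
  using prod_mono2[of I "{i}" "\<lambda>i. qb (l i)"] assms qb_ge_1
  by (auto intro: order_trans[OF zero_le_one])

lemma lag_bound:
  assumes I: "finite I" and i: "i \<in> I" and "S \<subseteq> I" "0 < \<beta>" "0 \<le> \<delta>" "\<delta> \<le> 1"
    and h: "\<bar>h\<bar> \<le> K * qb (l i)" "0 \<le> K"
  shows "\<bar>(\<Prod>i\<in>S. l i) * h * lag \<delta> \<beta> a c I l\<bar> \<le> K * lag_dom \<beta> a c I l"
proof -
  let ?P = "\<Prod>i\<in>I. qb (l i)"
  have P: "0 \<le> ?P" using qb_ge_1 by (intro prod_nonneg) (auto intro: order_trans[OF zero_le_one])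
  have "\<bar>h\<bar> \<le> K * ?P" using h qb_le_prod[OF I i, of l] by (meson mult_left_mono order_trans)
  then have "\<bar>\<Prod>i\<in>S. l i\<bar> * \<bar>h\<bar> \<le> ?P * (K * ?P)"
    using prod_qb_ge[OF I assms(3), of l] P by (intro mult_mono) auto
  also have "\<dots> = K * (\<Prod>i\<in>I. (qb (l i))\<^sup>2)" by (simp add: power2_eq_square prod.distrib)
  finally have "\<bar>(\<Prod>i\<in>S. l i) * h * lag \<delta> \<beta> a c I l\<bar> \<le> K * (\<Prod>i\<in>I. (qb (l i))\<^sup>2) * lag \<delta> \<beta> a c I l"
    by (simp add: abs_mult mult_right_mono)
  also have "\<dots> \<le> K * lag_dom \<beta> a c I l"
    using lag_le_lag_dom[of I \<beta> \<delta> l a c] assms by (simp add: mult.assoc mult_left_mono)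
  finally show ?thesis .
qed

lemma integrable_lag:
  assumes I: "finite I" and i: "i \<in> I" and "S \<subseteq> I" "0 < \<beta>" "0 \<le> \<delta>" "\<delta> \<le> 1" "0 < a" "0 < c"
    and h: "\<And>l. \<bar>h l\<bar> \<le> K * qb (l i)" and [measurable]: "h \<in> borel_measurable (lebP I)"
  shows "integrable (lebP I) (\<lambda>l. (\<Prod>i\<in>S. l i) * h l * lag \<delta> \<beta> a c I l)"
proof (rule Bochner_Integration.integrable_bound)
  have "\<bar>h (\<lambda>_. 0)\<bar> \<le> K * qb 0" using h[of "\<lambda>_. 0"] by simp
  then have K: "0 \<le> K" using qb_ge_1[of 0] by (smt (verit) zero_le_mult_iff)
  show "integrable (lebP I) (\<lambda>l. K * lag_dom \<beta> a c I l)"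
    using assms by (intro integrable_mult_right integrable_lag_dom) auto
  show "AE l in lebP I. norm ((\<Prod>i\<in>S. l i) * h l * lag \<delta> \<beta> a c I l) \<le> norm (K * lag_dom \<beta> a c I l)"
  proof (rule AE_I2)
    fix l
    show "norm ((\<Prod>i\<in>S. l i) * h l * lag \<delta> \<beta> a c I l) \<le> norm (K * lag_dom \<beta> a c I l)"
      using lag_bound[where h = "h l" and l = l, OF I i assms(3-6) h[of l] K, of a c] by simp
  qed
  have "(\<lambda>l. \<Prod>i\<in>S. l i) \<in> borel_measurable (lebP I)"
    using assms(3) by (intro borel_measurable_prod) (auto intro!: measurable_component_singleton simp: measurable_lborel1)
  then show "(\<lambda>l. (\<Prod>i\<in>S. l i) * h l * lag \<delta> \<beta> a c I l) \<in> borel_measurable (lebP I)"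
    by measurable
qed

lemma lag_transpose:
  assumes "i \<in> I" "j \<in> I"
  shows "lag \<delta> \<beta> a c I (\<lambda>k\<in>I. l (Transposition.transpose i j k)) = lag \<delta> \<beta> a c I l"
proof -
  let ?t = "Transposition.transpose i j"
  have inj: "?t m = ?t k \<longleftrightarrow> m = k" for m k by (metis transpose_involutory)
  have t: "?t k \<in> I" if "k \<in> I" for k using that assms by (auto simp: Transposition.transpose_def)
  have "(\<Prod>k\<in>I. gw a c ((\<lambda>k\<in>I. l (?t k)) k)) = (\<Prod>k\<in>I. gw a c (l k))"
    by (rule prod.reindex_bij_witness[of _ ?t ?t]) (auto simp: t)
  moreover have "vdm \<delta> \<beta> I (\<lambda>k\<in>I. l (?t k)) = vdm \<delta> \<beta> I l"
    unfolding vdm_def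
  proof (rule prod.reindex_bij_witness[of _ ?t ?t])
    fix k assume k: "k \<in> I"
    show "(\<Prod>m\<in>I - {?t k}. ((l (?t k) - l m)\<^sup>2 + \<delta>) powr (\<beta> / 4))
       = (\<Prod>m\<in>I - {k}. (((\<lambda>k\<in>I. l (?t k)) k - (\<lambda>k\<in>I. l (?t k)) m)\<^sup>2 + \<delta>) powr (\<beta> / 4))"
      by (rule prod.reindex_bij_witness[of _ ?t ?t]) (use t k inj in auto)
  qed (auto simp: t)
  ultimately show ?thesis by (simp add: lag_def)
qed

section \<open>Integration by parts against the smoothed density\<close>

lemma powr_exp_tendsto_0:
  assumes c: "0 < (c::real)"
  shows "((\<lambda>x. x powr k * exp (- c * x)) \<longlongrightarrow> 0) at_top"
proof -
  define m where "m = nat \<lceil>\<bar>k\<bar>\<rceil>"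
  have "filterlim (\<lambda>x. c * x) at_top at_top"
    using c by (intro filterlim_tendsto_pos_mult_at_top[OF tendsto_const]) (auto simp: filterlim_ident)
  from filterlim_compose[OF tendsto_power_div_exp_0 this]
  have "((\<lambda>x. (c * x) ^ m / exp (c * x)) \<longlongrightarrow> 0) at_top" .
  from tendsto_mult[OF tendsto_const[of "inverse (c ^ m)"] this]
  have lim: "((\<lambda>x. x ^ m * exp (- c * x)) \<longlongrightarrow> 0) at_top"
    using c by (simp add: power_mult_distrib exp_minus field_simps)
  have km: "k \<le> real m" unfolding m_def by linarith
  show ?thesis
  proof (rule tendsto_sandwich[OF _ _ tendsto_const lim])
    show "\<forall>\<^sub>F x in at_top. x powr k * exp (- c * x) \<le> x ^ m * exp (- c * x)"
      using eventually_ge_at_top[of 1]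
    proof eventually_elim
      case (elim x)
      have "x powr k \<le> x powr real m" using elim km by (intro powr_mono) auto
      also have "\<dots> = x ^ m" using elim by (intro powr_realpow) auto
      finally show ?case by (intro mult_right_mono) auto
    qed
  qed auto
qed

lemma abs_divide_sq_le:
  fixes d \<delta> :: real
  assumes "0 < \<delta>" "\<delta> \<le> 1"
  shows "\<bar>d / (d\<^sup>2 + \<delta>)\<bar> \<le> 1 / \<delta>"
proof -
  have "0 \<le> (\<bar>d\<bar> - 1)\<^sup>2" by simp
  then have "2 * \<bar>d\<bar> \<le> 1 + d\<^sup>2" unfolding power2_diff by simp
  then have "\<bar>d\<bar> \<le> 1 + d\<^sup>2" by simp
  then have "\<delta> * \<bar>d\<bar> \<le> \<delta> * (1 + d\<^sup>2)" using assms by (intro mult_left_mono) auto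
  moreover have "\<delta> * d\<^sup>2 \<le> 1 * d\<^sup>2" using assms by (intro mult_right_mono) auto
  ultimately have "\<delta> * \<bar>d\<bar> \<le> d\<^sup>2 + \<delta>" by (simp add: algebra_simps)
  moreover have "0 < d\<^sup>2 + \<delta>" using assms by (simp add: add_nonneg_pos)
  ultimately have "\<bar>d\<bar> / (d\<^sup>2 + \<delta>) \<le> 1 / \<delta>" using assms by (simp add: field_simps)
  moreover have "\<bar>d / (d\<^sup>2 + \<delta>)\<bar> = \<bar>d\<bar> / (d\<^sup>2 + \<delta>)" using \<open>0 < d\<^sup>2 + \<delta>\<close> by (simp only: abs_divide abs_of_pos)
  ultimately show ?thesis by (simp only:)
qed

lemma abs_affine_le:
  fixes a c \<beta> :: real
  assumes "0 \<le> a" "0 \<le> c" "0 \<le> \<beta>"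
  shows "\<bar>a - c * x + \<beta> * y\<bar> \<le> a + c * \<bar>x\<bar> + \<beta> * \<bar>y\<bar>"
proof -
  have "\<bar>a - c * x + \<beta> * y\<bar> \<le> \<bar>a\<bar> + \<bar>c * x\<bar> + \<bar>\<beta> * y\<bar>" by linarith
  then show ?thesis using assms by (simp add: abs_mult)
qed

text \<open>The integrand is the derivative of \<open>x powr a * exp (- c * x)\<close> times the
  interaction product. Differentiating \<open>x\<close> times the weight, rather than the weight,
  raises the exponent from \<open>a - 1\<close> to \<open>a\<close>, so the boundary term at 0
  vanishes for every positive \<open>a\<close>.\<close>

lemma integral_gw_derivative_eq_0:
  fixes y :: "nat \<Rightarrow> real"
  assumes J: "finite J" and pos: "0 < \<beta>" "0 < a" "0 < c" "0 < \<delta>" "\<delta> \<le> 1"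
  shows "(\<integral>x. gw a c x * (a - c * x + \<beta> * (\<Sum>j\<in>J. x * (x - y j) / ((x - y j)\<^sup>2 + \<delta>)))
      * (\<Prod>j\<in>J. ((x - y j)\<^sup>2 + \<delta>) powr (\<beta> / 2)) \<partial>lborel) = 0"
proof -
  define Q where "Q x = (\<Prod>j\<in>J. ((x - y j)\<^sup>2 + \<delta>) powr (\<beta> / 2))" for x
  define D where "D x = (\<Sum>j\<in>J. (x - y j) / ((x - y j)\<^sup>2 + \<delta>))" for x
  define F where "F x = x powr a * exp (- c * x) * Q x" for x
  define f where "f x = x powr (a - 1) * exp (- c * x) * (a - c * x + \<beta> * (x * D x)) * Q x" for x
  have q0: "0 < (x - y j)\<^sup>2 + \<delta>" for x j using pos by (simp add: add_nonneg_pos)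
  have Qpos: "0 < Q x" for x unfolding Q_def using q0 by (intro prod_pos) (simp add: less_imp_neq[symmetric])
  have Qder: "(Q has_real_derivative Q x * (\<beta> * D x)) (at x)" for x
  proof -
    \<comment> \<open>Logarithmic differentiation replaces the product rule over \<open>J\<close>; a
      positive \<delta> keeps every factor positive.\<close>
    have Qexp: "Q = (\<lambda>x. exp (\<Sum>j\<in>J. \<beta> / 2 * ln ((x - y j)\<^sup>2 + \<delta>)))"
    proof
      fix x
      show "Q x = exp (\<Sum>j\<in>J. \<beta> / 2 * ln ((x - y j)\<^sup>2 + \<delta>))"
        unfolding Q_def exp_sum[OF J] using q0 by (intro prod.cong) (auto simp: powr_def less_imp_neq[symmetric])
    qed
    have "((\<lambda>x. \<Sum>j\<in>J. \<beta> / 2 * ln ((x - y j)\<^sup>2 + \<delta>)) has_real_derivative (\<Sum>j\<in>J. \<beta> * ((x - y j) / ((x - y j)\<^sup>2 + \<delta>)))) (at x)"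
    proof (rule DERIV_sum)
      fix j
      show "((\<lambda>x. \<beta> / 2 * ln ((x - y j)\<^sup>2 + \<delta>)) has_real_derivative \<beta> * ((x - y j) / ((x - y j)\<^sup>2 + \<delta>))) (at x)"
        using q0[of x j] by (auto intro!: derivative_eq_intros simp: field_simps)
    qed
    then have "(\<Sum>j\<in>J. \<beta> * ((x - y j) / ((x - y j)\<^sup>2 + \<delta>))) = \<beta> * D x \<and> ((\<lambda>x. \<Sum>j\<in>J. \<beta> / 2 * ln ((x - y j)\<^sup>2 + \<delta>)) has_real_derivative \<beta> * D x) (at x)"
      by (simp add: D_def sum_distrib_left)
    then have "((\<lambda>x. \<Sum>j\<in>J. \<beta> / 2 * ln ((x - y j)\<^sup>2 + \<delta>)) has_real_derivative \<beta> * D x) (at x)" by blast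
    from DERIV_chain2[OF DERIV_exp this] show ?thesis unfolding Qexp .
  qed
  have Fder: "(F has_real_derivative f x) (at x)" if "0 < x" for x
  proof -
    have "(F has_real_derivative (a * x powr (a - 1) * exp (- c * x) + x powr a * (exp (- c * x) * - c)) * Q x + (Q x * (\<beta> * D x)) * (x powr a * exp (- c * x))) (at x)"
      unfolding F_def using that by (auto intro!: derivative_eq_intros Qder)
    also have "x powr a = x powr (a - 1) * x" using that by (simp add: powr_diff)
    finally show ?thesis by (simp add: f_def algebra_simps)
  qed
  have fcont: "isCont f x" if "0 < x" for x
  proof -
    have "isCont Q x" using Qder DERIV_isCont by blast
    moreover have "isCont D x" unfolding D_def using q0 by (intro continuous_intros) (auto simp: less_imp_neq[symmetric])
    ultimately show ?thesis unfolding f_def using that by (intro continuous_intros) auto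
  qed
  \<comment> \<open>\<open>Q\<close> and the bracket grow at most like powers of \<open>qb\<close>,
    which gives integrability. The constant \<open>K\<close> below blows up as \<delta> tends to 0;
    this does no harm, since the limit is taken only after symmetrisation.\<close>
  define M where "M = real (card J) * \<beta> / 2"
  define C where "C = (\<Prod>j\<in>J. qb (y j) powr (\<beta> / 2))"
  have M: "0 \<le> M" using pos by (simp add: M_def)
  have C: "0 \<le> C" unfolding C_def by (intro prod_nonneg) auto
  have Qle: "Q x \<le> C * qb x powr M" for x
  proof -
    have "Q x \<le> (\<Prod>j\<in>J. qb x powr (\<beta> / 2) * qb (y j) powr (\<beta> / 2))"
      unfolding Q_def
    proof (intro prod_mono conjI)
      fix j
      have "((x - y j)\<^sup>2 + \<delta>) powr (\<beta> / 2) \<le> (qb x * qb (y j)) powr (\<beta> / 2)"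
        using pos q0[of x j] dist_sq_le_qb by (intro powr_mono2) auto
      then show "((x - y j)\<^sup>2 + \<delta>) powr (\<beta> / 2) \<le> qb x powr (\<beta> / 2) * qb (y j) powr (\<beta> / 2)"
        using qb_ge_1[of x] qb_ge_1[of "y j"] by (simp add: powr_mult)
    qed simp
    also have "\<dots> = (qb x powr (\<beta> / 2)) ^ card J * C" by (simp add: prod.distrib C_def)
    also have "(qb x powr (\<beta> / 2)) ^ card J = qb x powr M"
      using qb_ge_1[of x] by (subst powr_realpow[symmetric]) (auto simp: powr_powr M_def mult_ac)
    finally show ?thesis by (simp add: mult.commute)
  qed
  define K where "K = a + c + \<beta> * (real (card J) / \<delta>)"
  have K: "0 \<le> K" using pos by (simp add: K_def)
  have Dle: "\<bar>a - c * x + \<beta> * (x * D x)\<bar> \<le> K * qb x" for x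
  proof -
    have "\<bar>D x\<bar> \<le> (\<Sum>j\<in>J. 1 / \<delta>)"
      unfolding D_def
    proof (rule order_trans[OF sum_abs sum_mono])
      fix j
      show "\<bar>(x - y j) / ((x - y j)\<^sup>2 + \<delta>)\<bar> \<le> 1 / \<delta>" by (rule abs_divide_sq_le[OF pos(4,5)])
    qed
    then have "\<bar>D x\<bar> \<le> real (card J) / \<delta>" by simp
    then have "\<bar>x\<bar> * \<bar>D x\<bar> \<le> qb x * (real (card J) / \<delta>)"
      using qb_ge_abs[of x] by (intro mult_mono) auto
    then have "\<beta> * (\<bar>x\<bar> * \<bar>D x\<bar>) \<le> \<beta> * (qb x * (real (card J) / \<delta>))" using pos by (intro mult_left_mono) auto
    moreover have "\<bar>a - c * x + \<beta> * (x * D x)\<bar> \<le> a + c * \<bar>x\<bar> + \<beta> * (\<bar>x\<bar> * \<bar>D x\<bar>)"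
      using abs_affine_le[of a c \<beta> x "x * D x"] pos by (simp add: abs_mult)
    moreover have "c * \<bar>x\<bar> \<le> c * qb x" "a * 1 \<le> a * qb x" using pos qb_ge_abs qb_ge_1 by (auto intro!: mult_left_mono)
    ultimately show ?thesis unfolding K_def by (simp add: algebra_simps)
  qed
  have [measurable]: "Q \<in> borel_measurable borel" "D \<in> borel_measurable borel" unfolding Q_def D_def by measurable
  have int: "integrable lborel (\<lambda>x. gw a c x * (a - c * x + \<beta> * (x * D x)) * Q x)"
  proof (rule Bochner_Integration.integrable_bound)
    show "integrable lborel (\<lambda>x. K * C * (qb x powr (M + 1) * gw a c x))"
      using pos M by (intro integrable_mult_right integrable_qb_gw) auto
    show "AE x in lborel. norm (gw a c x * (a - c * x + \<beta> * (x * D x)) * Q x) \<le> norm (K * C * (qb x powr (M + 1) * gw a c x))"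
    proof (rule AE_I2)
      fix x
      have "\<bar>a - c * x + \<beta> * (x * D x)\<bar> * Q x \<le> (K * qb x) * (C * qb x powr M)"
        using Dle Qle Qpos[of x] K qb_ge_1[of x] by (intro mult_mono) auto
      also have "\<dots> = K * C * qb x powr (M + 1)" using qb_ge_1[of x] by (simp add: powr_add)
      finally have "gw a c x * (\<bar>a - c * x + \<beta> * (x * D x)\<bar> * Q x) \<le> gw a c x * (K * C * qb x powr (M + 1))"
        by (intro mult_left_mono) auto
      then show "norm (gw a c x * (a - c * x + \<beta> * (x * D x)) * Q x) \<le> norm (K * C * (qb x powr (M + 1) * gw a c x))"
        using Qpos[of x] K C by (simp add: abs_mult mult_ac)
    qed
  qed measurable
  have feq: "indicator {0<..} x * f x = gw a c x * (a - c * x + \<beta> * (x * D x)) * Q x" for x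
    by (simp add: f_def gw_def)
  have ein: "einterval 0 \<infinity> = {0::real<..}" by (auto simp: einterval_def)
  have "(LBINT x=0..\<infinity>. f x) = 0 - 0"
  proof (rule interval_integral_FTC_integrable)
    show "(F has_vector_derivative f x) (at x)" if "0 < ereal x" for x
      using Fder that by (simp add: has_real_derivative_iff_has_vector_derivative[symmetric])
    show "isCont f x" if "0 < ereal x" for x using fcont that by simp
    show "set_integrable lborel (einterval 0 \<infinity>) f"
      unfolding set_integrable_def ein using int by (simp add: feq)
    show "((F \<circ> real_of_ereal) \<longlongrightarrow> 0) (at_right 0)"
    proof -
      have "isCont Q 0" using Qder DERIV_isCont by blast
      then have Q0: "(Q \<longlongrightarrow> Q 0) (at_right 0)"
        using filterlim_at_split isContD by blast
      have "((\<lambda>x. x powr a) \<longlongrightarrow> 0 powr a) (at_right 0)"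
        using pos by (intro tendsto_powr2 tendsto_intros) (auto simp: eventually_at_right_less intro: eventually_at_rightI[of 0 1])
      moreover have "((\<lambda>x. exp (- c * x)) \<longlongrightarrow> exp (- c * 0)) (at_right 0)" by (intro tendsto_intros)
      ultimately have "(F \<longlongrightarrow> 0 powr a * exp (- c * 0) * Q 0) (at_right 0)"
        unfolding F_def using Q0 by (intro tendsto_mult) auto
      then show ?thesis unfolding zero_ereal_def by (simp add: ereal_tendsto_simps)
    qed
    show "((F \<circ> real_of_ereal) \<longlongrightarrow> 0) (at_left \<infinity>)"
    proof -
      have lim: "((\<lambda>x. C * 4 powr M * (x powr (a + 2 * M) * exp (- c * x))) \<longlongrightarrow> 0) at_top"
        using tendsto_mult[OF tendsto_const powr_exp_tendsto_0[OF pos(3)]] by simp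
      have "(F \<longlongrightarrow> 0) at_top"
      proof (rule tendsto_sandwich[OF _ _ tendsto_const lim])
        show "\<forall>\<^sub>F x in at_top. 0 \<le> F x" using Qpos by (auto simp: F_def less_imp_le)
        show "\<forall>\<^sub>F x in at_top. F x \<le> C * 4 powr M * (x powr (a + 2 * M) * exp (- c * x))"
          using eventually_ge_at_top[of 1]
        proof eventually_elim
          case (elim x)
          then have "1 \<le> x\<^sup>2" by (simp add: one_le_power)
          then have "qb x powr M \<le> (4 * x\<^sup>2) powr M" using M by (intro powr_mono2) (auto simp: qb_def)
          also have "\<dots> = 4 powr M * (x powr 2) powr M" using elim by (simp add: powr_mult)
          also have "\<dots> = 4 powr M * x powr (2 * M)" by (simp only: powr_powr)
          finally have "Q x \<le> C * (4 powr M * x powr (2 * M))"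
            using Qle[of x] C by (meson mult_left_mono order_trans)
          then have "F x \<le> x powr a * exp (- c * x) * (C * (4 powr M * x powr (2 * M)))"
            unfolding F_def by (intro mult_left_mono) auto
          then show ?case by (simp add: powr_add mult_ac)
        qed
      qed
      then show ?thesis by (simp add: ereal_tendsto_simps)
    qed
  qed simp_all
  then have "(\<integral>x. indicator {0<..} x * f x \<partial>lborel) = 0"
    by (simp add: interval_lebesgue_integral_def ein set_lebesgue_integral_def)
  moreover have "x * D x = (\<Sum>j\<in>J. x * (x - y j) / ((x - y j)\<^sup>2 + \<delta>))" for x
    by (simp add: D_def sum_distrib_left)
  ultimately show ?thesis by (simp add: feq Q_def)
qed

text \<open>The derivative in direction \<open>i\<close> is taken of \<open>l i\<close> times the
  density with the other coordinates frozen, so Fubini reduces everything to one dimension. The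
  moment product omits \<open>i\<close> because this extra \<open>l i\<close> already supplies that
  factor. The third claim allows the interaction sum to be split term by term.\<close>

lemma integral_lag_by_parts:
  assumes I: "finite I" and i: "i \<in> S" and S: "S \<subseteq> I" and pos: "0 < \<beta>" "0 < a" "0 < c" "0 < \<delta>" "\<delta> \<le> 1"
  shows "integrable (lebP I) (\<lambda>l. (\<Prod>k\<in>S-{i}. l k) * (a - c * l i + \<beta> * (\<Sum>j\<in>I-{i}. l i * (l i - l j) / ((l i - l j)\<^sup>2 + \<delta>))) * lag \<delta> \<beta> a c I l)"
    (is "integrable _ ?f")
    and "(\<integral>l. (\<Prod>k\<in>S-{i}. l k) * (a - c * l i + \<beta> * (\<Sum>j\<in>I-{i}. l i * (l i - l j) / ((l i - l j)\<^sup>2 + \<delta>))) * lag \<delta> \<beta> a c I l \<partial>lebP I) = 0"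
    and "j \<in> I \<Longrightarrow> integrable (lebP I) (\<lambda>l. (\<Prod>k\<in>S-{i}. l k) * (l i * (l i - l j) / ((l i - l j)\<^sup>2 + \<delta>)) * lag \<delta> \<beta> a c I l)"
proof -
  have iI: "i \<in> I" using i S by auto
  have q0: "0 < d\<^sup>2 + \<delta>" for d :: real using pos by (simp add: add_nonneg_pos)
  note dle = abs_divide_sq_le[OF pos(4,5)]
  have tle: "\<bar>x * d / (d\<^sup>2 + \<delta>)\<bar> \<le> 1 / \<delta> * qb x" for x d
  proof -
    have "\<bar>d / (d\<^sup>2 + \<delta>)\<bar> * \<bar>x\<bar> \<le> 1 / \<delta> * qb x" by (intro mult_mono dle qb_ge_abs) (use pos in auto)
    then show ?thesis by (simp add: abs_mult abs_divide mult_ac)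
  qed
  have comp[measurable]: "(\<lambda>l. l k) \<in> borel_measurable (lebP I)" if "k \<in> I" for k
    using that by (auto intro!: measurable_component_singleton simp: measurable_lborel1)
  note [measurable] = comp[OF iI]
  show "integrable (lebP I) (\<lambda>l. (\<Prod>k\<in>S-{i}. l k) * (l i * (l i - l j) / ((l i - l j)\<^sup>2 + \<delta>)) * lag \<delta> \<beta> a c I l)" if [measurable]: "j \<in> I"
    by (rule integrable_lag[OF I iI, where K = "1 / \<delta>"]) (use S pos tle in auto)
  show int: "integrable (lebP I) ?f"
  proof (rule integrable_lag[OF I iI, where K = "a + c + \<beta> * (real (card (I - {i})) / \<delta>)"])
    fix l :: "nat \<Rightarrow> real"
    have "\<bar>\<Sum>j\<in>I-{i}. l i * (l i - l j) / ((l i - l j)\<^sup>2 + \<delta>)\<bar> \<le> (\<Sum>j\<in>I-{i}. 1 / \<delta> * qb (l i))"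
      by (rule order_trans[OF sum_abs sum_mono[OF tle]])
    then have "\<beta> * \<bar>\<Sum>j\<in>I-{i}. l i * (l i - l j) / ((l i - l j)\<^sup>2 + \<delta>)\<bar> \<le> \<beta> * (real (card (I-{i})) / \<delta> * qb (l i))"
      using pos by (intro mult_left_mono) auto
    moreover have "c * \<bar>l i\<bar> \<le> c * qb (l i)" "a * 1 \<le> a * qb (l i)" using pos qb_ge_abs qb_ge_1 by (auto intro!: mult_left_mono)
    moreover have "\<bar>a - c * x + \<beta> * y\<bar> \<le> a + c * \<bar>x\<bar> + \<beta> * \<bar>y\<bar>" for x y
      using abs_affine_le pos by simp
    note this[of "l i" "\<Sum>j\<in>I-{i}. l i * (l i - l j) / ((l i - l j)\<^sup>2 + \<delta>)"]
    ultimately show "\<bar>a - c * l i + \<beta> * (\<Sum>j\<in>I-{i}. l i * (l i - l j) / ((l i - l j)\<^sup>2 + \<delta>))\<bar> \<le> (a + c + \<beta> * (real (card (I - {i})) / \<delta>)) * qb (l i)"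
      by (simp add: algebra_simps)
    show "(\<lambda>l. a - c * l i + \<beta> * (\<Sum>j\<in>I-{i}. l i * (l i - l j) / ((l i - l j)\<^sup>2 + \<delta>))) \<in> borel_measurable (lebP I)"
      by (intro borel_measurable_add borel_measurable_diff borel_measurable_times borel_measurable_const
          borel_measurable_sum borel_measurable_divide borel_measurable_power comp iI) auto
  qed (use S pos in auto)
  let ?J = "I - {i}"
  have ins: "insert i ?J = I" using iI by auto
  have J: "finite ?J" "i \<notin> ?J" using I by auto
  have "(\<integral>l. ?f l \<partial>lebP I) = (\<integral>x. (\<integral>y. ?f (x(i := y)) \<partial>lborel) \<partial>lebP ?J)"
    using lborel_product.product_integral_insert[OF J, of ?f] int by (simp only: ins)
  also have "\<dots> = (\<integral>x. 0 \<partial>lebP ?J)"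
  proof (rule Bochner_Integration.integral_cong[OF refl])
    fix x
    let ?c = "(\<Prod>k\<in>S-{i}. x k) * (\<Prod>k\<in>?J. gw a c (x k)) * vdm \<delta> \<beta> ?J x"
    let ?u = "\<lambda>y. gw a c y * (a - c * y + \<beta> * (\<Sum>j\<in>?J. y * (y - x j) / ((y - x j)\<^sup>2 + \<delta>))) * (\<Prod>j\<in>?J. ((y - x j)\<^sup>2 + \<delta>) powr (\<beta> / 2))"
    have "?f (x(i := y)) = ?c * ?u y" for y
    proof -
      have p1: "(\<Prod>k\<in>S-{i}. (x(i := y)) k) = (\<Prod>k\<in>S-{i}. x k)" by (intro prod.cong) auto
      have p2: "(\<Sum>j\<in>?J. (x(i := y)) i * ((x(i := y)) i - (x(i := y)) j) / (((x(i := y)) i - (x(i := y)) j)\<^sup>2 + \<delta>))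
          = (\<Sum>j\<in>?J. y * (y - x j) / ((y - x j)\<^sup>2 + \<delta>))" by (intro sum.cong) auto
      have "lag \<delta> \<beta> a c (insert i ?J) (x(i := y)) = gw a c y * (\<Prod>k\<in>?J. gw a c (x k)) * (vdm \<delta> \<beta> ?J x * (\<Prod>j\<in>?J. ((y - x j)\<^sup>2 + \<delta>) powr (\<beta> / 2)))"
      proof -
        have "(\<Prod>k\<in>?J. gw a c ((x(i := y)) k)) = (\<Prod>k\<in>?J. gw a c (x k))" by (intro prod.cong) auto
        moreover have "vdm \<delta> \<beta> ?J (x(i := y)) = vdm \<delta> \<beta> ?J x" by (intro vdm_cong) auto
        moreover have "(\<Prod>j\<in>?J. (((x(i := y)) i - (x(i := y)) j)\<^sup>2 + \<delta>) powr (\<beta> / 2)) = (\<Prod>j\<in>?J. ((y - x j)\<^sup>2 + \<delta>) powr (\<beta> / 2))"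
          by (intro prod.cong) auto
        ultimately show ?thesis
          unfolding lag_def vdm_insert[OF J] prod.insert[OF J] by (simp only: fun_upd_same)
      qed
      then have p3: "lag \<delta> \<beta> a c I (x(i := y)) = gw a c y * (\<Prod>k\<in>?J. gw a c (x k)) * (vdm \<delta> \<beta> ?J x * (\<Prod>j\<in>?J. ((y - x j)\<^sup>2 + \<delta>) powr (\<beta> / 2)))"
        by (simp only: ins)
      show ?thesis unfolding p1 p2 p3 unfolding fun_upd_same by (simp only: mult_ac)
    qed
    then have "(\<integral>y. ?f (x(i := y)) \<partial>lborel) = (\<integral>y. ?c * ?u y \<partial>lborel)" by (intro Bochner_Integration.integral_cong[OF refl])
    also have "\<dots> = ?c * (\<integral>y. ?u y \<partial>lborel)" by (rule integral_mult_right_zero)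
    also have "\<dots> = 0"
      unfolding integral_gw_derivative_eq_0[OF J(1) pos, of x] by (rule mult_zero_right)
    finally show "(\<integral>y. ?f (x(i := y)) \<partial>lborel) = 0" .
  qed
  finally show "(\<integral>l. ?f l \<partial>lebP I) = 0" by simp
qed

section \<open>Recursion for mixed moments of distinct coordinates\<close>

definition lag_moment :: "real \<Rightarrow> real \<Rightarrow> real \<Rightarrow> real \<Rightarrow> nat set \<Rightarrow> nat set \<Rightarrow> real" where
  "lag_moment \<delta> \<beta> a c I S = (\<integral>l. (\<Prod>k\<in>S. l k) * lag \<delta> \<beta> a c I l \<partial>lebP I)"

lemma prod_measurable_lebP [measurable]: "S \<subseteq> I \<Longrightarrow> (\<lambda>l. \<Prod>k\<in>S. l k) \<in> borel_measurable (lebP I)"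
  by (intro borel_measurable_prod) (auto intro!: measurable_component_singleton simp: measurable_lborel1)

lemma prod_transpose_eq:
  assumes "i \<notin> S" "j \<notin> S" "S \<subseteq> I"
  shows "(\<Prod>k\<in>S. (\<lambda>k\<in>I. l (Transposition.transpose i j k)) k) = (\<Prod>k\<in>S. l k)"
  using assms by (intro prod.cong) (auto simp: Transposition.transpose_def)

text \<open>Exchange \<open>i\<close> and \<open>j\<close>. If \<open>j \<in> S\<close>, the factor
  \<open>l j\<close> of the moment product makes the integrand antisymmetric. Otherwise the
  integrand and its swap add up to a term with ratio
  \<open>(l i - l j)^2 / ((l i - l j)^2 + \<delta>)\<close>, which is bounded by 1 uniformly in
  \<delta>; the singularity has disappeared.\<close>

lemma lag_interaction_moment:
  assumes I: "finite I" and i: "i \<in> S" and S: "S \<subseteq> I" and pos: "0 < \<beta>" "0 < a" "0 < c" "0 < \<delta>" "\<delta> \<le> 1"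
    and j: "j \<in> I - {i}"
  shows "(\<integral>l. (\<Prod>k\<in>S-{i}. l k) * (l i * (l i - l j) / ((l i - l j)\<^sup>2 + \<delta>)) * lag \<delta> \<beta> a c I l \<partial>lebP I)
    = (if j \<in> S then 0 else (\<integral>l. (\<Prod>k\<in>S-{i}. l k) * ((l i - l j)\<^sup>2 / ((l i - l j)\<^sup>2 + \<delta>)) * lag \<delta> \<beta> a c I l \<partial>lebP I) / 2)"
proof -
  let ?f = "\<lambda>l. (\<Prod>k\<in>S-{i}. l k) * (l i * (l i - l j) / ((l i - l j)\<^sup>2 + \<delta>)) * lag \<delta> \<beta> a c I l"
  let ?\<tau> = "\<lambda>l. \<lambda>k\<in>I. l (Transposition.transpose i j k)"
  have iI: "i \<in> I" and jI: "j \<in> I" and ij: "i \<noteq> j" using i S j by auto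
  have comp: "(\<lambda>l. l k) \<in> borel_measurable (lebP I)" if "k \<in> I" for k
    using that by (auto intro!: measurable_component_singleton simp: measurable_lborel1)
  note [measurable] = comp[OF iI] comp[OF jI]
  have SI: "S - {i} \<subseteq> I" "S - {i} - {j} \<subseteq> I" using S by auto
  have [measurable]: "?f \<in> borel_measurable (lebP I)"
    using prod_measurable_lebP[OF SI(1)] by measurable
  have int: "integrable (lebP I) ?f" by (rule integral_lag_by_parts(3)[OF I i S pos jI])
  have sw: "(\<integral>l. ?f (?\<tau> l) \<partial>lebP I) = (\<integral>l. ?f l \<partial>lebP I)"
    by (rule integral_lebP_transpose[OF I iI jI]) measurable
  have \<tau>: "?\<tau> l i = l j" "?\<tau> l j = l i" for l using iI jI by auto
  show ?thesis
  proof (cases "j \<in> S")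
    case True
    have fs: "finite (S - {i})" using I S finite_subset by blast
    have "?f (?\<tau> l) = - ?f l" for l
    proof -
      have p: "(\<Prod>k\<in>S-{i}. l k) = l j * (\<Prod>k\<in>S-{i}-{j}. l k)" for l :: "nat \<Rightarrow> real"
        using fs True ij by (intro prod.remove) auto
      have q: "(\<Prod>k\<in>S-{i}-{j}. ?\<tau> l k) = (\<Prod>k\<in>S-{i}-{j}. l k)"
        by (rule prod_transpose_eq) (use SI in auto)
      show ?thesis
        unfolding p q \<tau> lag_transpose[OF iI jI] power2_commute[of "l j" "l i"]
        by (cases "(l i - l j)\<^sup>2 + \<delta> = 0") (simp_all add: divide_simps, simp_all add: algebra_simps)
    qed
    then have "(\<integral>l. ?f (?\<tau> l) \<partial>lebP I) = - (\<integral>l. ?f l \<partial>lebP I)" by simp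
    with sw have "(\<integral>l. ?f l \<partial>lebP I) = 0" by linarith
    with True show ?thesis by simp
  next
    case False
    have q: "(\<Prod>k\<in>S-{i}. ?\<tau> l k) = (\<Prod>k\<in>S-{i}. l k)" for l
      by (rule prod_transpose_eq) (use SI False in auto)
    have eq: "?f l + ?f (?\<tau> l) = (\<Prod>k\<in>S-{i}. l k) * ((l i - l j)\<^sup>2 / ((l i - l j)\<^sup>2 + \<delta>)) * lag \<delta> \<beta> a c I l" for l
    proof -
      have "l i * (l i - l j) / D + l j * (l j - l i) / D = (l i - l j)\<^sup>2 / D" for D
        by (simp add: power2_eq_square algebra_simps flip: add_divide_distrib)
      from this[of "(l i - l j)\<^sup>2 + \<delta>"] show ?thesis
        unfolding q \<tau> lag_transpose[OF iI jI] power2_commute[of "l j" "l i"]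
        by (simp only: flip: distrib_left distrib_right)
    qed
    have int': "integrable (lebP I) (\<lambda>l. ?f (?\<tau> l))"
    proof -
      have m: "?\<tau> \<in> measurable (lebP I) (lebP I)"
        using iI jI by (intro measurable_restrict measurable_component_singleton) (auto simp: Transposition.transpose_def)
      have "integrable (distr (lebP I) (lebP I) ?\<tau>) ?f"
        using int by (simp add: distr_lebP_transpose[OF I iI jI])
      then show ?thesis by (subst (asm) integrable_distr_eq[OF m]) measurable
    qed
    have "(\<integral>l. ?f l + ?f (?\<tau> l) \<partial>lebP I) = (\<integral>l. ?f l \<partial>lebP I) + (\<integral>l. ?f (?\<tau> l) \<partial>lebP I)"
      by (rule Bochner_Integration.integral_add[OF int int'])
    then have "2 * (\<integral>l. ?f l \<partial>lebP I) = (\<integral>l. (\<Prod>k\<in>S-{i}. l k) * ((l i - l j)\<^sup>2 / ((l i - l j)\<^sup>2 + \<delta>)) * lag \<delta> \<beta> a c I l \<partial>lebP I)"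
      unfolding eq sw by simp
    with False show ?thesis by simp
  qed
qed

lemma integrable_lag_moment:
  assumes I: "finite I" and "I \<noteq> {}" and S: "S \<subseteq> I" and pos: "0 < \<beta>" "0 < a" "0 < c" "0 \<le> \<delta>" "\<delta> \<le> 1"
  shows "integrable (lebP I) (\<lambda>l. (\<Prod>k\<in>S. l k) * lag \<delta> \<beta> a c I l)"
proof -
  obtain i where i: "i \<in> I" using \<open>I \<noteq> {}\<close> by auto
  show ?thesis
    using integrable_lag[OF I i S pos(1,4,5,2,3), of "\<lambda>_. 1" 1] qb_ge_1 by simp
qed

text \<open>Linearity applied to the integration by parts identity. Partners inside \<open>S\<close>
  drop out by antisymmetry, so only \<open>I - S\<close> is left in the sum.\<close>

lemma lag_moment_regularised:
  assumes I: "finite I" and i: "i \<in> S" and S: "S \<subseteq> I" and pos: "0 < \<beta>" "0 < a" "0 < c" "0 < \<delta>" "\<delta> \<le> 1"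
  shows "c * lag_moment \<delta> \<beta> a c I S = a * lag_moment \<delta> \<beta> a c I (S - {i})
    + \<beta> / 2 * (\<Sum>j\<in>I-S. \<integral>l. (\<Prod>k\<in>S-{i}. l k) * ((l i - l j)\<^sup>2 / ((l i - l j)\<^sup>2 + \<delta>)) * lag \<delta> \<beta> a c I l \<partial>lebP I)"
proof -
  have Sf: "finite S" "I \<noteq> {}" using I S finite_subset i by auto
  let ?p = "\<lambda>l. \<Prod>k\<in>S-{i}. l k :: real" and ?L = "lag \<delta> \<beta> a c I"
  let ?t = "\<lambda>j l. l i * (l i - l j) / ((l i - l j)\<^sup>2 + \<delta>)"
  let ?d = "\<lambda>j l. (l i - l j)\<^sup>2 / ((l i - l j)\<^sup>2 + \<delta>)"
  have p: "(\<Prod>k\<in>S. l k) = l i * ?p l" for l :: "nat \<Rightarrow> real"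
    using Sf i by (intro prod.remove)
  have eq: "?p l * (a - c * l i + \<beta> * (\<Sum>j\<in>I-{i}. ?t j l)) * ?L l
     = a * (?p l * ?L l) - c * ((\<Prod>k\<in>S. l k) * ?L l) + \<beta> * (\<Sum>j\<in>I-{i}. ?p l * ?t j l * ?L l)" for l
  proof -
    have "(\<Sum>j\<in>I-{i}. ?p l * ?t j l * ?L l) = ?p l * (\<Sum>j\<in>I-{i}. ?t j l) * ?L l"
      by (simp add: sum_distrib_left sum_distrib_right)
    then show ?thesis unfolding p by (simp only: algebra_simps)
  qed
  have i1: "integrable (lebP I) (\<lambda>l. ?p l * ?L l)"
    by (rule integrable_lag_moment) (use I Sf S pos in auto)
  have i2: "integrable (lebP I) (\<lambda>l. (\<Prod>k\<in>S. l k) * ?L l)"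
    by (rule integrable_lag_moment) (use I Sf S pos in auto)
  have i3: "integrable (lebP I) (\<lambda>l. ?p l * ?t j l * ?L l)" if "j \<in> I - {i}" for j
    using integral_lag_by_parts(3)[OF I i S pos] that by auto
  have "0 = (\<integral>l. a * (?p l * ?L l) - c * ((\<Prod>k\<in>S. l k) * ?L l) + \<beta> * (\<Sum>j\<in>I-{i}. ?p l * ?t j l * ?L l) \<partial>lebP I)"
    using integral_lag_by_parts(2)[OF I i S pos] unfolding eq by simp
  also have "\<dots> = (\<integral>l. a * (?p l * ?L l) - c * ((\<Prod>k\<in>S. l k) * ?L l) \<partial>lebP I) + (\<integral>l. \<beta> * (\<Sum>j\<in>I-{i}. ?p l * ?t j l * ?L l) \<partial>lebP I)"
    by (intro Bochner_Integration.integral_add Bochner_Integration.integrable_diff integrable_mult_right Bochner_Integration.integrable_sum i1 i2 i3)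
  also have "(\<integral>l. a * (?p l * ?L l) - c * ((\<Prod>k\<in>S. l k) * ?L l) \<partial>lebP I) = (\<integral>l. a * (?p l * ?L l) \<partial>lebP I) - (\<integral>l. c * ((\<Prod>k\<in>S. l k) * ?L l) \<partial>lebP I)"
    by (intro Bochner_Integration.integral_diff integrable_mult_right i1 i2)
  also have "(\<integral>l. a * (?p l * ?L l) \<partial>lebP I) = a * lag_moment \<delta> \<beta> a c I (S - {i})"
    unfolding lag_moment_def by (rule integral_mult_right_zero)
  also have "(\<integral>l. c * ((\<Prod>k\<in>S. l k) * ?L l) \<partial>lebP I) = c * lag_moment \<delta> \<beta> a c I S"
    unfolding lag_moment_def by (rule integral_mult_right_zero)
  also have "(\<integral>l. \<beta> * (\<Sum>j\<in>I-{i}. ?p l * ?t j l * ?L l) \<partial>lebP I) = \<beta> * (\<integral>l. (\<Sum>j\<in>I-{i}. ?p l * ?t j l * ?L l) \<partial>lebP I)"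
    by (rule integral_mult_right_zero)
  also have "(\<integral>l. (\<Sum>j\<in>I-{i}. ?p l * ?t j l * ?L l) \<partial>lebP I) = (\<Sum>j\<in>I-{i}. \<integral>l. ?p l * ?t j l * ?L l \<partial>lebP I)"
    by (rule Bochner_Integration.integral_sum[OF i3])
  also have "\<dots> = (\<Sum>j\<in>I-{i}. if j \<in> S then 0 else (\<integral>l. ?p l * ?d j l * ?L l \<partial>lebP I) / 2)"
    by (intro sum.cong refl lag_interaction_moment[OF I i S pos])
  also have "\<dots> = (\<Sum>j\<in>I-S. (\<integral>l. ?p l * ?d j l * ?L l \<partial>lebP I) / 2)"
    by (rule sum.mono_neutral_cong_right) (use I i in auto)
  also have "\<dots> = (\<Sum>j\<in>I-S. \<integral>l. ?p l * ?d j l * ?L l \<partial>lebP I) / 2"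
    by (simp only: sum_divide_distrib)
  finally show ?thesis by simp
qed

lemma lag_tendsto:
  assumes "finite I" "0 < \<beta>"
  shows "(\<lambda>m. lag (1 / real (Suc m)) \<beta> a c I l) \<longlonglongrightarrow> lag 0 \<beta> a c I l"
proof -
  have lim: "(\<lambda>m. ((x::real)\<^sup>2 + 1 / real (Suc m)) powr (\<beta> / 4)) \<longlonglongrightarrow> (x\<^sup>2 + 0) powr (\<beta> / 4)" for x
    using assms by (intro tendsto_powr2 tendsto_intros LIMSEQ_Suc[OF lim_1_over_n]) auto
  show ?thesis
    unfolding lag_def vdm_def by (intro tendsto_mult tendsto_const tendsto_prod lim)
qed

text \<open>Dominated convergence with majorant \<open>lag_dom\<close>. Convergence of
  \<open>h\<close> is asked only where the limiting density is nonzero, because the ratios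
  \<open>d^2 / (d^2 + \<delta>)\<close> stay 0 at a tie.\<close>

lemma lag_moment_tendsto:
  assumes I: "finite I" "I \<noteq> {}" and S: "S \<subseteq> I" and pos: "0 < \<beta>" "0 < a" "0 < c"
    and h: "\<And>m l. \<bar>h m l\<bar> \<le> 1" "\<And>l. lag 0 \<beta> a c I l \<noteq> 0 \<Longrightarrow> (\<lambda>m. h m l) \<longlonglongrightarrow> 1"
    and m[measurable]: "\<And>m. h m \<in> borel_measurable (lebP I)"
  shows "(\<lambda>m. \<integral>l. (\<Prod>k\<in>S. l k) * h m l * lag (1 / real (Suc m)) \<beta> a c I l \<partial>lebP I) \<longlonglongrightarrow> lag_moment 0 \<beta> a c I S"
  unfolding lag_moment_def
proof (rule integral_dominated_convergence[where w = "lag_dom \<beta> a c I"])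
  note [measurable] = prod_measurable_lebP[OF S]
  show "(\<lambda>l. (\<Prod>k\<in>S. l k) * lag 0 \<beta> a c I l) \<in> borel_measurable (lebP I)" by measurable
  show "(\<lambda>l. (\<Prod>k\<in>S. l k) * h m l * lag (1 / real (Suc m)) \<beta> a c I l) \<in> borel_measurable (lebP I)" for m by measurable
  show "integrable (lebP I) (lag_dom \<beta> a c I)" by (rule integrable_lag_dom) (use I pos in auto)
  show "AE l in lebP I. (\<lambda>m. (\<Prod>k\<in>S. l k) * h m l * lag (1 / real (Suc m)) \<beta> a c I l) \<longlonglongrightarrow> (\<Prod>k\<in>S. l k) * lag 0 \<beta> a c I l"
  proof (rule AE_I2)
    fix l
    note lim = lag_tendsto[OF I(1) pos(1), of a c l]
    show "(\<lambda>m. (\<Prod>k\<in>S. l k) * h m l * lag (1 / real (Suc m)) \<beta> a c I l) \<longlonglongrightarrow> (\<Prod>k\<in>S. l k) * lag 0 \<beta> a c I l"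
    proof (cases "lag 0 \<beta> a c I l = 0")
      case True
      have "(\<lambda>m. (\<Prod>k\<in>S. l k) * (h m l * lag (1 / real (Suc m)) \<beta> a c I l)) \<longlonglongrightarrow> (\<Prod>k\<in>S. l k) * 0"
      proof (intro tendsto_mult tendsto_const)
        show "(\<lambda>m. h m l * lag (1 / real (Suc m)) \<beta> a c I l) \<longlonglongrightarrow> 0"
        proof (rule Lim_null_comparison)
          show "\<forall>\<^sub>F m in sequentially. norm (h m l * lag (1 / real (Suc m)) \<beta> a c I l) \<le> lag (1 / real (Suc m)) \<beta> a c I l"
            using h(1) by (intro always_eventually allI) (auto simp: abs_mult intro!: mult_left_le_one_le)
          show "(\<lambda>m. lag (1 / real (Suc m)) \<beta> a c I l) \<longlonglongrightarrow> 0" using lim True by simp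
        qed
      qed
      then show ?thesis using True by (simp add: mult.assoc)
    next
      case False
      from tendsto_mult[OF tendsto_mult[OF tendsto_const h(2)[OF False]] lim] show ?thesis by simp
    qed
  qed
  obtain i where i: "i \<in> I" using I by auto
  show "AE l in lebP I. norm ((\<Prod>k\<in>S. l k) * h m l * lag (1 / real (Suc m)) \<beta> a c I l) \<le> lag_dom \<beta> a c I l" for m
  proof (rule AE_I2)
    fix l
    have "\<bar>h m l\<bar> \<le> 1 * qb (l i)" using h(1)[of m l] qb_ge_1[of "l i"] by linarith
    from lag_bound[where h = "h m l" and l = l, OF I(1) i S pos(1) _ _ this, of "1 / real (Suc m)" a c]
    show "norm ((\<Prod>k\<in>S. l k) * h m l * lag (1 / real (Suc m)) \<beta> a c I l) \<le> lag_dom \<beta> a c I l" by simp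
  qed
qed

text \<open>Aomoto's recursion: as the smoothing vanishes, each of the \<open>card (I - S)\<close>
  symmetrised terms tends to the same lower moment and contributes \<open>\<beta> / 2\<close> of
  it.\<close>

lemma lag_moment_step:
  assumes I: "finite I" and i: "i \<in> S" and S: "S \<subseteq> I" and pos: "0 < \<beta>" "0 < a" "0 < c"
  shows "c * lag_moment 0 \<beta> a c I S = (a + \<beta> / 2 * real (card (I - S))) * lag_moment 0 \<beta> a c I (S - {i})"
proof -
  let ?\<delta> = "\<lambda>m::nat. 1 / real (Suc m)"
  have ne: "I \<noteq> {}" and iI: "i \<in> I" using i S by auto
  have comp: "(\<lambda>l. l k) \<in> borel_measurable (lebP I)" if "k \<in> I" for k
    using that by (auto intro!: measurable_component_singleton simp: measurable_lborel1)
  have plain: "(\<lambda>m. lag_moment (?\<delta> m) \<beta> a c I T) \<longlonglongrightarrow> lag_moment 0 \<beta> a c I T" if "T \<subseteq> I" for T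
    using lag_moment_tendsto[OF I ne that pos, of "\<lambda>_ _. 1"] unfolding lag_moment_def[of "?\<delta> _"] by simp
  have inter: "(\<lambda>m. \<integral>l. (\<Prod>k\<in>S-{i}. l k) * ((l i - l j)\<^sup>2 / ((l i - l j)\<^sup>2 + ?\<delta> m)) * lag (?\<delta> m) \<beta> a c I l \<partial>lebP I) \<longlonglongrightarrow> lag_moment 0 \<beta> a c I (S - {i})"
    if j: "j \<in> I - S" for j
  proof (rule lag_moment_tendsto[OF I ne _ pos])
    have ij: "i \<noteq> j" "j \<in> I" using i j by auto
    show "S - {i} \<subseteq> I" using S by auto
    have q0: "0 < (x::real)\<^sup>2 + ?\<delta> m" for x m by (simp add: add_nonneg_pos)
    show "\<bar>(l i - l j)\<^sup>2 / ((l i - l j)\<^sup>2 + ?\<delta> m)\<bar> \<le> 1" for m and l :: "nat \<Rightarrow> real"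
    proof -
      have "(l i - l j)\<^sup>2 / ((l i - l j)\<^sup>2 + ?\<delta> m) \<le> 1" using q0[of "l i - l j" m] by (subst divide_le_eq_1_pos) auto
      moreover have "0 \<le> (l i - l j)\<^sup>2 / ((l i - l j)\<^sup>2 + ?\<delta> m)" using q0[of "l i - l j" m] by (intro divide_nonneg_pos) auto
      ultimately show ?thesis by linarith
    qed
    show "(\<lambda>m. (l i - l j)\<^sup>2 / ((l i - l j)\<^sup>2 + ?\<delta> m)) \<longlonglongrightarrow> 1" if "lag 0 \<beta> a c I l \<noteq> 0" for l
    proof -
      have "l i \<noteq> l j" using vdm_0_eq_0[OF I iI ij(2,1), of l \<beta>] that unfolding lag_def by auto
      then have "(\<lambda>m. (l i - l j)\<^sup>2 / ((l i - l j)\<^sup>2 + ?\<delta> m)) \<longlonglongrightarrow> (l i - l j)\<^sup>2 / ((l i - l j)\<^sup>2 + 0)"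
        by (intro tendsto_intros LIMSEQ_Suc[OF lim_1_over_n]) auto
      then show ?thesis using \<open>l i \<noteq> l j\<close> by simp
    qed
    show "(\<lambda>l. (l i - l j)\<^sup>2 / ((l i - l j)\<^sup>2 + ?\<delta> m)) \<in> borel_measurable (lebP I)" for m
      using comp[OF iI] comp[OF ij(2)] by measurable
  qed
  have S': "S - {i} \<subseteq> I" using S by auto
  have "(\<lambda>m. c * lag_moment (?\<delta> m) \<beta> a c I S) \<longlonglongrightarrow> c * lag_moment 0 \<beta> a c I S"
    by (intro tendsto_mult tendsto_const plain S)
  moreover have "(\<lambda>m. c * lag_moment (?\<delta> m) \<beta> a c I S) \<longlonglongrightarrow> a * lag_moment 0 \<beta> a c I (S - {i})
    + \<beta> / 2 * (\<Sum>j\<in>I-S. lag_moment 0 \<beta> a c I (S - {i}))"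
  proof -
    have "(\<lambda>m. a * lag_moment (?\<delta> m) \<beta> a c I (S - {i})
      + \<beta> / 2 * (\<Sum>j\<in>I-S. \<integral>l. (\<Prod>k\<in>S-{i}. l k) * ((l i - l j)\<^sup>2 / ((l i - l j)\<^sup>2 + ?\<delta> m)) * lag (?\<delta> m) \<beta> a c I l \<partial>lebP I))
      \<longlonglongrightarrow> a * lag_moment 0 \<beta> a c I (S - {i}) + \<beta> / 2 * (\<Sum>j\<in>I-S. lag_moment 0 \<beta> a c I (S - {i}))"
      by (intro tendsto_add tendsto_mult tendsto_const tendsto_sum plain S' inter)
    moreover have "c * lag_moment (?\<delta> m) \<beta> a c I S = a * lag_moment (?\<delta> m) \<beta> a c I (S - {i})
      + \<beta> / 2 * (\<Sum>j\<in>I-S. \<integral>l. (\<Prod>k\<in>S-{i}. l k) * ((l i - l j)\<^sup>2 / ((l i - l j)\<^sup>2 + ?\<delta> m)) * lag (?\<delta> m) \<beta> a c I l \<partial>lebP I)" for m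
      by (rule lag_moment_regularised[OF I i S pos]) auto
    ultimately show ?thesis by simp
  qed
  ultimately have "c * lag_moment 0 \<beta> a c I S = a * lag_moment 0 \<beta> a c I (S - {i}) + \<beta> / 2 * (\<Sum>j\<in>I-S. lag_moment 0 \<beta> a c I (S - {i}))"
    by (rule LIMSEQ_unique)
  then show ?thesis by (simp add: algebra_simps)
qed

lemma lag_moment_full:
  assumes I: "finite I" and pos: "0 < \<beta>" "0 < a" "0 < c"
  shows "c ^ card I * lag_moment 0 \<beta> a c I I = (\<Prod>j<card I. a + \<beta> / 2 * real j) * lag_moment 0 \<beta> a c I {}"
proof -
  have "c ^ card S * lag_moment 0 \<beta> a c I S = (\<Prod>j=card I - card S..<card I. a + \<beta> / 2 * real j) * lag_moment 0 \<beta> a c I {}"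
    if "S \<subseteq> I" for S
    using finite_subset[OF that I] that
  proof (induction S rule: finite_induct)
    case (insert i T)
    have c: "card (insert i T) = Suc (card T)" using insert.hyps by simp
    have le: "Suc (card T) \<le> card I" using card_mono[OF I insert.prems] c by simp
    have "card (I - insert i T) = card I - Suc (card T)"
      using insert.prems insert.hyps by (subst card_Diff_subset) (auto simp: c)
    then have st: "c * lag_moment 0 \<beta> a c I (insert i T) = (a + \<beta> / 2 * real (card I - Suc (card T))) * lag_moment 0 \<beta> a c I T"
      using lag_moment_step[OF I _ insert.prems pos, of i] insert.hyps by simp
    have "{card I - Suc (card T)..<card I} = insert (card I - Suc (card T)) {card I - card T..<card I}"
      using le by auto
    then have pr: "(\<Prod>j=card I - Suc (card T)..<card I. a + \<beta> / 2 * real j) = (a + \<beta> / 2 * real (card I - Suc (card T))) * (\<Prod>j=card I - card T..<card I. a + \<beta> / 2 * real j)"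
      using le by (simp only:) (subst prod.insert, auto)
    have "c ^ card (insert i T) * lag_moment 0 \<beta> a c I (insert i T) = c ^ card T * (c * lag_moment 0 \<beta> a c I (insert i T))"
      unfolding c by simp
    also have "\<dots> = (a + \<beta> / 2 * real (card I - Suc (card T))) * (c ^ card T * lag_moment 0 \<beta> a c I T)"
      unfolding st by (simp only: mult_ac)
    also have "c ^ card T * lag_moment 0 \<beta> a c I T = (\<Prod>j=card I - card T..<card I. a + \<beta> / 2 * real j) * lag_moment 0 \<beta> a c I {}"
      using insert by auto
    finally show ?case unfolding c pr by (simp only: mult_ac)
  qed simp
  from this[OF order_refl] show ?thesis by (simp add: atLeast0LessThan)
qed

section \<open>Evaluation of the Laguerre partition function\<close>

text \<open>Bohr-Mollerup argument for a general increment \<open>s\<close>: the difference of the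
  two functions has period 1, while convexity squeezes the slopes of both, to the right of a large
  integer \<open>m\<close>, between \<open>s (m - 1)\<close> and \<open>s m\<close>.\<close>

lemma convex_increment_unique:
  fixes L \<Lambda> s :: "real \<Rightarrow> real"
  assumes conv: "convex_on {0<..} L" "convex_on {0<..} \<Lambda>"
    and inc: "\<And>x. 0 < x \<Longrightarrow> L (x + 1) = L x + s x" "\<And>x. 0 < x \<Longrightarrow> \<Lambda> (x + 1) = \<Lambda> x + s x"
    and lim: "(\<lambda>m. s (real m + 1) - s (real m)) \<longlonglongrightarrow> 0" and x: "0 < x"
  shows "L x - \<Lambda> x = L 1 - \<Lambda> 1"
proof -
  define d where "d x = L x - \<Lambda> x" for x
  have per: "d (x + real k) = d x" if "0 < x" for x k
  proof (induction k)
    case (Suc k)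
    have "d (x + real (Suc k)) = d ((x + real k) + 1)" by (simp add: add_ac)
    also have "\<dots> = d (x + real k)" unfolding d_def using inc[of "x + real k"] that by simp
    finally show ?case using Suc by simp
  qed simp
  \<comment> \<open>The slopes of a convex function over \<open>[m - 1, m]\<close>,
    \<open>[m, m + t]\<close> and \<open>[m, m + 1]\<close> are ordered, and the outer two are the
    prescribed increments.\<close>
  have slope: "s (m - 1) \<le> (f (m + t) - f m) / t \<and> (f (m + t) - f m) / t \<le> s m"
    if "convex_on {0<..} f" "\<And>x. 0 < x \<Longrightarrow> f (x + 1) = f x + s x" "1 < m" "0 < t" "t < 1" for f :: "real \<Rightarrow> real" and m t
  proof
    have "(f m - f (m + t)) / (m - (m + t)) \<le> (f m - f (m + 1)) / (m - (m + 1))"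
      using that by (intro convex_on_slope_le(1)[OF that(1)]) auto
    then show "(f (m + t) - f m) / t \<le> s m" using that(2)[of m] that(3,4) by (simp add: field_simps)
    have "(f (m - 1) - f m) / (m - 1 - m) \<le> (f (m - 1) - f (m + t)) / (m - 1 - (m + t))"
      using that by (intro convex_on_slope_le(1)[OF that(1)]) auto
    also have "\<dots> \<le> (f m - f (m + t)) / (m - (m + t))"
      using that by (intro convex_on_slope_le(2)[OF that(1)]) auto
    finally show "s (m - 1) \<le> (f (m + t) - f m) / t" using that(2)[of "m - 1"] that(3,4) by (simp add: field_simps)
  qed
  have frac: "d t = d 1" if t: "0 < t" "t < 1" for t
  proof -
    have "\<bar>d t - d 1\<bar> \<le> s (real m + 2) - s (real m + 1)" for m :: nat
    proof -
      let ?m = "real m + 2"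
      have "\<bar>(L (?m + t) - L ?m) / t - (\<Lambda> (?m + t) - \<Lambda> ?m) / t\<bar> \<le> s ?m - s (?m - 1)"
        using slope[OF conv(1) inc(1), of ?m t] slope[OF conv(2) inc(2), of ?m t] t by auto
      moreover have "(L (?m + t) - L ?m) / t - (\<Lambda> (?m + t) - \<Lambda> ?m) / t = (d (?m + t) - d ?m) / t"
        using t by (simp add: d_def field_simps)
      ultimately have "\<bar>(d (?m + t) - d ?m) / t\<bar> \<le> s ?m - s (?m - 1)" by simp
      moreover have "d (?m + t) = d t" "d ?m = d 1"
        using per[of t "m + 2"] per[of 1 "m + 1"] t by (simp_all add: add_ac)
      ultimately have "\<bar>d t - d 1\<bar> \<le> t * (s ?m - s (?m - 1))" using t by (simp add: field_simps)
      moreover have "t * (s ?m - s (?m - 1)) \<le> 1 * (s ?m - s (?m - 1))"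
        using t calculation by (intro mult_right_mono) (auto simp: zero_le_mult_iff dest: order_trans[OF abs_ge_zero])
      ultimately show ?thesis by (simp add: add.commute)
    qed
    moreover have "(\<lambda>m. s (real m + 2) - s (real m + 1)) \<longlonglongrightarrow> 0"
      using LIMSEQ_Suc[OF lim] by (simp add: add_ac)
    ultimately have "\<bar>d t - d 1\<bar> \<le> 0" by (intro LIMSEQ_le_const) auto
    then show ?thesis by simp
  qed
  define k where "k = nat \<lfloor>x\<rfloor>"
  have k: "real k \<le> x" "x < real k + 1" using x by (auto simp: k_def)
  have "d x = d 1"
  proof (cases "x = real k")
    case True
    with x have "0 < k" by simp
    then show ?thesis using per[of 1 "k - 1"] True by simp
  next
    case False
    then show ?thesis using frac[of "x - real k"] per[of "x - real k" k] k by simp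
  qed
  then show ?thesis by (simp add: d_def)
qed

section \<open>Positivity, shift relation and log-convexity in the exponent\<close>

abbreviation lagZ :: "real \<Rightarrow> real \<Rightarrow> real \<Rightarrow> nat set \<Rightarrow> real" where
  "lagZ \<beta> a c I \<equiv> lag_moment 0 \<beta> a c I {}"

lemma emeasure_lebP_empty: "emeasure (lebP {}) (space (lebP {})) = 1"
proof -
  have "space (lebP {}) = (\<Pi>\<^sub>E i\<in>{}. UNIV)" by (simp add: space_PiM)
  also have "emeasure (lebP {}) (\<Pi>\<^sub>E i\<in>{}. UNIV) = 1"
    by (subst lborel_product.emeasure_PiM) auto
  finally show ?thesis .
qed

lemma sel_empty [simp]: "sel \<beta> {} W = 1"
  using emeasure_lebP_empty by (simp add: sel_def)

lemma integrable_lag_0: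
  assumes "finite I" "0 < \<beta>" "0 < a" "0 < c"
  shows "integrable (lebP I) (lag 0 \<beta> a c I)"
proof (cases "I = {}")
  case True
  interpret finite_measure "lebP {}" by (rule finite_measureI) (simp add: emeasure_lebP_empty)
  show ?thesis unfolding True lag_def by simp
next
  case False
  then show ?thesis using integrable_lag_moment[of I "{}" \<beta> a c 0] assms by simp
qed

lemma sel_gw:
  assumes "finite I" "0 < \<beta>" "0 < a" "0 < c"
  shows "sel \<beta> I (gw a c) = ennreal (lagZ \<beta> a c I)"
  unfolding sel_def lag_def[symmetric] lag_moment_def
  using integrable_lag_0[OF assms] by (subst nn_integral_eq_integral) auto

text \<open>Restrict to the box with particle \<open>i\<close> in \<open>[2 i + 1, 2 i + 2]\<close>:
  all gaps are at least 1, hence so is the Vandermonde factor. Positions at least 1 also give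
  \<open>y powr (a - 1) \<ge> 1 / y\<close> for every positive \<open>a\<close>, whence the explicit
  lower bound \<open>?m\<close>.\<close>

lemma lagZ_pos:
  assumes I: "finite I" and pos: "0 < \<beta>" "0 < a" "0 < c"
  shows "0 < lagZ \<beta> a c I"
proof -
  let ?A = "\<lambda>i. {2 * real i + 1..2 * real i + 2}"
  let ?m = "\<lambda>i. exp (- c * (2 * real i + 2)) / (2 * real i + 2)"
  have "0 < (\<Prod>i\<in>I. ennreal (?m i))"
    using I by (auto simp: zero_less_iff_neq_zero)
  also have "\<dots> = (\<Prod>i\<in>I. \<integral>\<^sup>+y. ennreal (?m i) * indicator (?A i) y \<partial>lborel)"
    by (intro prod.cong refl) (simp add: nn_integral_cmult)
  also have "\<dots> = (\<integral>\<^sup>+l. (\<Prod>i\<in>I. ennreal (?m i) * indicator (?A i) (l i)) \<partial>lebP I)"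
    by (rule lborel_product.product_nn_integral_prod[OF I, symmetric]) measurable
  also have "\<dots> \<le> sel \<beta> I (gw a c)"
    unfolding sel_def
  proof (rule nn_integral_mono)
    fix l
    show "(\<Prod>i\<in>I. ennreal (?m i) * indicator (?A i) (l i)) \<le> ennreal ((\<Prod>i\<in>I. gw a c (l i)) * vdm 0 \<beta> I l)"
    proof (cases "\<forall>i\<in>I. l i \<in> ?A i")
      case True
      have "1 \<le> vdm 0 \<beta> I l"
        unfolding vdm_def
      proof (intro prod_ge_1)
        fix i j assume ij: "i \<in> I" "j \<in> I - {i}"
        have "1 \<le> \<bar>real i - real j\<bar>" using ij by (cases "i < j") auto
        moreover have "l i \<in> ?A i" "l j \<in> ?A j" using True ij by auto
        ultimately have "1 \<le> \<bar>l i - l j\<bar>" by (auto simp: abs_if split: if_splits)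
        then have "1 \<le> (l i - l j)\<^sup>2" by (metis abs_ge_self one_le_power order_trans power2_abs)
        then show "1 \<le> ((l i - l j)\<^sup>2 + 0) powr (\<beta> / 4)" using pos by (intro ge_one_powr_ge_zero) auto
      qed
      then have "(\<Prod>i\<in>I. gw a c (l i)) * 1 \<le> (\<Prod>i\<in>I. gw a c (l i)) * vdm 0 \<beta> I l"
        by (intro mult_left_mono prod_nonneg) auto
      moreover have "(\<Prod>i\<in>I. ?m i) \<le> (\<Prod>i\<in>I. gw a c (l i))"
      proof (intro prod_mono conjI)
        fix i assume "i \<in> I"
        define y where "y = l i"
        have y: "1 \<le> y" "y \<le> 2 * real i + 2" using True \<open>i \<in> I\<close> by (auto simp: y_def)
        have "1 / (2 * real i + 2) \<le> 1 / y" using y by (intro divide_left_mono) auto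
        also have "\<dots> = y powr -1" using y by (simp add: powr_minus_divide)
        also have "\<dots> \<le> y powr (a - 1)" using y pos by (intro powr_mono) auto
        finally have "exp (- c * (2 * real i + 2)) * (1 / (2 * real i + 2)) \<le> exp (- c * y) * y powr (a - 1)"
          using y pos by (intro mult_mono) auto
        then have "?m i \<le> gw a c y" using y by (simp add: gw_def mult.commute)
        then show "?m i \<le> gw a c (l i)" by (simp only: y_def)
      qed auto
      ultimately have "(\<Prod>i\<in>I. ?m i) \<le> (\<Prod>i\<in>I. gw a c (l i)) * vdm 0 \<beta> I l" by simp
      moreover have "(\<Prod>i\<in>I. ennreal (?m i) * indicator (?A i) (l i)) = (\<Prod>i\<in>I. ennreal (?m i))"
        using True by (intro prod.cong) auto
      ultimately show ?thesis by (simp add: prod_ennreal ennreal_leI)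
    next
      case False
      then have "\<exists>i\<in>I. ennreal (?m i) * indicator (?A i) (l i) = 0"
        by (metis indicator_simps(2) mult_zero_right)
      from prod_zero[OF I this] show ?thesis by (simp only: zero_le)
    qed
  qed
  finally show ?thesis unfolding sel_gw[OF I pos] by simp
qed

text \<open>The moment over all of \<open>I\<close> multiplies each weight by its variable, which
  raises \<open>a\<close> by 1. The moment recursion thereby becomes the functional equation of a
  product of Gamma functions.\<close>

lemma lagZ_shift:
  assumes I: "finite I" and pos: "0 < \<beta>" "0 < a" "0 < c"
  shows "c ^ card I * lagZ \<beta> (a + 1) c I = (\<Prod>j<card I. a + \<beta> / 2 * real j) * lagZ \<beta> a c I"
proof -
  have "l i * gw a c (l i) = gw (a + 1) c (l i)" for l :: "nat \<Rightarrow> real" and i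
    using gw_mult_powr[of a c "l i" 1] by (cases "0 < l i") (auto simp: mult.commute gw_def)
  then have "(\<Prod>i\<in>I. l i) * lag 0 \<beta> a c I l = lag 0 \<beta> (a + 1) c I l" for l
    unfolding lag_def mult.assoc[symmetric] prod.distrib[symmetric] by simp
  then have "lag_moment 0 \<beta> a c I I = lagZ \<beta> (a + 1) c I" by (simp add: lag_moment_def)
  then show ?thesis using lag_moment_full[OF I pos] by simp
qed

lemma lag_log_convex:
  assumes "0 < t" "t < 1"
  shows "lag 0 \<beta> ((1 - t) * x + t * y) c I l = lag 0 \<beta> x c I l powr (1 - t) * lag 0 \<beta> y c I l powr t"
proof -
  have g: "gw ((1 - t) * x + t * y) c s = gw x c s powr (1 - t) * gw y c s powr t" for s
  proof (cases "0 < s")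
    case True
    have "(s powr (x - 1) * exp (- c * s)) powr (1 - t) * (s powr (y - 1) * exp (- c * s)) powr t
       = s powr ((x - 1) * (1 - t) + (y - 1) * t) * exp (- c * s * (1 - t) + - c * s * t)"
      unfolding powr_mult powr_powr powr_add exp_add exp_powr_real by (simp only: mult_ac)
    also have "(x - 1) * (1 - t) + (y - 1) * t = (1 - t) * x + t * y - 1" by (simp add: algebra_simps)
    also have "- c * s * (1 - t) + - c * s * t = - c * s" by (simp add: algebra_simps)
    finally show ?thesis using True by (simp add: gw_def)
  qed (simp add: gw_def)
  have v: "v powr (1 - t) * v powr t = v" if "0 \<le> v" for v :: real
    using that by (cases "v = 0") (auto simp flip: powr_add)
  have "lag 0 \<beta> ((1 - t) * x + t * y) c I l = ((\<Prod>i\<in>I. gw x c (l i)) powr (1 - t) * (\<Prod>i\<in>I. gw y c (l i)) powr t) * (vdm 0 \<beta> I l powr (1 - t) * vdm 0 \<beta> I l powr t)"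
    by (simp add: lag_def g prod.distrib v prod_powr_distrib)
  also have "\<dots> = lag 0 \<beta> x c I l powr (1 - t) * lag 0 \<beta> y c I l powr t"
    unfolding lag_def by (simp add: powr_mult prod_nonneg mult_ac)
  finally show ?thesis .
qed

text \<open>Hoelder's inequality in the exponent: the logarithm of the density is affine in
  \<open>a\<close>; Young's inequality is applied pointwise to the densities divided by their total
  masses, and the result is integrated.\<close>

lemma lagZ_log_convex:
  assumes I: "finite I" and pos: "0 < \<beta>" "0 < c"
  shows "convex_on {0<..} (\<lambda>a. ln (lagZ \<beta> a c I))"
proof (rule convex_onI)
  fix t x y :: real assume t: "0 < t" "t < 1" and "x \<in> {0<..}" "y \<in> {0<..}"
  then have xy: "0 < x" "0 < y" by auto
  define z where "z = (1 - t) * x + t * y"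
  have z: "0 < z" unfolding z_def using xy t by (intro add_pos_pos mult_pos_pos) auto
  let ?X = "lagZ \<beta> x c I" and ?Y = "lagZ \<beta> y c I"
  have X: "0 < ?X" "0 < ?Y" "0 < lagZ \<beta> z c I" using lagZ_pos[OF I pos(1) _ pos(2)] xy z by auto
  have pt: "lag 0 \<beta> z c I l \<le> ?X powr (1 - t) * ?Y powr t * ((1 - t) / ?X * lag 0 \<beta> x c I l + t / ?Y * lag 0 \<beta> y c I l)" for l
  proof -
    let ?A = "lag 0 \<beta> x c I l" and ?B = "lag 0 \<beta> y c I l"
    show ?thesis
    proof (cases "?A = 0 \<or> ?B = 0")
      case True
      then have "lag 0 \<beta> z c I l = 0" unfolding z_def lag_log_convex[OF t] by auto
      then show ?thesis using t X by (simp add: mult_nonneg_nonneg add_nonneg_nonneg)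
    next
      case False
      then have AB: "0 < ?A" "0 < ?B" by (auto simp: less_le)
      have "(?A / ?X) powr (1 - t) * (?B / ?Y) powr t \<le> (1 - t) * (?A / ?X) + t * (?B / ?Y)"
        using t X AB by (intro Youngs_inequality_0) auto
      then show ?thesis unfolding z_def lag_log_convex[OF t] using X AB
        by (simp add: powr_divide field_simps)
    qed
  qed
  have "lagZ \<beta> z c I \<le> (\<integral>l. ?X powr (1 - t) * ?Y powr t * ((1 - t) / ?X * lag 0 \<beta> x c I l + t / ?Y * lag 0 \<beta> y c I l) \<partial>lebP I)"
    unfolding lag_moment_def[of 0 \<beta> z c I "{}"] prod.empty mult_1
    using pt integrable_lag_0[OF I pos(1) _ pos(2)] xy z
    by (intro integral_mono integrable_mult_right Bochner_Integration.integrable_add) (auto simp: lag_moment_def)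
  also have "\<dots> = ?X powr (1 - t) * ?Y powr t * ((1 - t) / ?X * ?X + t / ?Y * ?Y)"
    using integrable_lag_0[OF I pos(1) xy(1) pos(2)] integrable_lag_0[OF I pos(1) xy(2) pos(2)]
    by (simp add: lag_moment_def)
  also have "\<dots> = ?X powr (1 - t) * ?Y powr t" using X by simp
  finally have "ln (lagZ \<beta> z c I) \<le> ln (?X powr (1 - t) * ?Y powr t)" using X by simp
  also have "\<dots> = (1 - t) * ln ?X + t * ln ?Y" using X by (simp add: ln_mult ln_powr)
  finally show "ln (lagZ \<beta> ((1 - t) *\<^sub>R x + t *\<^sub>R y) c I) \<le> (1 - t) * ln ?X + t * ln ?Y" by (simp add: z_def)
qed simp

definition Gprod :: "real \<Rightarrow> nat \<Rightarrow> real \<Rightarrow> real" where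
  "Gprod \<beta> n a = (\<Prod>j<n. Gamma (a + \<beta> / 2 * real j))"

text \<open>Both \<open>L\<close>, the logarithm corrected by the linear term
  \<open>card I * ln c * a\<close>, and the sum of log-Gammas are convex with increment
  \<open>s\<close>, whose own differences vanish at infinity. The factor \<kappa> is still unknown;
  it may depend on \<beta>, \<open>c\<close> and \<open>I\<close>, but not on
  \<open>a\<close>.\<close>

lemma lagZ_ratio_const:
  assumes I: "finite I" and pos: "0 < \<beta>" "0 < c"
  shows "\<exists>\<kappa>>0. \<forall>a>0. lagZ \<beta> a c I = \<kappa> * Gprod \<beta> (card I) a * c powr (- real (card I) * a)"
proof -
  let ?n = "card I"
  define L where "L a = ln (lagZ \<beta> a c I) + real ?n * ln c * a" for a
  define \<Lambda> where "\<Lambda> a = (\<Sum>j<?n. ln (Gamma (a + \<beta> / 2 * real j)))" for a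
  define s where "s a = (\<Sum>j<?n. ln (a + \<beta> / 2 * real j))" for a
  have sh: "0 < a + \<beta> / 2 * real j" if "0 < a" for a j using that pos by (simp add: add_pos_nonneg)
  have inc1: "L (a + 1) = L a + s a" if "0 < a" for a
  proof -
    have "ln (c ^ ?n * lagZ \<beta> (a + 1) c I) = ln ((\<Prod>j<?n. a + \<beta> / 2 * real j) * lagZ \<beta> a c I)"
      using lagZ_shift[OF I pos(1) that pos(2)] by simp
    moreover have "ln (c ^ ?n * lagZ \<beta> (a + 1) c I) = real ?n * ln c + ln (lagZ \<beta> (a + 1) c I)"
      using pos lagZ_pos[OF I pos(1) _ pos(2), of "a + 1"] that by (subst ln_mult) (auto simp: ln_realpow)
    moreover have "ln ((\<Prod>j<?n. a + \<beta> / 2 * real j) * lagZ \<beta> a c I) = s a + ln (lagZ \<beta> a c I)"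
      using lagZ_pos[OF I pos(1) that pos(2)] sh[OF that] unfolding s_def
      by (subst ln_mult) (auto simp: ln_prod prod_zero_iff less_imp_neq[symmetric] intro!: prod_pos)
    ultimately show ?thesis by (simp add: L_def algebra_simps)
  qed
  have inc2: "\<Lambda> (a + 1) = \<Lambda> a + s a" if "0 < a" for a
  proof -
    have "ln (Gamma (a + 1 + \<beta> / 2 * real j)) = ln (Gamma (a + \<beta> / 2 * real j)) + ln (a + \<beta> / 2 * real j)" for j
    proof -
      have "Gamma (a + 1 + \<beta> / 2 * real j) = (a + \<beta> / 2 * real j) * Gamma (a + \<beta> / 2 * real j)"
      proof -
        have "a + \<beta> / 2 * real j \<notin> \<int>\<^sub>\<le>\<^sub>0" using sh[OF that, of j] nonpos_Ints_nonpos not_le by blast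
        from Gamma_plus1[OF this] show ?thesis by (simp add: add_ac)
      qed
      moreover have "Gamma (a + \<beta> / 2 * real j) \<noteq> 0" using Gamma_real_pos[OF sh[OF that, of j]] by linarith
      ultimately show ?thesis using sh[OF that, of j] by (simp add: ln_mult)
    qed
    then show ?thesis by (simp add: \<Lambda>_def s_def sum.distrib)
  qed
  have convL: "convex_on {0<..} L"
    unfolding L_def
    by (intro convex_on_add lagZ_log_convex[OF I pos]) (rule convex_onI, auto simp: algebra_simps)
  have conv\<Lambda>: "convex_on {0<..} \<Lambda>"
  proof (rule convex_onI)
    fix t x y :: real assume t: "0 < t" "t < 1" and "x \<in> {0<..}" "y \<in> {0<..}"
    then have xy: "0 < x" "0 < y" by auto
    have "ln (Gamma ((1 - t) * x + t * y + \<beta> / 2 * real j)) \<le> (1 - t) * ln (Gamma (x + \<beta> / 2 * real j)) + t * ln (Gamma (y + \<beta> / 2 * real j))" for j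
    proof -
      have "(ln \<circ> Gamma) ((1 - t) *\<^sub>R (x + \<beta> / 2 * real j) + t *\<^sub>R (y + \<beta> / 2 * real j)) \<le> (1 - t) * (ln \<circ> Gamma) (x + \<beta> / 2 * real j) + t * (ln \<circ> Gamma) (y + \<beta> / 2 * real j)"
        using t sh[OF xy(1)] sh[OF xy(2)] by (intro convex_onD[OF log_convex_Gamma_real]) auto
      moreover have "(1 - t) *\<^sub>R (x + \<beta> / 2 * real j) + t *\<^sub>R (y + \<beta> / 2 * real j) = (1 - t) * x + t * y + \<beta> / 2 * real j"
      proof -
        have "(1 - t) *\<^sub>R (x + q) + t *\<^sub>R (y + q) = (1 - t) * x + t * y + q" for q
          by (simp add: algebra_simps)
        then show ?thesis .
      qed
      ultimately show ?thesis by (simp only: o_def)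
    qed
    then show "\<Lambda> ((1 - t) *\<^sub>R x + t *\<^sub>R y) \<le> (1 - t) * \<Lambda> x + t * \<Lambda> y"
      unfolding \<Lambda>_def real_scaleR_def sum_distrib_left sum.distrib[symmetric] by (intro sum_mono)
  qed simp
  have lim: "(\<lambda>m. s (real m + 1) - s (real m)) \<longlonglongrightarrow> 0"
  proof -
    have "(\<lambda>m. \<Sum>j<?n. ln (real m + 1 + \<beta> / 2 * real j) - ln (real m + \<beta> / 2 * real j)) \<longlonglongrightarrow> (\<Sum>j<?n. 0)"
    proof (rule tendsto_sum)
      fix j
      let ?y = "\<lambda>m::nat. real m + \<beta> / 2 * real j"
      have "filterlim ?y at_top sequentially"
        by (rule filterlim_at_top_mono[OF filterlim_real_sequentially]) (use pos in auto)
      then have "(\<lambda>m. inverse (?y m)) \<longlonglongrightarrow> 0" by (rule tendsto_inverse_0_at_top)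
      then have "(\<lambda>m. ln (1 + inverse (?y m))) \<longlonglongrightarrow> ln (1 + 0)" by (intro tendsto_intros) auto
      moreover have "\<forall>\<^sub>F m in sequentially. ln (1 + inverse (?y m)) = ln (real m + 1 + \<beta> / 2 * real j) - ln (?y m)"
        using eventually_gt_at_top[of 0]
      proof eventually_elim
        case (elim m)
        have y: "0 < ?y m" using elim pos by (simp add: add_pos_nonneg)
        have "1 + inverse (?y m) = (real m + 1 + \<beta> / 2 * real j) / ?y m" using y by (simp add: field_simps)
        then show ?case using y by (simp add: ln_div)
      qed
      ultimately show "(\<lambda>m. ln (real m + 1 + \<beta> / 2 * real j) - ln (?y m)) \<longlonglongrightarrow> 0"
        by (simp add: Lim_transform_eventually)
    qed
    then show ?thesis by (simp add: s_def sum_subtractf)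
  qed
  show ?thesis
  proof (intro exI[of _ "exp (L 1 - \<Lambda> 1)"] conjI allI impI)
    fix a :: real assume a: "0 < a"
    have "L a - \<Lambda> a = L 1 - \<Lambda> 1"
      by (rule convex_increment_unique[OF convL conv\<Lambda> inc1 inc2 lim a])
    then have "lagZ \<beta> a c I = exp (L 1 - \<Lambda> 1 + \<Lambda> a - real ?n * ln c * a)"
      using lagZ_pos[OF I pos(1) a pos(2)] unfolding L_def by (metis add_diff_cancel_right' diff_add_cancel exp_ln)
    also have "\<dots> = exp (L 1 - \<Lambda> 1) * exp (\<Lambda> a) * exp (- real ?n * a * ln c)"
      by (simp add: mult_ac flip: exp_add)
    also have "exp (\<Lambda> a) = Gprod \<beta> ?n a"
      unfolding \<Lambda>_def Gprod_def using Gamma_real_pos sh[OF a] by (simp add: exp_sum)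
    also have "exp (- real ?n * a * ln c) = c powr (- real ?n * a)" using pos by (simp add: powr_def)
    finally show "lagZ \<beta> a c I = exp (L 1 - \<Lambda> 1) * Gprod \<beta> ?n a * c powr (- real ?n * a)" .
  qed simp
qed

section \<open>The missing constant, from the limit of vanishing exponent\<close>

lemma Gprod_pos: "0 < \<beta> \<Longrightarrow> 0 < a \<Longrightarrow> 0 < Gprod \<beta> n a"
  unfolding Gprod_def by (intro prod_pos) (auto intro!: Gamma_real_pos add_pos_nonneg)

text \<open>Isolates the only factor that blows up as \<open>a\<close> tends to 0.\<close>

lemma Gprod_Suc: "Gprod \<beta> (Suc n) a = Gamma a * Gprod \<beta> n (a + \<beta> / 2)"
  unfolding Gprod_def by (subst prod.lessThan_Suc_shift) (simp add: algebra_simps add_divide_distrib)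

lemma Gprod_Suc': "Gprod \<beta> (Suc n) a = Gprod \<beta> n a * Gamma (a + \<beta> / 2 * real n)"
  unfolding Gprod_def by simp

lemma isCont_Gprod:
  assumes "0 < \<beta>" "0 < a"
  shows "isCont (Gprod \<beta> n) a"
  unfolding Gprod_def
proof (intro continuous_intros)
  fix j
  have "0 < a + \<beta> / 2 * real j" using assms by (intro add_pos_nonneg) auto
  then show "a + \<beta> / 2 * real j \<notin> \<int>\<^sub>\<le>\<^sub>0" using nonpos_Ints_nonpos not_le by blast
qed

text \<open>Condition on the smallest particle \<open>y\<close>. The others lie above it, where
  \<open>(s - y) powr \<beta> \<le> s powr \<beta>\<close>, so they see the exponent
  \<open>a + \<beta>\<close>, and \<open>y\<close> contributes a Gamma integral. The bound becomes
  sharp as \<open>a\<close> tends to 0, since \<open>y\<close> then concentrates at 0.\<close>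

lemma lagZ_le_extremal:
  assumes I: "finite I" "I \<noteq> {}" and pos: "0 < \<beta>" "0 < a" "0 < c"
  shows "lagZ \<beta> a c I \<le> Gamma a * c powr - a * (\<Sum>i\<in>I. lagZ \<beta> (a + \<beta>) c (I - {i}))"
proof -
  have Iz: "finite (I - {i})" for i using I by auto
  have "ennreal (lagZ \<beta> a c I) = (\<integral>\<^sup>+l. ennreal (1 * ((\<Prod>k\<in>I. gw a c (l k)) * vdm 0 \<beta> I l)) \<partial>lebP I)"
    using sel_gw[OF I(1) pos] by (simp add: sel_def)
  also have "\<dots> = (\<Sum>i\<in>I. \<integral>\<^sup>+y. ennreal (1 * gw a c y) * sel \<beta> (I - {i}) (\<lambda>s. gw a c s * \<bar>y - s\<bar> powr \<beta> * of_bool (-1 * s < -1 * y)) \<partial>lborel)"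
    by (rule nn_integral_extremal_split[OF I, where \<sigma> = "-1" and \<eta> = "\<lambda>_. 1" and e = "\<lambda>_. 1"]) auto
  also have "\<dots> \<le> (\<Sum>i\<in>I. \<integral>\<^sup>+y. ennreal (gw a c y) * ennreal (lagZ \<beta> (a + \<beta>) c (I - {i})) \<partial>lborel)"
  proof (intro sum_mono nn_integral_mono)
    fix i and y :: real
    show "ennreal (1 * gw a c y) * sel \<beta> (I - {i}) (\<lambda>s. gw a c s * \<bar>y - s\<bar> powr \<beta> * of_bool (-1 * s < -1 * y))
       \<le> ennreal (gw a c y) * ennreal (lagZ \<beta> (a + \<beta>) c (I - {i}))"
    proof (cases "0 < y")
      case True
      have "sel \<beta> (I - {i}) (\<lambda>s. gw a c s * \<bar>y - s\<bar> powr \<beta> * of_bool (-1 * s < -1 * y)) \<le> sel \<beta> (I - {i}) (gw (a + \<beta>) c)"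
      proof (rule sel_mono)
        fix s
        show "gw a c s * \<bar>y - s\<bar> powr \<beta> * of_bool (-1 * s < -1 * y) \<le> gw (a + \<beta>) c s"
        proof (cases "y < s")
          case True
          then have "\<bar>y - s\<bar> powr \<beta> \<le> s powr \<beta>" using \<open>0 < y\<close> pos by (intro powr_mono2) auto
          then have "gw a c s * \<bar>y - s\<bar> powr \<beta> \<le> gw a c s * s powr \<beta>" by (intro mult_left_mono) auto
          then show ?thesis using True by (simp add: gw_mult_powr)
        qed simp
      qed simp
      then show ?thesis using sel_gw[OF Iz pos(1) _ pos(3)] pos by (simp add: mult_left_mono)
    qed (simp add: gw_def)
  qed
  also have "\<dots> = (\<Sum>i\<in>I. ennreal (Gamma a * c powr - a) * ennreal (lagZ \<beta> (a + \<beta>) c (I - {i})))"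
    using nn_integral_gw[OF pos(2,3)] by (simp add: nn_integral_multc)
  also have "\<dots> = ennreal (Gamma a * c powr - a * (\<Sum>i\<in>I. lagZ \<beta> (a + \<beta>) c (I - {i})))"
    using lagZ_pos[OF Iz pos(1) _ pos(3), of "a + \<beta>"] pos Gamma_real_pos[OF pos(2)]
    by (simp add: sum_ennreal less_imp_le sum_distrib_left flip: ennreal_mult)
  finally have "ennreal (lagZ \<beta> a c I) \<le> ennreal (Gamma a * c powr - a * (\<Sum>i\<in>I. lagZ \<beta> (a + \<beta>) c (I - {i})))" .
  moreover have "0 \<le> Gamma a * c powr - a * (\<Sum>i\<in>I. lagZ \<beta> (a + \<beta>) c (I - {i}))"
    using lagZ_pos[OF Iz pos(1) _ pos(3), of "a + \<beta>"] pos Gamma_real_pos[OF pos(2)]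
    by (intro mult_nonneg_nonneg sum_nonneg) (auto intro: less_imp_le)
  ultimately show ?thesis using ennreal_le_iff by blast
qed

text \<open>Lower envelope for the weight of the other particles when the smallest one is below
  \<open>e\<close>: \<open>s powr (a - 1)\<close> is at least \<open>e powr a * s powr -1\<close>,
  and the distance to the smallest is at least \<open>s - e\<close>. It depends neither on
  \<open>a\<close> nor on \<open>y\<close>, so \<open>a\<close> can tend to 0 first and
  \<open>e\<close> afterwards.\<close>

definition cutw :: "real \<Rightarrow> real \<Rightarrow> real \<Rightarrow> real \<Rightarrow> real" where
  "cutw \<beta> c e s = (if e < s then s powr - 1 * exp (- c * s) * (s - e) powr \<beta> else 0)"

lemma cutw_nonneg [simp]: "0 \<le> cutw \<beta> c e s"
  by (simp add: cutw_def)

lemma cutw_measurable [measurable]: "cutw \<beta> c e \<in> borel_measurable borel"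
  unfolding cutw_def by measurable

lemma cutw_le: "0 < \<beta> \<Longrightarrow> 0 < e \<Longrightarrow> cutw \<beta> c e s \<le> gw \<beta> c s"
proof -
  assume "0 < \<beta>" "0 < e"
  then have "e < s \<Longrightarrow> s powr - 1 * exp (- c * s) * (s - e) powr \<beta> \<le> s powr - 1 * exp (- c * s) * s powr \<beta>"
    by (intro mult_left_mono powr_mono2) auto
  then show ?thesis using \<open>0 < e\<close> by (auto simp: cutw_def gw_def powr_diff powr_minus field_simps)
qed

text \<open>The second of the two limits: the envelope converges pointwise to the weight of exponent
  \<beta>, which also dominates it.\<close>

lemma sel_cutw_tendsto:
  assumes I: "finite I" and pos: "0 < \<beta>" "0 < c"
  shows "(\<lambda>m. sel \<beta> I (cutw \<beta> c (1 / real (Suc m)))) \<longlonglongrightarrow> ennreal (lagZ \<beta> \<beta> c I)"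
  unfolding sel_gw[OF I pos(1,1,2), symmetric] sel_def
proof (rule nn_integral_dominated_convergence[where w = "\<lambda>l. ennreal ((\<Prod>i\<in>I. gw \<beta> c (l i)) * vdm 0 \<beta> I l)"])
  show "AE l in lebP I. ennreal ((\<Prod>i\<in>I. cutw \<beta> c (1 / real (Suc m)) (l i)) * vdm 0 \<beta> I l) \<le> ennreal ((\<Prod>i\<in>I. gw \<beta> c (l i)) * vdm 0 \<beta> I l)" for m
    using cutw_le[OF pos(1), of "1 / real (Suc m)" c]
    by (intro AE_I2 ennreal_leI mult_right_mono prod_mono) auto
  show "AE l in lebP I. (\<lambda>m. ennreal ((\<Prod>i\<in>I. cutw \<beta> c (1 / real (Suc m)) (l i)) * vdm 0 \<beta> I l)) \<longlonglongrightarrow> ennreal ((\<Prod>i\<in>I. gw \<beta> c (l i)) * vdm 0 \<beta> I l)"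
  proof (intro AE_I2 tendsto_ennrealI tendsto_mult tendsto_const tendsto_prod)
    fix l :: "nat \<Rightarrow> real" and i
    define s where "s = l i"
    show "(\<lambda>m. cutw \<beta> c (1 / real (Suc m)) (l i)) \<longlonglongrightarrow> gw \<beta> c (l i)"
      unfolding s_def[symmetric]
    proof (cases "0 < s")
      case False
      then have "cutw \<beta> c (1 / real (Suc m)) s = 0" for m
      proof -
        have "0 < 1 / real (Suc m)" by simp
        then have "\<not> 1 / real (Suc m) < s" using False by linarith
        then show ?thesis by (simp only: cutw_def if_False)
      qed
      then show "(\<lambda>m. cutw \<beta> c (1 / real (Suc m)) s) \<longlonglongrightarrow> gw \<beta> c s" using False by (simp add: gw_def)
    next
      case True
      have lim: "(\<lambda>m. 1 / real (Suc m)) \<longlonglongrightarrow> 0" by (rule LIMSEQ_Suc[OF lim_1_over_n])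
      have "(\<lambda>m. s powr - 1 * exp (- c * s) * (s - 1 / real (Suc m)) powr \<beta>) \<longlonglongrightarrow> s powr - 1 * exp (- c * s) * (s - 0) powr \<beta>"
        using True by (intro tendsto_intros lim) auto
      moreover have "s powr - 1 * exp (- c * s) * (s - 0) powr \<beta> = gw \<beta> c s"
        using True by (simp add: gw_def powr_diff powr_minus field_simps)
      moreover have "\<forall>\<^sub>F m in sequentially. s powr - 1 * exp (- c * s) * (s - 1 / real (Suc m)) powr \<beta> = cutw \<beta> c (1 / real (Suc m)) s"
        using order_tendstoD(2)[OF lim True] by eventually_elim (simp add: cutw_def)
      ultimately show "(\<lambda>m. cutw \<beta> c (1 / real (Suc m)) s) \<longlonglongrightarrow> gw \<beta> c s"
        by (simp add: Lim_transform_eventually)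
    qed
  qed
  show "(\<integral>\<^sup>+l. ennreal ((\<Prod>i\<in>I. gw \<beta> c (l i)) * vdm 0 \<beta> I l) \<partial>lebP I) < \<infinity>"
    using sel_gw[OF I pos(1,1,2)] by (simp add: sel_def)
qed measurable

text \<open>Only configurations whose smallest particle is below \<open>e\<close> are kept. The
  discarded Gamma mass is at most \<open>1 / (e * c)\<close>, because
  \<open>y powr (a - 1) \<le> 1 / e\<close> for \<open>y \<ge> e\<close>; this stays bounded while
  \<open>Gamma a\<close> diverges as \<open>a\<close> tends to 0.\<close>

lemma lagZ_ge_extremal:
  assumes I: "finite I" "I \<noteq> {}" and pos: "0 < \<beta>" "0 < a" "0 < c" and a: "a \<le> 1" and e: "0 < e" "e \<le> 1"
    and T: "\<And>i. i \<in> I \<Longrightarrow> sel \<beta> (I - {i}) (cutw \<beta> c e) = ennreal (T i)" "\<And>i. 0 \<le> T i"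
  shows "(Gamma a * c powr - a - 1 / (e * c)) * (e powr (a * real (card I - 1)) * (\<Sum>i\<in>I. T i)) \<le> lagZ \<beta> a c I"
proof -
  let ?J = "\<integral>\<^sup>+y. ennreal (gw a c y * of_bool (y < e)) \<partial>lborel"
  let ?E = "e powr (a * real (card I - 1))"
  have Iz: "finite (I - {i})" for i using I by auto
  have J: "ennreal (Gamma a * c powr - a - 1 / (e * c)) \<le> ?J"
  proof -
    have "ennreal (Gamma a * c powr - a) = (\<integral>\<^sup>+y. ennreal (gw a c y) \<partial>lborel)"
      by (rule nn_integral_gw[OF pos(2,3), symmetric])
    also have "\<dots> \<le> (\<integral>\<^sup>+y. ennreal (gw a c y * of_bool (y < e)) + ennreal (1 / e) * ennreal (gw 1 c y) \<partial>lborel)"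
    proof (rule nn_integral_mono)
      fix y
      show "ennreal (gw a c y) \<le> ennreal (gw a c y * of_bool (y < e)) + ennreal (1 / e) * ennreal (gw 1 c y)"
      proof (cases "y < e")
        case False
        with e have y: "e \<le> y" "0 < y" by auto
        have "y powr (a - 1) \<le> e powr (a - 1)" using y e a by (intro powr_mono2') auto
        also have "\<dots> \<le> e powr - 1" using e pos by (intro powr_mono') auto
        also have "\<dots> = 1 / e" using e by (simp add: powr_minus_divide)
        finally have "y powr (a - 1) * exp (- c * y) \<le> 1 / e * exp (- c * y)" by (intro mult_right_mono) auto
        then show ?thesis using False y e by (simp add: gw_def ennreal_leI flip: ennreal_mult)
      qed simp
    qed
    also have "\<dots> = ?J + ennreal (1 / e) * (\<integral>\<^sup>+y. ennreal (gw 1 c y) \<partial>lborel)"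
      by (subst nn_integral_add) (auto simp: nn_integral_cmult)
    also have "(\<integral>\<^sup>+y. ennreal (gw 1 c y) \<partial>lborel) = ennreal (1 / c)"
      using nn_integral_gw[OF zero_less_one pos(3)] pos by (simp add: powr_minus_divide)
    also have "ennreal (1 / e) * \<dots> = ennreal (1 / (e * c))" using e pos by (simp flip: ennreal_mult)
    finally have le: "ennreal (Gamma a * c powr - a) \<le> ?J + ennreal (1 / (e * c))" .
    have "ennreal (Gamma a * c powr - a - 1 / (e * c)) = ennreal (Gamma a * c powr - a) - ennreal (1 / (e * c))"
      using e pos by (simp add: ennreal_minus)
    also have "\<dots> \<le> ?J" using le by (simp add: ennreal_minus_le_iff add.commute)
    finally show ?thesis .
  qed
  show ?thesis
  proof (cases "0 \<le> Gamma a * c powr - a - 1 / (e * c)")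
    case False
    then have "(Gamma a * c powr - a - 1 / (e * c)) * (?E * (\<Sum>i\<in>I. T i)) \<le> 0"
      using T(2) by (intro mult_nonpos_nonneg mult_nonneg_nonneg sum_nonneg) auto
    then show ?thesis using lagZ_pos[OF I(1) pos] by simp
  next
    case True
    have sel_ge: "ennreal (?E * T i) \<le> sel \<beta> (I - {i}) (\<lambda>s. gw a c s * \<bar>y - s\<bar> powr \<beta> * of_bool (-1 * s < -1 * y))"
      if i: "i \<in> I" and y: "0 < y" "y < e" for i y
    proof -
      have "ennreal (?E * T i) = ennreal ((e powr a) ^ card (I - {i})) * ennreal (T i)"
        using i I e by (simp add: card_Diff_singleton powr_powr flip: powr_realpow ennreal_mult')
      also have "\<dots> = sel \<beta> (I - {i}) (\<lambda>s. e powr a * cutw \<beta> c e s)"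
        unfolding T(1)[OF i, symmetric] by (rule sel_cmult[symmetric]) (use Iz in auto)
      also have "\<dots> \<le> sel \<beta> (I - {i}) (\<lambda>s. gw a c s * \<bar>y - s\<bar> powr \<beta> * of_bool (-1 * s < -1 * y))"
      proof (rule sel_mono)
        fix s
        show "e powr a * cutw \<beta> c e s \<le> gw a c s * \<bar>y - s\<bar> powr \<beta> * of_bool (-1 * s < -1 * y)"
        proof (cases "e < s")
          case True
          have s: "0 < s" "y < s" using True y e by auto
          have "e powr a * s powr - 1 \<le> s powr a * s powr - 1"
            using True e pos by (intro mult_right_mono powr_mono2) auto
          also have "\<dots> = s powr (a - 1)" by (simp only: powr_add[symmetric]) simp
          finally have "(e powr a * s powr - 1) * exp (- c * s) * (s - e) powr \<beta> \<le> s powr (a - 1) * exp (- c * s) * \<bar>y - s\<bar> powr \<beta>"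
            using s y True pos by (intro mult_mono powr_mono2) auto
          then show ?thesis using True s by (simp add: cutw_def gw_def mult_ac)
        qed (simp add: cutw_def)
      qed simp
      finally show ?thesis .
    qed
    have "ennreal ((Gamma a * c powr - a - 1 / (e * c)) * (?E * (\<Sum>i\<in>I. T i)))
       = (\<Sum>i\<in>I. ennreal (Gamma a * c powr - a - 1 / (e * c)) * ennreal (?E * T i))"
      using True T(2) by (simp add: sum_distrib_left sum_ennreal flip: ennreal_mult)
    also have "\<dots> \<le> (\<Sum>i\<in>I. ?J * ennreal (?E * T i))"
      by (intro sum_mono mult_right_mono J) auto
    also have "\<dots> = (\<Sum>i\<in>I. \<integral>\<^sup>+y. ennreal (gw a c y * of_bool (y < e)) * ennreal (?E * T i) \<partial>lborel)"
      by (simp add: nn_integral_multc)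
    also have "\<dots> \<le> (\<Sum>i\<in>I. \<integral>\<^sup>+y. ennreal (1 * gw a c y) * sel \<beta> (I - {i}) (\<lambda>s. gw a c s * \<bar>y - s\<bar> powr \<beta> * of_bool (-1 * s < -1 * y)) \<partial>lborel)"
    proof (intro sum_mono nn_integral_mono)
      fix i and y :: real assume i: "i \<in> I"
      show "ennreal (gw a c y * of_bool (y < e)) * ennreal (?E * T i) \<le> ennreal (1 * gw a c y) * sel \<beta> (I - {i}) (\<lambda>s. gw a c s * \<bar>y - s\<bar> powr \<beta> * of_bool (-1 * s < -1 * y))"
        using sel_ge[OF i, of y] by (cases "0 < y \<and> y < e") (auto simp: gw_def intro!: mult_left_mono)
    qed
    also have "\<dots> = (\<integral>\<^sup>+l. ennreal (1 * ((\<Prod>k\<in>I. gw a c (l k)) * vdm 0 \<beta> I l)) \<partial>lebP I)"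
      by (rule nn_integral_extremal_split[OF I, where \<sigma> = "-1" and \<eta> = "\<lambda>_. 1" and e = "\<lambda>_. 1", symmetric]) auto
    also have "\<dots> = ennreal (lagZ \<beta> a c I)" using sel_gw[OF I(1) pos] by (simp add: sel_def)
    finally show ?thesis using lagZ_pos[OF I(1) pos] by (simp add: ennreal_le_iff)
  qed
qed

definition Kprod :: "real \<Rightarrow> nat \<Rightarrow> real" where
  "Kprod \<beta> n = (\<Prod>j<n. Gamma (1 + \<beta> / 2 * real (Suc j)) / Gamma (1 + \<beta> / 2))"

text \<open>Laguerre form of Selberg's integral, by induction on the number of particles: the
  dependence on \<open>a\<close> is known up to \<kappa>, and dividing the two extremal bounds by
  \<open>Gamma a\<close> before letting \<open>a\<close> tend to 0 expresses \<kappa> through the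
  formula for one particle fewer at exponent \<beta>.\<close>

lemma lagZ_eq:
  assumes "finite I" and pos: "0 < \<beta>" "0 < a" "0 < c" and "card I = n"
  shows "lagZ \<beta> a c I = Kprod \<beta> n * Gprod \<beta> n a * c powr - (real n * a + \<beta> / 2 * (real n * (real n - 1)))"
  using assms
proof (induction n arbitrary: I a)
  case 0
  then have "I = {}" by simp
  then have "ennreal (lagZ \<beta> a c I) = 1" using sel_gw[of I \<beta> a c] 0 by simp
  then have "lagZ \<beta> a c I = 1" by simp
  then show ?case using 0 by (simp add: Kprod_def Gprod_def)
next
  case (Suc n)
  let ?N = "real (Suc n)"
  have I: "finite I" "I \<noteq> {}" and c: "0 < c" and b: "0 < \<beta>" using Suc.prems by auto
  have cardz: "finite (I - {i})" "card (I - {i}) = n" if "i \<in> I" for i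
    using that I Suc.prems by auto
  obtain \<kappa> where \<kappa>: "0 < \<kappa>" "\<And>a. 0 < a \<Longrightarrow> lagZ \<beta> a c I = \<kappa> * Gprod \<beta> (Suc n) a * c powr (- ?N * a)"
    using lagZ_ratio_const[OF I(1) b c] Suc.prems by auto
  define ex where "ex a = real n * a + \<beta> / 2 * (real n * (real n - 1))" for a
  define F where "F a = Kprod \<beta> n * Gprod \<beta> n a * c powr - ex a" for a
  have IH: "lagZ \<beta> a c (I - {i}) = F a" if "i \<in> I" "0 < a" for i a
    unfolding F_def ex_def using Suc.IH[OF cardz(1)[OF that(1)] b that(2) c cardz(2)[OF that(1)]] .
  have Gam: "0 < Gamma a" if "0 < a" for a :: real using that by (rule Gamma_real_pos)
  have b2: "0 < \<beta> / 2" using b by simp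
  have contG: "((\<lambda>a. Gprod \<beta> n (a + x)) \<longlongrightarrow> Gprod \<beta> n x) (at_right 0)" if "0 < x" for x
  proof -
    have "((\<lambda>a. a + x) \<longlongrightarrow> 0 + x) (at_right 0)" by (intro tendsto_intros)
    then show ?thesis using isCont_tendsto_compose[OF isCont_Gprod[OF b that, of n]] by simp
  qed
  have contc: "((\<lambda>a. c powr f a) \<longlongrightarrow> c powr y) (at_right 0)" if "(f \<longlongrightarrow> y) (at_right 0)" for f y
    using that c by (intro tendsto_powr tendsto_const) auto
  have ev: "\<forall>\<^sub>F a in at_right 0. 0 < a \<and> a \<le> (1::real)"
    by (rule eventually_at_rightI[of 0 1]) auto
  have upper: "\<kappa> * Gprod \<beta> n (\<beta> / 2) \<le> ?N * F \<beta>"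
  proof (rule tendsto_le[OF trivial_limit_at_right_real])
    show "((\<lambda>a. c powr - a * (?N * (Kprod \<beta> n * Gprod \<beta> n (a + \<beta>) * c powr - ex (a + \<beta>)))) \<longlongrightarrow> ?N * F \<beta>) (at_right 0)"
    proof -
      have "((\<lambda>a. c powr - a * (?N * (Kprod \<beta> n * Gprod \<beta> n (a + \<beta>) * c powr - ex (a + \<beta>)))) \<longlongrightarrow> c powr - 0 * (?N * (Kprod \<beta> n * Gprod \<beta> n \<beta> * c powr - ex (0 + \<beta>)))) (at_right 0)"
        unfolding ex_def by (intro tendsto_mult tendsto_const contG b contc tendsto_intros)
      then show ?thesis using c by (simp add: F_def)
    qed
    show "((\<lambda>a. \<kappa> * Gprod \<beta> n (a + \<beta> / 2) * c powr (- ?N * a)) \<longlongrightarrow> \<kappa> * Gprod \<beta> n (\<beta> / 2)) (at_right 0)"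
    proof -
      have "((\<lambda>a. \<kappa> * Gprod \<beta> n (a + \<beta> / 2) * c powr (- ?N * a)) \<longlongrightarrow> \<kappa> * Gprod \<beta> n (\<beta> / 2) * c powr (- ?N * 0)) (at_right 0)"
        by (intro tendsto_mult tendsto_const contG b2 contc tendsto_ident_at)
      then show ?thesis using c by simp
    qed
    show "\<forall>\<^sub>F a in at_right 0. \<kappa> * Gprod \<beta> n (a + \<beta> / 2) * c powr (- ?N * a) \<le> c powr - a * (?N * (Kprod \<beta> n * Gprod \<beta> n (a + \<beta>) * c powr - ex (a + \<beta>)))"
      using ev
    proof eventually_elim
      case (elim a)
      then have a: "0 < a" by simp
      have "(\<Sum>i\<in>I. lagZ \<beta> (a + \<beta>) c (I - {i})) = (\<Sum>i\<in>I. F (a + \<beta>))" by (intro sum.cong refl IH) (use a b in auto)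
      then have "\<kappa> * (Gamma a * Gprod \<beta> n (a + \<beta> / 2)) * c powr (- ?N * a) \<le> Gamma a * c powr - a * (?N * F (a + \<beta>))"
        using lagZ_le_extremal[OF I b a c] \<kappa>(2)[OF a] Suc.prems by (simp only: Gprod_Suc sum_constant)
      then have "Gamma a * (\<kappa> * Gprod \<beta> n (a + \<beta> / 2) * c powr (- ?N * a)) \<le> Gamma a * (c powr - a * (?N * F (a + \<beta>)))"
        by (simp only: mult_ac)
      then show ?case using Gam[OF a] unfolding F_def by (simp only: mult_le_cancel_left_pos)
    qed
  qed
  have lower: "(\<Sum>i\<in>I. enn2real (sel \<beta> (I - {i}) (cutw \<beta> c e))) \<le> \<kappa> * Gprod \<beta> n (\<beta> / 2)" if e: "0 < e" "e \<le> 1" for e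
  proof (rule tendsto_le[OF trivial_limit_at_right_real])
    let ?T = "\<lambda>i. enn2real (sel \<beta> (I - {i}) (cutw \<beta> c e))"
    show "((\<lambda>a. \<kappa> * Gprod \<beta> n (a + \<beta> / 2) * c powr (- ?N * a)) \<longlongrightarrow> \<kappa> * Gprod \<beta> n (\<beta> / 2)) (at_right 0)"
    proof -
      have "((\<lambda>a. \<kappa> * Gprod \<beta> n (a + \<beta> / 2) * c powr (- ?N * a)) \<longlongrightarrow> \<kappa> * Gprod \<beta> n (\<beta> / 2) * c powr (- ?N * 0)) (at_right 0)"
        by (intro tendsto_mult tendsto_const contG b2 contc tendsto_ident_at)
      then show ?thesis using c by simp
    qed
    show "((\<lambda>a. (c powr - a - rGamma a / (e * c)) * (e powr (a * real n) * (\<Sum>i\<in>I. ?T i))) \<longlongrightarrow> (\<Sum>i\<in>I. ?T i)) (at_right 0)"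
    proof -
      \<comment> \<open>The reciprocal Gamma function vanishes at 0, which removes the correction
        \<open>1 / (e * c)\<close> in the limit.\<close>
      have rG: "(rGamma \<longlongrightarrow> rGamma 0) (at_right (0::real))"
        using isCont_rGamma[OF continuous_ident, of "0::real"] by (simp add: isCont_def filterlim_at_split)
      have "((\<lambda>a. (c powr - a - rGamma a / (e * c)) * (e powr (a * real n) * (\<Sum>i\<in>I. ?T i))) \<longlongrightarrow> (c powr - 0 - rGamma 0 / (e * c)) * (e powr (0 * real n) * (\<Sum>i\<in>I. ?T i))) (at_right 0)"
        using e c by (intro tendsto_mult tendsto_const tendsto_diff contc tendsto_divide rG tendsto_powr tendsto_minus tendsto_ident_at) auto
      then show ?thesis using c e by simp
    qed
    have sel_fin: "sel \<beta> (I - {i}) (cutw \<beta> c e) = ennreal (?T i)" if "i \<in> I" for i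
    proof -
      have "sel \<beta> (I - {i}) (cutw \<beta> c e) \<le> sel \<beta> (I - {i}) (gw \<beta> c)"
        by (intro sel_mono cutw_le b e) auto
      also have "\<dots> < \<top>" using sel_gw[OF cardz(1)[OF that] b b c] by simp
      finally show ?thesis by simp
    qed
    show "\<forall>\<^sub>F a in at_right 0. (c powr - a - rGamma a / (e * c)) * (e powr (a * real n) * (\<Sum>i\<in>I. ?T i)) \<le> \<kappa> * Gprod \<beta> n (a + \<beta> / 2) * c powr (- ?N * a)"
      using ev
    proof eventually_elim
      case (elim a)
      then have a: "0 < a" "a \<le> 1" by auto
      have "Gamma a * c powr - a - 1 / (e * c) = Gamma a * (c powr - a - rGamma a / (e * c))"
        using Gam[OF a(1)] by (simp add: rGamma_inverse_Gamma field_simps)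
      then have "Gamma a * (c powr - a - rGamma a / (e * c)) * (e powr (a * real n) * (\<Sum>i\<in>I. ?T i)) \<le> \<kappa> * (Gamma a * Gprod \<beta> n (a + \<beta> / 2)) * c powr (- ?N * a)"
        using lagZ_ge_extremal[OF I b a(1) c a(2) e sel_fin enn2real_nonneg] \<kappa>(2)[OF a(1)] Suc.prems
        by (simp only: Gprod_Suc diff_Suc_1)
      then have "Gamma a * ((c powr - a - rGamma a / (e * c)) * (e powr (a * real n) * (\<Sum>i\<in>I. ?T i))) \<le> Gamma a * (\<kappa> * Gprod \<beta> n (a + \<beta> / 2) * c powr (- ?N * a))"
        by (simp only: mult_ac)
      then show ?case using Gam[OF a(1)] by (simp only: mult_le_cancel_left_pos)
    qed
  qed
  have "(\<lambda>m. \<Sum>i\<in>I. enn2real (sel \<beta> (I - {i}) (cutw \<beta> c (1 / real (Suc m))))) \<longlonglongrightarrow> (\<Sum>i\<in>I. F \<beta>)"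
  proof (rule tendsto_sum)
    fix i assume i: "i \<in> I"
    have "(\<lambda>m. enn2real (sel \<beta> (I - {i}) (cutw \<beta> c (1 / real (Suc m))))) \<longlonglongrightarrow> lagZ \<beta> \<beta> c (I - {i})"
      using lagZ_pos[OF cardz(1)[OF i] b b c]
      by (intro tendsto_enn2real sel_cutw_tendsto[OF cardz(1)[OF i] b c]) auto
    then show "(\<lambda>m. enn2real (sel \<beta> (I - {i}) (cutw \<beta> c (1 / real (Suc m))))) \<longlonglongrightarrow> F \<beta>" using IH[OF i b] by simp
  qed
  then have "(\<Sum>i\<in>I. F \<beta>) \<le> \<kappa> * Gprod \<beta> n (\<beta> / 2)"
    by (rule LIMSEQ_le_const2) (auto intro!: exI[of _ 0] lower)
  then have A: "\<kappa> * Gprod \<beta> n (\<beta> / 2) = ?N * F \<beta>" using upper Suc.prems by simp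
  \<comment> \<open>Splitting \<open>Gprod \<beta> (Suc n) (\<beta> / 2)\<close> at its first and at
    its last factor compares the products started at \<beta> and at \<open>\<beta> / 2\<close>. This
    turns \<open>A\<close> into a formula for \<kappa>.\<close>
  have B: "Gamma (\<beta> / 2) * Gprod \<beta> n \<beta> = Gprod \<beta> n (\<beta> / 2) * Gamma (\<beta> / 2 * ?N)"
    using Gprod_Suc[of \<beta> n "\<beta> / 2"] Gprod_Suc'[of \<beta> n "\<beta> / 2"] by (simp add: algebra_simps add_divide_distrib)
  have "Gprod \<beta> n (\<beta> / 2) * (Gamma (\<beta> / 2) * \<kappa>) = Gamma (\<beta> / 2) * (\<kappa> * Gprod \<beta> n (\<beta> / 2))"
    by (simp only: mult_ac)
  also have "\<dots> = (Gamma (\<beta> / 2) * Gprod \<beta> n \<beta>) * (?N * Kprod \<beta> n * c powr - ex \<beta>)"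
    unfolding A F_def by (simp only: mult_ac)
  also have "\<dots> = Gprod \<beta> n (\<beta> / 2) * (?N * Kprod \<beta> n * c powr - ex \<beta> * Gamma (\<beta> / 2 * ?N))"
    unfolding B by (simp only: mult_ac)
  finally have "Gprod \<beta> n (\<beta> / 2) * (Gamma (\<beta> / 2) * \<kappa>) = Gprod \<beta> n (\<beta> / 2) * (?N * Kprod \<beta> n * c powr - ex \<beta> * Gamma (\<beta> / 2 * ?N))" .
  then have \<kappa>eq: "Gamma (\<beta> / 2) * \<kappa> = ?N * Kprod \<beta> n * c powr - ex \<beta> * Gamma (\<beta> / 2 * ?N)"
    using Gprod_pos[OF b b2, of n] by simp
  have gs: "Gamma (1 + x) = x * Gamma x" if "0 < x" for x :: real
  proof -
    have "x \<notin> \<int>\<^sub>\<le>\<^sub>0" using that nonpos_Ints_nonpos not_le by blast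
    from Gamma_plus1[OF this] show ?thesis by (simp add: add.commute)
  qed
  have "\<kappa> = Kprod \<beta> n * (Gamma (1 + \<beta> / 2 * ?N) / Gamma (1 + \<beta> / 2)) * c powr - ex \<beta>"
  proof -
    have "0 < \<beta> / 2 * ?N" using b by simp
    then have R: "Gamma (1 + \<beta> / 2 * ?N) / Gamma (1 + \<beta> / 2) = ?N * Gamma (\<beta> / 2 * ?N) / Gamma (\<beta> / 2)"
      unfolding gs[OF \<open>0 < \<beta> / 2 * ?N\<close>] gs[OF b2] using b by simp
    have "\<kappa> = ?N * Kprod \<beta> n * c powr - ex \<beta> * Gamma (\<beta> / 2 * ?N) / Gamma (\<beta> / 2)"
      using \<kappa>eq Gam[OF b2] by (intro eq_divide_imp) (auto simp only: mult.commute less_irrefl)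
    then show ?thesis unfolding R by (simp only: mult_ac times_divide_eq_left times_divide_eq_right)
  qed
  then have "\<kappa> = Kprod \<beta> (Suc n) * c powr - ex \<beta>" by (simp add: Kprod_def)
  then have "lagZ \<beta> a c I = Kprod \<beta> (Suc n) * Gprod \<beta> (Suc n) a * (c powr - ex \<beta> * c powr (- ?N * a))"
    using \<kappa>(2)[OF Suc.prems(3)] by (simp only: mult_ac)
  also have "c powr - ex \<beta> * c powr (- ?N * a) = c powr (- ex \<beta> + - ?N * a)" by (simp only: powr_add)
  also have "- ex \<beta> + - ?N * a = - (?N * a + \<beta> / 2 * (?N * (?N - 1)))" by (simp add: ex_def field_simps)
  finally show ?case .
qed

section \<open>Moment bounds by moving particles\<close>

text \<open>Unnormalised mean of a linear statistic. Since \<open>ennreal\<close> cuts negative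
  values to 0, additivity asks for nonnegative statistics wherever \<open>W\<close> is
  nonzero.\<close>

definition sel_sum :: "real \<Rightarrow> nat set \<Rightarrow> (real \<Rightarrow> real) \<Rightarrow> (real \<Rightarrow> real) \<Rightarrow> ennreal" where
  "sel_sum \<beta> I W F = (\<integral>\<^sup>+l. ennreal ((\<Sum>i\<in>I. F (l i)) * ((\<Prod>i\<in>I. W (l i)) * vdm 0 \<beta> I l)) \<partial>lebP I)"

lemma sel_density_eq_0:
  assumes "finite I" "i \<in> I" "W (l i) = 0"
  shows "(\<Prod>i\<in>I. W (l i)) * vdm 0 \<beta> I l = 0"
proof -
  have "(\<Prod>i\<in>I. W (l i)) = 0" using assms by (intro prod_zero) auto
  then show ?thesis by simp
qed

lemma sel_sum_mono:
  assumes I: "finite I" and W: "\<And>s. 0 \<le> W s" and le: "\<And>s. W s \<noteq> 0 \<Longrightarrow> F s \<le> G s"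
  shows "sel_sum \<beta> I W F \<le> sel_sum \<beta> I W G"
  unfolding sel_sum_def
proof (intro nn_integral_mono ennreal_leI)
  fix l
  show "(\<Sum>i\<in>I. F (l i)) * ((\<Prod>i\<in>I. W (l i)) * vdm 0 \<beta> I l) \<le> (\<Sum>i\<in>I. G (l i)) * ((\<Prod>i\<in>I. W (l i)) * vdm 0 \<beta> I l)"
  proof (cases "\<exists>i\<in>I. W (l i) = 0")
    case True
    then obtain i where "i \<in> I" "W (l i) = 0" by blast
    from sel_density_eq_0[where W = W and l = l, OF I this] show ?thesis by (simp only: mult_zero_right)
  next
    case False
    then show ?thesis using W le by (intro mult_right_mono sum_mono mult_nonneg_nonneg prod_nonneg) auto
  qed
qed

lemma sel_density_measurable:
  assumes [measurable]: "W \<in> borel_measurable borel"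
  shows "(\<lambda>l. (\<Prod>i\<in>I. W (l i)) * vdm 0 \<beta> I l) \<in> borel_measurable (lebP I)"
  by measurable

lemma sel_sum_density_measurable:
  assumes [measurable]: "W \<in> borel_measurable borel" "F \<in> borel_measurable borel"
  shows "(\<lambda>l. (\<Sum>i\<in>I. F (l i)) * ((\<Prod>i\<in>I. W (l i)) * vdm 0 \<beta> I l)) \<in> borel_measurable (lebP I)"
  by measurable

lemma sel_sum_cmult:
  assumes "W \<in> borel_measurable borel" "F \<in> borel_measurable borel" and c: "0 \<le> c"
  shows "sel_sum \<beta> I W (\<lambda>s. c * F s) = ennreal c * sel_sum \<beta> I W F"
proof -
  have "sel_sum \<beta> I W (\<lambda>s. c * F s) = (\<integral>\<^sup>+l. ennreal c * ennreal ((\<Sum>i\<in>I. F (l i)) * ((\<Prod>i\<in>I. W (l i)) * vdm 0 \<beta> I l)) \<partial>lebP I)"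
    unfolding sel_sum_def using c by (intro nn_integral_cong) (simp add: mult.assoc flip: sum_distrib_left ennreal_mult')
  then show ?thesis
    using sel_sum_density_measurable[OF assms(1,2)] unfolding sel_sum_def by (simp add: nn_integral_cmult)
qed

lemma sel_sum_add:
  assumes I: "finite I" and [measurable]: "W \<in> borel_measurable borel" "F \<in> borel_measurable borel" "G \<in> borel_measurable borel"
    and nn: "\<And>s. 0 \<le> W s" "\<And>s. W s \<noteq> 0 \<Longrightarrow> 0 \<le> F s" "\<And>s. W s \<noteq> 0 \<Longrightarrow> 0 \<le> G s"
  shows "sel_sum \<beta> I W (\<lambda>s. F s + G s) = sel_sum \<beta> I W F + sel_sum \<beta> I W G"
proof -
  have "ennreal ((\<Sum>i\<in>I. F (l i) + G (l i)) * ((\<Prod>i\<in>I. W (l i)) * vdm 0 \<beta> I l))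
      = ennreal ((\<Sum>i\<in>I. F (l i)) * ((\<Prod>i\<in>I. W (l i)) * vdm 0 \<beta> I l)) + ennreal ((\<Sum>i\<in>I. G (l i)) * ((\<Prod>i\<in>I. W (l i)) * vdm 0 \<beta> I l))" for l
  proof (cases "\<exists>i\<in>I. W (l i) = 0")
    case True
    then obtain i where "i \<in> I" "W (l i) = 0" by blast
    from sel_density_eq_0[where W = W and l = l, OF I this] show ?thesis by (simp only: mult_zero_right ennreal_0 add_0)
  next
    case False
    then show ?thesis using nn
      by (subst ennreal_plus[symmetric]) (auto simp: sum.distrib distrib_right intro!: mult_nonneg_nonneg sum_nonneg prod_nonneg)
  qed
  then show ?thesis
    unfolding sel_sum_def by (subst nn_integral_add[symmetric]) (auto intro!: sel_sum_density_measurable)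
qed

lemma sel_sum_const: "W \<in> borel_measurable borel \<Longrightarrow> 0 \<le> c \<Longrightarrow> sel_sum \<beta> I W (\<lambda>s. c) = ennreal (c * real (card I)) * sel \<beta> I W"
  unfolding sel_sum_def sel_def
  by (subst nn_integral_cmult[symmetric])
     (auto intro!: nn_integral_cong simp: mult_ac simp flip: ennreal_mult')

lemma exp_le_one_minus:
  assumes "0 \<le> k" "k \<le> 1 / 2"
  shows "exp (- 2 * k) \<le> 1 - (k::real)"
proof -
  have "- 2 * k \<le> - k - 2 * k\<^sup>2" using assms mult_left_mono[of k "1/2" k] by (simp add: power2_eq_square)
  also have "\<dots> \<le> ln (1 - k)" using ln_one_minus_pos_lower_bound[of k] assms by simp
  finally have "exp (- 2 * k) \<le> exp (ln (1 - k))" by simp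
  then show ?thesis using assms by simp
qed

text \<open>Moving all particles simultaneously by the contraction \<open>z \<mapsto> z - g z\<close> can only decrease the
  total mass; comparing the weights before and after the move bounds exponential moments.\<close>

locale contracting_field =
  fixes g k :: "real \<Rightarrow> real"
  assumes deriv: "\<And>z. (g has_real_derivative k z) (at z)"
    and k_cont: "continuous_on UNIV k"
    and k_nonneg: "\<And>z. 0 \<le> k z" and k_le: "\<And>z. k z \<le> 1 / 2"
    and k_mono: "\<And>y z. \<bar>y\<bar> \<le> \<bar>z\<bar> \<Longrightarrow> k y \<le> k z"
    and g_0: "g 0 = 0"
begin

definition \<phi> :: "real \<Rightarrow> real" where "\<phi> z = z - g z"

lemma g_cont: "continuous_on UNIV g"
  using deriv by (intro DERIV_continuous_on) (auto intro: DERIV_subset)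

lemma measurable_g [measurable]: "g \<in> borel_measurable borel"
  by (rule borel_measurable_continuous_onI[OF g_cont])

lemma measurable_k [measurable]: "k \<in> borel_measurable borel"
  by (rule borel_measurable_continuous_onI[OF k_cont])

lemma measurable_\<phi> [measurable]: "\<phi> \<in> borel_measurable borel"
  unfolding \<phi>_def by measurable

lemma diff_g: "\<exists>\<xi>. g x - g y = (x - y) * k \<xi> \<and> min x y \<le> \<xi> \<and> \<xi> \<le> max x y"
proof (cases x y rule: linorder_cases)
  case less
  from MVT2[OF this, of g k] deriv obtain \<xi> where "x < \<xi>" "\<xi> < y" "g y - g x = (y - x) * k \<xi>" by blast
  then show ?thesis using less by (intro exI[of _ \<xi>]) (auto simp: algebra_simps)
next
  case greater
  from MVT2[OF this, of g k] deriv obtain \<xi> where "y < \<xi>" "\<xi> < x" "g x - g y = (x - y) * k \<xi>" by blast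
  then show ?thesis using greater by (intro exI[of _ \<xi>]) auto
qed auto

lemma g_eq: obtains q where "0 \<le> q" "q \<le> k z" "g z = z * q"
proof -
  obtain \<xi> where "g z - g 0 = (z - 0) * k \<xi>" "min z 0 \<le> \<xi>" "\<xi> \<le> max z 0" using diff_g[of z 0] by blast
  then show thesis using that[of "k \<xi>"] k_nonneg k_mono[of \<xi> z] g_0 by (auto simp: min_def max_def split: if_splits)
qed

text \<open>The mean value theorem gives the contraction factor \<open>1 - k \<xi>\<close> with
  \<xi> between the points, and monotonicity of \<open>k\<close> in the absolute value bounds
  \<open>k \<xi>\<close> by \<open>k x + k y\<close>. A loss that is a sum over the two particles
  lets all pair losses add up to a linear statistic.\<close>

lemma \<phi>_pair: "exp (- 2 * (k x + k y)) * \<bar>x - y\<bar> \<le> \<bar>\<phi> x - \<phi> y\<bar>"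
proof -
  obtain \<xi> where \<xi>: "g x - g y = (x - y) * k \<xi>" "min x y \<le> \<xi>" "\<xi> \<le> max x y" using diff_g[of x y] by blast
  have "k \<xi> \<le> k x + k y"
  proof (cases "\<bar>\<xi>\<bar> \<le> \<bar>x\<bar>")
    case True
    then show ?thesis using k_mono[of \<xi> x] k_nonneg[of y] by linarith
  next
    case False
    then have "\<bar>\<xi>\<bar> \<le> \<bar>y\<bar>" using \<xi> by linarith
    then show ?thesis using k_mono[of \<xi> y] k_nonneg[of x] by linarith
  qed
  then have "exp (- 2 * (k x + k y)) \<le> exp (- 2 * k \<xi>)" by simp
  also have "\<dots> \<le> 1 - k \<xi>" by (intro exp_le_one_minus k_nonneg k_le)
  finally have "exp (- 2 * (k x + k y)) * \<bar>x - y\<bar> \<le> (1 - k \<xi>) * \<bar>x - y\<bar>" by (rule mult_right_mono) simp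
  also have "\<dots> = \<bar>(x - y) * (1 - k \<xi>)\<bar>" using k_le[of \<xi>] by (simp add: abs_mult)
  also have "(x - y) * (1 - k \<xi>) = \<phi> x - \<phi> y" using \<xi>(1) by (simp add: \<phi>_def algebra_simps)
  finally show ?thesis .
qed

text \<open>The moved density times the Jacobian is at least \<open>exp X\<close>, hence at least
  \<open>1 + X\<close>, times the old density, where \<open>X\<close> is the sum of \<open>H\<close>
  minus a multiple of the sum of \<open>k\<close>. Integrating and cancelling the finite total mass
  gives the claim. In the multiple, \<open>e\<close> stems from the weight, \<open>2\<close> from
  the Jacobian via \<open>1 - k \<ge> exp (- 2 * k)\<close>, and \<open>2 * \<beta> * card I\<close>
  from the pairs.\<close>

lemma sel_sum_contraction:
  assumes I: "finite I" and W[measurable]: "W \<in> borel_measurable borel" and W0: "\<And>s. 0 \<le> W s"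
    and H[measurable]: "H \<in> borel_measurable borel" and H0: "\<And>s. W s \<noteq> 0 \<Longrightarrow> 0 \<le> H (s / s0 - 1)"
    and s0: "0 < s0" and \<beta>: "0 < \<beta>" and e: "0 \<le> e" and fin: "sel \<beta> I W < \<infinity>"
    and weight: "\<And>s. W s * exp (H (s / s0 - 1) - e * k (s / s0 - 1)) \<le> W (s0 * (1 + \<phi> (s / s0 - 1)))"
  shows "sel_sum \<beta> I W (\<lambda>s. H (s / s0 - 1)) \<le> ennreal (e + 2 + 2 * \<beta> * real (card I)) * sel_sum \<beta> I W (\<lambda>s. k (s / s0 - 1))"
proof -
  define z where "z s = s / s0 - 1" for s
  define \<Phi> where "\<Phi> s = s0 * (1 + \<phi> (z s))" for s
  define E where "E = e + 2 + 2 * \<beta> * real (card I)"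
  have E: "0 \<le> E" using e \<beta> by (simp add: E_def)
  have [measurable]: "z \<in> borel_measurable borel" unfolding z_def by measurable
  let ?f = "\<lambda>l. (\<Prod>i\<in>I. W (l i)) * vdm 0 \<beta> I l"
  let ?X = "\<lambda>l. (\<Sum>i\<in>I. H (z (l i))) - E * (\<Sum>i\<in>I. k (z (l i)))"
  have f0: "0 \<le> ?f l" for l using W0 by (intro mult_nonneg_nonneg prod_nonneg) auto
  have vd: "exp (- 2 * \<beta> * real (card I) * (\<Sum>i\<in>I. k (z (l i)))) * vdm 0 \<beta> I l \<le> vdm 0 \<beta> I (\<lambda>i\<in>I. \<Phi> (l i))" for l
  proof -
    let ?k = "\<lambda>i. k (z (l i))"
    have "(\<Sum>i\<in>I. \<Sum>j\<in>I-{i}. ?k i + ?k j) \<le> (\<Sum>i\<in>I. \<Sum>j\<in>I. ?k i + ?k j)"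
      using I k_nonneg by (intro sum_mono sum_mono2) (auto intro: add_nonneg_nonneg)
    also have "\<dots> = 2 * real (card I) * (\<Sum>i\<in>I. ?k i)"
      by (simp add: sum.distrib sum_distrib_left mult.assoc)
    finally have "\<beta> * (\<Sum>i\<in>I. \<Sum>j\<in>I-{i}. ?k i + ?k j) \<le> \<beta> * (2 * real (card I) * (\<Sum>i\<in>I. ?k i))"
      using \<beta> by (intro mult_left_mono) auto
    then have "exp (- 2 * \<beta> * real (card I) * (\<Sum>i\<in>I. ?k i)) \<le> exp (\<Sum>i\<in>I. \<Sum>j\<in>I-{i}. - \<beta> * (?k i + ?k j))"
      by (simp add: mult_ac sum_negf flip: sum_distrib_left)
    also have "\<dots> = (\<Prod>i\<in>I. \<Prod>j\<in>I-{i}. exp (- \<beta> * (?k i + ?k j)))"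
      using I by (simp add: exp_sum)
    finally have "exp (- 2 * \<beta> * real (card I) * (\<Sum>i\<in>I. ?k i)) * vdm 0 \<beta> I l
       \<le> (\<Prod>i\<in>I. \<Prod>j\<in>I-{i}. exp (- \<beta> * (?k i + ?k j))) * vdm 0 \<beta> I l" by (rule mult_right_mono) simp
    also have "\<dots> = (\<Prod>i\<in>I. \<Prod>j\<in>I-{i}. exp (- \<beta> * (?k i + ?k j)) * ((l i - l j)\<^sup>2 + 0) powr (\<beta> / 4))"
      unfolding vdm_def by (simp add: prod.distrib)
    also have "\<dots> \<le> (\<Prod>i\<in>I. \<Prod>j\<in>I-{i}. (((\<lambda>i\<in>I. \<Phi> (l i)) i - (\<lambda>i\<in>I. \<Phi> (l i)) j)\<^sup>2 + 0) powr (\<beta> / 4))"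
    proof (intro prod_mono conjI prod_nonneg mult_nonneg_nonneg)
      fix i j assume ij: "i \<in> I" "j \<in> I - {i}"
      have "s0 * (exp (- 2 * (?k i + ?k j)) * \<bar>z (l i) - z (l j)\<bar>) \<le> s0 * \<bar>\<phi> (z (l i)) - \<phi> (z (l j))\<bar>"
        using s0 \<phi>_pair by (intro mult_left_mono) auto
      also have "s0 * \<bar>\<phi> (z (l i)) - \<phi> (z (l j))\<bar> = \<bar>s0 * (\<phi> (z (l i)) - \<phi> (z (l j)))\<bar>" using s0 by (simp add: abs_mult)
      also have "s0 * (\<phi> (z (l i)) - \<phi> (z (l j))) = \<Phi> (l i) - \<Phi> (l j)" by (simp add: \<Phi>_def algebra_simps)
      also have "s0 * (exp (- 2 * (?k i + ?k j)) * \<bar>z (l i) - z (l j)\<bar>) = exp (- 2 * (?k i + ?k j)) * \<bar>s0 * (z (l i) - z (l j))\<bar>"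
        using s0 by (simp add: abs_mult)
      also have "s0 * (z (l i) - z (l j)) = l i - l j" using s0 by (simp add: z_def field_simps)
      finally have "exp (- 2 * (?k i + ?k j)) * \<bar>l i - l j\<bar> \<le> \<bar>\<Phi> (l i) - \<Phi> (l j)\<bar>" .
      then have "(exp (- 2 * (?k i + ?k j)) * \<bar>l i - l j\<bar>)\<^sup>2 \<le> \<bar>\<Phi> (l i) - \<Phi> (l j)\<bar>\<^sup>2"
        by (rule power_mono) simp
      then have "(exp (- 2 * (?k i + ?k j)))\<^sup>2 * (l i - l j)\<^sup>2 \<le> (\<Phi> (l i) - \<Phi> (l j))\<^sup>2" by (simp add: power_mult_distrib)
      then have "((exp (- 2 * (?k i + ?k j)))\<^sup>2 * (l i - l j)\<^sup>2) powr (\<beta> / 4) \<le> ((\<Phi> (l i) - \<Phi> (l j))\<^sup>2) powr (\<beta> / 4)"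
        using \<beta> by (intro powr_mono2) auto
      also have "((exp (- 2 * (?k i + ?k j)))\<^sup>2 * (l i - l j)\<^sup>2) powr (\<beta> / 4) = ((exp (- 2 * (?k i + ?k j)))\<^sup>2) powr (\<beta> / 4) * ((l i - l j)\<^sup>2) powr (\<beta> / 4)"
        by (simp add: powr_mult)
      also have "(exp (- 2 * (?k i + ?k j)))\<^sup>2 = exp (- 4 * (?k i + ?k j))" by (simp flip: exp_double)
      also have "exp (- 4 * (?k i + ?k j)) powr (\<beta> / 4) = exp (- \<beta> * (?k i + ?k j))" by (simp add: exp_powr_real algebra_simps)
      finally show "exp (- \<beta> * (?k i + ?k j)) * ((l i - l j)\<^sup>2 + 0) powr (\<beta> / 4)
         \<le> (((\<lambda>i\<in>I. \<Phi> (l i)) i - (\<lambda>i\<in>I. \<Phi> (l i)) j)\<^sup>2 + 0) powr (\<beta> / 4)"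
        using ij by simp
    qed auto
    also have "\<dots> = vdm 0 \<beta> I (\<lambda>i\<in>I. \<Phi> (l i))" by (simp only: vdm_def)
    finally show ?thesis .
  qed
  have key: "(1 + ?X l) * ?f l \<le> ?f (\<lambda>i\<in>I. \<Phi> (l i)) * (\<Prod>i\<in>I. 1 - k (z (l i)))" for l
  proof -
    let ?S = "\<Sum>i\<in>I. k (z (l i))"
    have eqX: "?X l = (\<Sum>i\<in>I. H (z (l i)) - e * k (z (l i))) + (\<Sum>i\<in>I. - 2 * k (z (l i))) + - 2 * \<beta> * real (card I) * ?S"
      by (simp add: E_def sum_subtractf sum_negf algebra_simps flip: sum_distrib_left)
    have "(1 + ?X l) * ?f l \<le> exp (?X l) * ?f l" using f0 by (intro mult_right_mono exp_ge_add_one_self) auto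
    also have "\<dots> = ((\<Prod>i\<in>I. W (l i) * exp (H (z (l i)) - e * k (z (l i)))) * (\<Prod>i\<in>I. exp (- 2 * k (z (l i))))) * (exp (- 2 * \<beta> * real (card I) * ?S) * vdm 0 \<beta> I l)"
      unfolding eqX by (simp only: exp_add exp_sum[OF I] prod.distrib mult_ac)
    also have "\<dots> \<le> ((\<Prod>i\<in>I. W (\<Phi> (l i))) * (\<Prod>i\<in>I. 1 - k (z (l i)))) * vdm 0 \<beta> I (\<lambda>i\<in>I. \<Phi> (l i))"
    proof (intro mult_mono prod_mono conjI vd)
      fix i
      show "W (l i) * exp (H (z (l i)) - e * k (z (l i))) \<le> W (\<Phi> (l i))" unfolding z_def \<Phi>_def by (rule weight)
      show "exp (- 2 * k (z (l i))) \<le> 1 - k (z (l i))" by (intro exp_le_one_minus k_nonneg k_le)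
    qed (use W0 k_le in \<open>auto intro!: prod_nonneg mult_nonneg_nonneg simp: order_trans[OF k_le]\<close>)
    also have "\<dots> = ?f (\<lambda>i\<in>I. \<Phi> (l i)) * (\<Prod>i\<in>I. 1 - k (z (l i)))" by simp
    finally show ?thesis .
  qed
  have "sel \<beta> I W + sel_sum \<beta> I W (\<lambda>s. H (z s)) = (\<integral>\<^sup>+l. ennreal (?f l) + ennreal ((\<Sum>i\<in>I. H (z (l i))) * ?f l) \<partial>lebP I)"
    unfolding sel_def sel_sum_def by (rule nn_integral_add[symmetric]) measurable
  also have "\<dots> \<le> (\<integral>\<^sup>+l. ennreal (?f (\<lambda>i\<in>I. \<Phi> (l i))) * (\<Prod>i\<in>I. ennreal (1 - k (z (l i)))) + ennreal E * ennreal ((\<Sum>i\<in>I. k (z (l i))) * ?f l) \<partial>lebP I)"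
  proof (rule nn_integral_mono)
    fix l
    have Hf: "0 \<le> (\<Sum>i\<in>I. H (z (l i))) * ?f l"
    proof (cases "\<exists>i\<in>I. W (l i) = 0")
      case True
      then obtain i where "i \<in> I" "W (l i) = 0" by blast
      from sel_density_eq_0[where W = W and l = l, OF I this] show ?thesis by (simp only: mult_zero_right order_refl)
    next
      case False
      then have "0 \<le> (\<Sum>i\<in>I. H (z (l i)))" using H0 unfolding z_def by (intro sum_nonneg) auto
      then show ?thesis by (rule mult_nonneg_nonneg[OF _ f0])
    qed
    have k1: "0 \<le> 1 - k y" for y using k_le[of y] by linarith
    have ks: "0 \<le> (\<Sum>i\<in>I. k (z (l i)))" using k_nonneg by (intro sum_nonneg) auto
    have "?f l + (\<Sum>i\<in>I. H (z (l i))) * ?f l = (1 + ?X l) * ?f l + E * ((\<Sum>i\<in>I. k (z (l i))) * ?f l)"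
      by (simp add: algebra_simps)
    also have "\<dots> \<le> ?f (\<lambda>i\<in>I. \<Phi> (l i)) * (\<Prod>i\<in>I. 1 - k (z (l i))) + E * ((\<Sum>i\<in>I. k (z (l i))) * ?f l)"
      using key[of l] by (rule add_right_mono)
    finally have "ennreal (?f l + (\<Sum>i\<in>I. H (z (l i))) * ?f l) \<le> ennreal (?f (\<lambda>i\<in>I. \<Phi> (l i)) * (\<Prod>i\<in>I. 1 - k (z (l i))) + E * ((\<Sum>i\<in>I. k (z (l i))) * ?f l))"
      by (rule ennreal_leI)
    moreover have "ennreal (?f l + (\<Sum>i\<in>I. H (z (l i))) * ?f l) = ennreal (?f l) + ennreal ((\<Sum>i\<in>I. H (z (l i))) * ?f l)"
      by (rule ennreal_plus[OF f0 Hf])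
    moreover have "ennreal (?f (\<lambda>i\<in>I. \<Phi> (l i)) * (\<Prod>i\<in>I. 1 - k (z (l i))) + E * ((\<Sum>i\<in>I. k (z (l i))) * ?f l))
       = ennreal (?f (\<lambda>i\<in>I. \<Phi> (l i)) * (\<Prod>i\<in>I. 1 - k (z (l i)))) + ennreal (E * ((\<Sum>i\<in>I. k (z (l i))) * ?f l))"
      by (rule ennreal_plus) (intro mult_nonneg_nonneg[OF f0] prod_nonneg k1 mult_nonneg_nonneg[OF E] mult_nonneg_nonneg[OF ks] f0)+
    moreover have "ennreal (?f (\<lambda>i\<in>I. \<Phi> (l i)) * (\<Prod>i\<in>I. 1 - k (z (l i)))) = ennreal (?f (\<lambda>i\<in>I. \<Phi> (l i))) * (\<Prod>i\<in>I. ennreal (1 - k (z (l i))))"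
      using k1 by (subst ennreal_mult'[OF f0]) (simp add: prod_ennreal)
    moreover have "ennreal (E * ((\<Sum>i\<in>I. k (z (l i))) * ?f l)) = ennreal E * ennreal ((\<Sum>i\<in>I. k (z (l i))) * ?f l)"
      by (rule ennreal_mult'[OF E])
    ultimately show "ennreal (?f l) + ennreal ((\<Sum>i\<in>I. H (z (l i))) * ?f l) \<le> ennreal (?f (\<lambda>i\<in>I. \<Phi> (l i))) * (\<Prod>i\<in>I. ennreal (1 - k (z (l i)))) + ennreal E * ennreal ((\<Sum>i\<in>I. k (z (l i))) * ?f l)"
      by simp
  qed
  also have "\<dots> = (\<integral>\<^sup>+l. ennreal (?f (\<lambda>i\<in>I. \<Phi> (l i))) * (\<Prod>i\<in>I. ennreal (1 - k (z (l i)))) \<partial>lebP I) + ennreal E * sel_sum \<beta> I W (\<lambda>s. k (z s))"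
  proof -
    have [measurable]: "\<Phi> \<in> borel_measurable borel" unfolding \<Phi>_def by measurable
    have "(\<lambda>l. \<lambda>i\<in>I. \<Phi> (l i)) \<in> measurable (lebP I) (lebP I)" by (intro measurable_restrict) measurable
    from measurable_compose[OF this sel_density_measurable[OF W, of I \<beta>]]
    have [measurable]: "(\<lambda>l. ?f (\<lambda>i\<in>I. \<Phi> (l i))) \<in> borel_measurable (lebP I)" .
    have m1: "(\<lambda>l. ennreal (?f (\<lambda>i\<in>I. \<Phi> (l i))) * (\<Prod>i\<in>I. ennreal (1 - k (z (l i))))) \<in> borel_measurable (lebP I)"
      by measurable
    have m2: "(\<lambda>l. ennreal ((\<Sum>i\<in>I. k (z (l i))) * ?f l)) \<in> borel_measurable (lebP I)"
      by measurable
    then have m3: "(\<lambda>l. ennreal E * ennreal ((\<Sum>i\<in>I. k (z (l i))) * ?f l)) \<in> borel_measurable (lebP I)"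
      by measurable
    show ?thesis unfolding sel_sum_def nn_integral_add[OF m1 m3] nn_integral_cmult[OF m2] ..
  qed
  also have "(\<integral>\<^sup>+l. ennreal (?f (\<lambda>i\<in>I. \<Phi> (l i))) * (\<Prod>i\<in>I. ennreal (1 - k (z (l i)))) \<partial>lebP I) \<le> sel \<beta> I W"
    unfolding sel_def
  proof (rule nn_integral_lebP_substitution_le[OF I])
    show "(\<lambda>l. ennreal (?f l)) \<in> borel_measurable (lebP I)" by measurable
    show "(\<Phi> has_real_derivative 1 - k (z s)) (at s)" for s
    proof -
      have dz: "(z has_real_derivative 1 / s0) (at s)"
        unfolding z_def[abs_def] using s0 by (auto intro!: derivative_eq_intros)
      have "((\<lambda>s. g (z s)) has_real_derivative k (z s) * (1 / s0)) (at s)"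
        by (rule DERIV_chain2[OF deriv dz])
      then have "((\<lambda>s. s0 * (1 + (z s - g (z s)))) has_real_derivative s0 * (0 + (1 / s0 - k (z s) * (1 / s0)))) (at s)"
        by (intro DERIV_cmult DERIV_add DERIV_const DERIV_diff dz)
      then show ?thesis using s0 by (simp add: \<Phi>_def[abs_def] \<phi>_def algebra_simps)
    qed
    show "continuous_on UNIV (\<lambda>s. 1 - k (z s))"
    proof -
      have "continuous_on UNIV z" unfolding z_def using s0 by (intro continuous_intros) auto
      from continuous_on_compose2[OF k_cont this] show ?thesis by (intro continuous_intros) auto
    qed
    show "0 \<le> 1 - k (z s)" for s using k_le[of "z s"] by linarith
  qed
  finally have "sel \<beta> I W + sel_sum \<beta> I W (\<lambda>s. H (z s)) \<le> sel \<beta> I W + ennreal E * sel_sum \<beta> I W (\<lambda>s. k (z s))"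
    by (simp add: add_right_mono)
  then have "sel_sum \<beta> I W (\<lambda>s. H (z s)) \<le> ennreal E * sel_sum \<beta> I W (\<lambda>s. k (z s))"
    using fin by (subst (asm) ennreal_add_left_cancel_le) auto
  then show ?thesis by (simp only: z_def E_def)
qed

end

section \<open>The relative entropy function of the Laguerre weight\<close>

text \<open>At \<open>s = s0 * (1 + z)\<close> with \<open>c * s0 = \<alpha>\<close>, the weight
  \<open>s powr \<alpha> * exp (- c * s)\<close> is a constant times
  \<open>exp (- \<alpha> * om z)\<close>. So \<open>om\<close> is the energy of a relative
  displacement, quadratic near 0 and logarithmically infinite at -1.\<close>

definition om :: "real \<Rightarrow> real" where "om z = z - ln (1 + z)"

lemma om_measurable [measurable]: "om \<in> borel_measurable borel"
  unfolding om_def by measurable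

lemma om_nonneg: "-1 < z \<Longrightarrow> 0 \<le> om z"
  using ln_add_one_self_le_self2[of z] by (simp add: om_def)

text \<open>Bernoulli's inequality \<open>(1 + z) powr t \<le> 1 + t * z\<close>: moving towards the
  centre lowers the energy.\<close>

lemma om_scale_le:
  assumes "-1 < z" "0 \<le> t" "t \<le> 1"
  shows "om (t * z) \<le> om z"
proof -
  have "(1 + z) powr t * 1 powr (1 - t) \<le> t * (1 + z) + (1 - t) * 1"
    using assms by (intro Youngs_inequality_0) auto
  then have le: "(1 + z) powr t \<le> 1 + t * z" by (simp add: algebra_simps)
  have "t * ln (1 + z) = ln ((1 + z) powr t)" using assms by (simp add: ln_powr)
  also have "\<dots> \<le> ln (1 + t * z)" using le assms by (subst ln_le_cancel_iff) (auto intro: less_le_trans[OF _ le])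
  finally have "om (t * z) \<le> t * om z" by (simp add: om_def algebra_simps)
  also have "\<dots> \<le> 1 * om z" using assms om_nonneg by (intro mult_right_mono) auto
  finally show ?thesis by simp
qed

lemma om_half_le: "-1 < z \<Longrightarrow> om (z / 2) \<le> om z / 2"
proof -
  assume z: "-1 < z"
  have "1 + z \<le> (1 + z / 2)\<^sup>2" by (simp add: power2_eq_square algebra_simps)
  then have "ln (1 + z) \<le> ln ((1 + z / 2)\<^sup>2)" using z by simp
  also have "\<dots> = 2 * ln (1 + z / 2)" using z by (simp add: ln_realpow)
  finally show ?thesis by (simp add: om_def)
qed

lemma ex_nonneg_DERIV:
  "(f has_real_derivative d) (at x) \<Longrightarrow> 0 \<le> d \<Longrightarrow> \<exists>y. (f has_real_derivative y) (at x) \<and> 0 \<le> y"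
  by blast

lemma om_ge_pos:
  assumes "0 \<le> z"
  shows "z\<^sup>2 / (2 * (1 + z)) \<le> om z"
proof -
  let ?f = "\<lambda>z. om z - z\<^sup>2 / (2 * (1 + z))"
  have "?f 0 \<le> ?f z"
  proof (rule DERIV_nonneg_imp_nondecreasing[OF assms])
    fix x :: real assume "0 \<le> x" "x \<le> z"
    then have x: "1 + x \<noteq> 0" "0 < 1 + x" by auto
    have "(?f has_real_derivative (1 - 1 / (1 + x)) - ((2 * x) * (2 * (1 + x)) - x\<^sup>2 * 2) / ((2 * (1 + x)) * (2 * (1 + x)))) (at x)"
      unfolding om_def using x by (auto intro!: derivative_eq_intros)
    also have "(1 - 1 / (1 + x)) - ((2 * x) * (2 * (1 + x)) - x\<^sup>2 * 2) / ((2 * (1 + x)) * (2 * (1 + x))) = x\<^sup>2 / (2 * (1 + x)\<^sup>2)"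
      using x by (simp add: divide_simps) (simp add: power2_eq_square algebra_simps)
    finally have "(?f has_real_derivative x\<^sup>2 / (2 * (1 + x)\<^sup>2)) (at x)" .
    then show "\<exists>y. (?f has_real_derivative y) (at x) \<and> 0 \<le> y" by (rule ex_nonneg_DERIV) simp
  qed
  then show ?thesis by (simp add: om_def)
qed

lemma om_ge_neg:
  assumes "0 \<le> w" "w < 1"
  shows "w\<^sup>2 / 2 \<le> om (- w)"
proof -
  let ?f = "\<lambda>w. om (- w) - w\<^sup>2 / 2"
  have "?f 0 \<le> ?f w"
  proof (rule DERIV_nonneg_imp_nondecreasing[OF assms(1)])
    fix x :: real assume x: "0 \<le> x" "x \<le> w"
    then have "(?f has_real_derivative x\<^sup>2 / (1 - x)) (at x)"
      unfolding om_def using assms by (auto intro!: derivative_eq_intros simp: field_simps power2_eq_square)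
    then show "\<exists>y. (?f has_real_derivative y) (at x) \<and> 0 \<le> y" by (rule ex_nonneg_DERIV) (use x assms in auto)
  qed
  then show ?thesis by (simp add: om_def)
qed

text \<open>Derivative of \<open>(z - arctan z) / 2\<close>. That field is about
  \<open>z^3 / 6\<close> near 0, and its derivative stays below \<open>1 / 2\<close> everywhere, as
  a contraction of particles at arbitrary positions requires.\<close>

definition k3 :: "real \<Rightarrow> real" where "k3 z = z\<^sup>2 / (2 * (1 + z\<^sup>2))"

lemma k3_alt: "k3 z = (1 - 1 / (1 + z\<^sup>2)) / 2"
proof -
  have "0 < 1 + z\<^sup>2" by (simp add: add_pos_nonneg)
  then show ?thesis by (simp add: k3_def field_simps)
qed

text \<open>Halving all displacements releases at least half of the energy \<open>om\<close>, and
  therefore bounds the mean of \<open>om\<close>.\<close>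

interpretation lin: contracting_field "\<lambda>z. z / 2" "\<lambda>z. 1 / 2"
  by unfold_locales (auto intro!: derivative_eq_intros continuous_intros)

interpretation cub: contracting_field "\<lambda>z. (z - arctan z) / 2" k3
proof
  show "((\<lambda>z. (z - arctan z) / 2) has_real_derivative k3 z) (at z)" for z
    unfolding k3_alt by (auto intro!: derivative_eq_intros simp: inverse_eq_divide)
  have nz: "2 * (1 + z\<^sup>2) \<noteq> 0" for z :: real by (smt (verit) zero_le_power2)
  show "continuous_on UNIV k3" unfolding k3_def by (intro continuous_intros ballI nz)
  show "0 \<le> k3 z" for z unfolding k3_def by simp
  show "k3 z \<le> 1 / 2" for z unfolding k3_alt by (simp add: add_nonneg_nonneg)
  show "k3 y \<le> k3 z" if "\<bar>y\<bar> \<le> \<bar>z\<bar>" for y z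
  proof -
    have "y\<^sup>2 \<le> z\<^sup>2" using that by (rule abs_le_square_iff[THEN iffD1])
    then have "1 / (1 + z\<^sup>2) \<le> 1 / (1 + y\<^sup>2)" by (intro divide_left_mono) (auto intro!: mult_pos_pos add_pos_nonneg)
    then show ?thesis unfolding k3_alt by simp
  qed
qed simp

text \<open>Closes the bootstrap: the cubic contraction bounds the mean of the fourth-order
  statistic \<open>h3\<close> by a multiple of the mean of \<open>k3\<close>, and the mean of
  \<open>om\<close> is already bounded by the halving map.\<close>

lemma k3_le_om:
  assumes "-1 < z"
  shows "k3 z \<le> 2 * om z"
proof (cases "0 \<le> z")
  case True
  have "0 \<le> (z - 1)\<^sup>2" by simp
  then have "1 + z \<le> 2 * (1 + z\<^sup>2)" unfolding power2_diff using True by (simp add: algebra_simps) (smt (verit) zero_le_power2)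
  then have "z\<^sup>2 * (1 + z) \<le> z\<^sup>2 * (2 * (1 + z\<^sup>2))" by (rule mult_left_mono) simp
  moreover have "0 < 1 + z\<^sup>2" by (simp add: add_pos_nonneg)
  ultimately have "k3 z \<le> 2 * (z\<^sup>2 / (2 * (1 + z)))" unfolding k3_def using True by (simp add: field_simps)
  then show ?thesis using om_ge_pos[OF True] by linarith
next
  case False
  have "k3 z \<le> z\<^sup>2 / 2" unfolding k3_def by (simp add: divide_le_eq field_simps add_pos_nonneg)
  moreover have "z\<^sup>2 / 2 \<le> om z" using om_ge_neg[of "- z"] False assms by simp
  ultimately show ?thesis using om_nonneg[OF assms] by linarith
qed

text \<open>Energy released by the cubic contraction. It is of order \<open>z^4\<close> near 0 and,
  since \<open>cub.\<phi>\<close> keeps away from -1, as singular at -1 as the logarithm. Both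
  ranges are needed to dominate the tilt remainder.\<close>

definition h3 :: "real \<Rightarrow> real" where "h3 z = om z - om (cub.\<phi> z)"

lemma cub_\<phi>: "cub.\<phi> z = (z + arctan z) / 2"
  by (simp add: cub.\<phi>_def field_simps)

lemma h3_measurable [measurable]: "h3 \<in> borel_measurable borel"
  unfolding h3_def by measurable

context contracting_field
begin

lemma \<phi>_scale: obtains t where "1 / 2 \<le> t" "t \<le> 1" "\<phi> z = t * z" "1 - t \<le> k z"
proof -
  obtain q where "0 \<le> q" "q \<le> k z" "g z = z * q" using g_eq[of z] .
  then show thesis using that[of "1 - q"] k_le[of z] by (auto simp: \<phi>_def algebra_simps)
qed

lemma \<phi>_gt: "-1 < z \<Longrightarrow> -1 < \<phi> z"
proof -
  assume z: "-1 < z"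
  obtain t where t: "1 / 2 \<le> t" "t \<le> 1" "\<phi> z = t * z" using \<phi>_scale[of z] by metis
  show ?thesis
  proof (cases "0 \<le> z")
    case True then show ?thesis using t by (auto intro: less_le_trans[of _ 0])
  next
    case False
    then have "(1 - t) * z \<le> 0" using t by (intro mult_nonneg_nonpos) auto
    then show ?thesis using t z by (simp add: algebra_simps)
  qed
qed

lemma om_decrease_nonneg: "-1 < z \<Longrightarrow> 0 \<le> om z - om (\<phi> z)"
proof -
  assume z: "-1 < z"
  obtain t where "1 / 2 \<le> t" "t \<le> 1" "\<phi> z = t * z" using \<phi>_scale[of z] by metis
  then show ?thesis using om_scale_le[OF z, of t] by simp
qed

lemma \<phi>_ge: "-1 < z \<Longrightarrow> \<phi> z - z \<le> k z"
proof -
  assume z: "-1 < z"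
  obtain t where t: "1 / 2 \<le> t" "t \<le> 1" "\<phi> z = t * z" "1 - t \<le> k z" using \<phi>_scale[of z] .
  have "(1 - t) * (- z) \<le> (1 - t) * 1" using z t by (intro mult_left_mono) auto
  then show ?thesis using t by (simp add: algebra_simps)
qed

text \<open>With \<open>c * s0 = \<alpha> + e'\<close> the weight is a constant times
  \<open>exp (- \<alpha> * om z - e' * z)\<close> and the correction \<tau>. The contraction gains
  in the first term. It may raise \<open>z\<close>, but for \<open>z > -1\<close> by at most
  \<open>k z\<close>, which is the price \<open>e'\<close>; the price \<open>e''\<close> is that of
  \<tau>.\<close>

lemma gw_contraction:
  assumes s0: "0 < s0" and par: "c * s0 = \<alpha> + e'" "0 \<le> \<alpha>" "0 \<le> e'"
    and \<tau>: "\<And>z. -1 < z \<Longrightarrow> 0 \<le> \<tau> z" "\<And>z. -1 < z \<Longrightarrow> \<tau> z * exp (- e'' * k z) \<le> \<tau> (\<phi> z)"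
    and W: "\<And>s. W s = gw (\<alpha> + 1) c s * \<tau> (s / s0 - 1)"
  shows "W s * exp (\<alpha> * (om (s / s0 - 1) - om (\<phi> (s / s0 - 1))) - (e' + e'') * k (s / s0 - 1)) \<le> W (s0 * (1 + \<phi> (s / s0 - 1)))"
proof (cases "0 < s")
  case False
  then have "W s = 0" by (simp add: W gw_def)
  moreover have "0 \<le> W (s0 * (1 + \<phi> (s / s0 - 1)))"
  proof (cases "0 < s0 * (1 + \<phi> (s / s0 - 1))")
    case True
    then have "-1 < \<phi> (s / s0 - 1)" using s0 by (simp add: zero_less_mult_iff)
    then show ?thesis using s0 \<tau>(1) by (simp add: W)
  qed (simp add: W gw_def)
  ultimately show ?thesis by simp
next
  case True
  define z where "z = s / s0 - 1"
  have z: "-1 < z" using True s0 by (simp add: z_def)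
  have pz: "-1 < \<phi> z" by (rule \<phi>_gt[OF z])
  have g: "gw (\<alpha> + 1) c (s0 * (1 + y)) = exp (\<alpha> * ln s0 + \<alpha> * ln (1 + y) - (\<alpha> + e') * (1 + y))" if "-1 < y" for y
  proof -
    have "0 < s0 * (1 + y)" using that s0 by simp
    then have "gw (\<alpha> + 1) c (s0 * (1 + y)) = exp (\<alpha> * ln (s0 * (1 + y))) * exp (- (c * s0) * (1 + y))"
      using that s0 by (simp add: gw_def powr_def mult_ac)
    also have "\<alpha> * ln (s0 * (1 + y)) = \<alpha> * ln s0 + \<alpha> * ln (1 + y)" using that s0 by (simp add: ln_mult distrib_left[symmetric])
    finally show ?thesis unfolding par by (simp only: exp_add[symmetric]) (simp add: algebra_simps)
  qed
  have sz: "s = s0 * (1 + z)" using s0 by (simp add: z_def)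
  have zz: "s0 * (1 + y) / s0 - 1 = y" for y using s0 by simp
  have "W s * exp (\<alpha> * (om z - om (\<phi> z)) - (e' + e'') * k z)
      = \<tau> z * exp (- e'' * k z) * exp ((\<alpha> * ln s0 + \<alpha> * ln (1 + z) - (\<alpha> + e') * (1 + z)) + (\<alpha> * (om z - om (\<phi> z)) - e' * k z))"
    unfolding W g[OF z, folded sz] z_def[symmetric]
    by (simp add: algebra_simps flip: exp_add)
  also have "\<dots> \<le> \<tau> z * exp (- e'' * k z) * exp (\<alpha> * ln s0 + \<alpha> * ln (1 + \<phi> z) - (\<alpha> + e') * (1 + \<phi> z))"
  proof (intro mult_left_mono)
    have "e' * (\<phi> z - z) \<le> e' * k z" using \<phi>_ge[OF z] par by (intro mult_left_mono) auto
    then show "exp ((\<alpha> * ln s0 + \<alpha> * ln (1 + z) - (\<alpha> + e') * (1 + z)) + (\<alpha> * (om z - om (\<phi> z)) - e' * k z)) \<le> exp (\<alpha> * ln s0 + \<alpha> * ln (1 + \<phi> z) - (\<alpha> + e') * (1 + \<phi> z))"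
      by (simp add: om_def algebra_simps)
  qed (use \<tau>(1)[OF z] in auto)
  also have "\<dots> \<le> \<tau> (\<phi> z) * exp (\<alpha> * ln s0 + \<alpha> * ln (1 + \<phi> z) - (\<alpha> + e') * (1 + \<phi> z))"
    by (intro mult_right_mono \<tau>(2)[OF z]) simp
  also have "\<dots> = W (s0 * (1 + \<phi> z))" unfolding W zz g[OF pz] by simp
  finally show ?thesis unfolding z_def .
qed

end

lemma h3_deriv:
  assumes "-1 < z"
  shows "(h3 has_real_derivative z / (1 + z) - cub.\<phi> z / (1 + cub.\<phi> z) * (1 - k3 z)) (at z)"
proof -
  have pz: "-1 < cub.\<phi> z" by (rule cub.\<phi>_gt[OF assms])
  have d: "(om has_real_derivative y / (1 + y)) (at y)" if "-1 < y" for y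
    unfolding om_def[abs_def] using that by (auto intro!: derivative_eq_intros simp: field_simps)
  have "(cub.\<phi> has_real_derivative 1 - k3 z) (at z)"
    unfolding cub.\<phi>_def[abs_def] by (auto intro!: derivative_intros cub.deriv)
  from DERIV_chain2[OF d[OF pz] this] d[OF assms] show ?thesis
    unfolding h3_def[abs_def] by (intro derivative_intros)
qed

lemma h3_0: "h3 0 = 0"
  by (simp add: h3_def cub_\<phi> om_def)

text \<open>Both sides vanish at 0. The left side has derivative \<open>x^3 / (1 - x)\<close>; that
  of \<open>h3 (- x)\<close> is at least \<open>x / (1 - x) * k3 x\<close>, and
  \<open>k3 x \<ge> x^2 / 4\<close> on the unit interval, hence the factor 4.\<close>

lemma h3_ge_neg:
  assumes "0 \<le> w" "w < 1"
  shows "- ln (1 - w) - w - w\<^sup>2 / 2 - w ^ 3 / 3 \<le> 4 * h3 (- w)"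
proof -
  let ?f = "\<lambda>w. 4 * h3 (- w) - (- ln (1 - w) - w - w\<^sup>2 / 2 - w ^ 3 / 3)"
  have "?f 0 \<le> ?f w"
  proof (rule DERIV_nonneg_imp_nondecreasing[OF assms(1)])
    fix x :: real assume x: "0 \<le> x" "x \<le> w"
    then have x1: "x < 1" using assms by simp
    define y where "y = - cub.\<phi> (- x)"
    obtain t where t: "1 / 2 \<le> t" "t \<le> 1" "cub.\<phi> (- x) = t * - x" using cub.\<phi>_scale[of "- x"] by metis
    have y: "0 \<le> y" "y \<le> x" using t x by (auto simp: y_def intro: mult_left_le_one_le)
    define d where "d = x / (1 - x) - y / (1 - y) * (1 - k3 x)"
    have k: "k3 (- x) = k3 x" by (simp add: k3_def)
    have "(h3 has_real_derivative - x / (1 + - x) - cub.\<phi> (- x) / (1 + cub.\<phi> (- x)) * (1 - k3 (- x))) (at (- x))"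
      using x1 by (intro h3_deriv) simp
    also have "- x / (1 + - x) - cub.\<phi> (- x) / (1 + cub.\<phi> (- x)) * (1 - k3 (- x)) = - d"
      unfolding d_def k y_def by simp
    finally have "((\<lambda>w. h3 (- w)) has_real_derivative - d * -1) (at x)"
      by (rule DERIV_chain2) (auto intro!: derivative_eq_intros)
    then have "((\<lambda>w. h3 (- w)) has_real_derivative d) (at x)" by simp
    moreover have "((\<lambda>w. - ln (1 - w) - w - w\<^sup>2 / 2 - w ^ 3 / 3) has_real_derivative 1 / (1 - x) - 1 - x - x\<^sup>2) (at x)"
      using x1 by (auto intro!: derivative_eq_intros)
    ultimately have D: "(?f has_real_derivative 4 * d - (1 / (1 - x) - 1 - x - x\<^sup>2)) (at x)"
      by (rule DERIV_diff[OF DERIV_cmult])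
    have "y / (1 - y) * (1 - k3 x) \<le> x / (1 - x) * (1 - k3 x)"
      using y x1 cub.k_le[of x] by (intro mult_right_mono frac_le) auto
    then have "x / (1 - x) * k3 x \<le> d" unfolding d_def right_diff_distrib mult_1_right by linarith
    moreover have "x / (1 - x) * (x\<^sup>2 / 4) \<le> x / (1 - x) * k3 x"
    proof (intro mult_left_mono)
      have "x\<^sup>2 \<le> 1" using x x1 by (simp add: power_le_one)
      then have "x\<^sup>2 / 4 \<le> x\<^sup>2 / (2 * (1 + x\<^sup>2))" by (intro divide_left_mono) (auto intro!: mult_pos_pos add_pos_nonneg)
      then show "x\<^sup>2 / 4 \<le> k3 x" by (simp add: k3_def)
    qed (use x x1 in auto)
    moreover have "1 / (1 - x) - 1 - x - x\<^sup>2 = 4 * (x / (1 - x) * (x\<^sup>2 / 4))"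
      using x1 by (simp add: field_simps power2_eq_square power3_eq_cube)
    ultimately have "0 \<le> 4 * d - (1 / (1 - x) - 1 - x - x\<^sup>2)" by linarith
    then show "\<exists>y. (?f has_real_derivative y) (at x) \<and> 0 \<le> y" using D by blast
  qed
  then show ?thesis by (simp add: h3_0)
qed

text \<open>Comparison of derivatives again: on the unit interval
  \<open>x / (1 + x) \<ge> x / 2\<close> and \<open>k3 x \<ge> x^2 / 4\<close> give at least
  \<open>x^3 / 8\<close>, so 32 is what \<open>4 * x^3\<close> asks for.\<close>

lemma h3_ge_pos:
  assumes "0 \<le> z" "z \<le> 1"
  shows "z ^ 4 \<le> 32 * h3 z"
proof -
  let ?f = "\<lambda>z. 32 * h3 z - z ^ 4"
  have "?f 0 \<le> ?f z"
  proof (rule DERIV_nonneg_imp_nondecreasing[OF assms(1)])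
    fix x :: real assume x: "0 \<le> x" "x \<le> z"
    then have x1: "x \<le> 1" using assms by simp
    obtain t where t: "1 / 2 \<le> t" "t \<le> 1" "cub.\<phi> x = t * x" using cub.\<phi>_scale[of x] by metis
    define y where "y = cub.\<phi> x"
    have y: "0 \<le> y" "y \<le> x" using t x by (auto simp: y_def intro: mult_left_le_one_le)
    define d where "d = x / (1 + x) - y / (1 + y) * (1 - k3 x)"
    have "(h3 has_real_derivative d) (at x)" unfolding d_def y_def using x by (intro h3_deriv) simp
    then have D: "(?f has_real_derivative 32 * d - 4 * x ^ 3) (at x)"
      by (auto intro!: derivative_eq_intros)
    have "y / (1 + y) \<le> x / (1 + x)" using y x by (simp add: field_simps)
    then have "y / (1 + y) * (1 - k3 x) \<le> x / (1 + x) * (1 - k3 x)"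
      using cub.k_le[of x] by (intro mult_right_mono) auto
    then have "x / (1 + x) * k3 x \<le> d" unfolding d_def right_diff_distrib mult_1_right by linarith
    moreover have "x / 2 * (x\<^sup>2 / 4) \<le> x / (1 + x) * k3 x"
    proof (intro mult_mono)
      show "x / 2 \<le> x / (1 + x)" using x x1 by (intro divide_left_mono) auto
      have "x\<^sup>2 \<le> 1" using x x1 by (simp add: power_le_one)
      then have "x\<^sup>2 / 4 \<le> x\<^sup>2 / (2 * (1 + x\<^sup>2))" by (intro divide_left_mono) (auto intro!: mult_pos_pos add_pos_nonneg)
      then show "x\<^sup>2 / 4 \<le> k3 x" by (simp add: k3_def)
    qed (use x in auto)
    ultimately have "x / 2 * (x\<^sup>2 / 4) \<le> d" by linarith
    then have "0 \<le> 32 * d - 4 * x ^ 3" by (simp add: power2_eq_square power3_eq_cube)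
    then show "\<exists>y. (?f has_real_derivative y) (at x) \<and> 0 \<le> y" using D by blast
  qed
  then show ?thesis by (simp add: h3_0)
qed

text \<open>The scale \<theta> will be the typical size of \<open>z\<close>. Both terms on the right
  are then of order \<open>\<theta>^3\<close>, and no third absolute moment has to be estimated
  directly.\<close>

lemma cube_le_young:
  fixes z \<theta> :: real
  assumes "0 < \<theta>" "0 \<le> z"
  shows "z ^ 3 \<le> (\<theta> * z\<^sup>2 + z ^ 4 / \<theta>) / 2"
proof -
  have "0 \<le> z\<^sup>2 * (\<theta> - z)\<^sup>2 / \<theta>" using assms by simp
  also have "\<dots> = \<theta> * z\<^sup>2 + z ^ 4 / \<theta> - 2 * z ^ 3"
    using assms by (simp add: field_simps power2_eq_square power3_eq_cube power4_eq_xxxx)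
  finally show ?thesis by simp
qed

text \<open>Majorant of the cubic tilt remainder, built from the two statistics whose means the
  contractions control. The constants 2 and 16 are half of those in
  \<open>z^2 \<le> 4 * om z\<close> and \<open>z^4 \<le> 32 * h3 z\<close>, valid for
  \<open>z\<close> between 0 and 1.\<close>

definition rem :: "real \<Rightarrow> real \<Rightarrow> real" where
  "rem \<theta> z = 2 * \<theta> * om z + 16 / \<theta> * h3 z"

text \<open>On the negative side the remainder is singular at \<open>w = 1\<close>, so a cube cannot
  bound it. What exceeds the cubic term is at most \<open>4 * h3\<close>, the cubic term goes
  through Young's inequality, and \<open>\<theta> \<le> 1\<close> absorbs \<open>h3\<close> into
  \<open>h3 / \<theta>\<close>.\<close>

lemma log_remainder_le_rem:
  assumes \<theta>: "0 < \<theta>" "\<theta> \<le> 1" and w: "0 \<le> w" "w < 1"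
  shows "- ln (1 - w) - w - w\<^sup>2 / 2 \<le> rem \<theta> (- w)"
proof -
  have h: "0 \<le> h3 (- w)" unfolding h3_def using cub.om_decrease_nonneg[of "- w"] w by simp
  have om: "w\<^sup>2 \<le> 2 * om (- w)" using om_ge_neg[OF w] by simp
  have "w ^ 4 / 4 \<le> - ln (1 - w) - w - w\<^sup>2 / 2 - w ^ 3 / 3"
  proof -
    let ?f = "\<lambda>w. - ln (1 - w) - w - w\<^sup>2 / 2 - w ^ 3 / 3 - w ^ 4 / 4"
    have "?f 0 \<le> ?f w"
    proof (rule DERIV_nonneg_imp_nondecreasing[OF w(1)])
      fix x :: real assume x: "0 \<le> x" "x \<le> w"
      then have "(?f has_real_derivative x ^ 4 / (1 - x)) (at x)"
        using w by (auto intro!: derivative_eq_intros simp: field_simps power2_eq_square power3_eq_cube power4_eq_xxxx)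
      then show "\<exists>y. (?f has_real_derivative y) (at x) \<and> 0 \<le> y" by (rule ex_nonneg_DERIV) (use x w in auto)
    qed
    then show ?thesis by simp
  qed
  then have w4: "w ^ 4 \<le> 16 * h3 (- w)" using h3_ge_neg[OF w] by simp
  have "w ^ 3 \<le> (\<theta> * w\<^sup>2 + w ^ 4 / \<theta>) / 2" by (rule cube_le_young[OF \<theta>(1) w(1)])
  also have "\<dots> \<le> (\<theta> * (2 * om (- w)) + 16 * h3 (- w) / \<theta>) / 2"
    using \<theta> om w4 by (intro divide_right_mono add_mono mult_left_mono) auto
  finally have "w ^ 3 / 3 \<le> \<theta> * om (- w) / 3 + 8 / 3 * (h3 (- w) / \<theta>)" by simp
  moreover have "h3 (- w) \<le> h3 (- w) / \<theta>" using \<theta> h by (simp add: le_divide_eq mult_left_le)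
  moreover have "0 \<le> \<theta> * om (- w)" using \<theta> om_nonneg[of "- w"] w by simp
  ultimately have "- ln (1 - w) - w - w\<^sup>2 / 2 \<le> 2 * (\<theta> * om (- w)) + 16 * (h3 (- w) / \<theta>)"
    using h3_ge_neg[OF w] h by linarith
  then show ?thesis by (simp add: rem_def)
qed

lemma cube_le_rem:
  assumes \<theta>: "0 < \<theta>" and z: "0 \<le> z" "z \<le> 1"
  shows "z ^ 3 \<le> rem \<theta> z"
proof -
  have "z\<^sup>2 / (2 * 2) \<le> z\<^sup>2 / (2 * (1 + z))" using z by (intro divide_left_mono) auto
  from order_trans[OF this om_ge_pos[OF z(1)]] have om: "z\<^sup>2 \<le> 4 * om z" by simp
  have "z ^ 3 \<le> (\<theta> * z\<^sup>2 + z ^ 4 / \<theta>) / 2" by (rule cube_le_young[OF \<theta> z(1)])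
  also have "\<dots> \<le> (\<theta> * (4 * om z) + 32 * h3 z / \<theta>) / 2"
    using \<theta> om h3_ge_pos[OF z] by (intro divide_right_mono add_mono mult_left_mono) auto
  finally show ?thesis by (simp add: rem_def)
qed

lemma rem_nonneg: "0 < \<theta> \<Longrightarrow> -1 < z \<Longrightarrow> 0 \<le> rem \<theta> z"
  unfolding rem_def h3_def using om_nonneg cub.om_decrease_nonneg by (intro add_nonneg_nonneg mult_nonneg_nonneg) auto

lemma rem_measurable [measurable]: "rem \<theta> \<in> borel_measurable borel"
  unfolding rem_def by measurable

lemma ennreal_divide_mono:
  assumes "ennreal a * X \<le> Y" "0 < a"
  shows "X \<le> ennreal (1 / a) * Y"
proof -
  have "X = ennreal (1 / a) * (ennreal a * X)"
    using assms(2) by (simp add: mult.assoc[symmetric] flip: ennreal_mult)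
  also have "\<dots> \<le> ennreal (1 / a) * Y" by (intro mult_left_mono assms) simp
  finally show ?thesis .
qed

text \<open>Per particle, the halving map bounds the mean of \<open>om\<close> by
  \<open>E / \<alpha>\<close>, and the cubic contraction then bounds the mean of \<open>h3\<close>
  by \<open>2 * (E / \<alpha>)^2\<close>. With \<open>E / \<alpha> \<le> \<theta>^2\<close> the two
  parts of \<open>rem\<close> contribute \<open>2 * \<theta>^3\<close> and
  \<open>32 * \<theta>^3\<close>, hence 34.\<close>

lemma sel_sum_rem_bound:
  assumes I: "finite I" and \<beta>: "0 < \<beta>" and s0: "0 < s0"
    and par: "c * s0 = \<alpha> + e'" "0 < \<alpha>" "0 \<le> e'" "0 \<le> e''"
    and \<tau>[measurable]: "\<tau> \<in> borel_measurable borel" and \<tau>0: "\<And>z. -1 < z \<Longrightarrow> 0 \<le> \<tau> z"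
    and \<tau>1: "\<And>z t. -1 < z \<Longrightarrow> 1 / 2 \<le> t \<Longrightarrow> t \<le> 1 \<Longrightarrow> \<tau> z * exp (- e'' * (1 - t)) \<le> \<tau> (t * z)"
    and W: "\<And>s. W s = gw (\<alpha> + 1) c s * \<tau> (s / s0 - 1)" and fin: "sel \<beta> I W < \<infinity>"
    and \<theta>: "0 < \<theta>" "e' + e'' + 2 + 2 * \<beta> * real (card I) \<le> \<alpha> * \<theta>\<^sup>2"
  shows "sel_sum \<beta> I W (\<lambda>s. rem \<theta> (s / s0 - 1)) \<le> ennreal (34 * real (card I) * \<theta> ^ 3) * sel \<beta> I W"
proof -
  define z where "z s = s / s0 - 1" for s
  define E where "E = e' + e'' + 2 + 2 * \<beta> * real (card I)"
  have E: "0 \<le> E" "E \<le> \<alpha> * \<theta>\<^sup>2" using par \<beta> \<theta> by (auto simp: E_def)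
  have [measurable]: "z \<in> borel_measurable borel" unfolding z_def by measurable
  have Wm[measurable]: "W \<in> borel_measurable borel"
  proof -
    have "(\<lambda>s. gw (\<alpha> + 1) c s * \<tau> (s / s0 - 1)) \<in> borel_measurable borel" by measurable
    then show ?thesis by (simp add: W[symmetric, abs_def] flip: W)
  qed
  have zgt: "-1 < z s" if "W s \<noteq> 0" for s
  proof -
    have "0 < s" using that unfolding W gw_def by (auto split: if_splits)
    then show ?thesis using s0 by (simp add: z_def)
  qed
  have W0: "0 \<le> W s" for s
  proof (cases "W s = 0")
    case False
    then show ?thesis using \<tau>0[OF zgt[OF False]] unfolding W z_def by simp
  qed simp
  let ?S = "sel \<beta> I W"
  \<comment> \<open>Every contraction acts on a given \<open>z\<close> as a scaling by some
    \<open>t\<close> in \<open>[1/2, 1]\<close> with \<open>1 - t \<le> k z\<close>; this is why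
    stability of \<tau> is assumed for scalings only.\<close>
  have weight: "W s * exp (\<alpha> * (om (z s) - om (contracting_field.\<phi> g (z s))) - (e' + e'') * k (z s)) \<le> W (s0 * (1 + contracting_field.\<phi> g (z s)))"
    if cf: "contracting_field g k" for g k s
  proof -
    interpret contracting_field g k by (rule cf)
    have "\<tau> z * exp (- e'' * k z) \<le> \<tau> (\<phi> z)" if "-1 < z" for z
    proof -
      obtain t where t: "1 / 2 \<le> t" "t \<le> 1" "\<phi> z = t * z" "1 - t \<le> k z" using \<phi>_scale[of z] .
      have "e'' * (1 - t) \<le> e'' * k z" using t par by (intro mult_left_mono) auto
      then have "\<tau> z * exp (- e'' * k z) \<le> \<tau> z * exp (- e'' * (1 - t))" using \<tau>0[OF that] by (intro mult_left_mono) auto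
      also have "\<dots> \<le> \<tau> (\<phi> z)" unfolding t(3) by (rule \<tau>1[OF that t(1,2)])
      finally show ?thesis .
    qed
    then show ?thesis unfolding z_def
      by (intro gw_contraction[where \<tau> = \<tau> and c = c]) (use s0 par \<tau>0 W in auto)
  qed
  have contr: "sel_sum \<beta> I W (\<lambda>s. \<alpha> * (om (z s) - om (contracting_field.\<phi> g (z s)))) \<le> ennreal E * sel_sum \<beta> I W (\<lambda>s. k (z s))"
    if cf: "contracting_field g k" for g k
  proof -
    interpret contracting_field g k by (rule cf)
    have "sel_sum \<beta> I W (\<lambda>s. (\<lambda>z. \<alpha> * (om z - om (\<phi> z))) (s / s0 - 1)) \<le> ennreal (e' + e'' + 2 + 2 * \<beta> * real (card I)) * sel_sum \<beta> I W (\<lambda>s. k (s / s0 - 1))"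
    proof (rule sel_sum_contraction[OF I Wm W0 _ _ s0 \<beta> _ fin])
      show "0 \<le> \<alpha> * (om (s / s0 - 1) - om (\<phi> (s / s0 - 1)))" if "W s \<noteq> 0" for s
        using om_decrease_nonneg[OF zgt[OF that]] par unfolding z_def by simp
    qed (use par weight[OF cf] in \<open>auto simp: z_def\<close>)
    then show ?thesis by (simp add: z_def E_def)
  qed
  have lin: "contracting_field (\<lambda>z. z / 2) (\<lambda>z. 1 / 2)"
    by unfold_locales (auto intro!: derivative_eq_intros continuous_intros)
  have cub: "contracting_field (\<lambda>z. (z - arctan z) / 2) k3" by (rule cub.contracting_field_axioms)
  have om_bound: "sel_sum \<beta> I W (\<lambda>s. om (z s)) \<le> ennreal (E * real (card I) / \<alpha>) * ?S"
  proof -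
    have "ennreal (\<alpha> / 2) * sel_sum \<beta> I W (\<lambda>s. om (z s)) = sel_sum \<beta> I W (\<lambda>s. \<alpha> / 2 * om (z s))"
      using par by (intro sel_sum_cmult[symmetric]) auto
    also have "\<dots> \<le> sel_sum \<beta> I W (\<lambda>s. \<alpha> * (om (z s) - om (contracting_field.\<phi> (\<lambda>z. z / 2) (z s))))"
    proof (rule sel_sum_mono[OF I W0])
      fix s assume "W s \<noteq> 0"
      have eq: "contracting_field.\<phi> (\<lambda>z. z / 2) (z s) = z s / 2" unfolding lin.\<phi>_def by simp
      have "om (z s) / 2 \<le> om (z s) - om (contracting_field.\<phi> (\<lambda>z. z / 2) (z s))"
        unfolding eq using om_half_le[OF zgt[OF \<open>W s \<noteq> 0\<close>]] by linarith
      then have "\<alpha> * (om (z s) / 2) \<le> \<alpha> * (om (z s) - om (contracting_field.\<phi> (\<lambda>z. z / 2) (z s)))"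
        using par by (intro mult_left_mono) auto
      then show "\<alpha> / 2 * om (z s) \<le> \<alpha> * (om (z s) - om (contracting_field.\<phi> (\<lambda>z. z / 2) (z s)))" by simp
    qed
    also have "\<dots> \<le> ennreal E * sel_sum \<beta> I W (\<lambda>s. 1 / 2)" by (rule contr[OF lin])
    also have "\<dots> = ennreal (E * (1 / 2 * real (card I))) * ?S"
      unfolding ennreal_mult'[OF E(1)] mult.assoc[of "ennreal E"] by (subst sel_sum_const[OF Wm]) auto
    finally have "sel_sum \<beta> I W (\<lambda>s. om (z s)) \<le> ennreal (1 / (\<alpha> / 2)) * (ennreal (E * (1 / 2 * real (card I))) * ?S)"
      using par by (intro ennreal_divide_mono) auto
    also have "\<dots> = ennreal (E * real (card I) / \<alpha>) * ?S"
      using par E by (simp add: mult.assoc[symmetric] flip: ennreal_mult)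
    finally show ?thesis .
  qed
  have h3_bound: "sel_sum \<beta> I W (\<lambda>s. h3 (z s)) \<le> ennreal (2 * E / \<alpha> * (E * real (card I) / \<alpha>)) * ?S"
  proof -
    have "ennreal \<alpha> * sel_sum \<beta> I W (\<lambda>s. h3 (z s)) = sel_sum \<beta> I W (\<lambda>s. \<alpha> * h3 (z s))"
      using par by (intro sel_sum_cmult[symmetric]) auto
    also have "\<dots> = sel_sum \<beta> I W (\<lambda>s. \<alpha> * (om (z s) - om (contracting_field.\<phi> (\<lambda>z. (z - arctan z) / 2) (z s))))"
      unfolding h3_def ..
    also have "\<dots> \<le> ennreal E * sel_sum \<beta> I W (\<lambda>s. k3 (z s))" by (rule contr[OF cub])
    also have "\<dots> \<le> ennreal E * sel_sum \<beta> I W (\<lambda>s. 2 * om (z s))"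
      by (intro mult_left_mono sel_sum_mono[OF I W0] k3_le_om zgt) auto
    also have "\<dots> = ennreal E * (ennreal 2 * sel_sum \<beta> I W (\<lambda>s. om (z s)))"
      using sel_sum_cmult[OF Wm, of "\<lambda>s. om (z s)" 2 \<beta> I] by simp
    also have "\<dots> \<le> ennreal E * (ennreal 2 * (ennreal (E * real (card I) / \<alpha>) * ?S))"
      by (intro mult_left_mono om_bound) auto
    finally have "sel_sum \<beta> I W (\<lambda>s. h3 (z s)) \<le> ennreal (1 / \<alpha>) * (ennreal E * (ennreal 2 * (ennreal (E * real (card I) / \<alpha>) * ?S)))"
      using par by (intro ennreal_divide_mono) auto
    also have "\<dots> = (ennreal (1 / \<alpha>) * (ennreal E * (ennreal 2 * ennreal (E * real (card I) / \<alpha>)))) * ?S"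
      by (simp only: mult_ac)
    also have "ennreal (1 / \<alpha>) * (ennreal E * (ennreal 2 * ennreal (E * real (card I) / \<alpha>))) = ennreal (2 * E / \<alpha> * (E * real (card I) / \<alpha>))"
      using par E by (subst ennreal_mult[symmetric]; simp add: mult_ac)+
    finally show ?thesis .
  qed
  have p: "0 \<le> 2 * \<theta>" "0 \<le> 16 / \<theta>" using \<theta> by auto
  have "sel_sum \<beta> I W (\<lambda>s. rem \<theta> (z s)) = sel_sum \<beta> I W (\<lambda>s. 2 * \<theta> * om (z s)) + sel_sum \<beta> I W (\<lambda>s. 16 / \<theta> * h3 (z s))"
    unfolding rem_def
  proof (rule sel_sum_add[OF I Wm])
    show "0 \<le> 2 * \<theta> * om (z s)" if "W s \<noteq> 0" for s using om_nonneg[OF zgt[OF that]] \<theta> by simp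
    show "0 \<le> 16 / \<theta> * h3 (z s)" if "W s \<noteq> 0" for s
      using cub.om_decrease_nonneg[OF zgt[OF that]] \<theta> by (simp add: h3_def)
  qed (use W0 in auto)
  also have "\<dots> = ennreal (2 * \<theta>) * sel_sum \<beta> I W (\<lambda>s. om (z s)) + ennreal (16 / \<theta>) * sel_sum \<beta> I W (\<lambda>s. h3 (z s))"
    using sel_sum_cmult[OF Wm, of "\<lambda>s. om (z s)" "2 * \<theta>" \<beta> I] sel_sum_cmult[OF Wm, of "\<lambda>s. h3 (z s)" "16 / \<theta>" \<beta> I] \<theta> by simp
  also have "\<dots> \<le> ennreal (2 * \<theta>) * (ennreal (E * real (card I) / \<alpha>) * ?S) + ennreal (16 / \<theta>) * (ennreal (2 * E / \<alpha> * (E * real (card I) / \<alpha>)) * ?S)"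
    by (intro add_mono mult_left_mono om_bound h3_bound) auto
  also have "\<dots> = ennreal (2 * \<theta> * (E * real (card I) / \<alpha>)) * ?S + ennreal (16 / \<theta> * (2 * E / \<alpha> * (E * real (card I) / \<alpha>))) * ?S"
    unfolding ennreal_mult'[OF p(1)] ennreal_mult'[OF p(2)] by (simp only: mult.assoc)
  also have "\<dots> = ennreal (2 * \<theta> * (E * real (card I) / \<alpha>) + 16 / \<theta> * (2 * E / \<alpha> * (E * real (card I) / \<alpha>))) * ?S"
    using \<theta> E par by (subst ennreal_plus) (auto simp: distrib_right)
  also have "\<dots> \<le> ennreal (34 * real (card I) * \<theta> ^ 3) * ?S"
  proof (intro mult_right_mono ennreal_leI)
    have q: "E / \<alpha> \<le> \<theta>\<^sup>2" "0 \<le> E / \<alpha>" using E par by (auto simp: pos_divide_le_eq mult.commute)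
    have "2 * \<theta> * (E * real (card I) / \<alpha>) = 2 * \<theta> * real (card I) * (E / \<alpha>)" by simp
    also have "\<dots> \<le> 2 * \<theta> * real (card I) * \<theta>\<^sup>2" using q \<theta> by (intro mult_left_mono) auto
    finally have 1: "2 * \<theta> * (E * real (card I) / \<alpha>) \<le> 2 * real (card I) * \<theta> ^ 3" by (simp add: power2_eq_square power3_eq_cube mult_ac)
    have "16 / \<theta> * (2 * E / \<alpha> * (E * real (card I) / \<alpha>)) = 32 * real (card I) / \<theta> * ((E / \<alpha>) * (E / \<alpha>))" by simp
    also have "\<dots> \<le> 32 * real (card I) / \<theta> * (\<theta>\<^sup>2 * \<theta>\<^sup>2)" using q \<theta> by (intro mult_left_mono mult_mono) auto
    also have "\<dots> = 32 * real (card I) * \<theta> ^ 3" using \<theta> by (simp add: power2_eq_square power3_eq_cube field_simps)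
    finally show "2 * \<theta> * (E * real (card I) / \<alpha>) + 16 / \<theta> * (2 * E / \<alpha> * (E * real (card I) / \<alpha>)) \<le> 34 * real (card I) * \<theta> ^ 3"
      using 1 by linarith
  qed auto
  finally show ?thesis by (simp only: z_def)
qed

text \<open>Jensen's inequality under the normalised density of \<open>W\<close>.\<close>

lemma sel_le_exp_sel:
  assumes I: "finite I" and [measurable]: "W \<in> borel_measurable borel" "V \<in> borel_measurable borel" "q \<in> borel_measurable borel"
    and W0: "\<And>s. 0 \<le> W s" and q0: "\<And>s. W s \<noteq> 0 \<Longrightarrow> 0 \<le> q s" and le: "\<And>s. W s * exp (- q s) \<le> V s"
    and fin: "sel \<beta> I W < \<infinity>" and \<mu>: "0 \<le> \<mu>" "sel_sum \<beta> I W q \<le> ennreal \<mu> * sel \<beta> I W"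
  shows "sel \<beta> I W \<le> ennreal (exp \<mu>) * sel \<beta> I V"
proof -
  let ?f = "\<lambda>l. (\<Prod>i\<in>I. W (l i)) * vdm 0 \<beta> I l" and ?g = "\<lambda>l. (\<Prod>i\<in>I. V (l i)) * vdm 0 \<beta> I l"
  let ?q = "\<lambda>l. \<Sum>i\<in>I. q (l i)" and ?S = "sel \<beta> I W"
  have V0: "0 \<le> V s" for s using le[of s] W0[of s] by (meson exp_ge_zero mult_nonneg_nonneg order_trans)
  have f0: "0 \<le> ?f l" for l using W0 by (intro mult_nonneg_nonneg prod_nonneg) auto
  have g0: "0 \<le> ?g l" for l using V0 by (intro mult_nonneg_nonneg prod_nonneg) auto
  have qf: "0 \<le> ?q l * ?f l" for l
  proof (cases "\<exists>i\<in>I. W (l i) = 0")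
    case True
    then obtain i where "i \<in> I" "W (l i) = 0" by blast
    from sel_density_eq_0[where W = W and l = l, OF I this] show ?thesis by (simp only: mult_zero_right order_refl)
  next
    case False
    then have "0 \<le> ?q l" using q0 by (intro sum_nonneg) auto
    then show ?thesis by (rule mult_nonneg_nonneg[OF _ f0])
  qed
  \<comment> \<open>The tangent of \<open>exp (- q)\<close> at \<open>q = \<mu>\<close> replaces the
    normalisation of the measure. After integration the terms with factor
    \<open>exp (- \<mu>) * \<mu>\<close> cancel by the moment hypothesis.\<close>
  have key: "exp (- \<mu>) * ?f l + exp (- \<mu>) * \<mu> * ?f l \<le> ?g l + exp (- \<mu>) * (?q l * ?f l)" for l
  proof -
    have "exp (- \<mu>) * (1 + (\<mu> - ?q l)) \<le> exp (- \<mu>) * exp (\<mu> - ?q l)"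
      by (intro mult_left_mono exp_ge_add_one_self) auto
    also have "\<dots> = exp (- ?q l)" by (simp flip: exp_add)
    finally have "exp (- \<mu>) * (1 + (\<mu> - ?q l)) * ?f l \<le> exp (- ?q l) * ?f l" by (rule mult_right_mono[OF _ f0])
    also have "\<dots> = (\<Prod>i\<in>I. W (l i) * exp (- q (l i))) * vdm 0 \<beta> I l"
      using I by (simp add: prod.distrib exp_sum sum_negf[symmetric] mult_ac)
    also have "\<dots> \<le> ?g l" using le W0 by (intro mult_right_mono prod_mono) auto
    finally show ?thesis by (simp add: algebra_simps)
  qed
  have "ennreal (exp (- \<mu>)) * ?S + ennreal (exp (- \<mu>) * \<mu>) * ?S
     = (\<integral>\<^sup>+l. ennreal (exp (- \<mu>)) * ennreal (?f l) + ennreal (exp (- \<mu>) * \<mu>) * ennreal (?f l) \<partial>lebP I)"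
    unfolding sel_def by (subst nn_integral_add) (auto simp: nn_integral_cmult)
  also have "\<dots> \<le> (\<integral>\<^sup>+l. ennreal (?g l) + ennreal (exp (- \<mu>)) * ennreal (?q l * ?f l) \<partial>lebP I)"
  proof (rule nn_integral_mono)
    fix l
    have "ennreal (exp (- \<mu>) * ?f l + exp (- \<mu>) * \<mu> * ?f l) \<le> ennreal (?g l + exp (- \<mu>) * (?q l * ?f l))"
      by (intro ennreal_leI key)
    moreover have "ennreal (exp (- \<mu>) * ?f l + exp (- \<mu>) * \<mu> * ?f l) = ennreal (exp (- \<mu>)) * ennreal (?f l) + ennreal (exp (- \<mu>) * \<mu>) * ennreal (?f l)"
      using f0[of l] \<mu> by (subst ennreal_plus) (auto intro!: mult_nonneg_nonneg simp: ennreal_mult')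
    moreover have "ennreal (?g l + exp (- \<mu>) * (?q l * ?f l)) = ennreal (?g l) + ennreal (exp (- \<mu>)) * ennreal (?q l * ?f l)"
      using g0[of l] qf[of l] by (subst ennreal_plus) (auto simp: ennreal_mult')
    ultimately show "ennreal (exp (- \<mu>)) * ennreal (?f l) + ennreal (exp (- \<mu>) * \<mu>) * ennreal (?f l) \<le> ennreal (?g l) + ennreal (exp (- \<mu>)) * ennreal (?q l * ?f l)"
      by simp
  qed
  also have "\<dots> = sel \<beta> I V + ennreal (exp (- \<mu>)) * sel_sum \<beta> I W q"
    unfolding sel_def sel_sum_def by (subst nn_integral_add) (auto simp: nn_integral_cmult)
  also have "\<dots> \<le> sel \<beta> I V + ennreal (exp (- \<mu>)) * (ennreal \<mu> * ?S)"
    by (intro add_left_mono mult_left_mono \<mu>) auto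
  also have "\<dots> = sel \<beta> I V + ennreal (exp (- \<mu>) * \<mu>) * ?S"
    using \<mu> by (simp add: ennreal_mult' mult.assoc)
  finally have "ennreal (exp (- \<mu>) * \<mu>) * ?S + ennreal (exp (- \<mu>)) * ?S \<le> ennreal (exp (- \<mu>) * \<mu>) * ?S + sel \<beta> I V"
    by (simp only: add.commute)
  moreover have "ennreal (exp (- \<mu>) * \<mu>) * ?S < \<top>" using fin by (simp add: ennreal_mult_less_top)
  ultimately have "ennreal (exp (- \<mu>)) * ?S \<le> sel \<beta> I V"
    by (simp add: ennreal_add_left_cancel_le less_top[symmetric])
  then have "?S \<le> ennreal (1 / exp (- \<mu>)) * sel \<beta> I V" by (intro ennreal_divide_mono) auto
  moreover have "1 / exp (- \<mu>) = exp \<mu>" by (simp add: exp_minus inverse_eq_divide[symmetric])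
  ultimately show ?thesis by (simp only:)
qed

section \<open>Taylor bounds for the logarithm\<close>

lemma ln_one_plus_le_cubic:
  assumes "0 \<le> (x::real)"
  shows "ln (1 + x) \<le> x - x\<^sup>2 / 2 + x ^ 3 / 3"
proof -
  let ?f = "\<lambda>x. x - x\<^sup>2 / 2 + x ^ 3 / 3 - ln (1 + x)"
  have "?f 0 \<le> ?f x"
  proof (rule DERIV_nonneg_imp_nondecreasing[OF assms])
    fix y :: real assume "0 \<le> y" "y \<le> x"
    then have "(?f has_real_derivative y ^ 3 / (1 + y)) (at y)"
      by (auto intro!: derivative_eq_intros simp: field_simps power2_eq_square power3_eq_cube)
    then show "\<exists>d. (?f has_real_derivative d) (at y) \<and> 0 \<le> d" by (rule ex_nonneg_DERIV) (use \<open>0 \<le> y\<close> in auto)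
  qed
  then show ?thesis by simp
qed

lemma ln_one_plus_ge_quadratic:
  assumes "0 \<le> (x::real)"
  shows "x - x\<^sup>2 / 2 \<le> ln (1 + x)"
proof -
  let ?f = "\<lambda>x. ln (1 + x) - (x - x\<^sup>2 / 2)"
  have "?f 0 \<le> ?f x"
  proof (rule DERIV_nonneg_imp_nondecreasing[OF assms])
    fix y :: real assume "0 \<le> y" "y \<le> x"
    then have "(?f has_real_derivative y ^ 2 / (1 + y)) (at y)"
      by (auto intro!: derivative_eq_intros simp: field_simps power2_eq_square)
    then show "\<exists>d. (?f has_real_derivative d) (at y) \<and> 0 \<le> d" by (rule ex_nonneg_DERIV) (use \<open>0 \<le> y\<close> in auto)
  qed
  then show ?thesis by simp
qed

lemma ln_one_minus_le_cubic:
  assumes "0 \<le> (x::real)" "x < 1"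
  shows "ln (1 - x) \<le> - x - x\<^sup>2 / 2 - x ^ 3 / 3"
proof -
  let ?f = "\<lambda>x. - x - x\<^sup>2 / 2 - x ^ 3 / 3 - ln (1 - x)"
  have "?f 0 \<le> ?f x"
  proof (rule DERIV_nonneg_imp_nondecreasing[OF assms(1)])
    fix y :: real assume y: "0 \<le> y" "y \<le> x"
    then have "(?f has_real_derivative y ^ 3 / (1 - y)) (at y)"
      using assms by (auto intro!: derivative_eq_intros simp: field_simps power2_eq_square power3_eq_cube)
    then show "\<exists>d. (?f has_real_derivative d) (at y) \<and> 0 \<le> d" by (rule ex_nonneg_DERIV) (use y assms in auto)
  qed
  then show ?thesis by simp
qed

lemma ln_one_minus_ge_cubic:
  assumes "0 \<le> (x::real)" "x \<le> 1 / 2"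
  shows "- x - x\<^sup>2 / 2 - x ^ 3 \<le> ln (1 - x)"
proof -
  let ?f = "\<lambda>x. ln (1 - x) - (- x - x\<^sup>2 / 2 - x ^ 3)"
  have "?f 0 \<le> ?f x"
  proof (rule DERIV_nonneg_imp_nondecreasing[OF assms(1)])
    fix y :: real assume y: "0 \<le> y" "y \<le> x"
    then have y1: "1 - y \<noteq> 0" "3 * y \<le> 2" using assms by auto
    have "(?f has_real_derivative y\<^sup>2 * (2 - 3 * y) / (1 - y)) (at y)"
      using y assms by (auto intro!: derivative_eq_intros simp: field_simps power2_eq_square power3_eq_cube)
    then show "\<exists>d. (?f has_real_derivative d) (at y) \<and> 0 \<le> d" by (rule ex_nonneg_DERIV) (use y assms in auto)
  qed
  then show ?thesis by simp
qed

section \<open>Tilting by the largest particle\<close>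

text \<open>Weight seen by the other particles when the largest one sits at \<open>y\<close>; the
  cut at \<open>s < y\<close> records that \<open>y\<close> is the largest.\<close>

definition tw :: "real \<Rightarrow> real \<Rightarrow> real \<Rightarrow> real \<Rightarrow> real" where
  "tw \<beta> a y s = gw a (1 / 2) s * (if s < y then (y - s) powr \<beta> else 0)"

text \<open>With \<open>r = s\<^sub>0 / (y - s\<^sub>0)\<close>, the function \<open>ln (1 - r z)\<close> agrees to second order at \<open>z = 0\<close> with
  \<open>r\<^sup>2 ln (1 + z) - (r + r\<^sup>2) z\<close>, and the latter only shifts the parameters of a Laguerre weight.\<close>

definition tilt_scale :: "real \<Rightarrow> real \<Rightarrow> real \<Rightarrow> real" where
  "tilt_scale \<beta> s0 y = (let r = s0 / (y - s0) in (y - s0) powr \<beta> * s0 powr (- \<beta> * r\<^sup>2) * exp (\<beta> * (r + r\<^sup>2)))"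

text \<open>For \<open>z \<ge> 0\<close> the cubic terms make the left side nonpositive. For
  \<open>z = - w < 0\<close> it is at most \<open>r^3 * w^3 / 3\<close> plus \<open>r^2\<close>
  times the remainder of \<open>- ln (1 - w)\<close>, and \<open>rem\<close> dominates both; hence
  the coefficient \<open>r^3 + r^2\<close>.\<close>

lemma tilt_remainder_upper:
  assumes r: "0 < r" and z: "-1 < z" "r * z < 1" and \<theta>: "0 < \<theta>" "\<theta> \<le> 1"
  shows "ln (1 - r * z) - r\<^sup>2 * ln (1 + z) + (r + r\<^sup>2) * z \<le> (r ^ 3 + r\<^sup>2) * rem \<theta> z"
proof (cases "0 \<le> z")
  case True
  have "ln (1 - r * z) \<le> - (r * z) - (r * z)\<^sup>2 / 2 - (r * z) ^ 3 / 3" using ln_one_minus_le_cubic[of "r * z"] True r z by simp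
  moreover have "0 \<le> (r * z) ^ 3" using True r by simp
  moreover have "r\<^sup>2 * (z - z\<^sup>2 / 2) \<le> r\<^sup>2 * ln (1 + z)" using ln_one_plus_ge_quadratic[OF True] by (intro mult_left_mono) auto
  ultimately have "ln (1 - r * z) - r\<^sup>2 * ln (1 + z) + (r + r\<^sup>2) * z \<le> 0" by (simp add: algebra_simps power_mult_distrib)
  also have "0 \<le> (r ^ 3 + r\<^sup>2) * rem \<theta> z" using r rem_nonneg[OF \<theta>(1) z(1)] by (intro mult_nonneg_nonneg add_nonneg_nonneg) auto
  finally show ?thesis .
next
  case False
  define w where "w = - z"
  have w: "0 \<le> w" "w < 1" using False z by (auto simp: w_def)
  define m where "m = - ln (1 - w) - w - w\<^sup>2 / 2"
  have m: "w ^ 3 / 3 \<le> m" "m \<le> rem \<theta> (- w)"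
    using ln_one_minus_le_cubic[OF w] log_remainder_le_rem[OF \<theta> w] by (auto simp: m_def)
  have "ln (1 + r * w) \<le> r * w - (r * w)\<^sup>2 / 2 + (r * w) ^ 3 / 3" using ln_one_plus_le_cubic[of "r * w"] w r by simp
  moreover have "r\<^sup>2 * - ln (1 - w) = r\<^sup>2 * m + r\<^sup>2 * w + r\<^sup>2 * w\<^sup>2 / 2" by (simp add: m_def algebra_simps)
  ultimately have "ln (1 + r * w) - r\<^sup>2 * ln (1 - w) - (r + r\<^sup>2) * w \<le> r ^ 3 * (w ^ 3 / 3) + r\<^sup>2 * m"
    by (simp add: algebra_simps power_mult_distrib)
  also have "\<dots> \<le> r ^ 3 * m + r\<^sup>2 * m" using r m by (intro add_mono mult_left_mono) auto
  also have "\<dots> = (r ^ 3 + r\<^sup>2) * m" by (simp add: algebra_simps)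
  also have "\<dots> \<le> (r ^ 3 + r\<^sup>2) * rem \<theta> (- w)" using r m by (intro mult_left_mono add_nonneg_nonneg) auto
  finally show ?thesis by (simp add: w_def)
qed

text \<open>Now negative \<open>z\<close> is the harmless side. For positive \<open>z\<close> the
  term \<open>ln (1 - r * z)\<close> tends to minus infinity at \<open>z = 1 / r\<close>, so the
  bound needs a cut-off \<open>z0\<close> with \<open>r * z0 \<le> 1 / 2\<close>, below which the
  remainder is cubic.\<close>

lemma tilt_remainder_lower:
  assumes r: "0 < r" and z: "-1 < z" "z \<le> z0" and z0: "z0 \<le> 1" "r * z0 \<le> 1 / 2" and \<theta>: "0 < \<theta>"
  shows "- ((r ^ 3 + r\<^sup>2) * rem \<theta> z) \<le> ln (1 - r * z) - r\<^sup>2 * ln (1 + z) + (r + r\<^sup>2) * z"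
proof (cases "0 \<le> z")
  case True
  have "r * z \<le> r * z0" using z r by (intro mult_left_mono) auto
  then have "r * z \<le> 1 / 2" using z0 by linarith
  then have "- (r * z) - (r * z)\<^sup>2 / 2 - (r * z) ^ 3 \<le> ln (1 - r * z)"
    using True r by (intro ln_one_minus_ge_cubic) auto
  moreover have "r\<^sup>2 * ln (1 + z) \<le> r\<^sup>2 * (z - z\<^sup>2 / 2 + z ^ 3 / 3)"
    using ln_one_plus_le_cubic[OF True] by (intro mult_left_mono) auto
  ultimately have "- (r ^ 3 * z ^ 3) - r\<^sup>2 * (z ^ 3 / 3) \<le> ln (1 - r * z) - r\<^sup>2 * ln (1 + z) + (r + r\<^sup>2) * z"
    by (simp add: algebra_simps power_mult_distrib)
  moreover have "r\<^sup>2 * (z ^ 3 / 3) \<le> r\<^sup>2 * z ^ 3" using True by (intro mult_left_mono) auto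
  ultimately have "- ((r ^ 3 + r\<^sup>2) * z ^ 3) \<le> ln (1 - r * z) - r\<^sup>2 * ln (1 + z) + (r + r\<^sup>2) * z"
    by (simp add: algebra_simps)
  moreover have "(r ^ 3 + r\<^sup>2) * z ^ 3 \<le> (r ^ 3 + r\<^sup>2) * rem \<theta> z"
    using cube_le_rem[OF \<theta> True] z z0 r by (intro mult_left_mono add_nonneg_nonneg) auto
  ultimately show ?thesis by linarith
next
  case False
  define w where "w = - z"
  have w: "0 \<le> w" "w < 1" using False z by (auto simp: w_def)
  have "r * w - (r * w)\<^sup>2 / 2 \<le> ln (1 + r * w)" using ln_one_plus_ge_quadratic[of "r * w"] w r by simp
  moreover have "ln (1 - w) \<le> - w - w\<^sup>2 / 2" using ln_one_minus_le_cubic[OF w] w zero_le_power[OF w(1), of 3] by linarith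
  then have "r\<^sup>2 * ln (1 - w) \<le> r\<^sup>2 * (- w - w\<^sup>2 / 2)" by (intro mult_left_mono) auto
  ultimately have "0 \<le> ln (1 + r * w) - r\<^sup>2 * ln (1 - w) - (r + r\<^sup>2) * w" by (simp add: algebra_simps power_mult_distrib)
  moreover have "0 \<le> (r ^ 3 + r\<^sup>2) * rem \<theta> z" using r rem_nonneg[OF \<theta> z(1)] by (intro mult_nonneg_nonneg add_nonneg_nonneg) auto
  ultimately show ?thesis by (simp add: w_def)
qed

locale tilt =
  fixes \<beta> a s0 y :: real
  assumes \<beta>: "0 < \<beta>" and s0: "0 < s0" "s0 < y"
begin

definition r :: real where "r = s0 / (y - s0)"
definition a' :: real where "a' = a + \<beta> * r\<^sup>2"
definition c' :: real where "c' = 1 / 2 + \<beta> * (r + r\<^sup>2) / s0"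
abbreviation "\<kappa> \<equiv> tilt_scale \<beta> s0 y"

lemma r: "0 < r" using s0 by (simp add: r_def)

lemma \<kappa>_nonneg: "0 \<le> \<kappa>" by (simp add: tilt_scale_def Let_def)

lemma y_minus: "y - s = (y - s0) * (1 - r * (s / s0 - 1))"
proof -
  have "(y - s0) * (r * (s / s0 - 1)) = s - s0" using s0 by (simp add: r_def field_simps)
  then show ?thesis by (simp add: algebra_simps)
qed

lemma less_iff: "s < y \<longleftrightarrow> r * (s / s0 - 1) < 1"
  using y_minus[of s] s0 by (smt (verit) zero_less_mult_iff)

lemma tilted_weight:
  assumes "0 < s"
  shows "\<kappa> * gw a' c' s = gw a (1 / 2) s * (y - s0) powr \<beta> * exp (\<beta> * (r\<^sup>2 * ln (1 + (s / s0 - 1)) - (r + r\<^sup>2) * (s / s0 - 1)))"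
proof -
  have "ln s = ln (s / s0) + ln s0" using assms s0 by (simp add: ln_div)
  then have "gw a' c' s = gw a (1 / 2) s * exp (\<beta> * r\<^sup>2 * (ln (s / s0) + ln s0) - \<beta> * (r + r\<^sup>2) * (s / s0))"
    using assms by (simp add: gw_def a'_def c'_def powr_def algebra_simps add_divide_distrib flip: exp_add)
  moreover have "\<kappa> = (y - s0) powr \<beta> * exp (- \<beta> * r\<^sup>2 * ln s0 + \<beta> * (r + r\<^sup>2))"
    unfolding tilt_scale_def r_def[symmetric] Let_def using s0 by (simp add: powr_def algebra_simps flip: exp_add)
  ultimately have "\<kappa> * gw a' c' s = gw a (1 / 2) s * (y - s0) powr \<beta> * (exp (- \<beta> * r\<^sup>2 * ln s0 + \<beta> * (r + r\<^sup>2)) * exp (\<beta> * r\<^sup>2 * (ln (s / s0) + ln s0) - \<beta> * (r + r\<^sup>2) * (s / s0)))"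
    by (simp only: mult_ac)
  also have "exp (- \<beta> * r\<^sup>2 * ln s0 + \<beta> * (r + r\<^sup>2)) * exp (\<beta> * r\<^sup>2 * (ln (s / s0) + ln s0) - \<beta> * (r + r\<^sup>2) * (s / s0))
     = exp (\<beta> * (r\<^sup>2 * ln (1 + (s / s0 - 1)) - (r + r\<^sup>2) * (s / s0 - 1)))"
    by (simp add: algebra_simps flip: exp_add)
  finally show ?thesis .
qed

lemma tw_eq:
  assumes "0 < s" "s < y"
  shows "tw \<beta> a y s = \<kappa> * gw a' c' s * exp (\<beta> * (ln (1 - r * (s / s0 - 1)) - r\<^sup>2 * ln (1 + (s / s0 - 1)) + (r + r\<^sup>2) * (s / s0 - 1)))"
proof -
  let ?z = "s / s0 - 1"
  have "0 < 1 - r * ?z" using less_iff assms by simp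
  then have "(1 - r * ?z) powr \<beta> = exp (\<beta> * ln (1 - r * ?z))" by (simp add: powr_def)
  then have "(y - s) powr \<beta> = (y - s0) powr \<beta> * exp (\<beta> * ln (1 - r * ?z))"
    unfolding y_minus[of s] powr_mult by (simp only:)
  then have "tw \<beta> a y s = gw a (1 / 2) s * (y - s0) powr \<beta> * exp (\<beta> * ln (1 - r * ?z))" using assms by (simp add: tw_def)
  also have "\<dots> = \<kappa> * gw a' c' s * exp (\<beta> * (ln (1 - r * ?z) - r\<^sup>2 * ln (1 + ?z) + (r + r\<^sup>2) * ?z))"
    unfolding tilted_weight[OF assms(1)] mult.assoc exp_add[symmetric] by (simp add: algebra_simps)
  finally show ?thesis .
qed

lemma tw_measurable [measurable]: "tw \<beta> a y \<in> borel_measurable borel"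
  unfolding tw_def[abs_def] by measurable

lemma tw_nonneg: "0 \<le> tw \<beta> a y s" by (simp add: tw_def)

lemma sel_tw_finite:
  assumes I: "finite I" and a: "0 < a"
  shows "sel \<beta> I (tw \<beta> a y) < \<infinity>"
proof -
  have "sel \<beta> I (tw \<beta> a y) \<le> sel \<beta> I (\<lambda>s. y powr \<beta> * gw a (1 / 2) s)"
  proof (rule sel_mono[OF tw_nonneg])
    fix s
    show "tw \<beta> a y s \<le> y powr \<beta> * gw a (1 / 2) s"
    proof (cases "0 < s \<and> s < y")
      case True
      then have "(y - s) powr \<beta> \<le> y powr \<beta>" using \<beta> by (intro powr_mono2) auto
      then have "gw a (1 / 2) s * (y - s) powr \<beta> \<le> gw a (1 / 2) s * y powr \<beta>" by (intro mult_left_mono) auto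
      then show ?thesis using True by (simp add: tw_def mult.commute)
    qed (auto simp: tw_def gw_def)
  qed
  also have "\<dots> = ennreal ((y powr \<beta>) ^ card I) * ennreal (lagZ \<beta> a (1 / 2) I)"
    using sel_gw[OF I \<beta> a, of "1/2"] I by (subst sel_cmult) auto
  also have "\<dots> < \<infinity>" by (simp add: ennreal_mult_less_top)
  finally show ?thesis .
qed

text \<open>Jensen's inequality started from the true weight, whose moments are therefore the ones
  to bound. Up to a constant it is a Laguerre weight times \<open>(1 - r * z) powr \<beta>\<close>,
  and a scaling of \<open>z\<close> by \<open>t\<close> lowers that factor by at most
  \<open>exp (- \<beta> * r * (1 - t))\<close>: this is the \<open>\<beta> * r\<close> in
  \<open>E\<close>. The rest of \<open>E\<close> is \<open>s0 / 2 - (a - 1)\<close> and the fixed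
  contraction cost.\<close>

lemma sel_tw_upper:
  assumes I: "finite I" and a: "1 < a" "a \<le> s0 / 2 + 1" and \<theta>: "0 < \<theta>" "\<theta> \<le> 1"
    and E: "s0 / 2 - a + 3 + \<beta> * r + 2 * \<beta> * real (card I) \<le> (a - 1) * \<theta>\<^sup>2"
  shows "sel \<beta> I (tw \<beta> a y) \<le> ennreal (exp (\<beta> * (r ^ 3 + r\<^sup>2) * (34 * real (card I) * \<theta> ^ 3))) * sel \<beta> I (\<lambda>s. \<kappa> * gw a' c' s)"
proof (rule sel_le_exp_sel[where q = "\<lambda>s. \<beta> * (r ^ 3 + r\<^sup>2) * rem \<theta> (s / s0 - 1)"])
  let ?Q = "\<beta> * (r ^ 3 + r\<^sup>2)"
  have Q: "0 \<le> ?Q" using \<beta> r by (intro mult_nonneg_nonneg add_nonneg_nonneg) auto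
  let ?\<tau> = "\<lambda>z. if r * z < 1 then ((y - s0) * (1 - r * z)) powr \<beta> else 0"
  have W: "tw \<beta> a y s = gw (a - 1 + 1) (1 / 2) s * ?\<tau> (s / s0 - 1)" for s
    unfolding tw_def less_iff[of s] by (simp add: y_minus[of s, symmetric])
  show fin: "sel \<beta> I (tw \<beta> a y) < \<infinity>" using sel_tw_finite[OF I] a by simp
  have "sel_sum \<beta> I (tw \<beta> a y) (\<lambda>s. rem \<theta> (s / s0 - 1)) \<le> ennreal (34 * real (card I) * \<theta> ^ 3) * sel \<beta> I (tw \<beta> a y)"
  proof (rule sel_sum_rem_bound[OF I \<beta> s0(1) _ _ _ _ _ _ _ W fin \<theta>(1)])
    show "1 / 2 * s0 = a - 1 + (s0 / 2 - a + 1)" by simp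
    show "0 < a - 1" "0 \<le> s0 / 2 - a + 1" "0 \<le> \<beta> * r" using a \<beta> r by auto
    show "s0 / 2 - a + 1 + \<beta> * r + 2 + 2 * \<beta> * real (card I) \<le> (a - 1) * \<theta>\<^sup>2" using E by simp
    show "?\<tau> \<in> borel_measurable borel" by measurable
    show "0 \<le> ?\<tau> z" for z by simp
    fix z t :: real assume z: "-1 < z" and t: "1 / 2 \<le> t" "t \<le> 1"
    show "?\<tau> z * exp (- (\<beta> * r) * (1 - t)) \<le> ?\<tau> (t * z)"
    proof (cases "r * z < 1")
      case False
      then show ?thesis by simp
    next
      case True
      have tz: "r * (t * z) < 1"
      proof (cases "0 \<le> z")
        case True
        then have "t * z \<le> z" using t by (simp add: mult_left_le_one_le)
        then have "r * (t * z) \<le> r * z" using r by (intro mult_left_mono) auto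
        then show ?thesis using \<open>r * z < 1\<close> by simp
      next
        case False
        then have "r * (t * z) \<le> 0" using r t by (intro mult_nonneg_nonpos) auto
        then show ?thesis by simp
      qed
      \<comment> \<open>Shrinking a negative \<open>z\<close> lowers \<open>1 - r * z\<close>, but
        by at most \<open>r * (1 - t)\<close> because \<open>z > -1\<close>; for positive
        \<open>z\<close> the factor only grows.\<close>
      have "(1 - r * z) * exp (- (r * (1 - t))) \<le> 1 - r * (t * z)"
      proof -
        have "- z * (1 - t) \<le> 1 * (1 - t)" using z t by (intro mult_right_mono) auto
        then have "r * (- z * (1 - t)) \<le> r * (1 - t)" using r by (intro mult_left_mono) auto
        then have le: "1 - r * z \<le> 1 - r * (t * z) + r * (1 - t)" by (simp add: algebra_simps)
        have "1 - r * z \<le> (1 - r * (t * z)) * (1 + r * (1 - t))"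
        proof (cases "0 \<le> z")
          case True
          have "0 \<le> r * (z * (1 - t))" using r t True by (intro mult_nonneg_nonneg) auto
          then have "1 - r * z \<le> (1 - r * (t * z)) * 1" by (simp add: algebra_simps)
          also have "\<dots> \<le> (1 - r * (t * z)) * (1 + r * (1 - t))" using tz r t by (intro mult_left_mono) auto
          finally show ?thesis .
        next
          case False
          have "0 \<le> r * (t * - z) * (r * (1 - t))" using False r t by (intro mult_nonneg_nonneg) auto
          then show ?thesis using le by (simp add: algebra_simps)
        qed
        also have "\<dots> \<le> (1 - r * (t * z)) * exp (r * (1 - t))" using tz by (intro mult_left_mono exp_ge_add_one_self) auto
        finally have "(1 - r * z) * exp (- (r * (1 - t))) \<le> (1 - r * (t * z)) * exp (r * (1 - t)) * exp (- (r * (1 - t)))"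
          by (rule mult_right_mono) simp
        also have "\<dots> = 1 - r * (t * z)" by (simp only: mult.assoc exp_add[symmetric]) simp
        finally show ?thesis .
      qed
      then have "(y - s0) * ((1 - r * z) * exp (- (r * (1 - t)))) \<le> (y - s0) * (1 - r * (t * z))"
        using s0 by (intro mult_left_mono) auto
      then have "((y - s0) * ((1 - r * z) * exp (- (r * (1 - t))))) powr \<beta> \<le> ((y - s0) * (1 - r * (t * z))) powr \<beta>"
        using \<beta> s0 True by (intro powr_mono2) auto
      moreover have "((y - s0) * ((1 - r * z) * exp (- (r * (1 - t))))) powr \<beta> = ((y - s0) * (1 - r * z)) powr \<beta> * exp (- (\<beta> * r) * (1 - t))"
        using s0 True by (simp add: powr_mult exp_powr_real mult_ac)
      ultimately show ?thesis using True tz by simp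
    qed
  qed
  then have "ennreal ?Q * sel_sum \<beta> I (tw \<beta> a y) (\<lambda>s. rem \<theta> (s / s0 - 1)) \<le> ennreal ?Q * (ennreal (34 * real (card I) * \<theta> ^ 3) * sel \<beta> I (tw \<beta> a y))"
    by (intro mult_left_mono) auto
  then show "sel_sum \<beta> I (tw \<beta> a y) (\<lambda>s. ?Q * rem \<theta> (s / s0 - 1)) \<le> ennreal (?Q * (34 * real (card I) * \<theta> ^ 3)) * sel \<beta> I (tw \<beta> a y)"
    unfolding ennreal_mult'[OF Q] mult.assoc[of "ennreal ?Q"] by (subst sel_sum_cmult[OF _ _ Q]) auto
  show "0 \<le> ?Q * (34 * real (card I) * \<theta> ^ 3)" by (rule mult_nonneg_nonneg[OF Q]) (use \<theta> in auto)
  fix s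
  show "0 \<le> ?Q * rem \<theta> (s / s0 - 1)" if "tw \<beta> a y s \<noteq> 0"
  proof -
    have "0 < s" using that unfolding tw_def gw_def by (auto split: if_splits)
    then show ?thesis using rem_nonneg[OF \<theta>(1), of "s / s0 - 1"] s0 by (intro mult_nonneg_nonneg[OF Q]) auto
  qed
  show "tw \<beta> a y s * exp (- (?Q * rem \<theta> (s / s0 - 1))) \<le> \<kappa> * gw a' c' s"
  proof (cases "0 < s \<and> s < y")
    case False
    then have "tw \<beta> a y s = 0" by (auto simp: tw_def gw_def)
    then show ?thesis using \<kappa>_nonneg by simp
  next
    case True
    let ?z = "s / s0 - 1"
    let ?R = "ln (1 - r * ?z) - r\<^sup>2 * ln (1 + ?z) + (r + r\<^sup>2) * ?z"
    have "?R \<le> (r ^ 3 + r\<^sup>2) * rem \<theta> ?z"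
      using True less_iff[of s] s0 by (intro tilt_remainder_upper r \<theta>) auto
    then have "\<beta> * ?R \<le> \<beta> * ((r ^ 3 + r\<^sup>2) * rem \<theta> ?z)" using \<beta> by (intro mult_left_mono) auto
    then have "exp (\<beta> * ?R + - (?Q * rem \<theta> ?z)) \<le> 1" by (simp add: mult.assoc)
    then have "\<kappa> * gw a' c' s * exp (\<beta> * ?R + - (?Q * rem \<theta> ?z)) \<le> \<kappa> * gw a' c' s * 1"
      using \<kappa>_nonneg by (intro mult_left_mono mult_nonneg_nonneg) auto
    then show ?thesis
      unfolding tw_eq[OF conjunct1[OF True] conjunct2[OF True]] exp_add by (simp only: mult.assoc mult_1_right)
  qed
qed (use I in \<open>auto simp: tw_nonneg\<close>)

text \<open>Jensen's inequality in the opposite direction, started from the shifted Laguerre weight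
  cut at \<open>s0 * (1 + z0)\<close>, where the lower remainder bound is available. Contractions
  preserve the cut, so \<tau> costs nothing; \<open>\<beta> * r\<close> now enters as part of
  \<open>c' * s0 - (a' - 1)\<close>.\<close>

lemma sel_tw_lower:
  assumes I: "finite I" and a: "1 < a" "a \<le> s0 / 2 + 1" and \<theta>: "0 < \<theta>"
    and z0: "0 < z0" "z0 \<le> 1" "r * z0 \<le> 1 / 2"
    and E: "s0 / 2 - a + 3 + \<beta> * r + 2 * \<beta> * real (card I) \<le> (a - 1) * \<theta>\<^sup>2"
  shows "sel \<beta> I (\<lambda>s. \<kappa> * gw a' c' s * of_bool (s \<le> s0 * (1 + z0))) \<le> ennreal (exp (\<beta> * (r ^ 3 + r\<^sup>2) * (34 * real (card I) * \<theta> ^ 3))) * sel \<beta> I (tw \<beta> a y)"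
proof (rule sel_le_exp_sel[where q = "\<lambda>s. \<beta> * (r ^ 3 + r\<^sup>2) * rem \<theta> (s / s0 - 1)"])
  let ?Q = "\<beta> * (r ^ 3 + r\<^sup>2)" and ?W = "\<lambda>s. \<kappa> * gw a' c' s * of_bool (s \<le> s0 * (1 + z0))"
  have Q: "0 \<le> ?Q" using \<beta> r by (intro mult_nonneg_nonneg add_nonneg_nonneg) auto
  have a'1: "a - 1 \<le> a' - 1" using \<beta> by (simp add: a'_def)
  have c'pos: "0 < c'" using \<beta> r s0 unfolding c'_def by (intro add_pos_nonneg divide_nonneg_nonneg mult_nonneg_nonneg add_nonneg_nonneg) auto
  let ?\<tau> = "\<lambda>z. \<kappa> * of_bool (z \<le> z0)"
  have W: "?W s = gw (a' - 1 + 1) c' s * ?\<tau> (s / s0 - 1)" for s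
  proof -
    have "s \<le> s0 * (1 + z0) \<longleftrightarrow> s / s0 - 1 \<le> z0" using s0 by (simp add: field_simps)
    then show ?thesis by simp
  qed
  show W0: "0 \<le> ?W s" for s using \<kappa>_nonneg by simp
  show fin: "sel \<beta> I ?W < \<infinity>"
  proof -
    have "sel \<beta> I ?W \<le> sel \<beta> I (\<lambda>s. \<kappa> * gw a' c' s)" using \<kappa>_nonneg by (intro sel_mono) auto
    also have "\<dots> = ennreal (\<kappa> ^ card I) * ennreal (lagZ \<beta> a' c' I)"
      using sel_gw[OF I \<beta> _ c'pos, of a'] I \<kappa>_nonneg a a'1 by (subst sel_cmult) auto
    also have "\<dots> < \<infinity>" by (simp add: ennreal_mult_less_top)
    finally show ?thesis .
  qed
  have "sel_sum \<beta> I ?W (\<lambda>s. rem \<theta> (s / s0 - 1)) \<le> ennreal (34 * real (card I) * \<theta> ^ 3) * sel \<beta> I ?W"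
  proof (rule sel_sum_rem_bound[OF I \<beta> s0(1) _ _ _ _ _ _ _ W fin \<theta>])
    show "c' * s0 = a' - 1 + (s0 / 2 - a + 1 + \<beta> * r)" using s0 by (simp add: c'_def a'_def field_simps)
    show "0 < a' - 1" "0 \<le> s0 / 2 - a + 1 + \<beta> * r" "0 \<le> (0::real)" using a a'1 \<beta> r by auto
    have "(a - 1) * \<theta>\<^sup>2 \<le> (a' - 1) * \<theta>\<^sup>2" using a'1 by (intro mult_right_mono) auto
    then show "s0 / 2 - a + 1 + \<beta> * r + 0 + 2 + 2 * \<beta> * real (card I) \<le> (a' - 1) * \<theta>\<^sup>2" using E by simp
    show "?\<tau> \<in> borel_measurable borel" by measurable
    show "0 \<le> ?\<tau> z" for z using \<kappa>_nonneg by simp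
    fix z t :: real assume z: "-1 < z" and t: "1 / 2 \<le> t" "t \<le> 1"
    have "t * z \<le> z0" if "z \<le> z0"
    proof (cases "0 \<le> z")
      case True
      then have "t * z \<le> z" using t by (simp add: mult_left_le_one_le)
      then show ?thesis using that by simp
    next
      case False
      then have "t * z \<le> 0" using t by (intro mult_nonneg_nonpos) auto
      then show ?thesis using z0 by simp
    qed
    then show "?\<tau> z * exp (- 0 * (1 - t)) \<le> ?\<tau> (t * z)" using \<kappa>_nonneg by auto
  qed
  then have "ennreal ?Q * sel_sum \<beta> I ?W (\<lambda>s. rem \<theta> (s / s0 - 1)) \<le> ennreal ?Q * (ennreal (34 * real (card I) * \<theta> ^ 3) * sel \<beta> I ?W)"
    by (intro mult_left_mono) auto
  then show "sel_sum \<beta> I ?W (\<lambda>s. ?Q * rem \<theta> (s / s0 - 1)) \<le> ennreal (?Q * (34 * real (card I) * \<theta> ^ 3)) * sel \<beta> I ?W"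
    unfolding ennreal_mult'[OF Q] mult.assoc[of "ennreal ?Q"] by (subst sel_sum_cmult[OF _ _ Q]) auto
  show "0 \<le> ?Q * (34 * real (card I) * \<theta> ^ 3)" by (rule mult_nonneg_nonneg[OF Q]) (use \<theta> in auto)
  fix s
  show "0 \<le> ?Q * rem \<theta> (s / s0 - 1)" if "?W s \<noteq> 0"
  proof -
    have "0 < s" using that unfolding gw_def by (auto split: if_splits)
    then show ?thesis using rem_nonneg[OF \<theta>, of "s / s0 - 1"] s0 by (intro mult_nonneg_nonneg[OF Q]) auto
  qed
  show "?W s * exp (- (?Q * rem \<theta> (s / s0 - 1))) \<le> tw \<beta> a y s"
  proof (cases "0 < s \<and> s \<le> s0 * (1 + z0)")
    case False
    then have W_0: "?W s = 0" by (auto simp: gw_def)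
    show ?thesis unfolding W_0 using tw_nonneg by simp
  next
    case True
    let ?z = "s / s0 - 1"
    let ?R = "ln (1 - r * ?z) - r\<^sup>2 * ln (1 + ?z) + (r + r\<^sup>2) * ?z"
    have zz: "?z \<le> z0" using True s0 by (simp add: field_simps)
    then have "r * ?z \<le> r * z0" using r by (intro mult_left_mono) auto
    then have sy: "s < y" using z0 less_iff[of s] by simp
    have "- ((r ^ 3 + r\<^sup>2) * rem \<theta> ?z) \<le> ?R"
      using True s0 zz by (intro tilt_remainder_lower[OF r _ _ z0(2,3) \<theta>]) auto
    then have "\<beta> * - ((r ^ 3 + r\<^sup>2) * rem \<theta> ?z) \<le> \<beta> * ?R" using \<beta> by (intro mult_left_mono) auto
    then have "exp (- (?Q * rem \<theta> ?z)) \<le> exp (\<beta> * ?R)" by (simp add: mult.assoc)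
    then have "\<kappa> * gw a' c' s * exp (- (?Q * rem \<theta> ?z)) \<le> \<kappa> * gw a' c' s * exp (\<beta> * ?R)"
      using \<kappa>_nonneg by (intro mult_left_mono mult_nonneg_nonneg) auto
    then show ?thesis using True sy by (simp add: tw_eq)
  qed
qed (use I in auto)

end

section \<open>Exponential tail bound and truncation of Laguerre ensembles\<close>

lemma nn_integral_gw_tail:
  assumes "0 < a" "0 < c" "0 \<le> h" "h < c"
  shows "(\<integral>\<^sup>+y. ennreal (of_bool (S < y) * gw a c y) \<partial>lborel) \<le> ennreal (exp (- h * S) * (Gamma a * (c - h) powr - a))"
proof -
  have "(\<integral>\<^sup>+y. ennreal (of_bool (S < y) * gw a c y) \<partial>lborel) \<le> (\<integral>\<^sup>+y. ennreal (exp (- h * S)) * ennreal (gw a (c - h) y) \<partial>lborel)"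
  proof (rule nn_integral_mono)
    fix y
    show "ennreal (of_bool (S < y) * gw a c y) \<le> ennreal (exp (- h * S)) * ennreal (gw a (c - h) y)"
    proof (cases "S < y \<and> 0 < y")
      case True
      have "h * S \<le> h * y" using True assms by (intro mult_left_mono) auto
      then have "exp (- c * y) \<le> exp (- h * S + - (c - h) * y)" by (simp add: algebra_simps)
      then have "y powr (a - 1) * exp (- c * y) \<le> y powr (a - 1) * (exp (- h * S) * exp (- (c - h) * y))"
        unfolding exp_add by (intro mult_left_mono) auto
      then show ?thesis using True by (simp add: gw_def mult_ac ennreal_leI flip: ennreal_mult')
    qed (auto simp: gw_def)
  qed
  also have "\<dots> = ennreal (exp (- h * S)) * ennreal (Gamma a * (c - h) powr - a)"
    using nn_integral_gw[of a "c - h"] assms by (simp add: nn_integral_cmult)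
  also have "\<dots> = ennreal (exp (- h * S) * (Gamma a * (c - h) powr - a))" by (simp add: ennreal_mult')
  finally show ?thesis .
qed

text \<open>Removing the largest particle, whose interactions are at most its position to the power
  \<open>\<beta> (n - 1)\<close>, costs a Gamma tail.\<close>

lemma sel_gw_truncate:
  assumes I: "finite I" "I \<noteq> {}" and pos: "0 < \<beta>" "0 < a" "0 < c" and h: "0 \<le> h" "h < c" and S: "0 \<le> S"
  defines "A \<equiv> a + \<beta> * real (card I - 1)"
  shows "ennreal (lagZ \<beta> a c I) \<le> sel \<beta> I (\<lambda>s. gw a c s * of_bool (s \<le> S))
    + ennreal (exp (- h * S) * (Gamma A * (c - h) powr - A) * (\<Sum>i\<in>I. lagZ \<beta> a c (I - {i})))"
proof -
  let ?f = "\<lambda>l. (\<Prod>k\<in>I. gw a c (l k)) * vdm 0 \<beta> I l"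
  let ?e = "\<lambda>l. of_bool (\<exists>i\<in>I. S < l i) :: real"
  have A: "0 < A" using pos unfolding A_def by (intro add_pos_nonneg) auto
  have Iz: "finite (I - {i})" for i using I by auto
  have Z: "0 < lagZ \<beta> a c (I - {i})" for i by (rule lagZ_pos[OF Iz pos])
  have f0: "0 \<le> ?f l" for l by (intro mult_nonneg_nonneg prod_nonneg) auto
  have em[measurable]: "?e \<in> borel_measurable (lebP I)"
  proof -
    have "Measurable.pred (lebP I) (\<lambda>l. \<exists>i\<in>I. S < l i)" using I by measurable
    then show ?thesis by measurable
  qed
  have tail: "(\<integral>\<^sup>+l. ennreal (?e l * ?f l) \<partial>lebP I) \<le> ennreal (exp (- h * S) * (Gamma A * (c - h) powr - A) * (\<Sum>i\<in>I. lagZ \<beta> a c (I - {i})))"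
  proof -
    have "(\<integral>\<^sup>+l. ennreal (?e l * ?f l) \<partial>lebP I) = (\<Sum>i\<in>I. \<integral>\<^sup>+y. ennreal (of_bool (S < y) * gw a c y) * sel \<beta> (I - {i}) (\<lambda>s. gw a c s * \<bar>y - s\<bar> powr \<beta> * of_bool (1 * s < 1 * y)) \<partial>lborel)"
    proof (rule nn_integral_extremal_split[OF I, where \<sigma> = 1 and \<eta> = "\<lambda>y. of_bool (S < y)" and e = ?e])
      show "?e l = of_bool (S < l i)" if "i \<in> I" "\<And>j. j \<in> I \<Longrightarrow> 1 * l j \<le> 1 * l i" for l i
        using that by (auto intro: less_le_trans)
    qed auto
    also have "\<dots> \<le> (\<Sum>i\<in>I. \<integral>\<^sup>+y. ennreal (of_bool (S < y) * gw A c y) * ennreal (lagZ \<beta> a c (I - {i})) \<partial>lborel)"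
    proof (intro sum_mono nn_integral_mono)
      fix i and y :: real assume i: "i \<in> I"
      show "ennreal (of_bool (S < y) * gw a c y) * sel \<beta> (I - {i}) (\<lambda>s. gw a c s * \<bar>y - s\<bar> powr \<beta> * of_bool (1 * s < 1 * y))
        \<le> ennreal (of_bool (S < y) * gw A c y) * ennreal (lagZ \<beta> a c (I - {i}))"
      proof (cases "S < y \<and> 0 < y")
        case True
        have "sel \<beta> (I - {i}) (\<lambda>s. gw a c s * \<bar>y - s\<bar> powr \<beta> * of_bool (1 * s < 1 * y)) \<le> sel \<beta> (I - {i}) (\<lambda>s. y powr \<beta> * gw a c s)"
        proof (rule sel_mono)
          fix s
          show "gw a c s * \<bar>y - s\<bar> powr \<beta> * of_bool (1 * s < 1 * y) \<le> y powr \<beta> * gw a c s"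
          proof (cases "0 < s \<and> s < y")
            case True
            then have "\<bar>y - s\<bar> powr \<beta> \<le> y powr \<beta>" using pos by (intro powr_mono2) auto
            then have "gw a c s * \<bar>y - s\<bar> powr \<beta> \<le> gw a c s * y powr \<beta>" by (intro mult_left_mono) auto
            then show ?thesis using True by (simp add: mult.commute)
          qed (auto simp: gw_def)
        qed simp
        also have "\<dots> = ennreal ((y powr \<beta>) ^ card (I - {i})) * ennreal (lagZ \<beta> a c (I - {i}))"
          using sel_gw[OF Iz pos] Iz by (subst sel_cmult) auto
        also have "(y powr \<beta>) ^ card (I - {i}) = y powr (\<beta> * real (card I - 1))"
          using True i I by (simp add: card_Diff_singleton powr_powr flip: powr_realpow)
        finally have "ennreal (gw a c y) * sel \<beta> (I - {i}) (\<lambda>s. gw a c s * \<bar>y - s\<bar> powr \<beta> * of_bool (1 * s < 1 * y))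
           \<le> ennreal (gw a c y) * (ennreal (y powr (\<beta> * real (card I - 1))) * ennreal (lagZ \<beta> a c (I - {i})))"
          by (intro mult_left_mono) auto
        also have "\<dots> = ennreal (gw A c y) * ennreal (lagZ \<beta> a c (I - {i}))"
          unfolding A_def gw_mult_powr[symmetric] by (simp add: ennreal_mult mult.assoc)
        finally show ?thesis using True by simp
      qed (auto simp: gw_def)
    qed
    also have "\<dots> = (\<Sum>i\<in>I. (\<integral>\<^sup>+y. ennreal (of_bool (S < y) * gw A c y) \<partial>lborel) * ennreal (lagZ \<beta> a c (I - {i})))"
      by (intro sum.cong refl nn_integral_multc) measurable
    also have "\<dots> \<le> (\<Sum>i\<in>I. ennreal (exp (- h * S) * (Gamma A * (c - h) powr - A)) * ennreal (lagZ \<beta> a c (I - {i})))"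
      by (intro sum_mono mult_right_mono nn_integral_gw_tail A pos h) auto
    also have "\<dots> = (\<Sum>i\<in>I. ennreal (exp (- h * S) * (Gamma A * (c - h) powr - A) * lagZ \<beta> a c (I - {i})))"
      using Gamma_real_pos[OF A] by (intro sum.cong refl ennreal_mult'[symmetric]) auto
    also have "\<dots> = ennreal (exp (- h * S) * (Gamma A * (c - h) powr - A) * (\<Sum>i\<in>I. lagZ \<beta> a c (I - {i})))"
      unfolding sum_distrib_left using less_imp_le[OF Gamma_real_pos[OF A]] less_imp_le[OF Z]
      by (intro sum_ennreal mult_nonneg_nonneg) auto
    finally show ?thesis .
  qed
  have "ennreal (lagZ \<beta> a c I) = (\<integral>\<^sup>+l. ennreal (?f l) \<partial>lebP I)" using sel_gw[OF I(1) pos] by (simp add: sel_def)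
  also have "\<dots> \<le> (\<integral>\<^sup>+l. ennreal ((\<Prod>k\<in>I. gw a c (l k) * of_bool (l k \<le> S)) * vdm 0 \<beta> I l) + ennreal (?e l * ?f l) \<partial>lebP I)"
  proof (rule nn_integral_mono)
    fix l
    show "ennreal (?f l) \<le> ennreal ((\<Prod>k\<in>I. gw a c (l k) * of_bool (l k \<le> S)) * vdm 0 \<beta> I l) + ennreal (?e l * ?f l)"
    proof (cases "\<exists>i\<in>I. S < l i")
      case False
      then have "(\<Prod>k\<in>I. gw a c (l k) * of_bool (l k \<le> S)) = (\<Prod>k\<in>I. gw a c (l k))" by (intro prod.cong) auto
      then show ?thesis by simp
    qed simp
  qed
  also have "\<dots> = sel \<beta> I (\<lambda>s. gw a c s * of_bool (s \<le> S)) + (\<integral>\<^sup>+l. ennreal (?e l * ?f l) \<partial>lebP I)"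
    unfolding sel_def by (rule nn_integral_add) measurable
  also have "\<dots> \<le> sel \<beta> I (\<lambda>s. gw a c s * of_bool (s \<le> S)) + ennreal (exp (- h * S) * (Gamma A * (c - h) powr - A) * (\<Sum>i\<in>I. lagZ \<beta> a c (I - {i})))"
    by (intro add_left_mono tail)
  finally show ?thesis .
qed

section \<open>Stirling's formula with explicit remainder\<close>

definition stirling_rem :: "real \<Rightarrow> real" where
  "stirling_rem x = ln (Gamma x) - ((x - 1 / 2) * ln x - x)"

lemma Gamma_plus_1_real: "0 < (x::real) \<Longrightarrow> Gamma (x + 1) = x * Gamma x"
proof -
  assume "0 < x"
  then have "x \<notin> \<int>\<^sub>\<le>\<^sub>0" using nonpos_Ints_nonpos not_le by blast
  then show ?thesis by (rule Gamma_plus1)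
qed

lemma ln_Gamma_plus_1: "0 < (x::real) \<Longrightarrow> ln (Gamma (x + 1)) = ln x + ln (Gamma x)"
  using less_imp_neq[OF Gamma_real_pos[of x]] by (simp add: Gamma_plus_1_real ln_mult)

text \<open>The increment is of order \<open>1 / x^2\<close>; bounding it by a difference of
  reciprocals lets it telescope over integer steps.\<close>

lemma stirling_rem_step:
  assumes "1 \<le> x"
  shows "\<bar>stirling_rem x - stirling_rem (x + 1)\<bar> \<le> (1 / x - 1 / (x + 1)) / 2"
proof -
  define y where "y = 1 / x"
  have y: "0 < y" "y \<le> 1" "x = 1 / y" using assms by (auto simp: y_def)
  have xy: "x * y = 1" using assms by (simp add: y_def)
  have "ln (x + 1) = ln x + ln (1 + y)"
  proof -
    have "x + 1 = x * (1 + y)" using assms by (simp add: y_def field_simps)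
    then show ?thesis using assms y(1) by (simp add: ln_mult)
  qed
  then have d: "stirling_rem x - stirling_rem (x + 1) = (x + 1 / 2) * ln (1 + y) - 1"
    using ln_Gamma_plus_1[of x] assms by (simp add: stirling_rem_def algebra_simps)
  have "(x + 1 / 2) * ln (1 + y) \<le> (x + 1 / 2) * (y - y\<^sup>2 / 2 + y ^ 3 / 3)"
    using ln_one_plus_le_cubic[of y] y assms by (intro mult_left_mono) auto
  also have "\<dots> = (x * y) * (1 - y / 2 + y\<^sup>2 / 3) + (y - y\<^sup>2 / 2 + y ^ 3 / 3) / 2"
    by (simp add: algebra_simps power2_eq_square power3_eq_cube add_divide_distrib diff_divide_distrib)
  also have "\<dots> = 1 + y\<^sup>2 / 12 + y ^ 3 / 6" unfolding xy mult_1_left by (simp add: field_simps)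
  also have "y ^ 3 \<le> y\<^sup>2" using y by (simp add: power_decreasing)
  finally have up: "(x + 1 / 2) * ln (1 + y) - 1 \<le> y\<^sup>2 / 4" by simp
  have "(x + 1 / 2) * (y - y\<^sup>2 / 2) \<le> (x + 1 / 2) * ln (1 + y)"
    using ln_one_plus_ge_quadratic[of y] y assms by (intro mult_left_mono) auto
  moreover have "(x + 1 / 2) * (y - y\<^sup>2 / 2) = (x * y) * (1 - y / 2) + (y - y\<^sup>2 / 2) / 2"
    by (simp add: algebra_simps power2_eq_square add_divide_distrib diff_divide_distrib)
  then have "(x + 1 / 2) * (y - y\<^sup>2 / 2) = 1 - y\<^sup>2 / 4" unfolding xy mult_1_left by (simp add: field_simps)
  ultimately have lo: "- (y\<^sup>2 / 4) \<le> (x + 1 / 2) * ln (1 + y) - 1" by simp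
  have "x + 1 \<le> 2 * x" using assms by simp
  then have "1 / (2 * x) * (1 / x) \<le> 1 / (x + 1) * (1 / x)" using assms by (intro mult_right_mono divide_left_mono) auto
  also have "1 / (x + 1) * (1 / x) = 1 / x - 1 / (x + 1)" using assms by (simp add: field_simps)
  finally have "y\<^sup>2 / 4 \<le> (1 / x - 1 / (x + 1)) / 2" by (simp add: y_def power2_eq_square)
  then show ?thesis unfolding d using up lo by linarith
qed

lemma stirling_rem_add_nat:
  assumes "1 \<le> x"
  shows "\<bar>stirling_rem x - stirling_rem (x + real m)\<bar> \<le> (1 / x - 1 / (x + real m)) / 2"
proof (induction m)
  case (Suc m)
  have "\<bar>stirling_rem (x + real m) - stirling_rem (x + real m + 1)\<bar> \<le> (1 / (x + real m) - 1 / (x + real m + 1)) / 2"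
    using assms by (intro stirling_rem_step) auto
  moreover have "x + real (Suc m) = x + real m + 1" by simp
  moreover have "\<bar>A - C\<bar> \<le> (u - w) / 2" if "\<bar>A - B\<bar> \<le> (u - v) / 2" "\<bar>B - C\<bar> \<le> (v - w) / 2" for A B C u v w :: real
    using that unfolding diff_divide_distrib by linarith
  ultimately show ?case using Suc by metis
qed simp

text \<open>Integer steps do not relate arguments with different fractional parts. Log-convexity of
  Gamma does: it squeezes the increment over \<open>h\<close> between \<open>h * ln (x - 1)\<close>
  and \<open>h * ln x\<close>.\<close>

lemma stirling_rem_frac:
  assumes x: "2 \<le> x" and h: "0 \<le> h" "h \<le> 1"
  shows "\<bar>stirling_rem (x + h) - stirling_rem x\<bar> \<le> 4 / x"
proof (cases "h = 0 \<or> h = 1")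
  case True
  then show ?thesis
  proof
    assume "h = 1"
    have "1 / x - 1 / (x + 1) \<le> 1 / x" "1 / x \<le> 8 / x" using x by (simp_all add: divide_right_mono)
    then have "1 / x - 1 / (x + 1) \<le> 8 / x" by (rule order_trans)
    then have "(1 / x - 1 / (x + 1)) / 2 \<le> 4 / x" by simp
    from order_trans[OF stirling_rem_step this] show ?thesis using x \<open>h = 1\<close> by (simp add: abs_minus_commute)
  qed (use x in simp)
next
  case False
  then have h: "0 < h" "h < 1" using h by auto
  let ?G = "ln \<circ> Gamma :: real \<Rightarrow> real"
  have "(?G x - ?G (x + h)) / (x - (x + h)) \<le> (?G x - ?G (x + 1)) / (x - (x + 1))"
    using x h by (intro convex_on_slope_le(1)[OF log_convex_Gamma_real]) auto
  then have up: "ln (Gamma (x + h)) - ln (Gamma x) \<le> h * ln x"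
    using ln_Gamma_plus_1[of x] x h by (simp add: field_simps)
  have "(?G (x - 1) - ?G x) / (x - 1 - x) \<le> (?G (x - 1) - ?G (x + h)) / (x - 1 - (x + h))"
    using x h by (intro convex_on_slope_le(1)[OF log_convex_Gamma_real]) auto
  also have "\<dots> \<le> (?G x - ?G (x + h)) / (x - (x + h))"
    using x h by (intro convex_on_slope_le(2)[OF log_convex_Gamma_real]) auto
  finally have lo: "h * ln (x - 1) \<le> ln (Gamma (x + h)) - ln (Gamma x)"
    using ln_Gamma_plus_1[of "x - 1"] x h by (simp add: field_simps)
  define y where "y = h / x"
  have y: "0 \<le> y" "h = y * x" using x h by (auto simp: y_def)
  have lnx: "ln (x + h) = ln x + ln (1 + y)"
  proof -
    have "x + h = x * (1 + y)" using x by (simp add: y_def field_simps)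
    then show ?thesis using x y by (simp add: ln_mult)
  qed
  define T where "T = h - (x + h - 1 / 2) * ln (1 + y)"
  have eq: "stirling_rem (x + h) - stirling_rem x = (ln (Gamma (x + h)) - ln (Gamma x) - h * ln x) + T"
    unfolding stirling_rem_def T_def lnx by (simp add: algebra_simps)
  have "(x + h - 1 / 2) * ln (1 + y) \<le> (x + h - 1 / 2) * y"
    using ln_add_one_self_le_self[OF y(1)] x h by (intro mult_left_mono) auto
  moreover have "(x + h - 1 / 2) * y = h + (h - 1 / 2) * h / x" using x by (simp add: y_def field_simps)
  moreover have "(h - 1 / 2) * h / x \<le> 1 / x"
  proof (intro divide_right_mono)
    show "(h - 1 / 2) * h \<le> 1" using h mult_mono[of "h - 1/2" 1 h 1] by simp
  qed (use x in auto)
  ultimately have T1: "- (1 / x) \<le> T" by (simp add: T_def)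
  have "(x + h - 1 / 2) * (y - y\<^sup>2 / 2) \<le> (x + h - 1 / 2) * ln (1 + y)"
    using ln_one_plus_ge_quadratic[OF y(1)] x h by (intro mult_left_mono) auto
  moreover have "h - 2 / x \<le> (x + h - 1 / 2) * (y - y\<^sup>2 / 2)"
  proof -
    have y2: "y\<^sup>2 \<le> 1 / x\<^sup>2" using h x by (simp add: y_def power_divide divide_right_mono power_le_one)
    have "(x + h - 1 / 2) * (y\<^sup>2 / 2) \<le> (2 * x) * (1 / x\<^sup>2 / 2)" using y2 x h by (intro mult_mono divide_right_mono) auto
    also have "\<dots> = 1 / x" using x by (simp add: power2_eq_square)
    finally have a: "(x + h - 1 / 2) * (y\<^sup>2 / 2) \<le> 1 / x" .
    have "(x + h - 1 / 2) * y = h + (h - 1 / 2) * h / x" using x by (simp add: y_def field_simps)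
    moreover have "- (1 / x) \<le> (h - 1 / 2) * h / x"
    proof -
      have "- 1 / x \<le> (h - 1 / 2) * h / x"
      proof (intro divide_right_mono)
        have "- (1 / 2) * h \<le> (h - 1 / 2) * h" using h by (intro mult_right_mono) auto
        then show "- 1 \<le> (h - 1 / 2) * h" using h by simp
      qed (use x in auto)
      then show ?thesis by simp
    qed
    ultimately show ?thesis using a by (simp add: right_diff_distrib)
  qed
  ultimately have T2: "T \<le> 2 / x" by (simp add: T_def)
  have "ln x - ln (x - 1) \<le> 2 / x"
  proof -
    have "x = (x - 1) * (1 + 1 / (x - 1))" using x by (simp add: field_simps)
    moreover have "0 < 1 / (x - 1)" using x by simp
    then have "0 < 1 + 1 / (x - 1)" by linarith
    then have "ln ((x - 1) * (1 + 1 / (x - 1))) = ln (x - 1) + ln (1 + 1 / (x - 1))"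
      using x by (intro ln_mult_pos) auto
    ultimately have "ln x - ln (x - 1) = ln (1 + 1 / (x - 1))" by simp
    also have "\<dots> \<le> 1 / (x - 1)" using x by (intro ln_add_one_self_le_self) auto
    also have "\<dots> \<le> 2 / x" using x by (simp add: field_simps)
    finally show ?thesis .
  qed
  moreover have "0 \<le> ln x - ln (x - 1)" using x by simp
  ultimately have "h * (ln x - ln (x - 1)) \<le> 1 * (2 / x)" using h by (intro mult_mono) auto
  then have "- (2 / x) \<le> ln (Gamma (x + h)) - ln (Gamma x) - h * ln x" using lo by (simp add: algebra_simps)
  then show ?thesis unfolding eq using T1 T2 up x by (simp add: abs_le_iff)
qed

text \<open>Legendre's formula, transferred from the complex Gamma function; it identifies the
  constant in Stirling's formula.\<close>

lemma ln_Gamma_duplication: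
  assumes "0 < (z::real)"
  shows "ln (Gamma z) + ln (Gamma (z + 1 / 2)) = (1 - 2 * z) * ln 2 + ln pi / 2 + ln (Gamma (2 * z))"
proof -
  let ?z = "complex_of_real z"
  have np: "complex_of_real x \<notin> \<int>\<^sub>\<le>\<^sub>0" if "0 < x" for x
    using that by (auto elim!: nonpos_Ints_cases simp: complex_eq_iff)
  have "?z \<notin> \<int>\<^sub>\<le>\<^sub>0" using np assms by simp
  moreover have "?z + 1 / 2 \<notin> \<int>\<^sub>\<le>\<^sub>0" using np[of "z + 1/2"] assms by simp
  ultimately have "Gamma ?z * Gamma (?z + 1 / 2) = exp ((1 - 2 * ?z) * of_real (ln 2)) * of_real (sqrt pi) * Gamma (2 * ?z)"
    by (rule Gamma_legendre_duplication)
  moreover have "Gamma (?z + 1 / 2) = of_real (Gamma (z + 1 / 2))" using Gamma_complex_of_real[of "z + 1/2"] by simp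
  moreover have "Gamma (2 * ?z) = of_real (Gamma (2 * z))" using Gamma_complex_of_real[of "2 * z"] by simp
  moreover have "exp ((1 - 2 * ?z) * of_real (ln 2)) = of_real (exp ((1 - 2 * z) * ln 2))"
    unfolding exp_of_real[symmetric] by simp
  ultimately have "complex_of_real (Gamma z * Gamma (z + 1 / 2)) = complex_of_real (exp ((1 - 2 * z) * ln 2) * sqrt pi * Gamma (2 * z))"
    by (simp add: Gamma_complex_of_real)
  then have "Gamma z * Gamma (z + 1 / 2) = exp ((1 - 2 * z) * ln 2) * sqrt pi * Gamma (2 * z)"
    by (simp only: of_real_eq_iff)
  then have "ln (Gamma z * Gamma (z + 1 / 2)) = ln (exp ((1 - 2 * z) * ln 2) * sqrt pi * Gamma (2 * z))" by (rule arg_cong)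
  moreover have "0 < Gamma z" "0 < Gamma (z + 1 / 2)" "0 < Gamma (2 * z)" using assms by (auto intro!: Gamma_real_pos)
  ultimately show ?thesis by (simp add: ln_mult ln_sqrt)
qed

text \<open>Telescoping makes the remainder Cauchy along the integers, the fractional comparison
  makes the limit \<open>L\<close> the same for every starting point, and duplication gives
  \<open>L + L - L = ln (2 * pi) / 2\<close>. The rate is the telescoped bound carried to
  infinity.\<close>

lemma stirling_rem_bound:
  assumes x: "1 \<le> x"
  shows "\<bar>stirling_rem x - ln (2 * pi) / 2\<bar> \<le> 1 / (2 * x)"
proof -
  let ?u = "\<lambda>m::nat. stirling_rem (1 + real m)"
  have dec: "\<bar>?u m - ?u k\<bar> \<le> 1 / (1 + real m)" if "m \<le> k" for m k
  proof -
    have "\<bar>?u m - stirling_rem (1 + real m + real (k - m))\<bar> \<le> (1 / (1 + real m) - 1 / (1 + real m + real (k - m))) / 2"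
      by (rule stirling_rem_add_nat) simp
    moreover have "0 \<le> 1 / (1 + real m + real (k - m))" by simp
    moreover have "1 + real m + real (k - m) = 1 + real k" using that by simp
    moreover have "0 \<le> 1 / (1 + real m)" by simp
    moreover have "d \<le> u" if "d \<le> (u - v) / 2" "0 \<le> u" "0 \<le> v" for d u v :: real
      using that unfolding diff_divide_distrib by linarith
    ultimately show ?thesis by metis
  qed
  have inv0: "(\<lambda>m. C / (1 + real m)) \<longlonglongrightarrow> 0" for C :: real
  proof -
    have "(\<lambda>m. C * (1 / real (Suc m))) \<longlonglongrightarrow> C * 0" by (intro tendsto_mult tendsto_const LIMSEQ_Suc[OF lim_1_over_n])
    then show ?thesis by simp
  qed
  have "Cauchy ?u"
  proof (rule metric_CauchyI)
    fix e :: real assume "0 < e"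
    then have e2: "0 < e / 2" by simp
    obtain M where M: "1 / (1 + real M) < e / 2" using order_tendstoD(2)[OF inv0[of 1] e2] by (auto simp: eventually_sequentially)
    have "dist (?u m) (?u k) < e" if "M \<le> m" "M \<le> k" for m k
      using dec[OF that(1)] dec[OF that(2)] M by (simp add: dist_real_def abs_le_iff abs_less_iff)
    then show "\<exists>M. \<forall>m\<ge>M. \<forall>n\<ge>M. dist (?u m) (?u n) < e" by blast
  qed
  then obtain L where L: "?u \<longlonglongrightarrow> L" using Cauchy_convergent_iff convergent_def by blast
  have lim: "(\<lambda>m. stirling_rem (y + real m)) \<longlonglongrightarrow> L" if y: "1 \<le> y" for y
  proof -
    define q where "q = nat \<lfloor>y\<rfloor>"
    define h where "h = y - real q"
    have "1 \<le> q" using y by (simp add: q_def le_nat_iff le_floor_iff)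
    moreover have "real q = of_int \<lfloor>y\<rfloor>" using y by (simp add: q_def)
    ultimately have q: "1 \<le> q" "0 \<le> h" "h \<le> 1" unfolding h_def by linarith+
    have "(\<lambda>m. ?u (m + q)) \<longlonglongrightarrow> L" by (rule LIMSEQ_ignore_initial_segment[OF L])
    moreover have "(\<lambda>m. stirling_rem (y + real (Suc m)) - ?u (m + q)) \<longlonglongrightarrow> 0"
    proof (rule Lim_null_comparison)
      show "\<forall>\<^sub>F m in sequentially. norm (stirling_rem (y + real (Suc m)) - ?u (m + q)) \<le> 4 / (1 + real m)"
      proof (rule always_eventually, rule allI)
        fix m
        have "\<bar>stirling_rem (1 + real (m + q) + h) - ?u (m + q)\<bar> \<le> 4 / (1 + real (m + q))"
          using q by (intro stirling_rem_frac) auto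
        also have "\<dots> \<le> 4 / (1 + real m)" by (intro divide_left_mono) auto
        also have "1 + real (m + q) + h = y + real (Suc m)" by (simp add: h_def)
        finally show "norm (stirling_rem (y + real (Suc m)) - ?u (m + q)) \<le> 4 / (1 + real m)" by simp
      qed
    qed (rule inv0)
    ultimately have "(\<lambda>m. (stirling_rem (y + real (Suc m)) - ?u (m + q)) + ?u (m + q)) \<longlonglongrightarrow> 0 + L" by (intro tendsto_add)
    then have "(\<lambda>m. stirling_rem (y + real (Suc m))) \<longlonglongrightarrow> L" by simp
    then show ?thesis by (rule LIMSEQ_imp_Suc)
  qed
  have "L = ln (2 * pi) / 2"
  proof -
    let ?m = "\<lambda>m::nat. 1 + real m"
    have half: "(\<lambda>m. stirling_rem (?m m + 1 / 2)) \<longlonglongrightarrow> L" using lim[of "1 + 1/2"] by (simp add: add_ac)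
    have dbl: "(\<lambda>m. stirling_rem (2 * ?m m)) \<longlonglongrightarrow> L"
    proof -
      have "(\<lambda>m. stirling_rem (1 + real (2 * m + 1))) \<longlonglongrightarrow> L"
        using LIMSEQ_subseq_LIMSEQ[OF L, of "\<lambda>m. 2 * m + 1"] by (simp add: o_def strict_mono_def)
      moreover have "1 + real (2 * m + 1) = 2 * ?m m" for m by simp
      ultimately show ?thesis by simp
    qed
    have "(\<lambda>m. ?u m + stirling_rem (?m m + 1 / 2) - stirling_rem (2 * ?m m)) \<longlonglongrightarrow> L + L - L"
      by (intro tendsto_add tendsto_diff L half dbl)
    moreover have "(\<lambda>m. ?u m + stirling_rem (?m m + 1 / 2) - stirling_rem (2 * ?m m)) \<longlonglongrightarrow> ln (2 * pi) / 2"
    proof (rule LIM_zero_cancel[OF Lim_null_comparison])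
      show "(\<lambda>m. 1 / (1 + real m)) \<longlonglongrightarrow> 0" by (rule inv0)
      show "\<forall>\<^sub>F m in sequentially. norm (?u m + stirling_rem (?m m + 1 / 2) - stirling_rem (2 * ?m m) - ln (2 * pi) / 2) \<le> 1 / (1 + real m)"
      proof (rule always_eventually, rule allI)
        fix m
        define z where "z = ?m m"
        have z: "1 \<le> z" by (simp add: z_def)
        define y where "y = 1 / (2 * z)"
        have y: "0 \<le> y" "z * y = 1 / 2" using z by (auto simp: y_def)
        have l: "ln (z + 1 / 2) = ln z + ln (1 + y)"
        proof -
          have "z + 1 / 2 = z * (1 + y)" using z y by (simp add: distrib_left)
          then show ?thesis using z y by (simp add: ln_mult)
        qed
        have "stirling_rem z + stirling_rem (z + 1 / 2) - stirling_rem (2 * z) - ln (2 * pi) / 2 = 1 / 2 - z * ln (1 + y)"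
          using ln_Gamma_duplication[of z] z
          by (simp add: stirling_rem_def l ln_mult algebra_simps add_divide_distrib)
        moreover have "z * ln (1 + y) \<le> 1 / 2"
          using mult_left_mono[OF ln_add_one_self_le_self[OF y(1)], of z] z y by simp
        moreover have "1 / 2 - 1 / z \<le> z * ln (1 + y)"
        proof -
          have "z * (y - y\<^sup>2 / 2) \<le> z * ln (1 + y)" using ln_one_plus_ge_quadratic[OF y(1)] z by (intro mult_left_mono) auto
          moreover have "z * (y - y\<^sup>2 / 2) = 1 / 2 - 1 / (8 * z)" using z by (simp add: y_def field_simps power2_eq_square)
          moreover have "1 / (8 * z) \<le> 1 / z" using z by (simp add: field_simps)
          ultimately show ?thesis by linarith
        qed
        ultimately show "norm (?u m + stirling_rem (?m m + 1 / 2) - stirling_rem (2 * ?m m) - ln (2 * pi) / 2) \<le> 1 / (1 + real m)"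
          unfolding z_def[symmetric] by simp
      qed
    qed
    ultimately have "L + L - L = ln (2 * pi) / 2" by (rule LIMSEQ_unique)
    then show ?thesis by simp
  qed
  moreover have "\<bar>stirling_rem x - L\<bar> \<le> 1 / (2 * x)"
  proof (rule LIMSEQ_le_const2)
    show "(\<lambda>m. \<bar>stirling_rem x - stirling_rem (x + real m)\<bar>) \<longlonglongrightarrow> \<bar>stirling_rem x - L\<bar>"
      by (intro tendsto_intros lim x)
    have "(1 / x - 1 / (x + real m)) / 2 \<le> 1 / (2 * x)" for m
    proof -
      have "1 / x - 1 / (x + real m) \<le> 1 / x" using x by simp
      then have "(1 / x - 1 / (x + real m)) / 2 \<le> 1 / x / 2" by (rule divide_right_mono) simp
      then show ?thesis by (simp add: mult.commute)
    qed
    then show "\<exists>N. \<forall>m\<ge>N. \<bar>stirling_rem x - stirling_rem (x + real m)\<bar> \<le> 1 / (2 * x)"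
      using stirling_rem_add_nat[OF x] order_trans by blast
  qed
  ultimately show ?thesis by simp
qed

lemma ln_Gamma_stirling:
  "0 < x \<Longrightarrow> ln (Gamma x) = (x - 1 / 2) * ln x - x + stirling_rem x"
  by (simp add: stirling_rem_def)

text \<open>Stirling's formula at both arguments. The bound is uniform in \<open>a \<ge> 1\<close>
  so that it can be summed over the particles; the cube is a generous polynomial in the
  shift.\<close>

lemma ln_Gamma_add_bound:
  fixes a \<rho> :: real
  assumes a: "1 \<le> a" and \<rho>: "0 \<le> \<rho>"
  shows "\<bar>ln (Gamma (a + \<rho>)) - ln (Gamma a) - \<rho> * ln a\<bar> \<le> (1 + \<rho>) ^ 3 / a"
proof -
  define y where "y = \<rho> / a"
  have y: "0 \<le> y" unfolding y_def using a \<rho> by (intro divide_nonneg_nonneg) auto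
  have l: "ln (a + \<rho>) = ln a + ln (1 + y)"
  proof -
    have "a + \<rho> = a * (1 + y)" using a by (simp add: y_def field_simps)
    then show ?thesis using a y by (simp add: ln_mult)
  qed
  define T where "T = (a + \<rho> - 1 / 2) * ln (1 + y) - \<rho>"
  have eq: "ln (Gamma (a + \<rho>)) - ln (Gamma a) - \<rho> * ln a = T + (stirling_rem (a + \<rho>) - stirling_rem a)"
  proof -
    have "ln (Gamma (a + \<rho>)) = (a + \<rho> - 1 / 2) * (ln a + ln (1 + y)) - (a + \<rho>) + stirling_rem (a + \<rho>)"
      using ln_Gamma_stirling[of "a + \<rho>"] a \<rho> unfolding l by simp
    moreover have "ln (Gamma a) = (a - 1 / 2) * ln a - a + stirling_rem a" using ln_Gamma_stirling[of a] a by simp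
    ultimately show ?thesis unfolding T_def by (simp add: algebra_simps)
  qed
  have e: "(a + \<rho> - 1 / 2) * y = \<rho> + (\<rho> - 1 / 2) * \<rho> / a" using a by (simp add: y_def field_simps)
  have "(a + \<rho> - 1 / 2) * ln (1 + y) \<le> (a + \<rho> - 1 / 2) * y"
    using ln_add_one_self_le_self[OF y] a \<rho> by (intro mult_left_mono) auto
  moreover have "(\<rho> - 1 / 2) * \<rho> / a \<le> \<rho>\<^sup>2 / a" using a \<rho> by (intro divide_right_mono) (auto simp: power2_eq_square algebra_simps)
  ultimately have T1: "T \<le> \<rho>\<^sup>2 / a" using e by (simp add: T_def)
  have "(a + \<rho> - 1 / 2) * (y - y\<^sup>2 / 2) \<le> (a + \<rho> - 1 / 2) * ln (1 + y)"
    using ln_one_plus_ge_quadratic[OF y] a \<rho> by (intro mult_left_mono) auto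
  moreover have "(a + \<rho> - 1 / 2) * (y\<^sup>2 / 2) \<le> (1 + \<rho>) * \<rho>\<^sup>2 / a"
  proof -
    have "(a + \<rho> - 1 / 2) * (y\<^sup>2 / 2) \<le> (a * (1 + \<rho>)) * y\<^sup>2"
    proof (intro mult_mono)
      have "\<rho> * 1 \<le> \<rho> * a" using a \<rho> by (intro mult_left_mono) auto
      then show "a + \<rho> - 1 / 2 \<le> a * (1 + \<rho>)" by (simp add: algebra_simps)
    qed (use a \<rho> in auto)
    also have "\<dots> = (1 + \<rho>) * \<rho>\<^sup>2 / a" using a by (simp add: y_def field_simps power2_eq_square)
    finally show ?thesis .
  qed
  moreover have "- \<rho> / a \<le> (\<rho> - 1 / 2) * \<rho> / a"
  proof (intro divide_right_mono)
    have "0 \<le> \<rho> * (\<rho> + 1 / 2)" using \<rho> by simp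
    then show "- \<rho> \<le> (\<rho> - 1 / 2) * \<rho>" by (simp add: algebra_simps)
  qed (use a in auto)
  ultimately have T2: "- \<rho> / a - (1 + \<rho>) * \<rho>\<^sup>2 / a \<le> T" using e by (simp add: T_def right_diff_distrib)
  have s: "\<bar>stirling_rem (a + \<rho>) - stirling_rem a\<bar> \<le> 1 / a"
  proof -
    have "1 / (2 * (a + \<rho>)) \<le> 1 / (2 * a)" using a \<rho> by (intro divide_left_mono) auto
    moreover have "1 / (2 * a) + 1 / (2 * a) = 1 / a" by simp
    ultimately show ?thesis using stirling_rem_bound[OF a] stirling_rem_bound[of "a + \<rho>"] a \<rho> by linarith
  qed
  have "(1 + \<rho>) ^ 3 / a = 1 / a + 3 * \<rho> / a + 3 * \<rho>\<^sup>2 / a + \<rho> ^ 3 / a"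
    by (simp add: power3_eq_cube power2_eq_square algebra_simps add_divide_distrib)
  moreover have "(1 + \<rho>) * \<rho>\<^sup>2 / a = \<rho>\<^sup>2 / a + \<rho> ^ 3 / a"
    by (simp add: power3_eq_cube power2_eq_square algebra_simps add_divide_distrib)
  moreover have "0 \<le> \<rho> / a" "0 \<le> \<rho>\<^sup>2 / a" "0 \<le> \<rho> ^ 3 / a" "- \<rho> / a = - (\<rho> / a)" "3 * \<rho> / a = 3 * (\<rho> / a)" "3 * \<rho>\<^sup>2 / a = 3 * (\<rho>\<^sup>2 / a)"
    using a \<rho> by auto
  ultimately show ?thesis unfolding eq using T1 T2 s by linarith
qed

section \<open>Asymptotics of the tilted partition function\<close>

text \<open>Source of the term with \<open>n^2 / p\<close> in \<open>B_fun\<close>: the Gamma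
  arguments of the particles spread over a range proportional to \<open>N\<close>, and the
  first-order expansion of the logarithms leaves \<open>- N^2 / (2 * p)\<close>.\<close>

lemma sum_ln_one_minus:
  fixes p :: real
  assumes "0 < p" "2 * real N \<le> p"
  shows "\<bar>(\<Sum>i=1..N. ln (1 - real i / p)) + (real N)\<^sup>2 / (2 * p)\<bar> \<le> real N / p + real N ^ 3 / p\<^sup>2"
proof -
  have "\<bar>(\<Sum>i=1..N. ln (1 - real i / p)) + (\<Sum>i=1..N. real i / p)\<bar> \<le> (\<Sum>i=1..N. (real N)\<^sup>2 / p\<^sup>2)"
    unfolding sum.distrib[symmetric]
  proof (rule order_trans[OF sum_abs sum_mono])
    fix i assume i: "i \<in> {1..N}"
    define y where "y = real i / p"
    have "real i \<le> real N" using i by simp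
    then have "2 * real i \<le> p" using assms by linarith
    then have y: "0 \<le> y" "y \<le> 1 / 2" using assms by (auto simp: y_def field_simps)
    have "ln (1 - y) \<le> - y" using ln_le_minus_one[of "1 - y"] y by simp
    moreover have "- y - y\<^sup>2 / 2 - y ^ 3 \<le> ln (1 - y)" by (rule ln_one_minus_ge_cubic[OF y])
    moreover have "y ^ 3 \<le> y\<^sup>2 / 2"
      using mult_left_mono[OF y(2), of "y\<^sup>2"] by (simp add: power2_eq_square power3_eq_cube)
    ultimately have "\<bar>ln (1 - y) + y\<bar> \<le> y\<^sup>2" by (simp add: abs_le_iff)
    also have "y\<^sup>2 \<le> (real N / p)\<^sup>2" using i assms by (intro power_mono) (auto simp: y_def divide_right_mono)
    finally show "\<bar>ln (1 - real i / p) + real i / p\<bar> \<le> (real N)\<^sup>2 / p\<^sup>2" by (simp add: y_def power_divide)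
  qed
  also have "(\<Sum>i=1..N. (real N)\<^sup>2 / p\<^sup>2) = real N ^ 3 / p\<^sup>2" by (simp add: power2_eq_square power3_eq_cube)
  finally have 1: "\<bar>(\<Sum>i=1..N. ln (1 - real i / p)) + (\<Sum>i=1..N. real i / p)\<bar> \<le> real N ^ 3 / p\<^sup>2" .
  have "(\<Sum>i=1..N. real i / p) = (\<Sum>i=1..N. real i) / p" by (simp add: sum_divide_distrib)
  also have "(\<Sum>i=1..N. real i) = real N * (real N + 1) / 2" by (induction N) (auto simp: field_simps)
  also have "real N * (real N + 1) / 2 / p = (real N)\<^sup>2 / (2 * p) + real N / p / 2"
    by (simp add: power2_eq_square algebra_simps add_divide_distrib)
  finally have "(\<Sum>i=1..N. real i / p) = (real N)\<^sup>2 / (2 * p) + real N / p / 2" .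
  moreover have "0 \<le> real N / p" using assms by simp
  moreover have "\<bar>S + v\<bar> \<le> u + w" if "\<bar>S + T\<bar> \<le> w" "T = v + u / 2" "0 \<le> u" for S T u v w :: real
    using that by linarith
  ultimately show ?thesis using 1 by blast
qed

lemma ln_lagZ:
  assumes I: "finite I" and pos: "0 < \<beta>" "0 < a" "0 < c" and n: "card I = N"
  shows "ln (lagZ \<beta> a c I) = ln (Kprod \<beta> N) + (\<Sum>j<N. ln (Gamma (a + \<beta> / 2 * real j))) - (real N * a + \<beta> / 2 * (real N * (real N - 1))) * ln c"
proof -
  have g: "0 < a + \<beta> / 2 * real j" for j using pos by (intro add_pos_nonneg) auto
  have K: "0 < Kprod \<beta> N" unfolding Kprod_def using pos
    by (intro prod_pos divide_pos_pos Gamma_real_pos) (auto intro!: add_pos_nonneg)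
  have "ln (Gprod \<beta> N a) = (\<Sum>j<N. ln (Gamma (a + \<beta> / 2 * real j)))"
    unfolding Gprod_def using Gamma_real_pos[OF g] by (intro ln_prod) (auto simp: less_imp_neq[symmetric])
  moreover have "ln (lagZ \<beta> a c I) = ln (Kprod \<beta> N * Gprod \<beta> N a) + ln (c powr - (real N * a + \<beta> / 2 * (real N * (real N - 1))))"
    unfolding lagZ_eq[OF I pos n] using K Gprod_pos[OF pos(1,2), of N] pos by (intro ln_mult_pos) auto
  moreover have "ln (Kprod \<beta> N * Gprod \<beta> N a) = ln (Kprod \<beta> N) + ln (Gprod \<beta> N a)"
    using K Gprod_pos[OF pos(1,2), of N] by (intro ln_mult_pos)
  ultimately show ?thesis using pos by (simp add: ln_powr algebra_simps)
qed

lemma sum_ln_shape: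
  assumes p: "0 < p" "2 * real N < p" and g: "0 < (g::real)"
  shows "(\<Sum>j<N. ln (g * (p - real N + real j))) = real N * ln (g * p) + (\<Sum>i=1..N. ln (1 - real i / p))"
proof -
  have "(\<Sum>j<N. ln (g * (p - real N + real j))) = (\<Sum>i=1..N. ln (g * (p - real i)))"
    by (rule sum.reindex_bij_witness[of _ "\<lambda>i. N - i" "\<lambda>j. N - j"]) (auto simp: algebra_simps of_nat_diff)
  also have "\<dots> = (\<Sum>i=1..N. ln (g * p) + ln (1 - real i / p))"
  proof (rule sum.cong[OF refl])
    fix i assume "i \<in> {1..N}"
    then have "real i < p" using p by auto
    then have "0 < 1 - real i / p" using p by simp
    moreover have "g * (p - real i) = g * p * (1 - real i / p)" using p by (simp add: field_simps)
    ultimately show "ln (g * (p - real i)) = ln (g * p) + ln (1 - real i / p)" using g p by (simp only:) (intro ln_mult_pos, auto)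
  qed
  finally show ?thesis by (simp add: sum.distrib)
qed

lemma ln_one_plus_bound: "0 \<le> (d::real) \<Longrightarrow> \<bar>ln (1 + d) - d\<bar> \<le> d\<^sup>2 / 2"
  using ln_one_plus_ge_quadratic[of d] ln_add_one_self_le_self[of d] by (auto simp: abs_le_iff)

text \<open>Raising the exponent by \<rho> multiplies each Gamma factor by about
  \<open>X j powr \<rho>\<close>; this yields \<open>N * \<rho> * ln (\<beta> * p / 2)\<close> and
  the quadratic term. Changing the rate from \<open>1 / 2\<close> to
  \<open>(1 + \<delta>) / 2\<close> costs \<open>M * ln (1 + \<delta>)\<close>, about
  \<open>N * \<beta> * q\<close>, and the powers of 2 turn \<open>\<beta> * p / 2\<close> into
  \<open>\<beta> * p\<close>. The errors are \<open>E1\<close> (Gamma ratios), \<open>E2\<close>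
  (sum of logarithms) and \<open>E3\<close> (rate).\<close>

lemma ln_lagZ_tilt:
  fixes p :: real
  assumes \<beta>: "0 < \<beta>" and I: "finite I" "card I = N" and r: "0 < r"
    and p: "2 * (real N + 1) \<le> p" "4 \<le> \<beta> * p"
  defines "a \<equiv> \<beta> * (p - real N) / 2" and "\<rho> \<equiv> \<beta> * r\<^sup>2" and "q \<equiv> r + r\<^sup>2"
  shows "\<bar>ln (lagZ \<beta> (a + \<rho>) (1 / 2 + \<beta> * q / (\<beta> * p)) I) - ln (lagZ \<beta> a (1 / 2) I)
      - real N * \<rho> * ln (\<beta> * p) + real N * \<beta> * q + \<rho> * (real N)\<^sup>2 / (2 * p)\<bar>
    \<le> (4 * (1 + \<rho>) ^ 3 / \<beta> + \<rho> + 2 * (\<beta> + \<rho>) * q + 2 * (\<beta> + \<rho>) * q\<^sup>2) * (real N / p) + \<rho> * (real N ^ 3 / p\<^sup>2)"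
proof -
  have p0: "0 < p" "1 \<le> p" using p by auto
  have q0: "0 \<le> q" "0 \<le> \<rho>" using r \<beta> by (auto simp: q_def \<rho>_def)
  have Np: "real N \<le> p / 2" using p by simp
  have a: "\<beta> * p / 4 \<le> a" "1 \<le> a"
  proof -
    have "\<beta> * (p / 2) \<le> \<beta> * (p - real N)" using Np \<beta> by (intro mult_left_mono) auto
    then show "\<beta> * p / 4 \<le> a" by (simp add: a_def)
    then show "1 \<le> a" using p by simp
  qed
  define \<delta> where "\<delta> = 2 * q / p"
  have \<delta>: "0 \<le> \<delta>" using q0 p0 by (simp add: \<delta>_def)
  define c' where "c' = 1 / 2 + \<beta> * q / (\<beta> * p)"
  have c': "c' = (1 + \<delta>) / 2" using \<beta> by (simp add: c'_def \<delta>_def)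
  have c'pos: "0 < c'" using \<delta> by (simp add: c')
  have lnc': "ln c' = ln (1 + \<delta>) - ln 2" unfolding c' using \<delta> by (simp add: ln_div)
  define X where "X j = a + \<beta> / 2 * real j" for j :: nat
  have X: "X j = \<beta> / 2 * (p - real N + real j)" for j
    by (simp add: X_def a_def algebra_simps add_divide_distrib diff_divide_distrib)
  have X1: "1 \<le> X j" "\<beta> * p / 4 \<le> X j" for j using a \<beta> by (auto simp: X_def intro: add_increasing2)
  define er where "er j = ln (Gamma (X j + \<rho>)) - ln (Gamma (X j)) - \<rho> * ln (X j)" for j
  have "\<bar>er j\<bar> \<le> (1 + \<rho>) ^ 3 / (\<beta> * p / 4)" for j
  proof -
    have "\<bar>er j\<bar> \<le> (1 + \<rho>) ^ 3 / X j" unfolding er_def by (rule ln_Gamma_add_bound[OF X1(1) q0(2)])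
    also have "\<dots> \<le> (1 + \<rho>) ^ 3 / (\<beta> * p / 4)" 
    proof (rule divide_left_mono[OF X1(2)])
      have "0 < X j" using X1(1)[of j] by linarith
      then show "0 < X j * (\<beta> * p / 4)" using \<beta> p0 by simp
    qed (use q0 in simp)
    finally show ?thesis .
  qed
  then have "(\<Sum>j<N. \<bar>er j\<bar>) \<le> (\<Sum>j<N. (1 + \<rho>) ^ 3 / (\<beta> * p / 4))" by (intro sum_mono) auto
  then have E1: "\<bar>\<Sum>j<N. er j\<bar> \<le> 4 * (1 + \<rho>) ^ 3 / \<beta> * (real N / p)"
    using order_trans[OF sum_abs, of er "{..<N}"] by (simp add: field_simps)
  define S where "S = (\<Sum>i=1..N. ln (1 - real i / p))"
  have E2: "\<bar>\<rho> * (S + (real N)\<^sup>2 / (2 * p))\<bar> \<le> \<rho> * (real N / p + real N ^ 3 / p\<^sup>2)"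
    unfolding abs_mult abs_of_nonneg[OF q0(2)] S_def
    using sum_ln_one_minus[of p N] p0 Np q0 by (intro mult_left_mono) auto
  \<comment> \<open>The partition function with exponent \<open>a + \<rho>\<close> is proportional
    to the rate to the power \<open>- M\<close>.\<close>
  define M where "M = real N * (\<beta> / 2 * (p - 1) + \<rho>)"
  have M: "0 \<le> M" "M \<le> real N * ((\<beta> + \<rho>) * p)"
  proof -
    show "0 \<le> M" unfolding M_def using \<beta> p0 q0 by (intro mult_nonneg_nonneg add_nonneg_nonneg) auto
    have "\<rho> * 1 \<le> \<rho> * p" using p0 q0 by (intro mult_left_mono) auto
    moreover have "\<beta> / 2 * (p - 1) \<le> \<beta> * p" using \<beta> p0 by (intro mult_mono) auto
    ultimately have "\<beta> / 2 * (p - 1) + \<rho> \<le> (\<beta> + \<rho>) * p" unfolding distrib_right by linarith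
    then show "M \<le> real N * ((\<beta> + \<rho>) * p)" unfolding M_def by (rule mult_left_mono) simp
  qed
  \<comment> \<open>\<open>M * \<delta>\<close> differs from \<open>N * \<beta> * q\<close> by
    \<open>(2 * \<rho> - \<beta>) * q * N / p\<close>, and the quadratic term of the logarithm is of
    the same order.\<close>
  have E3: "\<bar>real N * \<beta> * q - M * ln (1 + \<delta>)\<bar> \<le> (2 * (\<beta> + \<rho>) * q + 2 * (\<beta> + \<rho>) * q\<^sup>2) * (real N / p)"
  proof -
    have Md: "M * \<delta> = real N * \<beta> * q + (2 * \<rho> - \<beta>) * q * (real N / p)"
      using p0 by (simp add: M_def \<delta>_def field_simps)
    have "\<bar>M * ln (1 + \<delta>) - M * \<delta>\<bar> = M * \<bar>ln (1 + \<delta>) - \<delta>\<bar>" using M by (simp add: abs_mult flip: right_diff_distrib)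
    also have "\<dots> \<le> (real N * ((\<beta> + \<rho>) * p)) * (\<delta>\<^sup>2 / 2)"
      using M ln_one_plus_bound[OF \<delta>] \<beta> q0 p0 by (intro mult_mono) auto
    also have "\<dots> = 2 * (\<beta> + \<rho>) * q\<^sup>2 * (real N / p)" using p0 by (simp add: \<delta>_def field_simps power2_eq_square)
    finally have A: "\<bar>M * ln (1 + \<delta>) - M * \<delta>\<bar> \<le> 2 * (\<beta> + \<rho>) * q\<^sup>2 * (real N / p)" .
    have "\<bar>2 * \<rho> - \<beta>\<bar> \<le> 2 * (\<beta> + \<rho>)" using \<beta> q0 by (simp add: abs_le_iff)
    then have "\<bar>2 * \<rho> - \<beta>\<bar> * (q * (real N / p)) \<le> 2 * (\<beta> + \<rho>) * (q * (real N / p))"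
      using q0 p0 by (intro mult_right_mono) auto
    then have B: "\<bar>(2 * \<rho> - \<beta>) * q * (real N / p)\<bar> \<le> 2 * (\<beta> + \<rho>) * q * (real N / p)"
      using q0 p0 by (simp add: abs_mult mult_ac)
    show ?thesis unfolding distrib_right using A B Md by (simp only: abs_le_iff) linarith
  qed
  have "(\<Sum>j<N. ln (Gamma (X j + \<rho>))) = (\<Sum>j<N. ln (Gamma (X j))) + \<rho> * (\<Sum>j<N. ln (X j)) + (\<Sum>j<N. er j)"
    by (simp add: er_def sum_subtractf sum_distrib_left)
  moreover have "(\<Sum>j<N. ln (X j)) = real N * ln (\<beta> * p / 2) + S"
    unfolding X S_def using sum_ln_shape[of p N "\<beta> / 2"] p0 p \<beta> by simp
  moreover have "ln (\<beta> * p / 2) = ln (\<beta> * p) - ln 2" using \<beta> p0 by (simp add: ln_div)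
  ultimately have G: "(\<Sum>j<N. ln (Gamma (X j + \<rho>))) = (\<Sum>j<N. ln (Gamma (X j))) + \<rho> * (real N * (ln (\<beta> * p) - ln 2) + S) + (\<Sum>j<N. er j)"
    by simp
  have a0: "0 < a" "0 < a + \<rho>" using a q0 by auto
  have X': "a + \<rho> + \<beta> / 2 * real j = X j + \<rho>" for j by (simp add: X_def)
  have ex: "real N * (a + \<rho>) + \<beta> / 2 * (real N * (real N - 1)) = M" "real N * a + \<beta> / 2 * (real N * (real N - 1)) = M - real N * \<rho>"
    by (simp_all add: M_def a_def field_simps)
  have "ln (lagZ \<beta> (a + \<rho>) c' I) = ln (Kprod \<beta> N) + (\<Sum>j<N. ln (Gamma (X j + \<rho>))) - M * (ln (1 + \<delta>) - ln 2)"
    using ln_lagZ[OF I(1) \<beta> a0(2) c'pos I(2)] unfolding ex lnc' X' .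
  moreover have "ln (lagZ \<beta> a (1 / 2) I) = ln (Kprod \<beta> N) + (\<Sum>j<N. ln (Gamma (X j))) + (M - real N * \<rho>) * ln 2"
    using ln_lagZ[OF I(1) \<beta> a0(1) _ I(2), of "1/2"] unfolding ex X_def[symmetric] by (simp add: ln_div)
  ultimately have "ln (lagZ \<beta> (a + \<rho>) c' I) - ln (lagZ \<beta> a (1 / 2) I) - real N * \<rho> * ln (\<beta> * p) + real N * \<beta> * q + \<rho> * (real N)\<^sup>2 / (2 * p)
     = (\<Sum>j<N. er j) + \<rho> * (S + (real N)\<^sup>2 / (2 * p)) + (real N * \<beta> * q - M * ln (1 + \<delta>))"
    unfolding G by (simp add: algebra_simps)
  also have "\<bar>\<dots>\<bar> \<le> 4 * (1 + \<rho>) ^ 3 / \<beta> * (real N / p) + \<rho> * (real N / p + real N ^ 3 / p\<^sup>2) + (2 * (\<beta> + \<rho>) * q + 2 * (\<beta> + \<rho>) * q\<^sup>2) * (real N / p)"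
    using E1 E2 E3 by (intro abs_triangle_ineq[THEN order_trans] add_mono)
  also have "\<dots> = (4 * (1 + \<rho>) ^ 3 / \<beta> + \<rho> + 2 * (\<beta> + \<rho>) * q + 2 * (\<beta> + \<rho>) * q\<^sup>2) * (real N / p) + \<rho> * (real N ^ 3 / p\<^sup>2)"
    by (simp only: distrib_left distrib_right add_ac)
  finally show ?thesis unfolding c'_def .
qed

section \<open>The truncation error is negligible\<close>

lemma ln_Gamma_diff_le:
  assumes "1 \<le> x" "x \<le> (y::real)"
  shows "ln (Gamma y) - ln (Gamma x) \<le> (y - x) * ln y + 1"
proof -
  have "1 / (2 * y) \<le> 1 / 2" "1 / (2 * x) \<le> 1 / 2" using assms by (auto simp: field_simps)
  then have s: "stirling_rem y - stirling_rem x \<le> 1"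
    using stirling_rem_bound[of x] stirling_rem_bound[of y] assms by linarith
  have "(x - 1 / 2) * (ln y - ln x) \<le> y - x"
  proof -
    have "ln y - ln x = ln (y / x)" using assms by (simp add: ln_div)
    also have "\<dots> \<le> y / x - 1" using assms by (intro ln_le_minus_one) auto
    also have "\<dots> = (y - x) / x" using assms by (simp add: field_simps)
    finally have "(x - 1 / 2) * (ln y - ln x) \<le> x * ((y - x) / x)" using assms by (intro mult_mono) auto
    then show ?thesis using assms by simp
  qed
  moreover have "(x - 1 / 2) * (ln y - ln x) = x * ln y - x * ln x - ln y / 2 + ln x / 2"
    by (simp add: algebra_simps diff_divide_distrib)
  moreover have "ln (Gamma x) = x * ln x - ln x / 2 - x + stirling_rem x"
    using ln_Gamma_stirling[of x] assms by (simp add: algebra_simps)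
  moreover have "ln (Gamma y) = y * ln y - ln y / 2 - y + stirling_rem y"
    using ln_Gamma_stirling[of y] assms by (simp add: algebra_simps)
  moreover have "(y - x) * ln y = y * ln y - x * ln y" by (simp add: algebra_simps)
  ultimately show ?thesis using s by linarith
qed

lemma ln_Gamma_1_plus_ge:
  assumes "0 < (y::real)"
  shows "y * ln y - y - 2 \<le> ln (Gamma (1 + y))"
proof -
  have "1 / (2 * (1 + y)) \<le> 1" using assms by (simp add: field_simps)
  moreover have "0 \<le> ln (2 * pi)" using pi_ge_two by (intro ln_ge_zero) auto
  ultimately have "- 1 \<le> stirling_rem (1 + y)" using stirling_rem_bound[of "1 + y"] assms by linarith
  moreover have "y * ln y \<le> y * ln (1 + y)" using assms by (intro mult_left_mono) auto
  moreover have "0 \<le> ln (1 + y)" using assms by simp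
  moreover have "ln (Gamma (1 + y)) = y * ln (1 + y) + ln (1 + y) / 2 - 1 - y + stirling_rem (1 + y)"
    using ln_Gamma_stirling[of "1 + y"] assms by (simp add: algebra_simps)
  ultimately show ?thesis by linarith
qed

text \<open>Dividing the closed forms for \<open>N\<close> and \<open>N - 1\<close> particles leaves
  the last factor of each product and a power of the rate.\<close>

lemma lagZ_remove_ratio:
  assumes I: "finite I" "card I = N" "i \<in> I" and pos: "0 < \<beta>" "0 < a" "0 < c"
  shows "lagZ \<beta> a c I = lagZ \<beta> a c (I - {i}) * (Gamma (1 + \<beta> / 2 * real N) / Gamma (1 + \<beta> / 2) * Gamma (a + \<beta> / 2 * (real N - 1)) * c powr - (a + \<beta> * (real N - 1)))"
proof -
  obtain m where m: "N = Suc m" using I by (cases N) auto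
  have c: "card (I - {i}) = m" "finite (I - {i})" using I m by auto
  have "- (real (Suc m) * a + \<beta> / 2 * (real (Suc m) * (real (Suc m) - 1))) = - (real m * a + \<beta> / 2 * (real m * (real m - 1))) + - (a + \<beta> * (real (Suc m) - 1))"
    by (simp add: algebra_simps)
  then have e: "c powr - (real (Suc m) * a + \<beta> / 2 * (real (Suc m) * (real (Suc m) - 1))) = c powr - (real m * a + \<beta> / 2 * (real m * (real m - 1))) * c powr - (a + \<beta> * (real (Suc m) - 1))"
    by (simp only: powr_add)
  have "real (Suc m) - 1 = real m" by simp
  then show ?thesis
    unfolding m lagZ_eq[OF I(1) pos I(2)[unfolded m]] lagZ_eq[OF c(2) pos c(1)] e Kprod_def Gprod_def prod.lessThan_Suc
    by (simp only: mult_ac)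
qed

text \<open>The Gamma tail beats the entropic factor \<open>(p / n)\<^bsup>O(n)\<^esup>\<close> as soon as \<open>p / n\<close> is large.\<close>

lemma truncation_small:
  assumes \<beta>: "0 < \<beta>" and R: "0 < R" and z0: "0 < z0" "z0 \<le> 1"
  shows "\<exists>K\<ge>1. \<forall>N p r. 1 \<le> N \<longrightarrow> K * (real N + 1) \<le> p \<longrightarrow> 0 < r \<longrightarrow> r \<le> R \<longrightarrow>
    ln (2 * (real N + 1)) + ln (real N) - (1 / 2 + \<beta> * (r + r\<^sup>2) / (\<beta> * p)) * (z0 / 2) * (\<beta> * p * (1 + z0))
    - (\<beta> * (p - real N) / 2 + \<beta> * r\<^sup>2 + \<beta> * (real N - 1)) * ln (1 - z0 / 2)
    + ln (Gamma (\<beta> * (p - real N) / 2 + \<beta> * r\<^sup>2 + \<beta> * (real N - 1)))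
    - ln (Gamma (\<beta> * (p - real N) / 2 + \<beta> * r\<^sup>2 + \<beta> / 2 * (real N - 1)))
    + ln (Gamma (1 + \<beta> / 2)) - ln (Gamma (1 + \<beta> / 2 * real N)) \<le> 0"
proof -
  define g where "g = \<beta> / 2"
  have g: "0 < g" using \<beta> by (simp add: g_def)
  define Q where "Q = \<beta> * R\<^sup>2"
  have Q: "0 \<le> Q" using \<beta> by (simp add: Q_def)
  define C2 where "C2 = 2 * (2 * g + Q) / g"
  have C2: "4 \<le> C2" using g Q by (simp add: C2_def field_simps)
  define w where "w = z0\<^sup>2 / 8"
  have w: "0 < w" "w \<le> 1" using z0 power_le_one[of z0 2] by (auto simp: w_def)
  define C4 where "C4 = 6 + \<bar>ln (Gamma (1 + \<beta> / 2))\<bar> + 2 * g + Q + g * ln C2 - g * ln w"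
  define K where "K = max (max 2 (4 / \<beta>)) (C4 / (g * w))"
  have K: "2 \<le> K" "4 / \<beta> \<le> K" "C4 / (g * w) \<le> K" by (auto simp: K_def)
  show ?thesis
  proof (intro exI[of _ K] conjI allI impI)
    show "1 \<le> K" using K by simp
    fix N :: nat and p r :: real
    assume N: "1 \<le> N" and p: "K * (real N + 1) \<le> p" and r: "0 < r" "r \<le> R"
    define n where "n = real N + 1"
    have n: "2 \<le> n" "real N = n - 1" using N by (auto simp: n_def)
    have p2: "2 * n \<le> p" "4 / \<beta> \<le> p"
    proof -
      have "2 * n \<le> K * n" using K n by (intro mult_right_mono) auto
      then show "2 * n \<le> p" using p by (simp add: n_def)
      have "4 / \<beta> * 1 \<le> K * n" using K n \<beta> by (intro mult_mono) auto
      then show "4 / \<beta> \<le> p" using p by (simp add: n_def)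
    qed
    have p0: "0 < p" using p2 n by linarith
    have bp: "4 \<le> \<beta> * p" using p2(2) \<beta> by (simp add: field_simps)
    define \<rho> where "\<rho> = \<beta> * r\<^sup>2"
    have \<rho>: "0 \<le> \<rho>" "\<rho> \<le> Q" using \<beta> r by (auto simp: \<rho>_def Q_def intro!: mult_left_mono power_mono)
    define A where "A = \<beta> * (p - real N) / 2 + \<rho> + \<beta> * (real N - 1)"
    define x1 where "x1 = \<beta> * (p - real N) / 2 + \<rho> + \<beta> / 2 * (real N - 1)"
    have x1eq: "x1 = g * (p - 1) + \<rho>" by (simp add: x1_def g_def field_simps)
    have Aeq: "A = x1 + g * (real N - 1)" by (simp add: A_def x1_def g_def field_simps)
    have x1: "1 \<le> x1"
    proof -
      have "p / 2 \<le> p - 1" using p2 n by simp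
      then have "g * (p / 2) \<le> g * (p - 1)" using g by (intro mult_left_mono) auto
      then show ?thesis using bp \<rho> by (simp add: x1eq g_def)
    qed
    have AX: "x1 \<le> A" using Aeq g N by simp
    have Ale: "A \<le> g * p + (g * n + Q)"
      using Aeq x1eq \<rho> g n by (simp add: algebra_simps)
    define Y where "Y = g * real N"
    have Y: "0 < Y" "Y \<le> g * n" "g * (n / 2) \<le> Y" using g N n by (auto simp: Y_def)
    define \<tau> where "\<tau> = z0 / 2"
    have \<tau>: "0 < \<tau>" "\<tau> \<le> 1 / 2" using z0 by (auto simp: \<tau>_def)
    have tail: "- ln (1 - \<tau>) \<le> \<tau> + \<tau>\<^sup>2"
    proof -
      have "\<tau> ^ 3 \<le> \<tau>\<^sup>2 / 2" using mult_left_mono[OF \<tau>(2), of "\<tau>\<^sup>2"] by (simp add: power2_eq_square power3_eq_cube)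
      then show ?thesis using ln_one_minus_ge_cubic[of \<tau>] \<tau> by linarith
    qed
    have t1: "- A * ln (1 - \<tau>) \<le> g * p * (\<tau> + \<tau>\<^sup>2) + (g * n + Q)"
    proof -
      have "A * - ln (1 - \<tau>) \<le> (g * p + (g * n + Q)) * (\<tau> + \<tau>\<^sup>2)"
        using tail Ale x1 AX \<tau> by (intro mult_mono) auto
      moreover have "(g * n + Q) * (\<tau> + \<tau>\<^sup>2) \<le> (g * n + Q) * 1"
      proof (intro mult_left_mono)
        have "\<tau>\<^sup>2 \<le> (1 / 2)\<^sup>2" using \<tau> by (intro power_mono) auto
        then show "\<tau> + \<tau>\<^sup>2 \<le> 1" using \<tau> by (simp add: power2_eq_square)
      qed (use g n Q in auto)
      ultimately show ?thesis by (simp add: algebra_simps)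
    qed
    have t2: "g * p * (\<tau> * (1 + z0)) \<le> (1 / 2 + \<beta> * (r + r\<^sup>2) / (\<beta> * p)) * (z0 / 2) * (\<beta> * p * (1 + z0))"
    proof -
      have "0 \<le> \<beta> * (r + r\<^sup>2) / (\<beta> * p)" using \<beta> r p0 by simp
      then have "1 / 2 * (\<tau> * (\<beta> * p * (1 + z0))) \<le> (1 / 2 + \<beta> * (r + r\<^sup>2) / (\<beta> * p)) * (\<tau> * (\<beta> * p * (1 + z0)))"
        using \<tau> \<beta> p0 z0 by (intro mult_right_mono) auto
      then show ?thesis by (simp add: g_def \<tau>_def mult_ac)
    qed
    \<comment> \<open>Net exponential gain of tilting the tail, with \<open>w\<close> chosen to be
      half of it per unit of \<open>g * p\<close>. One half pays for the entropic logarithm in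
      \<open>t9\<close>, the other for everything linear in \<open>n\<close>, by \<open>t10\<close>
      and the choice of \<open>K\<close>.\<close>
    have t3: "g * p * (\<tau> + \<tau>\<^sup>2) - g * p * (\<tau> * (1 + z0)) = - 2 * (g * p * w)"
      by (simp add: \<tau>_def w_def power2_eq_square algebra_simps)
    have t4: "ln (Gamma A) - ln (Gamma x1) \<le> Y * ln A + 1"
    proof -
      have "ln (Gamma A) - ln (Gamma x1) \<le> (A - x1) * ln A + 1" by (rule ln_Gamma_diff_le[OF x1 AX])
      also have "(A - x1) * ln A \<le> Y * ln A" using Aeq g x1 AX by (intro mult_right_mono) (auto simp: Y_def)
      finally show ?thesis by simp
    qed
    have t5: "Y * ln Y - Y - 2 \<le> ln (Gamma (1 + \<beta> / 2 * real N))"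
      using ln_Gamma_1_plus_ge[OF Y(1)] by (simp add: Y_def g_def)
    \<comment> \<open>This is the entropic factor: the Gamma quotients behave like
      \<open>(A / Y) powr Y\<close>, where \<open>A / Y\<close> is at most a constant times
      \<open>p / n\<close>.\<close>
    have t6: "Y * ln A - Y * ln Y \<le> g * n * (ln C2 + ln (p / n))"
    proof -
      have "A \<le> (2 * g + Q) * p"
      proof -
        have "1 \<le> p" "n \<le> p" using p2 n by linarith+
        then have "g * n \<le> g * p" "Q * 1 \<le> Q * p" using g mult_left_mono[OF _ Q, of 1 p] by auto
        then show ?thesis using Ale by (simp add: algebra_simps)
      qed
      also have "\<dots> = C2 * (p / n) * (g * (n / 2))" using g n by (simp add: C2_def field_simps)
      also have "\<dots> \<le> C2 * (p / n) * Y" using Y C2 p0 n by (intro mult_left_mono) auto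
      finally have AY: "A / Y \<le> C2 * (p / n)" using Y by (simp add: pos_divide_le_eq)
      have A0: "0 < A" using x1 AX by simp
      have pn: "1 \<le> p / n" using p2 n by simp
      have C2p: "1 * 1 \<le> C2 * (p / n)" using C2 pn by (intro mult_mono) auto
      have "Y * ln A - Y * ln Y = Y * ln (A / Y)" using Y A0 by (simp add: ln_div algebra_simps)
      also have "\<dots> \<le> Y * ln (C2 * (p / n))"
      proof (intro mult_left_mono)
        have "0 < A / Y" using A0 Y by simp
        moreover have "0 < C2 * (p / n)" using C2p by linarith
        ultimately show "ln (A / Y) \<le> ln (C2 * (p / n))" using AY by (simp only: ln_le_cancel_iff)
      qed (use Y in simp)
      also have "\<dots> \<le> g * n * ln (C2 * (p / n))" using Y C2p by (intro mult_right_mono) auto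
      also have "ln (C2 * (p / n)) = ln C2 + ln (p / n)" using C2 pn by (intro ln_mult_pos) auto
      finally show ?thesis .
    qed
    \<comment> \<open>The logarithm lies below a line of any prescribed slope \<open>w\<close>, so
      the entropic factor can be charged to a small fraction of \<open>p\<close>.\<close>
    have t7: "ln (p / n) \<le> p / n * w - ln w"
    proof -
      have "ln (p / n * w) \<le> p / n * w - 1" using p0 n w by (intro ln_le_minus_one) auto
      moreover have "ln (p / n * w) = ln (p / n) + ln w" using p0 n w by (intro ln_mult_pos) auto
      ultimately show ?thesis by simp
    qed
    have t8: "ln (2 * (real N + 1)) + ln (real N) \<le> 3 * n"
    proof -
      have "ln (2 * n) \<le> 2 * n - 1" "ln (n - 1) \<le> n - 1 - 1"
        using n(1) ln_le_minus_one[of "2 * n"] ln_le_minus_one[of "n - 1"] by linarith+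
      moreover have "real N + 1 = n" by (simp add: n_def)
      ultimately show ?thesis unfolding n(2) using n by simp
    qed
    have t9: "g * n * (ln C2 + ln (p / n)) \<le> n * (g * ln C2 - g * ln w) + g * p * w"
    proof -
      have "g * n * (ln C2 + ln (p / n)) \<le> g * n * (ln C2 + (p / n * w - ln w))"
        using t7 g n by (intro mult_left_mono) auto
      also have "\<dots> = n * (g * ln C2 - g * ln w) + g * p * w" using n by (simp add: field_simps)
      finally show ?thesis .
    qed
    have t10: "n * C4 \<le> g * p * w"
    proof -
      have "n * (C4 / (g * w)) \<le> n * K" using K n by (intro mult_left_mono) auto
      also have "\<dots> \<le> p" using p by (simp add: n_def mult.commute)
      finally show ?thesis using g w by (simp add: field_simps)
    qed
    have t11: "3 * n + (g * n + Q) + 1 + (Y + 2) + ln (Gamma (1 + \<beta> / 2)) + n * (g * ln C2 - g * ln w) \<le> n * C4"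
    proof -
      let ?G = "\<bar>ln (Gamma (1 + \<beta> / 2))\<bar>"
      have "1 * ?G \<le> n * ?G" by (rule mult_right_mono) (use n in auto)
      moreover have "1 * Q \<le> n * Q" by (rule mult_right_mono) (use n Q in auto)
      moreover have "n * C4 = 6 * n + n * ?G + 2 * (g * n) + n * Q + n * (g * ln C2 - g * ln w)"
        by (simp add: C4_def algebra_simps)
      moreover have "ln (Gamma (1 + \<beta> / 2)) \<le> ?G" by simp
      ultimately show ?thesis using Y n by linarith
    qed
    have "ln (2 * (real N + 1)) + ln (real N) - (1 / 2 + \<beta> * (r + r\<^sup>2) / (\<beta> * p)) * (z0 / 2) * (\<beta> * p * (1 + z0))
      - A * ln (1 - \<tau>) + ln (Gamma A) - ln (Gamma x1) + ln (Gamma (1 + \<beta> / 2)) - ln (Gamma (1 + \<beta> / 2 * real N)) \<le> 0"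
      using t1 t2 t3 t4 t5 t6 t8 t9 t10 t11 by linarith
    then show "ln (2 * (real N + 1)) + ln (real N) - (1 / 2 + \<beta> * (r + r\<^sup>2) / (\<beta> * p)) * (z0 / 2) * (\<beta> * p * (1 + z0))
      - (\<beta> * (p - real N) / 2 + \<beta> * r\<^sup>2 + \<beta> * (real N - 1)) * ln (1 - z0 / 2)
      + ln (Gamma (\<beta> * (p - real N) / 2 + \<beta> * r\<^sup>2 + \<beta> * (real N - 1)))
      - ln (Gamma (\<beta> * (p - real N) / 2 + \<beta> * r\<^sup>2 + \<beta> / 2 * (real N - 1)))
      + ln (Gamma (1 + \<beta> / 2)) - ln (Gamma (1 + \<beta> / 2 * real N)) \<le> 0"
      by (simp only: A_def x1_def \<rho>_def \<tau>_def)
  qed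
qed

text \<open>The first term is the number of particles times the cube of the relative scale
  \<open>sqrt (n / p)\<close>, that is \<open>n powr (5/2) / p powr (3/2)\<close>. The second takes
  up Stirling remainders and the cost of truncation.\<close>

definition err :: "real \<Rightarrow> real \<Rightarrow> real" where
  "err n p = n * sqrt (n / p) ^ 3 + 1 / n"

lemma err_nonneg: "0 < n \<Longrightarrow> 0 < p \<Longrightarrow> 0 \<le> err n p"
  unfolding err_def by (intro add_nonneg_nonneg mult_nonneg_nonneg) auto

lemma sqrt_cube_le_err: "0 < n \<Longrightarrow> n * sqrt (n / p) ^ 3 \<le> err n p"
  by (simp add: err_def)

lemma inverse_le_err: "0 < n \<Longrightarrow> 0 < p \<Longrightarrow> 1 / n \<le> err n p"
  by (simp add: err_def)

text \<open>The two terms of \<open>err\<close> interpolate: with \<open>\<theta>^2 = n / p\<close>,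
  either \<open>\<theta>^2 \<le> 1 / n\<close>, or
  \<open>n * \<theta> \<ge> n * \<theta>^2 \<ge> 1\<close> and then
  \<open>\<theta>^2 \<le> n * \<theta>^3\<close>. Corrections of order \<open>n / p\<close> thus
  require no error term of their own.\<close>

lemma ratio_le_err:
  assumes "1 \<le> n" "n \<le> p"
  shows "n / p \<le> err n p"
proof -
  define \<theta> where "\<theta> = sqrt (n / p)"
  have \<theta>: "0 \<le> \<theta>" "\<theta> \<le> 1" "n / p = \<theta>\<^sup>2" using assms by (auto simp: \<theta>_def)
  show ?thesis
  proof (cases "\<theta>\<^sup>2 \<le> 1 / n")
    case True
    then show ?thesis using inverse_le_err[of n p] assms \<theta> by simp
  next
    case False
    have t2: "\<theta>\<^sup>2 \<le> \<theta>" using \<theta> by (simp add: power2_eq_square mult_left_le)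
    have "1 \<le> n * \<theta>\<^sup>2" using False assms by (simp add: field_simps)
    also have "\<dots> \<le> n * \<theta>" using t2 assms by (intro mult_left_mono) auto
    finally have "\<theta>\<^sup>2 * 1 \<le> \<theta>\<^sup>2 * (n * \<theta>)" by (intro mult_left_mono) auto
    also have "\<dots> = n * \<theta> ^ 3" by (simp add: power2_eq_square power3_eq_cube)
    also have "\<dots> \<le> err n p" unfolding \<theta>_def using assms by (intro sqrt_cube_le_err) auto
    finally show ?thesis using \<theta>(3) by simp
  qed
qed

lemma cube_ratio_le_err:
  assumes "1 \<le> n" "n \<le> p"
  shows "n ^ 3 / p\<^sup>2 \<le> err n p"
proof -
  define \<theta> where "\<theta> = sqrt (n / p)"
  have \<theta>: "0 \<le> \<theta>" "\<theta> \<le> 1" "n / p = \<theta>\<^sup>2" using assms by (auto simp: \<theta>_def)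
  have "n ^ 3 / p\<^sup>2 = n * (n / p)\<^sup>2" by (simp add: power2_eq_square power3_eq_cube)
  also have "\<dots> = n * \<theta> ^ 4" unfolding \<theta>(3) by simp
  also have "\<dots> \<le> n * \<theta> ^ 3" using \<theta> assms by (intro mult_left_mono power_decreasing) auto
  also have "\<dots> \<le> err n p" unfolding \<theta>_def using assms by (intro sqrt_cube_le_err) auto
  finally show ?thesis .
qed

text \<open>By the exact ratio of the partition functions for \<open>N\<close> and
  \<open>N - 1\<close> particles, hypothesis \<open>small\<close> says in logarithmic form that the
  discarded mass is at most the fraction \<open>1 / (2 * (N + 1))\<close> of the total. The fraction
  kept is then at least \<open>exp (- 1 / (N + 1))\<close>. The tail is tilted by
  \<open>h = c * z0 / 2\<close>.\<close>

lemma truncate_ge: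
  assumes \<beta>: "0 < \<beta>" and I: "finite I" "card I = N" "1 \<le> N" and pos: "0 < a" "0 < c" and z0: "0 < z0" "z0 \<le> 1" and S: "0 \<le> S"
    and small: "ln (2 * (real N + 1)) + ln (real N) - c * (z0 / 2) * S - (a + \<beta> * (real N - 1)) * ln (1 - z0 / 2)
      + ln (Gamma (a + \<beta> * (real N - 1))) - ln (Gamma (a + \<beta> / 2 * (real N - 1))) + ln (Gamma (1 + \<beta> / 2)) - ln (Gamma (1 + \<beta> / 2 * real N)) \<le> 0"
  shows "ennreal (exp (- 1 / (real N + 1)) * lagZ \<beta> a c I) \<le> sel \<beta> I (\<lambda>s. gw a c s * of_bool (s \<le> S))"
proof -
  define \<tau> where "\<tau> = z0 / 2"
  have \<tau>: "0 < \<tau>" "\<tau> \<le> 1 / 2" using z0 by (auto simp: \<tau>_def)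
  define A where "A = a + \<beta> * (real N - 1)"
  define x1 where "x1 = a + \<beta> / 2 * (real N - 1)"
  have ge: "0 < A" "0 < x1" using pos \<beta> I unfolding A_def x1_def by (auto intro!: add_pos_nonneg)
  define n where "n = real N + 1"
  have n: "2 \<le> n" using I by (simp add: n_def)
  let ?Z = "lagZ \<beta> a c I"
  have Z: "0 < ?Z" by (rule lagZ_pos[OF I(1) \<beta> pos])
  define T where "T = exp (- (c * \<tau>) * S) * (Gamma A * (c - c * \<tau>) powr - A) * (\<Sum>i\<in>I. lagZ \<beta> a c (I - {i}))"
  have ne: "I \<noteq> {}" using I by auto
  have cA: "a + \<beta> * real (card I - 1) = A" using I by (simp add: A_def of_nat_diff)
  have bound: "ennreal ?Z \<le> sel \<beta> I (\<lambda>s. gw a c s * of_bool (s \<le> S)) + ennreal T"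
    unfolding T_def cA[symmetric] using pos \<tau> by (intro sel_gw_truncate[OF I(1) ne \<beta> pos _ _ S]) auto
  define q where "q = Gamma (1 + \<beta> / 2 * real N) / Gamma (1 + \<beta> / 2) * Gamma x1 * c powr - A"
  have G: "0 < Gamma (1 + \<beta> / 2 * real N)" "0 < Gamma (1 + \<beta> / 2)" "0 < Gamma x1" "0 < Gamma A"
    using \<beta> ge by (auto intro!: Gamma_real_pos add_pos_nonneg)
  have q: "0 < q" using G pos by (simp add: q_def)
  have Zi: "lagZ \<beta> a c (I - {i}) = ?Z / q" if "i \<in> I" for i
  proof -
    have "?Z = lagZ \<beta> a c (I - {i}) * q"
      unfolding q_def x1_def A_def by (rule lagZ_remove_ratio[OF I(1,2) that \<beta> pos])
    then show ?thesis using q by (simp only: nonzero_eq_divide_eq[OF less_imp_neq[OF q, symmetric]])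
  qed
  have T1: "T = exp (- (c * \<tau>) * S) * (Gamma A * (c - c * \<tau>) powr - A) * (real N * (?Z / q))"
    unfolding T_def using Zi I by simp
  have T2: "(c - c * \<tau>) powr - A = c powr - A * (1 - \<tau>) powr - A"
  proof -
    have "c - c * \<tau> = c * (1 - \<tau>)" by (simp add: algebra_simps)
    then show ?thesis by (simp add: powr_mult)
  qed
  have T: "T = ?Z * (exp (- (c * \<tau>) * S) * Gamma A * (1 - \<tau>) powr - A * real N * Gamma (1 + \<beta> / 2) / (Gamma (1 + \<beta> / 2 * real N) * Gamma x1))"
  proof -
    have "e * (g * (u * v)) * (m * (Z / (G1 / G2 * G3 * u))) = Z * (e * g * v * m * G2 / (G1 * G3))"
      if "G1 \<noteq> 0" "G2 \<noteq> 0" "G3 \<noteq> 0" "u \<noteq> 0" for e g u v m Z G1 G2 G3 :: real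
      using that by (simp add: field_simps)
    from this[of "Gamma (1 + \<beta> / 2 * real N)" "Gamma (1 + \<beta> / 2)" "Gamma x1" "c powr - A"] show ?thesis
      unfolding T1 T2 q_def using G pos by simp
  qed
  define D where "D = exp (- (c * \<tau>) * S) * Gamma A * (1 - \<tau>) powr - A * real N * Gamma (1 + \<beta> / 2) / (Gamma (1 + \<beta> / 2 * real N) * Gamma x1)"
  have e: "exp (ln (Gamma (1 + \<beta> / 2 * real N))) = Gamma (1 + \<beta> / 2 * real N)" "exp (ln (Gamma (1 + \<beta> / 2))) = Gamma (1 + \<beta> / 2)"
    "exp (ln (Gamma x1)) = Gamma x1" "exp (ln (Gamma A)) = Gamma A" "exp (ln (real N)) = real N"
    using G I by auto
  have "D = exp (- (c * \<tau>) * S + ln (Gamma A) + - A * ln (1 - \<tau>) + ln (real N) + ln (Gamma (1 + \<beta> / 2)) - (ln (Gamma (1 + \<beta> / 2 * real N)) + ln (Gamma x1)))"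
    unfolding exp_add exp_diff e D_def using \<tau> by (simp add: powr_def)
  also have "\<dots> \<le> exp (- ln (2 * n))"
    using small unfolding exp_le_cancel_iff by (simp add: A_def x1_def n_def \<tau>_def algebra_simps)
  also have "\<dots> = 1 / (2 * n)" using n by (simp add: exp_minus inverse_eq_divide)
  finally have D: "D \<le> 1 / (2 * n)" .
  have D0: "0 \<le> D" unfolding D_def using G by (intro divide_nonneg_nonneg mult_nonneg_nonneg) auto
  have TD: "T = ?Z * D" unfolding T D_def ..
  have "1 / (2 * n) \<le> 1 / 2" using n by (simp add: field_simps)
  then have "exp (- 2 * D) \<le> 1 - D" using D D0 by (intro exp_le_one_minus) auto
  moreover have "exp (- 1 / n) \<le> exp (- 2 * D)" using D by simp
  ultimately have "exp (- 1 / n) \<le> 1 - D" by linarith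
  then have "exp (- 1 / n) * ?Z \<le> (1 - D) * ?Z" using Z by (intro mult_right_mono) auto
  also have "\<dots> = ?Z - T" by (simp add: TD algebra_simps)
  finally have "ennreal (exp (- 1 / n) * ?Z) \<le> ennreal (?Z - T)" by (rule ennreal_leI)
  also have "\<dots> = ennreal ?Z - ennreal T" using Z D0 by (intro ennreal_minus[symmetric]) (simp add: TD)
  also have "\<dots> \<le> sel \<beta> I (\<lambda>s. gw a c s * of_bool (s \<le> S))" using bound by (simp add: ennreal_minus_le_iff add.commute)
  finally show ?thesis by (simp only: n_def)
qed

text \<open>Since \<open>r = \<beta> / (t - \<beta>)\<close> decreases in \<open>t\<close>, its
  value \<open>R\<close> at \<open>t = x\<close> serves for all \<open>t \<ge> x\<close>, so
  \<open>K\<close> and \<open>C\<close> depend on \<beta> and \<open>x\<close> only. Without this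
  uniformity the estimate could not be integrated over the position of the largest particle.\<close>

lemma sel_tw_asymptotics:
  assumes \<beta>: "0 < \<beta>" and x: "\<beta> < x"
  shows "\<exists>K\<ge>1. \<exists>C\<ge>0. \<forall>N p t I. 1 \<le> N \<longrightarrow> K * (real N + 1) \<le> p \<longrightarrow> x \<le> t \<longrightarrow> finite I \<longrightarrow> card I = N \<longrightarrow>
    (let a = \<beta> * (p - real N) / 2; r = \<beta> / (t - \<beta>);
         E = real N * \<beta> * ln (p * (t - \<beta>)) - \<beta> * r\<^sup>2 * (real N)\<^sup>2 / (2 * p)
     in sel \<beta> I (tw \<beta> a (p * t)) \<le> ennreal (lagZ \<beta> a (1 / 2) I * exp (E + C * err (real N + 1) p)) \<and>
        ennreal (lagZ \<beta> a (1 / 2) I * exp (E - C * err (real N + 1) p)) \<le> sel \<beta> I (tw \<beta> a (p * t)))"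
proof -
  define R where "R = \<beta> / (x - \<beta>)"
  have R: "0 < R" using \<beta> x by (simp add: R_def)
  \<comment> \<open>Meets the condition of the lower remainder bound in the worst case
    \<open>r = R\<close>.\<close>
  define z0 where "z0 = min 1 (1 / (2 * R))"
  have z0: "0 < z0" "z0 \<le> 1" "R * z0 \<le> 1 / 2"
  proof -
    show "0 < z0" "z0 \<le> 1" using R by (auto simp: z0_def)
    have "R * z0 \<le> R * (1 / (2 * R))" using R by (intro mult_left_mono) (auto simp: z0_def)
    then show "R * z0 \<le> 1 / 2" using R by simp
  qed
  obtain K1 where K1: "1 \<le> K1" and trunc: "\<And>N p r. 1 \<le> N \<Longrightarrow> K1 * (real N + 1) \<le> p \<Longrightarrow> 0 < r \<Longrightarrow> r \<le> R \<Longrightarrow>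
    ln (2 * (real N + 1)) + ln (real N) - (1 / 2 + \<beta> * (r + r\<^sup>2) / (\<beta> * p)) * (z0 / 2) * (\<beta> * p * (1 + z0))
    - (\<beta> * (p - real N) / 2 + \<beta> * r\<^sup>2 + \<beta> * (real N - 1)) * ln (1 - z0 / 2)
    + ln (Gamma (\<beta> * (p - real N) / 2 + \<beta> * r\<^sup>2 + \<beta> * (real N - 1)))
    - ln (Gamma (\<beta> * (p - real N) / 2 + \<beta> * r\<^sup>2 + \<beta> / 2 * (real N - 1)))
    + ln (Gamma (1 + \<beta> / 2)) - ln (Gamma (1 + \<beta> / 2 * real N)) \<le> 0"
    using truncation_small[OF \<beta> R z0(1,2)] by metis
  define C1 where "C1 = 5 * \<beta> / 2 + 3 + \<beta> * R"
  have C1: "0 < C1" using \<beta> R by (simp add: C1_def add_pos_pos)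
  \<comment> \<open>Chosen so that \<open>\<theta> = D * sqrt (n / p)\<close> gives
    \<open>C1 * n = \<beta> * p / 8 * \<theta>^2\<close>, which together with
    \<open>\<beta> * p / 8 \<le> a - 1\<close> is the moment condition \<open>E\<close>.\<close>
  define D where "D = sqrt (8 * C1 / \<beta>)"
  have D: "0 < D" "D\<^sup>2 = 8 * C1 / \<beta>" using C1 \<beta> by (auto simp: D_def)
  \<comment> \<open>The entries ensure, in this order, negligible truncation,
    \<open>2 * n \<le> p\<close>, \<open>\<beta> * p / 8 \<le> a - 1\<close>, and
    \<open>\<theta> \<le> 1\<close>.\<close>
  define K where "K = Max {K1, 2, 4 + 8 / \<beta>, D\<^sup>2}"
  have K: "K1 \<le> K" "2 \<le> K" "4 + 8 / \<beta> \<le> K" "D\<^sup>2 \<le> K" by (auto simp: K_def)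
  define q1 where "q1 = R + R\<^sup>2"
  define \<rho>1 where "\<rho>1 = \<beta> * R\<^sup>2"
  define CA where "CA = \<beta> * (R ^ 3 + R\<^sup>2) * 34 * D ^ 3"
  define CB where "CB = 4 * (1 + \<rho>1) ^ 3 / \<beta> + \<rho>1 + 2 * (\<beta> + \<rho>1) * q1 + 2 * (\<beta> + \<rho>1) * q1\<^sup>2"
  define C where "C = CA + CB + \<rho>1 + 1"
  have cn: "0 \<le> q1" "0 \<le> \<rho>1" "0 \<le> CA" "0 \<le> CB"
    using \<beta> R D by (auto simp: q1_def \<rho>1_def CA_def CB_def)
  have C0: "0 \<le> C" using cn by (simp add: C_def)
  show ?thesis
  proof (rule exI[of _ K], rule conjI[OF order_trans[OF K1 K(1)]], rule exI[of _ C], rule conjI[OF C0], intro allI impI)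
    fix N :: nat and p t :: real and I :: "nat set"
    assume N: "1 \<le> N" and p: "K * (real N + 1) \<le> p" and t: "x \<le> t" and I: "finite I" "card I = N"
    define n where "n = real N + 1"
    have n: "2 \<le> n" "real N = n - 1" "real N \<le> n" using N by (auto simp: n_def)
    have Kn: "k * n \<le> p" if "k \<le> K" for k
    proof -
      have "k * n \<le> K * n" using that n by (intro mult_right_mono) auto
      then show ?thesis using p unfolding n_def by linarith
    qed
    have p2: "2 * n \<le> p" "D\<^sup>2 * n \<le> p" "K1 * (real N + 1) \<le> p" "(4 + 8 / \<beta>) * n \<le> p"
      using Kn[OF K(2)] Kn[OF K(4)] Kn[OF K(1)] Kn[OF K(3)] by (auto simp: n_def)
    have p0: "0 < p" "n \<le> p" using p2 n by linarith+
    define r where "r = \<beta> / (t - \<beta>)"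
    have tb: "0 < t - \<beta>" using t x by simp
    have r: "0 < r" "r \<le> R" using \<beta> tb t x by (auto simp: r_def R_def intro!: divide_left_mono)
    define \<rho> where "\<rho> = \<beta> * r\<^sup>2"
    define q where "q = r + r\<^sup>2"
    have r2: "r\<^sup>2 \<le> R\<^sup>2" using r by (intro power_mono) auto
    have \<rho>q: "0 \<le> \<rho>" "\<rho> \<le> \<rho>1" "0 \<le> q" "q \<le> q1"
      using r r2 \<beta> by (auto simp: \<rho>_def \<rho>1_def q_def q1_def intro!: mult_left_mono add_mono)
    define a where "a = \<beta> * (p - real N) / 2"
    define s0 where "s0 = \<beta> * p"
    define y where "y = p * t"
    have s0: "0 < s0" "s0 < y" using \<beta> p0 t x by (auto simp: s0_def y_def)
    interpret T: tilt \<beta> a s0 y by unfold_locales (use \<beta> s0 in auto)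
    have ym: "y - s0 = p * (t - \<beta>)" by (simp add: y_def s0_def algebra_simps)
    have Tr: "T.r = r" unfolding T.r_def ym using p0 by (simp add: s0_def r_def)
    have Ta': "T.a' = a + \<rho>" unfolding T.a'_def Tr \<rho>_def ..
    have Tc': "T.c' = 1 / 2 + \<beta> * q / (\<beta> * p)" unfolding T.c'_def Tr by (simp only: q_def s0_def)
    define c' where "c' = 1 / 2 + \<beta> * q / (\<beta> * p)"
    have c'pos: "0 < c'" using \<beta> p0 \<rho>q by (simp add: c'_def add_pos_nonneg)
    have bp: "4 \<le> \<beta> * p" "\<beta> * p / 8 \<le> a - 1"
    proof -
      have "\<beta> * ((4 + 8 / \<beta>) * n) \<le> \<beta> * p" using p2 \<beta> by (intro mult_left_mono) auto
      then have 1: "4 * (\<beta> * n) + 8 * n \<le> \<beta> * p" using \<beta> by (simp add: algebra_simps)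
      have bn: "0 \<le> \<beta> * n" using \<beta> n by simp
      then show "4 \<le> \<beta> * p" using 1 n by linarith
      have "a = \<beta> * p / 2 - \<beta> * real N / 2" by (simp add: a_def algebra_simps diff_divide_distrib)
      moreover have "\<beta> * real N \<le> \<beta> * n" using \<beta> n by (intro mult_left_mono) auto
      ultimately show "\<beta> * p / 8 \<le> a - 1" using 1 bn n by linarith
    qed
    have a: "1 < a" "a \<le> s0 / 2 + 1"
      using bp \<beta> by (auto simp: a_def s0_def algebra_simps diff_divide_distrib)
    define \<theta>0 where "\<theta>0 = sqrt (n / p)"
    define \<theta> where "\<theta> = D * \<theta>0"
    have \<theta>: "0 < \<theta>" "\<theta>\<^sup>2 = D\<^sup>2 * (n / p)" using D n p0 by (auto simp: \<theta>_def \<theta>0_def power_mult_distrib)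
    have "\<theta>\<^sup>2 \<le> 1\<^sup>2" unfolding \<theta>(2) using p2 p0 by (simp add: field_simps)
    then have \<theta>1: "\<theta> \<le> 1" by (rule power2_le_imp_le) simp
    have E: "s0 / 2 - a + 3 + \<beta> * T.r + 2 * \<beta> * real (card I) \<le> (a - 1) * \<theta>\<^sup>2"
    proof -
      have "s0 / 2 - a = \<beta> * real N / 2" by (simp add: s0_def a_def algebra_simps diff_divide_distrib)
      moreover have "2 * \<beta> * real N = 2 * (\<beta> * real N)" by simp
      ultimately have "s0 / 2 - a + 3 + \<beta> * T.r + 2 * \<beta> * real (card I) = 5 / 2 * (\<beta> * real N) + 3 + \<beta> * r"
        unfolding Tr I(2) by linarith
      also have "\<dots> \<le> 5 / 2 * (\<beta> * n) + 3 * n + \<beta> * R * n"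
      proof (intro add_mono)
        have "\<beta> * r * 1 \<le> \<beta> * R * n" using \<beta> r n R by (intro mult_mono) auto
        then show "\<beta> * r \<le> \<beta> * R * n" by simp
      qed (use \<beta> n in \<open>auto intro!: mult_left_mono\<close>)
      also have "\<dots> = C1 * n" by (simp add: C1_def algebra_simps)
      also have "\<dots> = \<beta> * p / 8 * \<theta>\<^sup>2" unfolding \<theta>(2) D(2) using \<beta> p0 by simp
      also have "\<dots> \<le> (a - 1) * \<theta>\<^sup>2" using bp by (intro mult_right_mono) auto
      finally show ?thesis .
    qed
    define \<mu> where "\<mu> = \<beta> * (r ^ 3 + r\<^sup>2) * (34 * real N * \<theta> ^ 3)"
    have \<mu>: "\<mu> \<le> CA * err n p"
    proof -
      have "\<mu> \<le> \<beta> * (R ^ 3 + R\<^sup>2) * (34 * n * \<theta> ^ 3)"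
        unfolding \<mu>_def using \<beta> r n \<theta> R
        by (intro mult_mono add_mono power_mono) (auto intro!: mult_nonneg_nonneg add_nonneg_nonneg)
      also have "\<dots> = CA * (n * \<theta>0 ^ 3)" by (simp add: CA_def \<theta>_def power_mult_distrib)
      also have "\<dots> \<le> CA * err n p" unfolding \<theta>0_def using n cn by (intro mult_left_mono sqrt_cube_le_err) auto
      finally show ?thesis .
    qed
    let ?L = "lagZ \<beta> a (1 / 2) I" and ?L' = "lagZ \<beta> (a + \<rho>) c' I"
    have L: "0 < ?L" "0 < ?L'" using a \<rho>q c'pos by (auto intro!: lagZ_pos I \<beta>)
    let ?\<kappa> = "tilt_scale \<beta> s0 y"
    have \<kappa>: "0 < ?\<kappa>" "ln ?\<kappa> = \<beta> * ln (p * (t - \<beta>)) - \<rho> * ln (\<beta> * p) + \<beta> * q"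
    proof -
      have k: "?\<kappa> = (p * (t - \<beta>)) powr \<beta> * s0 powr - \<rho> * exp (\<beta> * q)"
        unfolding tilt_scale_def ym Let_def using Tr[unfolded T.r_def ym] by (simp add: \<rho>_def q_def)
      show "0 < ?\<kappa>" unfolding k using p0 tb s0 by simp
      have 1: "0 < (p * (t - \<beta>)) powr \<beta>" "0 < s0 powr - \<rho>" using p0 tb s0 by auto
      then show "ln ?\<kappa> = \<beta> * ln (p * (t - \<beta>)) - \<rho> * ln (\<beta> * p) + \<beta> * q"
        unfolding k using p0 tb s0 by (subst ln_mult_pos; (subst ln_mult_pos)?) (auto simp: ln_powr s0_def)
    qed
    define EE where "EE = real N * \<beta> * ln (p * (t - \<beta>)) - \<beta> * r\<^sup>2 * (real N)\<^sup>2 / (2 * p)"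
    define CE where "CE = (CB + \<rho>1) * err n p"
    \<comment> \<open>The part \<open>- N * \<rho> * ln (\<beta> * p) + N * \<beta> * q\<close>
      coming from the tilt scale cancels the main terms of the ratio of partition functions. Only
      the interaction with the centre \<open>s0\<close> and the quadratic term survive in
      \<open>EE\<close>.\<close>
    have main: "\<bar>real N * ln ?\<kappa> + ln ?L' - ln ?L - EE\<bar> \<le> CE"
    proof -
      have "real N * ln ?\<kappa> + ln ?L' - ln ?L - EE = ln ?L' - ln ?L - real N * \<rho> * ln (\<beta> * p) + real N * \<beta> * q + \<rho> * (real N)\<^sup>2 / (2 * p)"
        unfolding \<kappa>(2) EE_def \<rho>_def by (simp add: algebra_simps)
      also have "\<bar>\<dots>\<bar> \<le> (4 * (1 + \<rho>) ^ 3 / \<beta> + \<rho> + 2 * (\<beta> + \<rho>) * q + 2 * (\<beta> + \<rho>) * q\<^sup>2) * (real N / p) + \<rho> * (real N ^ 3 / p\<^sup>2)"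
        unfolding a_def c'_def \<rho>_def q_def
        by (rule ln_lagZ_tilt[OF \<beta> I r(1)]) (use p2 bp in \<open>auto simp: n_def\<close>)
      also have "\<dots> \<le> CB * err n p + \<rho>1 * err n p"
      proof (intro add_mono mult_mono)
        show "4 * (1 + \<rho>) ^ 3 / \<beta> + \<rho> + 2 * (\<beta> + \<rho>) * q + 2 * (\<beta> + \<rho>) * q\<^sup>2 \<le> CB"
          unfolding CB_def using \<rho>q \<beta> cn by (intro add_mono mult_mono divide_right_mono power_mono) auto
        have "real N / p \<le> n / p" using n p0 by (intro divide_right_mono) auto
        then show "real N / p \<le> err n p" using ratio_le_err[of n p] n p0 by linarith
        have "real N ^ 3 / p\<^sup>2 \<le> n ^ 3 / p\<^sup>2" using n p0 by (intro divide_right_mono power_mono) auto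
        then show "real N ^ 3 / p\<^sup>2 \<le> err n p" using cube_ratio_le_err[of n p] n p0 by linarith
      qed (use cn \<rho>q p0 in auto)
      finally show ?thesis by (simp add: CE_def algebra_simps)
    qed
    have prodform: "?\<kappa> ^ N * ?L' = ?L * exp (real N * ln ?\<kappa> + ln ?L' - ln ?L)"
      using \<kappa>(1) L by (simp add: exp_add exp_diff exp_of_nat_mult)
    have err0: "0 \<le> err n p" using n p0 by (intro err_nonneg) auto
    have selV: "sel \<beta> I (\<lambda>s. ?\<kappa> * gw T.a' T.c' s) = ennreal (?\<kappa> ^ N * ?L')"
      unfolding Ta' Tc' c'_def[symmetric] using \<kappa> sel_gw[OF I(1) \<beta>, of "a + \<rho>" c'] a \<rho>q c'pos I
      by (subst sel_cmult) (auto simp: ennreal_mult')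
    have upper: "sel \<beta> I (tw \<beta> a y) \<le> ennreal (?L * exp (EE + C * err n p))"
    proof -
      have "sel \<beta> I (tw \<beta> a y) \<le> ennreal (exp \<mu>) * sel \<beta> I (\<lambda>s. ?\<kappa> * gw T.a' T.c' s)"
        using T.sel_tw_upper[OF I(1) a \<theta>(1) \<theta>1 E] unfolding Tr I(2) \<mu>_def .
      also have "\<dots> = ennreal (?L * exp (\<mu> + (real N * ln ?\<kappa> + ln ?L' - ln ?L)))"
        unfolding selV prodform by (simp add: exp_add mult_ac flip: ennreal_mult')
      also have "\<dots> \<le> ennreal (?L * exp (EE + C * err n p))"
      proof (intro ennreal_leI mult_left_mono)
        have "C * err n p = CA * err n p + CE + err n p" by (simp add: C_def CE_def algebra_simps)
        then have "\<mu> + (real N * ln ?\<kappa> + ln ?L' - ln ?L) \<le> EE + C * err n p" using \<mu> main err0 by linarith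
        then show "exp (\<mu> + (real N * ln ?\<kappa> + ln ?L' - ln ?L)) \<le> exp (EE + C * err n p)" by simp
      qed (use L in simp)
      finally show ?thesis .
    qed
    have lower: "ennreal (?L * exp (EE - C * err n p)) \<le> sel \<beta> I (tw \<beta> a y)"
    proof -
      let ?W = "\<lambda>s. gw T.a' T.c' s * of_bool (s \<le> s0 * (1 + z0))"
      have "ennreal (exp (- 1 / (real N + 1)) * ?L') \<le> sel \<beta> I ?W"
        unfolding Ta' Tc' c'_def
      proof (rule truncate_ge[OF \<beta> I N _ _ z0(1,2)])
        show "0 < a + \<rho>" using a \<rho>q by simp
        show "0 < 1 / 2 + \<beta> * q / (\<beta> * p)" using c'pos by (simp add: c'_def)
        show "0 \<le> s0 * (1 + z0)" using s0 z0 by simp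
        show "ln (2 * (real N + 1)) + ln (real N) - (1 / 2 + \<beta> * q / (\<beta> * p)) * (z0 / 2) * (s0 * (1 + z0))
           - (a + \<rho> + \<beta> * (real N - 1)) * ln (1 - z0 / 2) + ln (Gamma (a + \<rho> + \<beta> * (real N - 1))) - ln (Gamma (a + \<rho> + \<beta> / 2 * (real N - 1)))
           + ln (Gamma (1 + \<beta> / 2)) - ln (Gamma (1 + \<beta> / 2 * real N)) \<le> 0"
          unfolding a_def \<rho>_def q_def s0_def by (rule trunc[OF N p2(3) r])
      qed
      then have "ennreal (?\<kappa> ^ N) * ennreal (exp (- 1 / n) * ?L') \<le> ennreal (?\<kappa> ^ N) * sel \<beta> I ?W"
        unfolding n_def by (intro mult_left_mono) auto
      also have "\<dots> = sel \<beta> I (\<lambda>s. ?\<kappa> * ?W s)" using \<kappa> I by (subst sel_cmult) auto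
      also have "\<dots> = sel \<beta> I (\<lambda>s. ?\<kappa> * gw T.a' T.c' s * of_bool (s \<le> s0 * (1 + z0)))" by (simp add: mult.assoc)
      also have "\<dots> \<le> ennreal (exp \<mu>) * sel \<beta> I (tw \<beta> a y)"
      proof -
        have "r * z0 \<le> R * z0" using r z0 by (intro mult_right_mono) auto
        then have "T.r * z0 \<le> 1 / 2" unfolding Tr using z0 by linarith
        from T.sel_tw_lower[OF I(1) a \<theta>(1) z0(1,2) this E] show ?thesis unfolding Tr I(2) \<mu>_def .
      qed
      finally have le: "ennreal (?\<kappa> ^ N) * ennreal (exp (- 1 / n) * ?L') \<le> ennreal (exp \<mu>) * sel \<beta> I (tw \<beta> a y)" .
      have "ennreal (exp \<mu>) * ennreal (exp (- \<mu> + - 1 / n) * (?\<kappa> ^ N * ?L')) = ennreal (?\<kappa> ^ N) * ennreal (exp (- 1 / n) * ?L')"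
      proof -
        have "exp \<mu> * (exp (- \<mu> + - 1 / n) * (?\<kappa> ^ N * ?L')) = (exp \<mu> * exp (- \<mu> + - 1 / n)) * (?\<kappa> ^ N * ?L')" by (simp only: mult.assoc)
        also have "exp \<mu> * exp (- \<mu> + - 1 / n) = exp (- 1 / n)" by (simp only: exp_add[symmetric]) simp
        finally have "exp \<mu> * (exp (- \<mu> + - 1 / n) * (?\<kappa> ^ N * ?L')) = ?\<kappa> ^ N * (exp (- 1 / n) * ?L')" by (simp only: mult_ac)
        then show ?thesis using \<kappa> L by (simp flip: ennreal_mult')
      qed
      with le have "ennreal (exp \<mu>) * ennreal (exp (- \<mu> + - 1 / n) * (?\<kappa> ^ N * ?L')) \<le> ennreal (exp \<mu>) * sel \<beta> I (tw \<beta> a y)" by simp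
      then have le2: "ennreal (exp (- \<mu> + - 1 / n) * (?\<kappa> ^ N * ?L')) \<le> sel \<beta> I (tw \<beta> a y)"
        by (subst (asm) ennreal_mult_le_mult_iff) auto
      have "ennreal (?L * exp (EE - C * err n p)) \<le> ennreal (exp (- \<mu> + - 1 / n) * (?\<kappa> ^ N * ?L'))"
      proof (rule ennreal_leI)
        have "1 / n \<le> err n p" using n p0 by (intro inverse_le_err) auto
        moreover have "C * err n p = CA * err n p + CE + err n p" by (simp add: C_def CE_def algebra_simps)
        moreover have "- 1 / n = - (1 / n)" by simp
        ultimately have "EE - C * err n p \<le> (- \<mu> + - 1 / n) + (real N * ln ?\<kappa> + ln ?L' - ln ?L)" using \<mu> main by linarith
        then have "exp (EE - C * err n p) \<le> exp (- \<mu> + - 1 / n) * exp (real N * ln ?\<kappa> + ln ?L' - ln ?L)" by (simp flip: exp_add)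
        then have "?L * exp (EE - C * err n p) \<le> ?L * (exp (- \<mu> + - 1 / n) * exp (real N * ln ?\<kappa> + ln ?L' - ln ?L))"
          using L by (intro mult_left_mono) auto
        also have "\<dots> = exp (- \<mu> + - 1 / n) * (?\<kappa> ^ N * ?L')" unfolding prodform by (simp only: mult_ac)
        finally show "?L * exp (EE - C * err n p) \<le> exp (- \<mu> + - 1 / n) * (?\<kappa> ^ N * ?L')" .
      qed
      with le2 show ?thesis by (rule order_trans[rotated])
    qed
    show "let a = \<beta> * (p - real N) / 2; r = \<beta> / (t - \<beta>);
         E = real N * \<beta> * ln (p * (t - \<beta>)) - \<beta> * r\<^sup>2 * (real N)\<^sup>2 / (2 * p)
     in sel \<beta> I (tw \<beta> a (p * t)) \<le> ennreal (lagZ \<beta> a (1 / 2) I * exp (E + C * err (real N + 1) p)) \<and>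
        ennreal (lagZ \<beta> a (1 / 2) I * exp (E - C * err (real N + 1) p)) \<le> sel \<beta> I (tw \<beta> a (p * t))"
      unfolding Let_def using upper lower by (simp only: a_def r_def EE_def n_def y_def)
  qed
qed

section \<open>Integration over the largest particle\<close>

text \<open>Logarithm of the integrand over the largest particle \<open>y\<close>: its own weight,
  its interaction with \<open>m\<close> particles placed at \<open>s0\<close>, and the second-order
  correction, where \<open>s0 / (y - s0)\<close> is the tilt parameter \<open>r\<close> at
  \<open>y\<close>.\<close>

definition lap :: "real \<Rightarrow> real \<Rightarrow> real \<Rightarrow> real \<Rightarrow> real \<Rightarrow> real \<Rightarrow> real" where
  "lap \<beta> a s0 m p y = (a - 1) * ln y - y / 2 + \<beta> * m * ln (y - s0) - \<beta> * m\<^sup>2 / (2 * p) * (s0 / (y - s0))\<^sup>2"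

lemma lap_measurable [measurable]: "lap \<beta> a s0 m p \<in> borel_measurable borel"
  unfolding lap_def[abs_def] by measurable

text \<open>Logarithms are bounded by their tangents, and the decrease of the squared tilt parameter
  by \<open>2 * r0^2 * u / d\<close>. Interaction and correction both grow with \<open>u\<close> and
  so reduce the decay rate.\<close>

lemma lap_upper:
  assumes "0 < \<beta>" "1 \<le> a" "0 < s0" "s0 < y0" "0 \<le> m" "0 < p" "0 \<le> u"
  shows "lap \<beta> a s0 m p (y0 + u) \<le> lap \<beta> a s0 m p y0
    - (1 / 2 - (a - 1) / y0 - \<beta> * m / (y0 - s0) - \<beta> * m\<^sup>2 / p * (s0 / (y0 - s0))\<^sup>2 / (y0 - s0)) * u"
proof -
  define d where "d = y0 - s0"
  have d: "0 < d" "0 < y0" using assms by (auto simp: d_def)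
  have ln_le: "ln (z + u) - ln z \<le> u / z" if "0 < z" for z
  proof -
    have "ln (z + u) - ln z = ln ((z + u) / z)" using that assms by (simp add: ln_div)
    also have "\<dots> \<le> (z + u) / z - 1" using that assms by (intro ln_le_minus_one) auto
    also have "\<dots> = u / z" using that by (simp add: field_simps)
    finally show ?thesis .
  qed
  have 1: "(a - 1) * (ln (y0 + u) - ln y0) \<le> (a - 1) * (u / y0)" using ln_le d assms by (intro mult_left_mono) auto
  have 2: "\<beta> * m * (ln (d + u) - ln d) \<le> \<beta> * m * (u / d)" using ln_le d assms by (intro mult_left_mono) auto
  define r0 r where "r0 = s0 / d" and "r = s0 / (d + u)"
  have r: "0 \<le> r" "r \<le> r0" using d assms by (auto simp: r0_def r_def intro!: divide_left_mono mult_pos_pos add_pos_nonneg)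
  have "r0 - r \<le> r0 * (u / d)"
  proof -
    have "r0 - r = r * (u / d)" using d assms by (simp add: r0_def r_def field_simps)
    also have "\<dots> \<le> r0 * (u / d)" using r d assms by (intro mult_right_mono) auto
    finally show ?thesis .
  qed
  moreover have "r0\<^sup>2 - r\<^sup>2 = (r0 - r) * (r0 + r)" by (simp add: power2_eq_square algebra_simps)
  ultimately have "r0\<^sup>2 - r\<^sup>2 \<le> (r0 * (u / d)) * (2 * r0)"
    using r by (simp only:) (intro mult_mono, auto)
  then have "\<beta> * m\<^sup>2 / (2 * p) * (r0\<^sup>2 - r\<^sup>2) \<le> \<beta> * m\<^sup>2 / (2 * p) * ((r0 * (u / d)) * (2 * r0))"
    using assms by (intro mult_left_mono) auto
  also have "\<dots> = \<beta> * m\<^sup>2 / p * r0\<^sup>2 / d * u" by (simp add: power2_eq_square)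
  finally have 3: "\<beta> * m\<^sup>2 / (2 * p) * r0\<^sup>2 - \<beta> * m\<^sup>2 / (2 * p) * r\<^sup>2 \<le> \<beta> * m\<^sup>2 / p * r0\<^sup>2 / d * u"
    by (simp only: right_diff_distrib)
  have e: "y0 + u - s0 = d + u" "y0 - s0 = d" by (auto simp: d_def)
  have f: "(1 / 2 - (a - 1) / y0 - \<beta> * m / d - \<beta> * m\<^sup>2 / p * r0\<^sup>2 / d) * u = u / 2 - (a - 1) * (u / y0) - \<beta> * m * (u / d) - \<beta> * m\<^sup>2 / p * r0\<^sup>2 / d * u"
    by (simp add: left_diff_distrib)
  show ?thesis
    unfolding lap_def e r0_def[symmetric] r_def[symmetric] f
    using 1 2 3 unfolding right_diff_distrib add_divide_distrib by linarith
qed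

text \<open>Interaction and correction only increase with \<open>u\<close>, so they may be kept at
  their values at \<open>y0\<close>; the weight term is expanded to second order.\<close>

lemma lap_lower:
  assumes "0 < \<beta>" "1 \<le> a" "0 < s0" "s0 < y0" "0 \<le> m" "0 < p" "0 \<le> u"
  shows "lap \<beta> a s0 m p y0 - (1 / 2 - (a - 1) / y0) * u - (a - 1) / (2 * y0\<^sup>2) * u\<^sup>2 \<le> lap \<beta> a s0 m p (y0 + u)"
proof -
  define d where "d = y0 - s0"
  have d: "0 < d" "0 < y0" using assms by (auto simp: d_def)
  have "u / y0 - (u / y0)\<^sup>2 / 2 \<le> ln (1 + u / y0)" using d assms by (intro ln_one_plus_ge_quadratic) auto
  moreover have "ln (y0 + u) = ln y0 + ln (1 + u / y0)"
  proof -
    have "y0 + u = y0 * (1 + u / y0)" using d by (simp add: field_simps)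
    moreover have "0 < 1 + u / y0" using d assms by (intro add_pos_nonneg) auto
    ultimately show ?thesis using d by (simp only:) (intro ln_mult_pos, auto)
  qed
  ultimately have "u / y0 - (u / y0)\<^sup>2 / 2 \<le> ln (y0 + u) - ln y0" by simp
  then have 1: "(a - 1) * (u / y0 - (u / y0)\<^sup>2 / 2) \<le> (a - 1) * (ln (y0 + u) - ln y0)" using assms by (intro mult_left_mono) auto
  have 2: "\<beta> * m * ln d \<le> \<beta> * m * ln (d + u)" using d assms by (intro mult_left_mono) auto
  define r0 r where "r0 = s0 / d" and "r = s0 / (d + u)"
  have r: "0 \<le> r" "r \<le> r0" using d assms by (auto simp: r0_def r_def intro!: divide_left_mono mult_pos_pos add_pos_nonneg)
  have "r\<^sup>2 \<le> r0\<^sup>2" using r by (intro power_mono)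
  then have 3: "\<beta> * m\<^sup>2 / (2 * p) * r\<^sup>2 \<le> \<beta> * m\<^sup>2 / (2 * p) * r0\<^sup>2"
    using assms by (intro mult_left_mono) auto
  have e: "y0 + u - s0 = d + u" "y0 - s0 = d" by (auto simp: d_def)
  have f: "(1 / 2 - (a - 1) / y0) * u + (a - 1) / (2 * y0\<^sup>2) * u\<^sup>2 = u / 2 - (a - 1) * (u / y0 - (u / y0)\<^sup>2 / 2)"
    by (simp add: left_diff_distrib right_diff_distrib power_divide)
  have g: "(a - 1) * (ln (y0 + u) - ln y0) = (a - 1) * ln (y0 + u) - (a - 1) * ln y0" by (rule right_diff_distrib)
  show ?thesis
    unfolding lap_def e r0_def[symmetric] r_def[symmetric]
    using 1 2 3 f unfolding g add_divide_distrib by linarith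
qed

lemma nn_integral_shift:
  fixes f :: "real \<Rightarrow> ennreal"
  assumes "f \<in> borel_measurable borel"
  shows "(\<integral>\<^sup>+y. f y \<partial>lborel) = (\<integral>\<^sup>+u. f (y0 + u) \<partial>lborel)"
  using nn_integral_real_affine[OF assms, of 1 y0] by simp

lemma laplace_upper:
  assumes "0 < \<beta>" "1 \<le> a" "0 < s0" "s0 < y0" "0 \<le> m" "0 < p"
    and \<sigma>: "\<sigma> = 1 / 2 - (a - 1) / y0 - \<beta> * m / (y0 - s0) - \<beta> * m\<^sup>2 / p * (s0 / (y0 - s0))\<^sup>2 / (y0 - s0)" "0 < \<sigma>"
  shows "(\<integral>\<^sup>+y. ennreal (of_bool (y0 < y) * exp (lap \<beta> a s0 m p y)) \<partial>lborel) \<le> ennreal (exp (lap \<beta> a s0 m p y0) / \<sigma>)"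
proof -
  let ?L = "lap \<beta> a s0 m p"
  have "(\<integral>\<^sup>+y. ennreal (of_bool (y0 < y) * exp (?L y)) \<partial>lborel) = (\<integral>\<^sup>+u. ennreal (of_bool (y0 < y0 + u) * exp (?L (y0 + u))) \<partial>lborel)"
    by (rule nn_integral_shift) measurable
  also have "\<dots> \<le> (\<integral>\<^sup>+u. ennreal (exp (?L y0)) * ennreal (gw 1 \<sigma> u) \<partial>lborel)"
  proof (rule nn_integral_mono)
    fix u
    show "ennreal (of_bool (y0 < y0 + u) * exp (?L (y0 + u))) \<le> ennreal (exp (?L y0)) * ennreal (gw 1 \<sigma> u)"
    proof (cases "0 < u")
      case True
      have "?L (y0 + u) \<le> ?L y0 - \<sigma> * u"
        unfolding \<sigma>(1) by (rule lap_upper) (use assms True in auto)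
      then have "?L (y0 + u) \<le> ?L y0 + - \<sigma> * u" by simp
      then have "exp (?L (y0 + u)) \<le> exp (?L y0) * exp (- \<sigma> * u)" by (simp flip: exp_add)
      then show ?thesis using True by (simp add: gw_def ennreal_leI flip: ennreal_mult')
    qed simp
  qed
  also have "\<dots> = ennreal (exp (?L y0)) * ennreal (1 / \<sigma>)"
    using nn_integral_gw[of 1 \<sigma>] \<sigma> by (simp add: nn_integral_cmult powr_minus_divide)
  also have "\<dots> = ennreal (exp (?L y0) / \<sigma>)" by (simp flip: ennreal_mult')
  finally show ?thesis .
qed

text \<open>Use \<open>exp (- h * u^2) \<ge> 1 - h * u^2\<close> and the integrals
  \<open>1 / \<sigma>\<close> and \<open>2 / \<sigma>^3\<close> of
  \<open>exp (- \<sigma> * u)\<close> and \<open>u^2 * exp (- \<sigma> * u)\<close>. The quadratic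
  term is carried on the other side until the end, because \<open>1 - h * u^2\<close> may be
  negative.\<close>

lemma laplace_lower:
  assumes "0 < \<beta>" "1 \<le> a" "0 < s0" "s0 < y0" "0 \<le> m" "0 < p"
    and \<sigma>: "\<sigma> = 1 / 2 - (a - 1) / y0" "0 < \<sigma>" and h: "h = (a - 1) / (2 * y0\<^sup>2)"
  shows "ennreal (exp (lap \<beta> a s0 m p y0) * (1 / \<sigma> - 2 * h / \<sigma> ^ 3)) \<le> (\<integral>\<^sup>+y. ennreal (of_bool (y0 < y) * exp (lap \<beta> a s0 m p y)) \<partial>lborel)"
    (is "_ \<le> ?INT")
proof -
  let ?L = "lap \<beta> a s0 m p"
  have h0: "0 \<le> h" using assms by simp
  have eq: "?INT = (\<integral>\<^sup>+u. ennreal (of_bool (y0 < y0 + u) * exp (?L (y0 + u))) \<partial>lborel)"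
    by (rule nn_integral_shift) measurable
  have "ennreal (exp (?L y0)) * ennreal (1 / \<sigma>) = (\<integral>\<^sup>+u. ennreal (exp (?L y0)) * ennreal (gw 1 \<sigma> u) \<partial>lborel)"
    using nn_integral_gw[of 1 \<sigma>] \<sigma> by (simp add: nn_integral_cmult powr_minus_divide)
  also have "\<dots> \<le> (\<integral>\<^sup>+u. ennreal (of_bool (y0 < y0 + u) * exp (?L (y0 + u))) + ennreal (exp (?L y0) * h) * ennreal (gw 3 \<sigma> u) \<partial>lborel)"
  proof (rule nn_integral_mono)
    fix u
    show "ennreal (exp (?L y0)) * ennreal (gw 1 \<sigma> u) \<le> ennreal (of_bool (y0 < y0 + u) * exp (?L (y0 + u))) + ennreal (exp (?L y0) * h) * ennreal (gw 3 \<sigma> u)"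
    proof (cases "0 < u")
      case True
      have "?L y0 - \<sigma> * u - h * u\<^sup>2 \<le> ?L (y0 + u)" using lap_lower[of \<beta> a s0 y0 m p u] assms True by simp
      then have "exp (?L y0 + - \<sigma> * u + - (h * u\<^sup>2)) \<le> exp (?L (y0 + u))" by simp
      moreover have "exp (?L y0 + - \<sigma> * u) * (1 - h * u\<^sup>2) \<le> exp (?L y0 + - \<sigma> * u) * exp (- (h * u\<^sup>2))"
        using exp_ge_add_one_self[of "- (h * u\<^sup>2)"] by (intro mult_left_mono) auto
      ultimately have "exp (?L y0 + - \<sigma> * u) * (1 - h * u\<^sup>2) \<le> exp (?L (y0 + u))" unfolding exp_add by linarith
      then have "exp (?L y0) * exp (- \<sigma> * u) \<le> exp (?L (y0 + u)) + exp (?L y0) * h * (u\<^sup>2 * exp (- \<sigma> * u))"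
        unfolding exp_add by (simp add: algebra_simps)
      then have "ennreal (exp (?L y0) * exp (- \<sigma> * u)) \<le> ennreal (exp (?L (y0 + u)) + exp (?L y0) * h * (u\<^sup>2 * exp (- \<sigma> * u)))"
        by (rule ennreal_leI)
      also have "\<dots> = ennreal (exp (?L (y0 + u))) + ennreal (exp (?L y0) * h) * ennreal (u\<^sup>2 * exp (- \<sigma> * u))"
        using h0 by (subst ennreal_plus) (auto simp: ennreal_mult')
      finally show ?thesis using True by (simp add: gw_def flip: ennreal_mult')
    qed (simp add: gw_def)
  qed
  also have "\<dots> = ?INT + ennreal (exp (?L y0) * h) * (\<integral>\<^sup>+u. ennreal (gw 3 \<sigma> u) \<partial>lborel)"
    unfolding eq by (subst nn_integral_add) (auto simp: nn_integral_cmult)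
  also have "(\<integral>\<^sup>+u. ennreal (gw 3 \<sigma> u) \<partial>lborel) = ennreal (2 / \<sigma> ^ 3)"
  proof -
    have "Gamma (3::real) = 2" using Gamma_fact[of 2, where 'a = real] by (simp add: numeral_eq_Suc)
    moreover have "\<sigma> powr - 3 = 1 / \<sigma> ^ 3" using \<sigma> by (simp add: powr_minus_divide)
    ultimately show ?thesis using nn_integral_gw[of 3 \<sigma>] \<sigma> by simp
  qed
  also have "ennreal (exp (?L y0)) * ennreal (1 / \<sigma>) = ennreal (exp (?L y0) * (1 / \<sigma>))"
    by (rule ennreal_mult'[symmetric]) simp
  also have "ennreal (exp (?L y0) * h) * ennreal (2 / \<sigma> ^ 3) = ennreal (exp (?L y0) * h * (2 / \<sigma> ^ 3))"
    by (rule ennreal_mult'[symmetric]) (simp add: h0)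
  finally have le: "ennreal (exp (?L y0) * (1 / \<sigma>)) \<le> ?INT + ennreal (exp (?L y0) * h * (2 / \<sigma> ^ 3))" .
  have "ennreal (exp (?L y0) * (1 / \<sigma> - 2 * h / \<sigma> ^ 3)) = ennreal (exp (?L y0) * (1 / \<sigma>) - exp (?L y0) * h * (2 / \<sigma> ^ 3))"
    by (simp add: algebra_simps)
  also have "\<dots> = ennreal (exp (?L y0) * (1 / \<sigma>)) - ennreal (exp (?L y0) * h * (2 / \<sigma> ^ 3))"
    using h0 \<sigma> by (intro ennreal_minus[symmetric]) auto
  also have "\<dots> \<le> ?INT" using le by (simp add: ennreal_minus_le_iff add.commute)
  finally show ?thesis .
qed

text \<open>Confirms that the given constant normalises the density. In the closed form of the
  partition function, the arguments \<open>a + \<beta> / 2 * j\<close> for \<open>j < n\<close> are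
  \<open>\<beta> / 2 * (p - n + j)\<close> for \<open>j\<close> from 1 to \<open>n\<close>, and the
  total power of 2 is \<open>\<beta> * n * p / 2\<close>.\<close>

lemma laguerre_density_eq:
  fixes n :: nat and p \<beta> :: real
  assumes \<beta>: "0 < \<beta>" and n: "1 \<le> n" "real n \<le> p"
  defines "a \<equiv> \<beta> * (p - real n + 1) / 2"
  shows "laguerre_density n p \<beta> l = 1 / lagZ \<beta> a (1 / 2) {1..n} * ((\<Prod>i\<in>{1..n}. gw a (1 / 2) (l i)) * vdm 0 \<beta> {1..n} l)"
proof -
  have a: "0 < a" using \<beta> n by (simp add: a_def)
  have c: "laguerre_const n p \<beta> = 1 / lagZ \<beta> a (1 / 2) {1..n}"
  proof -
    have "lagZ \<beta> a (1 / 2) {1..n} = Kprod \<beta> n * Gprod \<beta> n a * (1 / 2) powr - (real n * a + \<beta> / 2 * (real n * (real n - 1)))"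
      by (rule lagZ_eq) (use \<beta> a in auto)
    also have "(1 / 2) powr - (real n * a + \<beta> / 2 * (real n * (real n - 1))) = (2::real) powr (\<beta> * real n * p / 2)"
    proof -
      have e: "real n * a + \<beta> / 2 * (real n * (real n - 1)) = \<beta> * real n * p / 2"
        by (simp add: a_def algebra_simps add_divide_distrib diff_divide_distrib)
      have "(1 / 2) powr - y = (2::real) powr y" for y by (simp add: powr_minus powr_divide)
      then show ?thesis unfolding e .
    qed
    also have "Kprod \<beta> n * Gprod \<beta> n a = (\<Prod>j=1..n. Gamma (1 + \<beta> / 2 * real j) * Gamma (\<beta> / 2 * (p - real n + real j)) / Gamma (1 + \<beta> / 2))"
    proof -
      have "Kprod \<beta> n * Gprod \<beta> n a = (\<Prod>j<n. Gamma (1 + \<beta> / 2 * real (Suc j)) / Gamma (1 + \<beta> / 2) * Gamma (a + \<beta> / 2 * real j))"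
        by (simp only: Kprod_def Gprod_def prod.distrib)
      also have "\<dots> = (\<Prod>j=1..n. Gamma (1 + \<beta> / 2 * real j) * Gamma (\<beta> / 2 * (p - real n + real j)) / Gamma (1 + \<beta> / 2))"
      proof (rule prod.reindex_bij_witness[of _ "\<lambda>j. j - 1" Suc])
        fix j assume "j \<in> {..<n}"
        have "\<beta> / 2 * (p - real n + real (Suc j)) = a + \<beta> / 2 * real j" by (simp add: a_def field_simps)
        then show "Gamma (1 + \<beta> / 2 * real (Suc j)) * Gamma (\<beta> / 2 * (p - real n + real (Suc j))) / Gamma (1 + \<beta> / 2) = Gamma (1 + \<beta> / 2 * real (Suc j)) / Gamma (1 + \<beta> / 2) * Gamma (a + \<beta> / 2 * real j)"
          by (simp only: times_divide_eq_left)
      qed auto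
      finally show ?thesis .
    qed
    finally have Z: "lagZ \<beta> a (1 / 2) {1..n} = (\<Prod>j=1..n. Gamma (1 + \<beta> / 2 * real j) * Gamma (\<beta> / 2 * (p - real n + real j)) / Gamma (1 + \<beta> / 2)) * 2 powr (\<beta> * real n * p / 2)" .
    show ?thesis
      unfolding Z laguerre_const_def by (simp add: powr_minus prod_dividef prod.distrib field_simps)
  qed
  show ?thesis
  proof (cases "\<forall>i\<in>{1..n}. 0 < l i")
    case True
    have "(\<Prod>i\<in>{1..n}. gw a (1 / 2) (l i)) = (\<Prod>i=1..n. l i powr (a - 1)) * exp (- (1 / 2) * (\<Sum>i=1..n. l i))"
    proof -
      have "(\<Prod>i\<in>{1..n}. gw a (1 / 2) (l i)) = (\<Prod>i\<in>{1..n}. l i powr (a - 1) * exp (- (1 / 2) * l i))"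
        using True by (intro prod.cong) (auto simp: gw_def)
      also have "\<dots> = (\<Prod>i=1..n. l i powr (a - 1)) * exp (\<Sum>i=1..n. - (1 / 2) * l i)" by (simp only: prod.distrib exp_sum finite_atLeastAtMost)
      finally show ?thesis by (simp only: sum_distrib_left)
    qed
    then show ?thesis using True unfolding laguerre_density_def c vdm_0_lessThan by (simp add: a_def mult_ac)
  next
    case False
    then obtain i where i: "i \<in> {1..n}" "gw a (1 / 2) (l i) = 0" by (auto simp: gw_def)
    have "(\<Prod>i\<in>{1..n}. gw a (1 / 2) (l i)) * vdm 0 \<beta> {1..n} l = 0"
      by (rule sel_density_eq_0[where W = "gw a (1 / 2)"]) (use i in auto)
    with False show ?thesis by (auto simp: laguerre_density_def)
  qed
qed

text \<open>Splitting by which particle is the largest leaves, for each choice, an outer integral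
  over its position and the tilted partition function of the others.\<close>

lemma laguerre_tail_eq:
  fixes n :: nat and p \<beta> :: real
  assumes \<beta>: "0 < \<beta>" and n: "1 \<le> n" "real n \<le> p"
  defines "a \<equiv> \<beta> * (p - real n + 1) / 2"
  shows "emeasure (laguerre_ensemble n p \<beta>) {l \<in> space (laguerre_ensemble n p \<beta>). largest_eigenvalue n l > y0}
    = ennreal (1 / lagZ \<beta> a (1 / 2) {1..n}) * (\<Sum>i\<in>{1..n}. \<integral>\<^sup>+y. ennreal (of_bool (y0 < y) * gw a (1 / 2) y) * sel \<beta> ({1..n} - {i}) (tw \<beta> a y) \<partial>lborel)"
proof -
  let ?I = "{1..n}" and ?g = "gw a (1 / 2)"
  let ?f = "\<lambda>l. (\<Prod>i\<in>?I. ?g (l i)) * vdm 0 \<beta> ?I l"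
  let ?Z = "lagZ \<beta> a (1 / 2) ?I"
  have a: "0 < a" using \<beta> n by (simp add: a_def)
  have Z: "0 < ?Z" by (rule lagZ_pos) (use \<beta> a in auto)
  have zz: "0 \<le> 1 / ?Z" using Z by simp
  have I: "finite ?I" "?I \<noteq> {}" using n by auto
  have f0: "0 \<le> ?f l" for l by (intro mult_nonneg_nonneg prod_nonneg) auto
  have le_m[measurable]: "largest_eigenvalue n \<in> borel_measurable (lebP ?I)"
  proof -
    have "(\<lambda>l. Max ((\<lambda>i. l i) ` ?I)) \<in> borel_measurable (lebP ?I)"
      using I by (intro borel_measurable_Max) (auto intro!: measurable_component_singleton simp: measurable_lborel1)
    then show ?thesis by (simp add: largest_eigenvalue_def[abs_def])
  qed
  have dens: "laguerre_density n p \<beta> l = 1 / ?Z * ?f l" for l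
    unfolding a_def by (rule laguerre_density_eq[OF \<beta> n])
  let ?A = "{l \<in> space (lebP ?I). largest_eigenvalue n l > y0}"
  have sp: "space (laguerre_ensemble n p \<beta>) = space (lebP ?I)" by (simp add: laguerre_ensemble_def)
  have dm: "(\<lambda>l. ennreal (laguerre_density n p \<beta> l)) \<in> borel_measurable (lebP ?I)" unfolding dens by measurable
  have "emeasure (laguerre_ensemble n p \<beta>) ?A = (\<integral>\<^sup>+l. ennreal (laguerre_density n p \<beta> l) * indicator ?A l \<partial>lebP ?I)"
    unfolding laguerre_ensemble_def by (rule emeasure_density[OF dm]) measurable
  also have "\<dots> = (\<integral>\<^sup>+l. ennreal (1 / ?Z) * ennreal (of_bool (y0 < largest_eigenvalue n l) * ?f l) \<partial>lebP ?I)"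
  proof (rule nn_integral_cong)
    fix l assume "l \<in> space (lebP ?I)"
    then show "ennreal (laguerre_density n p \<beta> l) * indicator ?A l = ennreal (1 / ?Z) * ennreal (of_bool (y0 < largest_eigenvalue n l) * ?f l)"
      unfolding dens ennreal_mult'[OF zz] by (cases "y0 < largest_eigenvalue n l") simp_all
  qed
  also have "\<dots> = ennreal (1 / ?Z) * (\<integral>\<^sup>+l. ennreal (of_bool (y0 < largest_eigenvalue n l) * ?f l) \<partial>lebP ?I)"
    by (rule nn_integral_cmult) measurable
  also have "(\<integral>\<^sup>+l. ennreal (of_bool (y0 < largest_eigenvalue n l) * ?f l) \<partial>lebP ?I)
    = (\<Sum>i\<in>?I. \<integral>\<^sup>+y. ennreal (of_bool (y0 < y) * ?g y) * sel \<beta> (?I - {i}) (\<lambda>s. ?g s * \<bar>y - s\<bar> powr \<beta> * of_bool (1 * s < 1 * y)) \<partial>lborel)"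
  proof (rule nn_integral_extremal_split[OF I, where \<sigma> = 1 and \<eta> = "\<lambda>y. of_bool (y0 < y)"])
    show "of_bool (y0 < largest_eigenvalue n l) = of_bool (y0 < l i)" if "i \<in> ?I" "\<And>j. j \<in> ?I \<Longrightarrow> 1 * l j \<le> 1 * l i" for l i
    proof -
      have "largest_eigenvalue n l = l i" unfolding largest_eigenvalue_def using that I by (intro Max_eqI) auto
      then show ?thesis by simp
    qed
  qed auto
  also have "(\<lambda>y s. ?g s * \<bar>y - s\<bar> powr \<beta> * of_bool (1 * s < 1 * y)) = (\<lambda>y. tw \<beta> a y)"
    by (auto simp: tw_def fun_eq_iff)
  finally show ?thesis unfolding sp .
qed

text \<open>Exact bookkeeping: \<open>lq\<close> is the logarithm of the ratio of partition
  functions for \<open>n\<close> and \<open>n - 1\<close> particles, and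
  \<open>(x - \<beta>) / (2 * x)\<close> is the limiting decay rate at the endpoint. The result
  differs from \<open>B_fun\<close> by two Stirling remainders and by the replacement of
  \<open>(n - 1)^2\<close> with \<open>n^2\<close>.\<close>

lemma B_fun_algebra:
  fixes n p \<beta> x :: real
  assumes "0 < \<beta>" "\<beta> < x" "0 < n" "0 < p"
  defines "a \<equiv> \<beta> * (p - n + 1) / 2"
  defines "lq \<equiv> ln (Gamma (1 + \<beta> / 2 * n)) - ln (Gamma (1 + \<beta> / 2)) + ln (Gamma (\<beta> / 2 * p)) + (a + \<beta> * (n - 1)) * ln 2"
  shows "ln n - lq + lap \<beta> a (\<beta> * p) (n - 1) p (p * x) - ln ((x - \<beta>) / (2 * x))
    = (p * (\<beta> / 2 - \<beta> / 2 * ln \<beta> - x / 2 + \<beta> / 2 * ln x)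
     + \<beta> * n / 2 * ln (p / n) - (\<beta> + 1) / 2 * ln p
     + \<beta> * n * (- (ln x / 2) + ln (x - \<beta>) - ln \<beta> / 2 + 1 / 2)
     + 1 / 2 * ln n - \<beta> ^ 3 * n\<^sup>2 / (2 * (x - \<beta>)\<^sup>2 * p)
     - (\<beta> + 1) * ln (x - \<beta>) + \<beta> / 2 * ln (2 * x) - ln pi + ln (Gamma (1 + \<beta> / 2)))
    + (ln (2 * pi) / 2 - stirling_rem (\<beta> / 2 * n)) + (ln (2 * pi) / 2 - stirling_rem (\<beta> / 2 * p))
    + \<beta> * (\<beta> / (x - \<beta>))\<^sup>2 * (2 * n - 1) / (2 * p)"
proof -
  define R where "R = (\<beta> / (x - \<beta>))\<^sup>2 / p"
  have pos: "0 < x" "0 < x - \<beta>" "0 < \<beta> / 2" "0 < \<beta> / 2 * n" "0 < \<beta> / 2 * p" using assms by auto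
  have 1: "ln (Gamma (1 + \<beta> / 2 * n)) = ln (\<beta> / 2 * n) + ((\<beta> / 2 * n - 1 / 2) * ln (\<beta> / 2 * n) - \<beta> / 2 * n + stirling_rem (\<beta> / 2 * n))"
    using ln_Gamma_plus_1[OF pos(4)] ln_Gamma_stirling[OF pos(4)] by (simp add: add.commute)
  have 2: "ln (\<beta> / 2 * n) = ln \<beta> - ln 2 + ln n" "ln (\<beta> / 2 * p) = ln \<beta> - ln 2 + ln p"
    using assms by (simp_all add: ln_mult_pos ln_div)
  have 3: "ln (p * x) = ln p + ln x" "ln (p / n) = ln p - ln n" "ln (2 * x) = ln 2 + ln x" "ln (2 * pi) = ln 2 + ln pi"
    "ln ((x - \<beta>) / (2 * x)) = ln (x - \<beta>) - (ln 2 + ln x)"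
    using assms pos by (simp_all add: ln_mult_pos ln_div)
  have "p * x - \<beta> * p = p * (x - \<beta>)" by (simp add: algebra_simps)
  then have 4: "ln (p * x - \<beta> * p) = ln p + ln (x - \<beta>)" "\<beta> * p / (p * x - \<beta> * p) = \<beta> / (x - \<beta>)"
    using assms pos by (simp_all add: ln_mult_pos)
  have 5: "\<beta> * m\<^sup>2 / (2 * p) * (\<beta> / (x - \<beta>))\<^sup>2 = \<beta> * m\<^sup>2 * R / 2" for m by (simp add: R_def)
  have 6: "\<beta> ^ 3 * n\<^sup>2 / (2 * (x - \<beta>)\<^sup>2 * p) = \<beta> * n\<^sup>2 * R / 2"
    by (simp add: R_def power_divide power2_eq_square power3_eq_cube mult_ac)
  have 7: "\<beta> * (\<beta> / (x - \<beta>))\<^sup>2 * (2 * n - 1) / (2 * p) = \<beta> * (2 * n - 1) * R / 2" by (simp add: R_def mult_ac)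
  show ?thesis
    unfolding lq_def lap_def 1 ln_Gamma_stirling[OF pos(5)] 4 2 3 5 6 7
    unfolding a_def by (simp add: field_simps power2_eq_square)
qed


text \<open>The partition function depends only on the number of particles, so all \<open>n\<close>
  choices of the largest particle give the same bound; this produces \<open>ln n\<close>, and
  removing a particle produces \<open>- lq\<close>. The error \<open>D\<close> is the same for every
  \<open>t \<ge> x\<close> and passes through the outer integral unchanged.\<close>

lemma laguerre_tail_bracket:
  fixes n :: nat and p \<beta> x D :: real
  assumes \<beta>: "0 < \<beta>" "\<beta> < x" and n: "1 \<le> n" "real n \<le> p"
  defines "a \<equiv> \<beta> * (p - real n + 1) / 2" and "m \<equiv> real n - 1"
  defines "lq \<equiv> ln (Gamma (1 + \<beta> / 2 * real n)) - ln (Gamma (1 + \<beta> / 2)) + ln (Gamma (\<beta> / 2 * p)) + (a + \<beta> * (real n - 1)) * ln 2"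
  defines "E \<equiv> \<lambda>t. m * \<beta> * ln (p * (t - \<beta>)) - \<beta> * (\<beta> / (t - \<beta>))\<^sup>2 * m\<^sup>2 / (2 * p)"
  defines "J \<equiv> (\<integral>\<^sup>+y. ennreal (of_bool (p * x < y) * exp (lap \<beta> a (\<beta> * p) m p y)) \<partial>lborel)"
  defines "Q \<equiv> emeasure (laguerre_ensemble n p \<beta>) {l \<in> space (laguerre_ensemble n p \<beta>). largest_eigenvalue n l > p * x}"
  assumes up: "\<And>t i. x \<le> t \<Longrightarrow> i \<in> {1..n} \<Longrightarrow> sel \<beta> ({1..n} - {i}) (tw \<beta> a (p * t)) \<le> ennreal (lagZ \<beta> a (1 / 2) ({1..n} - {i}) * exp (E t + D))"
    and lo: "\<And>t i. x \<le> t \<Longrightarrow> i \<in> {1..n} \<Longrightarrow> ennreal (lagZ \<beta> a (1 / 2) ({1..n} - {i}) * exp (E t - D)) \<le> sel \<beta> ({1..n} - {i}) (tw \<beta> a (p * t))"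
  shows "Q \<le> ennreal (exp (ln (real n) - lq + D)) * J" "ennreal (exp (ln (real n) - lq - D)) * J \<le> Q"
proof -
  let ?I = "{1..n}" and ?g = "gw a (1 / 2)"
  let ?Z = "lagZ \<beta> a (1 / 2) ?I" and ?Zi = "\<lambda>i. lagZ \<beta> a (1 / 2) (?I - {i})"
  have pos: "0 < a" "0 < p" "0 < x" using \<beta> n by (auto simp: a_def)
  have Z: "0 < ?Z" by (rule lagZ_pos) (use \<beta> pos in auto)
  have Zi0: "0 \<le> ?Zi i" for i by (rule less_imp_le[OF lagZ_pos]) (use \<beta> pos in auto)
  have Zi: "?Zi i = ?Z * exp (- lq)" if i: "i \<in> ?I" for i
  proof -
    have e1: "a + \<beta> / 2 * (real n - 1) = \<beta> / 2 * p" by (simp add: a_def field_simps)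
    have e2: "?Z = ?Zi i * (Gamma (1 + \<beta> / 2 * real n) / Gamma (1 + \<beta> / 2) * Gamma (a + \<beta> / 2 * (real n - 1)) * (1 / 2) powr - (a + \<beta> * (real n - 1)))"
      by (rule lagZ_remove_ratio) (use \<beta> pos i in auto)
    have e3: "exp lq = Gamma (1 + \<beta> / 2 * real n) / Gamma (1 + \<beta> / 2) * Gamma (\<beta> / 2 * p) * (1 / 2) powr - (a + \<beta> * (real n - 1))"
    proof -
      have "(1 / 2) powr - y = exp (y * ln (2::real))" for y by (simp add: powr_def ln_div)
      moreover have "0 < Gamma (1 + \<beta> / 2 * real n)" "0 < Gamma (1 + \<beta> / 2)" "0 < Gamma (\<beta> / 2 * p)"
        using \<beta> pos by (auto intro!: Gamma_real_pos add_pos_nonneg)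
      ultimately show ?thesis unfolding lq_def by (simp only: exp_add exp_diff exp_ln)
    qed
    have "?Z = ?Zi i * exp lq" using e2 unfolding e1 e3 .
    then show ?thesis by (simp add: mult.assoc flip: exp_add)
  qed
  have key: "ennreal (1 / ?Z) * (\<Sum>i\<in>?I. \<integral>\<^sup>+y. ennreal (of_bool (p * x < y) * ?g y) * ennreal (?Zi i * exp (E (y / p) + d)) \<partial>lborel)
    = ennreal (exp (ln (real n) - lq + d)) * J" for d
  proof -
    have "(\<integral>\<^sup>+y. ennreal (of_bool (p * x < y) * ?g y) * ennreal (?Zi i * exp (E (y / p) + d)) \<partial>lborel) = ennreal (?Z * exp (d - lq)) * J"
      if i: "i \<in> ?I" for i
    proof -
      have "ennreal (of_bool (p * x < y) * ?g y) * ennreal (?Zi i * exp (E (y / p) + d))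
          = ennreal (?Z * exp (d - lq)) * ennreal (of_bool (p * x < y) * exp (lap \<beta> a (\<beta> * p) m p y))" for y
      proof (cases "p * x < y")
        case True
        then have y: "0 < y" using mult_pos_pos[OF pos(2,3)] by linarith
        have "p * (y / p - \<beta>) = y - \<beta> * p" "\<beta> / (y / p - \<beta>) = \<beta> * p / (y - \<beta> * p)" using pos by (auto simp: field_simps)
        then have E: "E (y / p) = \<beta> * m * ln (y - \<beta> * p) - \<beta> * m\<^sup>2 / (2 * p) * (\<beta> * p / (y - \<beta> * p))\<^sup>2"
          unfolding E_def by (simp add: mult_ac)
        have g: "?g y = exp ((a - 1) * ln y - y / 2)" using y by (simp add: gw_def powr_def flip: exp_add)
        have "?g y * (?Zi i * exp (E (y / p) + d)) = ?Z * (exp ((a - 1) * ln y - y / 2) * exp (- lq) * exp (E (y / p) + d))"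
          unfolding Zi[OF i] g by (simp only: mult_ac)
        also have "exp ((a - 1) * ln y - y / 2) * exp (- lq) * exp (E (y / p) + d) = exp ((a - 1) * ln y - y / 2 + - lq + (E (y / p) + d))"
          by (simp only: exp_add)
        also have "(a - 1) * ln y - y / 2 + - lq + (E (y / p) + d) = (d - lq) + lap \<beta> a (\<beta> * p) m p y"
          unfolding lap_def E by linarith
        finally have "?g y * (?Zi i * exp (E (y / p) + d)) = ?Z * exp (d - lq) * exp (lap \<beta> a (\<beta> * p) m p y)"
          by (simp only: exp_add mult.assoc)
        moreover have "ennreal (?g y) * ennreal (?Zi i * exp (E (y / p) + d)) = ennreal (?g y * (?Zi i * exp (E (y / p) + d)))"
          by (rule ennreal_mult'[symmetric]) (simp add: g)
        moreover have "ennreal (?Z * exp (d - lq)) * ennreal (exp (lap \<beta> a (\<beta> * p) m p y)) = ennreal (?Z * exp (d - lq) * exp (lap \<beta> a (\<beta> * p) m p y))"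
          by (rule ennreal_mult'[symmetric]) (use Z in simp)
        ultimately show ?thesis using True by simp
      qed simp
      then show ?thesis unfolding J_def by (simp add: nn_integral_cmult)
    qed
    then have "ennreal (1 / ?Z) * (\<Sum>i\<in>?I. \<integral>\<^sup>+y. ennreal (of_bool (p * x < y) * ?g y) * ennreal (?Zi i * exp (E (y / p) + d)) \<partial>lborel)
      = ennreal (1 / ?Z) * (ennreal (real n) * (ennreal (?Z * exp (d - lq)) * J))" by (simp add: ennreal_of_nat_eq_real_of_nat)
    also have "\<dots> = ennreal (1 / ?Z * (real n * (?Z * exp (d - lq)))) * J"
    proof -
      have "ennreal (1 / ?Z * (real n * (?Z * exp (d - lq)))) = ennreal (1 / ?Z) * ennreal (real n * (?Z * exp (d - lq)))"
        by (rule ennreal_mult') (use Z in simp)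
      also have "ennreal (real n * (?Z * exp (d - lq))) = ennreal (real n) * ennreal (?Z * exp (d - lq))"
        by (rule ennreal_mult') simp
      finally show ?thesis by (simp only: mult.assoc)
    qed
    also have "1 / ?Z * (real n * (?Z * exp (d - lq))) = exp (ln (real n) - lq + d)"
      using Z n by (simp add: exp_diff exp_add)
    finally show ?thesis .
  qed
  have Q: "Q = ennreal (1 / ?Z) * (\<Sum>i\<in>?I. \<integral>\<^sup>+y. ennreal (of_bool (p * x < y) * ?g y) * sel \<beta> (?I - {i}) (tw \<beta> a y) \<partial>lborel)"
    unfolding Q_def a_def by (rule laguerre_tail_eq) (use \<beta> n in auto)
  have py: "x \<le> y / p" "p * (y / p) = y" if "p * x < y" for y using that pos by (auto simp: field_simps)
  show "Q \<le> ennreal (exp (ln (real n) - lq + D)) * J"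
    unfolding Q key[symmetric]
  proof (rule mult_left_mono[OF sum_mono[OF nn_integral_mono]])
    fix i y assume i: "i \<in> ?I"
    show "ennreal (of_bool (p * x < y) * ?g y) * sel \<beta> (?I - {i}) (tw \<beta> a y) \<le> ennreal (of_bool (p * x < y) * ?g y) * ennreal (?Zi i * exp (E (y / p) + D))"
    proof (cases "p * x < y")
      case True
      show ?thesis using up[OF py(1)[OF True] i] unfolding py(2)[OF True] by (intro mult_left_mono) auto
    qed simp
  qed simp
  have D: "E t - D = E t + - D" for t by simp
  have D': "ln (real n) - lq - D = ln (real n) - lq + - D" by simp
  show "ennreal (exp (ln (real n) - lq - D)) * J \<le> Q"
    unfolding Q D' key[symmetric]
  proof (rule mult_left_mono[OF sum_mono[OF nn_integral_mono]])
    fix i y assume i: "i \<in> ?I"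
    show "ennreal (of_bool (p * x < y) * ?g y) * ennreal (?Zi i * exp (E (y / p) + - D)) \<le> ennreal (of_bool (p * x < y) * ?g y) * sel \<beta> (?I - {i}) (tw \<beta> a y)"
    proof (cases "p * x < y")
      case True
      show ?thesis using lo[OF py(1)[OF True] i] unfolding py(2)[OF True] D by (intro mult_left_mono) auto
    qed simp
  qed simp
qed

text \<open>Both endpoint rates differ from
  \<open>1 / 2 - \<beta> / (2 * x) = (x - \<beta>) / (2 * x)\<close> by a multiple of
  \<open>n / p\<close>, and the curvature correction \<open>2 * h / \<sigma>2^2\<close> is bounded
  by such a multiple too.\<close>

lemma laplace_constants:
  fixes \<beta> x :: real
  assumes \<beta>: "0 < \<beta>" "\<beta> < x"
  shows "\<exists>K\<ge>1. \<exists>C\<ge>0. \<forall>n p a \<sigma>1 \<sigma>2 h. 1 \<le> n \<longrightarrow> K * n \<le> p \<longrightarrow> a = \<beta> * (p - n + 1) / 2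
    \<longrightarrow> \<sigma>1 = 1 / 2 - (a - 1) / (p * x) - \<beta> * (n - 1) / (p * x - \<beta> * p) - \<beta> * (n - 1)\<^sup>2 / p * (\<beta> * p / (p * x - \<beta> * p))\<^sup>2 / (p * x - \<beta> * p)
    \<longrightarrow> \<sigma>2 = 1 / 2 - (a - 1) / (p * x) \<longrightarrow> h = (a - 1) / (2 * (p * x)\<^sup>2)
    \<longrightarrow> 1 \<le> a \<and> 0 < \<sigma>1 \<and> 0 < \<sigma>2 \<and> 2 * h / \<sigma>2\<^sup>2 < 1 \<and> - ln \<sigma>1 \<le> - ln ((x - \<beta>) / (2 * x)) + C * (n / p)
      \<and> - ln ((x - \<beta>) / (2 * x)) - C * (n / p) \<le> - ln \<sigma>2 + ln (1 - 2 * h / \<sigma>2\<^sup>2)"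
proof -
  define s where "s = (x - \<beta>) / (2 * x)"
  define r where "r = \<beta> / (x - \<beta>)"
  define c1 c2 c3 where "c1 = \<beta> / (x - \<beta>) + \<beta> * r\<^sup>2 / (x - \<beta>)" and "c2 = (\<beta> + 1) / x" and "c3 = \<beta> / (2 * x\<^sup>2 * s\<^sup>2)"
  have s: "0 < s" "s = 1 / 2 - \<beta> / (2 * x)" using \<beta> by (auto simp: s_def field_simps)
  have c: "0 < c1" "0 < c2" "0 < c3" using \<beta> s by (auto simp: c1_def c2_def c3_def intro!: add_pos_nonneg)
  \<comment> \<open>In \<open>K\<close>, the summand \<open>2 / \<beta>\<close> gives
    \<open>1 \<le> a\<close>; those with \<open>c1\<close> and \<open>c3\<close> keep the relative
    loss of \<open>\<sigma>1\<close> and the curvature term at most \<open>1 / 2\<close>, so that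
    \<open>ln (1 - w) \<ge> - 2 * w\<close> applies.\<close>
  define K C where "K = 1 + 2 / \<beta> + 2 * c1 / s + 2 * c3" and "C = 2 * c1 / s + c2 / s + 2 * c3"
  have parts: "0 < 2 / \<beta>" "0 < 2 * c1 / s" "0 < c2 / s" "0 < 2 * c3" using \<beta> c s by auto
  have K: "1 \<le> K" and C: "0 \<le> C" using parts by (auto simp: K_def C_def)
  have "1 \<le> a \<and> 0 < \<sigma>1 \<and> 0 < \<sigma>2 \<and> 2 * h / \<sigma>2\<^sup>2 < 1 \<and> - ln \<sigma>1 \<le> - ln s + C * (n / p)
      \<and> - ln s - C * (n / p) \<le> - ln \<sigma>2 + ln (1 - 2 * h / \<sigma>2\<^sup>2)"
    if n: "1 \<le> n" and p: "K * n \<le> p" and a: "a = \<beta> * (p - n + 1) / 2"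
    and \<sigma>1: "\<sigma>1 = 1 / 2 - (a - 1) / (p * x) - \<beta> * (n - 1) / (p * x - \<beta> * p) - \<beta> * (n - 1)\<^sup>2 / p * (\<beta> * p / (p * x - \<beta> * p))\<^sup>2 / (p * x - \<beta> * p)"
    and \<sigma>2: "\<sigma>2 = 1 / 2 - (a - 1) / (p * x)" and h: "h = (a - 1) / (2 * (p * x)\<^sup>2)" for n p a \<sigma>1 \<sigma>2 h
  proof -
    define v where "v = n / p"
    have Kn: "n + 2 / \<beta> * n + 2 * c1 / s * n + 2 * c3 * n \<le> p" using p by (simp add: K_def algebra_simps)
    have nn: "0 < n" using n by simp
    have mp: "0 < 2 / \<beta> * n" "0 < 2 * c1 / s * n" "0 < 2 * c3 * n" using parts(1,2,4) nn by (blast intro: mult_pos_pos)+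
    have p0: "n \<le> p" "0 < p" using Kn mp n by linarith+
    have v: "0 < v" using p0 n by (simp add: v_def)
    have v1: "2 * c1 / s * v \<le> 1" and v3: "2 * c3 * v \<le> 1"
      using Kn mp p0 n unfolding v_def times_divide_eq_right by (simp_all only: pos_divide_le_eq)
    have nv: "n = v * p" using p0 by (simp add: v_def)
    have v_le: "v \<le> 1" using p0 by (simp add: v_def)
    have a1: "1 \<le> a"
    proof -
      have "2 / \<beta> * 1 \<le> 2 / \<beta> * n" using n parts by (intro mult_left_mono) auto
      then have "2 / \<beta> \<le> p - n" using Kn mp by linarith
      then have "2 \<le> \<beta> * (p - n)" using \<beta> by (simp add: field_simps)
      then show ?thesis using \<beta> by (simp add: a algebra_simps)
    qed
    have a2: "a - 1 \<le> \<beta> * p / 2"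
    proof -
      have "0 \<le> \<beta> * (n - 1)" using \<beta> n by simp
      then show ?thesis by (simp add: a field_simps)
    qed
    have px: "0 < p * x" "0 < x" using p0 \<beta> by auto
    have q: "(a - 1) / (p * x) \<le> \<beta> / (2 * x)"
    proof -
      have "(a - 1) / (p * x) \<le> (\<beta> * p / 2) / (p * x)" using a2 px by (intro divide_right_mono) auto
      then show ?thesis using p0 px by simp
    qed
    then have s2: "s \<le> \<sigma>2" unfolding \<sigma>2 s(2) by simp
    have \<sigma>1_ge: "s * (1 - c1 / s * v) \<le> \<sigma>1"
    proof -
      have e: "p * x - \<beta> * p = p * (x - \<beta>)" by (simp add: algebra_simps)
      have "\<beta> * (n - 1) / (p * (x - \<beta>)) \<le> \<beta> * n / (p * (x - \<beta>))" using \<beta> p0 by (intro divide_right_mono mult_left_mono) auto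
      also have "\<dots> = \<beta> / (x - \<beta>) * v" by (simp add: v_def)
      finally have 1: "\<beta> * (n - 1) / (p * (x - \<beta>)) \<le> \<beta> / (x - \<beta>) * v" .
      have "(n - 1)\<^sup>2 \<le> n * p" using n p0 unfolding power2_eq_square by (intro mult_mono) auto
      then have "(n - 1)\<^sup>2 / (p * p) \<le> n * p / (p * p)" using p0 by (intro divide_right_mono) auto
      also have "n * p / (p * p) = v" using p0 by (simp add: v_def)
      finally have "(n - 1)\<^sup>2 / (p * p) * (\<beta> * r\<^sup>2 / (x - \<beta>)) \<le> v * (\<beta> * r\<^sup>2 / (x - \<beta>))" using \<beta> by (intro mult_right_mono) auto
      moreover have "\<beta> * (n - 1)\<^sup>2 / p * (\<beta> * p / (p * (x - \<beta>)))\<^sup>2 / (p * (x - \<beta>)) = (n - 1)\<^sup>2 / (p * p) * (\<beta> * r\<^sup>2 / (x - \<beta>))"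
        using p0 \<beta> by (simp add: r_def mult_ac)
      ultimately have 2: "\<beta> * (n - 1)\<^sup>2 / p * (\<beta> * p / (p * (x - \<beta>)))\<^sup>2 / (p * (x - \<beta>)) \<le> \<beta> * r\<^sup>2 / (x - \<beta>) * v" by (simp only: mult.commute)
      have "s * (1 - c1 / s * v) = s - \<beta> / (x - \<beta>) * v - \<beta> * r\<^sup>2 / (x - \<beta>) * v"
      proof -
        have "s * (1 - c1 / s * v) = s - c1 * v" using s by (simp add: algebra_simps)
        then show ?thesis unfolding c1_def distrib_right by linarith
      qed
      then show ?thesis unfolding \<sigma>1 e using 1 2 q s(2) by linarith
    qed
    define w where "w = c1 / s * v"
    have w: "0 \<le> w" "w \<le> 1 / 2" using v1 v c s unfolding w_def by (auto)
    have w1: "0 < s * (1 - w)" using s w by (intro mult_pos_pos) auto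
    have \<sigma>1_pos: "0 < \<sigma>1" using \<sigma>1_ge w1 unfolding w_def by linarith
    have b1: "- ln \<sigma>1 \<le> - ln s + 2 * w"
    proof -
      have "ln (s * (1 - w)) \<le> ln \<sigma>1" using \<sigma>1_ge w1 \<sigma>1_pos unfolding w_def by simp
      moreover have "ln (s * (1 - w)) = ln s + ln (1 - w)" using s w by (intro ln_mult_pos) auto
      moreover have "- (2 * w) \<le> ln (1 - w)" using exp_le_one_minus[of w] w by (subst ln_ge_iff) auto
      ultimately show ?thesis by linarith
    qed
    have b2: "ln \<sigma>2 \<le> ln s + c2 / s * v"
    proof -
      have "\<sigma>2 - s = (\<beta> * (n - 1) / 2 + 1) / (p * x)" using px \<beta> p0 unfolding \<sigma>2 s(2) a by (simp add: field_simps)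
      also have "\<dots> \<le> ((\<beta> + 1) * n) / (p * x)"
      proof (rule divide_right_mono)
        have "0 \<le> \<beta> * n" using \<beta> n by simp
        then have "\<beta> * (n - 1) / 2 \<le> \<beta> * n" using \<beta> by (simp add: algebra_simps)
        then show "\<beta> * (n - 1) / 2 + 1 \<le> (\<beta> + 1) * n" using n by (simp only: distrib_right)
      qed (use px in auto)
      also have "\<dots> = c2 * v" by (simp add: c2_def v_def)
      finally have "\<sigma>2 \<le> s * (1 + c2 / s * v)" using s by (simp add: algebra_simps)
      moreover have pp: "0 < 1 + c2 / s * v" using mult_pos_pos[OF parts(3) v] by linarith
      ultimately have "ln \<sigma>2 \<le> ln (s * (1 + c2 / s * v))" using s s2 by simp
      also have "\<dots> = ln s + ln (1 + c2 / s * v)" using s pp by (intro ln_mult_pos) auto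
      also have "ln (1 + c2 / s * v) \<le> c2 / s * v" by (rule ln_add_one_self_le_self[OF less_imp_le[OF mult_pos_pos[OF parts(3) v]]])
      finally show ?thesis by simp
    qed
    have h0: "0 \<le> h" using a1 by (simp add: h)
    have b3: "2 * h / \<sigma>2\<^sup>2 \<le> c3 * v"
    proof -
      have "2 * (u / (2 * z)) = u / z" for u z :: real by simp
      then have "2 * h = (a - 1) / (p * x)\<^sup>2" unfolding h .
      also have "\<dots> \<le> (\<beta> * p / 2) / (p * x)\<^sup>2" using a2 by (intro divide_right_mono) auto
      also have "\<dots> = \<beta> / (2 * x\<^sup>2) * (1 / p)" using p0 by (simp add: power2_eq_square)
      also have "\<dots> \<le> \<beta> / (2 * x\<^sup>2) * v" unfolding v_def using n p0 \<beta> by (intro mult_left_mono divide_right_mono) auto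
      finally have "2 * h / \<sigma>2\<^sup>2 \<le> \<beta> / (2 * x\<^sup>2) * v / s\<^sup>2"
        using s s2 h0 v \<beta> by (intro frac_le power_mono) auto
      then show ?thesis by (simp add: c3_def)
    qed
    have b4: "- (2 * (2 * h / \<sigma>2\<^sup>2)) \<le> ln (1 - 2 * h / \<sigma>2\<^sup>2)" and b5: "2 * h / \<sigma>2\<^sup>2 < 1"
    proof -
      define z where "z = 2 * h / \<sigma>2\<^sup>2"
      have z: "0 \<le> z" "z \<le> 1 / 2" using b3 v3 h0 unfolding z_def by auto
      have "- (2 * z) \<le> ln (1 - z)" using exp_le_one_minus[of z] z by (subst ln_ge_iff) auto
      then show "- (2 * (2 * h / \<sigma>2\<^sup>2)) \<le> ln (1 - 2 * h / \<sigma>2\<^sup>2)" unfolding z_def .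
      show "2 * h / \<sigma>2\<^sup>2 < 1" using z unfolding z_def by linarith
    qed
    have Cv: "C * v = 2 * w + c2 / s * v + 2 * (c3 * v)" by (simp add: C_def w_def algebra_simps)
    have nonneg: "0 \<le> c2 / s * v" "0 \<le> c3 * v" using mult_pos_pos[OF parts(3) v] mult_pos_pos[OF c(3) v] by linarith+
    show ?thesis
      unfolding v_def[symmetric] using a1 \<sigma>1_pos s s2 b1 b2 b3 b4 b5 Cv nonneg w by (intro conjI; linarith)
  qed
  then show ?thesis using K C unfolding s_def[symmetric] by blast
qed

text \<open>The summands of \<open>C\<close> are the error sources: tilted partition function
  (\<open>C1\<close>), endpoint integral (\<open>C2\<close>), two Stirling remainders
  (\<open>2 / \<beta>\<close>), and \<open>(n - 1)^2\<close> against \<open>n^2\<close>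
  (\<open>\<beta> * r^2\<close>). The condition \<open>2 / \<beta> \<le> n\<close> keeps the
  Stirling arguments \<open>\<beta> / 2 * n\<close> and \<open>\<beta> / 2 * p\<close> at least
  1.\<close>

lemma ln_tail_minus_B_fun:
  fixes \<beta> x :: real
  assumes \<beta>: "0 < \<beta>" "\<beta> < x"
  shows "\<exists>K\<ge>1. \<exists>C\<ge>0. \<forall>n p. 2 \<le> n \<longrightarrow> 2 / \<beta> \<le> real n \<longrightarrow> K * real n \<le> p \<longrightarrow>
    (let P = \<P>(l in laguerre_ensemble n p \<beta>. largest_eigenvalue n l > p * x)
     in 0 < P \<and> \<bar>ln P - B_fun n p \<beta> x\<bar> \<le> C * err (real n) p)"
proof -
  obtain K1 C1 where K1: "1 \<le> K1" and C1: "0 \<le> C1"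
    and sel: "\<And>N p t I. \<lbrakk>1 \<le> N; K1 * (real N + 1) \<le> p; x \<le> t; finite I; card I = N\<rbrakk> \<Longrightarrow>
      (let a = \<beta> * (p - real N) / 2; r = \<beta> / (t - \<beta>);
         E = real N * \<beta> * ln (p * (t - \<beta>)) - \<beta> * r\<^sup>2 * (real N)\<^sup>2 / (2 * p)
       in sel \<beta> I (tw \<beta> a (p * t)) \<le> ennreal (lagZ \<beta> a (1 / 2) I * exp (E + C1 * err (real N + 1) p)) \<and>
          ennreal (lagZ \<beta> a (1 / 2) I * exp (E - C1 * err (real N + 1) p)) \<le> sel \<beta> I (tw \<beta> a (p * t)))"
    using sel_tw_asymptotics[OF \<beta>] by metis
  define s where "s = (x - \<beta>) / (2 * x)"
  obtain K2 C2 where K2: "1 \<le> K2" and C2: "0 \<le> C2"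
    and lc: "\<And>n p a \<sigma>1 \<sigma>2 h. 1 \<le> n \<Longrightarrow> K2 * n \<le> p \<Longrightarrow> a = \<beta> * (p - n + 1) / 2
    \<Longrightarrow> \<sigma>1 = 1 / 2 - (a - 1) / (p * x) - \<beta> * (n - 1) / (p * x - \<beta> * p) - \<beta> * (n - 1)\<^sup>2 / p * (\<beta> * p / (p * x - \<beta> * p))\<^sup>2 / (p * x - \<beta> * p)
    \<Longrightarrow> \<sigma>2 = 1 / 2 - (a - 1) / (p * x) \<Longrightarrow> h = (a - 1) / (2 * (p * x)\<^sup>2)
    \<Longrightarrow> 1 \<le> a \<and> 0 < \<sigma>1 \<and> 0 < \<sigma>2 \<and> 2 * h / \<sigma>2\<^sup>2 < 1 \<and> - ln \<sigma>1 \<le> - ln s + C2 * (n / p)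
      \<and> - ln s - C2 * (n / p) \<le> - ln \<sigma>2 + ln (1 - 2 * h / \<sigma>2\<^sup>2)"
    unfolding s_def using laplace_constants[OF \<beta>] by metis
  define r where "r = \<beta> / (x - \<beta>)"
  define C where "C = C1 + C2 + 2 / \<beta> + \<beta> * r\<^sup>2"
  have C: "0 \<le> C" using C1 C2 \<beta> by (simp add: C_def)
  have "0 < P \<and> \<bar>ln P - B_fun n p \<beta> x\<bar> \<le> C * err (real n) p"
    if n: "2 \<le> n" "2 / \<beta> \<le> real n" and p: "(K1 + K2) * real n \<le> p"
    and P: "P = \<P>(l in laguerre_ensemble n p \<beta>. largest_eigenvalue n l > p * x)" for n p P
  proof -
    have n0: "0 < real n" using n by simp
    have Kp: "0 \<le> K1 * real n" "0 \<le> K2 * real n" "1 * real n \<le> K1 * real n" using K1 K2 by (intro mult_nonneg_nonneg mult_right_mono; simp)+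
    have pK: "K1 * real n \<le> p" "K2 * real n \<le> p" "real n \<le> p" using p Kp unfolding distrib_right by linarith+
    have p0: "0 < p" using pK n0 by linarith
    define a where "a = \<beta> * (p - real n + 1) / 2"
    define m where "m = real n - 1"
    define e where "e = err (real n) p"
    define D where "D = C1 * e"
    define lq where "lq = ln (Gamma (1 + \<beta> / 2 * real n)) - ln (Gamma (1 + \<beta> / 2)) + ln (Gamma (\<beta> / 2 * p)) + (a + \<beta> * (real n - 1)) * ln 2"
    define \<sigma>1 where "\<sigma>1 = 1 / 2 - (a - 1) / (p * x) - \<beta> * m / (p * x - \<beta> * p) - \<beta> * m\<^sup>2 / p * (\<beta> * p / (p * x - \<beta> * p))\<^sup>2 / (p * x - \<beta> * p)"
    define \<sigma>2 where "\<sigma>2 = 1 / 2 - (a - 1) / (p * x)"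
    define h where "h = (a - 1) / (2 * (p * x)\<^sup>2)"
    define J where "J = (\<integral>\<^sup>+y. ennreal (of_bool (p * x < y) * exp (lap \<beta> a (\<beta> * p) m p y)) \<partial>lborel)"
    define Q where "Q = emeasure (laguerre_ensemble n p \<beta>) {l \<in> space (laguerre_ensemble n p \<beta>). largest_eigenvalue n l > p * x}"
    have m: "real (n - 1) = m" "m + 1 = real n" using n by (auto simp: m_def of_nat_diff)
    have b: "1 \<le> a" "0 < \<sigma>1" "0 < \<sigma>2" "2 * h / \<sigma>2\<^sup>2 < 1" "- ln \<sigma>1 \<le> - ln s + C2 * (real n / p)"
      "- ln s - C2 * (real n / p) \<le> - ln \<sigma>2 + ln (1 - 2 * h / \<sigma>2\<^sup>2)"
      using lc[OF _ pK(2) a_def \<sigma>1_def[unfolded m_def] \<sigma>2_def h_def] n by auto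
    \<comment> \<open>Applied to \<open>N = n - 1\<close> particles, for which
      \<open>\<beta> * (p - N) / 2\<close> is the exponent \<open>a\<close> of the full ensemble and
      \<open>N + 1 = n\<close> in \<open>err\<close>. As \<open>N \<ge> 1\<close> is needed,
      \<open>n \<ge> 2\<close> is assumed.\<close>
    have sel': "sel \<beta> ({1..n} - {i}) (tw \<beta> a (p * t)) \<le> ennreal (lagZ \<beta> a (1 / 2) ({1..n} - {i}) * exp (m * \<beta> * ln (p * (t - \<beta>)) - \<beta> * (\<beta> / (t - \<beta>))\<^sup>2 * m\<^sup>2 / (2 * p) + D)) \<and>
      ennreal (lagZ \<beta> a (1 / 2) ({1..n} - {i}) * exp (m * \<beta> * ln (p * (t - \<beta>)) - \<beta> * (\<beta> / (t - \<beta>))\<^sup>2 * m\<^sup>2 / (2 * p) - D)) \<le> sel \<beta> ({1..n} - {i}) (tw \<beta> a (p * t))"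
      if "x \<le> t" "i \<in> {1..n}" for t i
    proof -
      have a': "\<beta> * (p - m) / 2 = a" by (simp add: a_def m_def algebra_simps)
      show ?thesis
        using sel[of "n - 1" p t "{1..n} - {i}"] that n pK unfolding Let_def m a' D_def e_def by simp
    qed
    have Q_up: "Q \<le> ennreal (exp (ln (real n) - lq + D)) * J" and Q_lo: "ennreal (exp (ln (real n) - lq - D)) * J \<le> Q"
      using laguerre_tail_bracket[OF \<beta> _ pK(3), of D, folded a_def, folded m_def[symmetric], folded lq_def[unfolded m_def[symmetric]]] sel' n
      unfolding Q_def J_def m_def lq_def a_def by auto
    have Js: "J \<le> ennreal (exp (lap \<beta> a (\<beta> * p) m p (p * x)) / \<sigma>1)"
      "ennreal (exp (lap \<beta> a (\<beta> * p) m p (p * x)) * (1 / \<sigma>2 - 2 * h / \<sigma>2 ^ 3)) \<le> J"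
    proof -
      have "\<beta> * p < p * x" using \<beta> p0 by (simp add: mult.commute)
      then show "J \<le> ennreal (exp (lap \<beta> a (\<beta> * p) m p (p * x)) / \<sigma>1)"
        unfolding J_def using \<beta> b p0 n by (intro laplace_upper[OF _ _ _ _ _ _ \<sigma>1_def]) (auto simp: m_def)
      show "ennreal (exp (lap \<beta> a (\<beta> * p) m p (p * x)) * (1 / \<sigma>2 - 2 * h / \<sigma>2 ^ 3)) \<le> J"
        unfolding J_def using \<beta> b p0 n \<open>\<beta> * p < p * x\<close> by (intro laplace_lower[OF _ _ _ _ _ _ \<sigma>2_def _ h_def]) (auto simp: m_def)
    qed
    define L where "L = ln (real n) - lq + lap \<beta> a (\<beta> * p) m p (p * x)"
    have up: "Q \<le> ennreal (exp (L + D - ln \<sigma>1))"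
    proof -
      have "Q \<le> ennreal (exp (ln (real n) - lq + D)) * ennreal (exp (lap \<beta> a (\<beta> * p) m p (p * x)) / \<sigma>1)"
        using Q_up Js(1) by (meson mult_left_mono order_trans zero_le)
      also have "\<dots> = ennreal (exp (ln (real n) - lq + D) * (exp (lap \<beta> a (\<beta> * p) m p (p * x)) / \<sigma>1))"
        by (rule ennreal_mult'[symmetric]) simp
      also have "exp (ln (real n) - lq + D) * (exp (lap \<beta> a (\<beta> * p) m p (p * x)) / \<sigma>1) = exp ((ln (real n) - lq + D) + lap \<beta> a (\<beta> * p) m p (p * x) - ln \<sigma>1)"
        using b(2) by (simp add: exp_add exp_diff)
      also have "(ln (real n) - lq + D) + lap \<beta> a (\<beta> * p) m p (p * x) - ln \<sigma>1 = L + D - ln \<sigma>1" by (simp add: L_def)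
      finally show ?thesis .
    qed
    have lo: "ennreal (exp (L - D - ln \<sigma>2 + ln (1 - 2 * h / \<sigma>2\<^sup>2))) \<le> Q"
    proof -
      have f: "1 / \<sigma>2 - 2 * h / \<sigma>2 ^ 3 = (1 - 2 * h / \<sigma>2\<^sup>2) / \<sigma>2"
        by (simp add: diff_divide_distrib power2_eq_square power3_eq_cube)
      have "L - D - ln \<sigma>2 + ln (1 - 2 * h / \<sigma>2\<^sup>2) = (ln (real n) - lq - D) + lap \<beta> a (\<beta> * p) m p (p * x) + ln (1 - 2 * h / \<sigma>2\<^sup>2) - ln \<sigma>2"
        by (simp add: L_def)
      then have "exp (L - D - ln \<sigma>2 + ln (1 - 2 * h / \<sigma>2\<^sup>2)) = exp (ln (real n) - lq - D) * (exp (lap \<beta> a (\<beta> * p) m p (p * x)) * (1 / \<sigma>2 - 2 * h / \<sigma>2 ^ 3))"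
        unfolding f using b by (simp only: exp_add exp_diff exp_ln diff_gt_0_iff_gt) simp
      then have "ennreal (exp (L - D - ln \<sigma>2 + ln (1 - 2 * h / \<sigma>2\<^sup>2))) = ennreal (exp (ln (real n) - lq - D)) * ennreal (exp (lap \<beta> a (\<beta> * p) m p (p * x)) * (1 / \<sigma>2 - 2 * h / \<sigma>2 ^ 3))"
        by (simp only: ennreal_mult' exp_ge_zero)
      also have "\<dots> \<le> ennreal (exp (ln (real n) - lq - D)) * J" using Js(2) by (intro mult_left_mono) auto
      finally show ?thesis using Q_lo by (rule order_trans)
    qed
    have PQ: "P = enn2real Q" unfolding P Q_def measure_def ..
    have fin: "Q \<noteq> \<top>" using up by (auto simp: top_unique)
    then have QP: "Q = ennreal P" unfolding PQ by (simp add: ennreal_enn2real less_top)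
    have P_up: "P \<le> exp (L + D - ln \<sigma>1)" using up unfolding QP by (simp add: ennreal_le_iff)
    have P_lo: "exp (L - D - ln \<sigma>2 + ln (1 - 2 * h / \<sigma>2\<^sup>2)) \<le> P"
      using lo unfolding QP by (subst (asm) ennreal_le_iff) (auto simp: PQ)
    have P0: "0 < P" by (rule less_le_trans[OF exp_gt_zero P_lo])
    have l1: "ln P \<le> L + D - ln \<sigma>1" using P_up P0 by (metis exp_le_cancel_iff exp_ln)
    have l2: "L - D - ln \<sigma>2 + ln (1 - 2 * h / \<sigma>2\<^sup>2) \<le> ln P" using P_lo P0 by (metis exp_le_cancel_iff exp_ln)
    have alg: "L - ln s = B_fun n p \<beta> x + (ln (2 * pi) / 2 - stirling_rem (\<beta> / 2 * real n)) + (ln (2 * pi) / 2 - stirling_rem (\<beta> / 2 * p))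
        + \<beta> * r\<^sup>2 * (2 * real n - 1) / (2 * p)"
      unfolding L_def lq_def s_def r_def B_fun_def m_def a_def
      by (rule B_fun_algebra) (use \<beta> n0 p0 in auto)
    have st: "\<bar>stirling_rem (\<beta> / 2 * z) - ln (2 * pi) / 2\<bar> \<le> 1 / \<beta> * e" if "real n \<le> z" for z
    proof -
      have z: "0 < z" using that n0 by linarith
      have "2 \<le> \<beta> * real n" using n(2) \<beta> by (simp add: field_simps)
      also have "\<dots> \<le> \<beta> * z" using \<beta> that by (intro mult_left_mono) auto
      finally have "\<bar>stirling_rem (\<beta> / 2 * z) - ln (2 * pi) / 2\<bar> \<le> 1 / (2 * (\<beta> / 2 * z))" by (intro stirling_rem_bound) simp
      also have "\<dots> = 1 / \<beta> * (1 / z)" by simp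
      also have "\<dots> \<le> 1 / \<beta> * (1 / real n)" using \<beta> that n0 by (intro mult_left_mono divide_left_mono) auto
      also have "\<dots> \<le> 1 / \<beta> * e" unfolding e_def using \<beta> n0 p0 by (intro mult_left_mono inverse_le_err) auto
      finally show ?thesis .
    qed
    have re: "real n / p \<le> e" unfolding e_def using n pK by (intro ratio_le_err) auto
    have t0: "0 \<le> \<beta> * r\<^sup>2 * (2 * real n - 1) / (2 * p)" using \<beta> n p0 by (intro divide_nonneg_pos mult_nonneg_nonneg) auto
    have t1: "\<beta> * r\<^sup>2 * (2 * real n - 1) / (2 * p) \<le> \<beta> * r\<^sup>2 * e"
    proof -
      have "\<beta> * r\<^sup>2 * (2 * real n - 1) / (2 * p) \<le> \<beta> * r\<^sup>2 * (2 * real n) / (2 * p)" using \<beta> p0 by (intro divide_right_mono mult_left_mono) auto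
      also have "\<dots> = \<beta> * r\<^sup>2 * (real n / p)" by simp
      also have "\<dots> \<le> \<beta> * r\<^sup>2 * e" using re \<beta> by (intro mult_left_mono) auto
      finally show ?thesis .
    qed
    have t2: "C2 * (real n / p) \<le> C2 * e" using re C2 by (rule mult_left_mono)
    have Ce: "C * e = D + C2 * e + (1 / \<beta> * e + 1 / \<beta> * e) + \<beta> * r\<^sup>2 * e" unfolding C_def D_def by (simp add: algebra_simps)
    have e0: "0 \<le> \<beta> * r\<^sup>2 * e" using t0 t1 by linarith
    have "\<bar>ln P - B_fun n p \<beta> x\<bar> \<le> C * e"
      using l1 l2 alg st[of "real n"] st[of p] pK t0 t1 t2 Ce b(5,6) e0 unfolding abs_le_iff by linarith
    then show ?thesis using P0 unfolding e_def by simp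
  qed
  then show ?thesis using C K1 K2 by (intro exI[of _ "K1 + K2"] conjI exI[of _ C]) (auto simp: Let_def)
qed

section \<open>From the uniform estimate to the two asymptotic statements\<close>

lemma err_eq_powr:
  assumes "0 < n" "0 < p"
  shows "err n p = n powr (5 / 2) / p powr (3 / 2) + 1 / n"
proof -
  have "sqrt (n / p) ^ 3 = (n / p) powr (3 / 2)" using assms by (simp add: powr_half_sqrt[symmetric] powr_power)
  also have "\<dots> = n powr (3 / 2) / p powr (3 / 2)" using assms by (simp add: powr_divide)
  finally have "n * sqrt (n / p) ^ 3 = (n powr 1 * n powr (3 / 2)) / p powr (3 / 2)" using assms by simp
  also have "n powr 1 * n powr (3 / 2) = n powr (5 / 2)" unfolding powr_add[symmetric] by (rule arg_cong[where f = "(powr) n"]) simp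
  finally show ?thesis by (simp add: err_def)
qed

theorem theorem1:
  fixes \<beta> x :: real and p :: "nat \<Rightarrow> real"
  assumes "\<beta> > 0" and "x > \<beta>" and "\<And>n. n \<ge> 1 \<Longrightarrow> p n \<ge> real n"
  shows
    "(filterlim (\<lambda>n. p n / real n powr (5 / 3)) at_top sequentially \<longrightarrow>
       (\<lambda>n. \<P>(l in laguerre_ensemble n (p n) \<beta>. largest_eigenvalue n l > p n * x))
         \<sim>[sequentially] (\<lambda>n. exp (B_fun n (p n) \<beta> x))) \<and>
     (filterlim (\<lambda>n. p n / real n) at_top sequentially \<longrightarrow>
       (\<lambda>n. ln (\<P>(l in laguerre_ensemble n (p n) \<beta>. largest_eigenvalue n l > p n * x))
             - B_fun n (p n) \<beta> x)
         \<in> O[sequentially](\<lambda>n. real n powr (5 / 2) / p n powr (3 / 2) + 1 / real n))"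
proof -
  define P where "P n = \<P>(l in laguerre_ensemble n (p n) \<beta>. largest_eigenvalue n l > p n * x)" for n
  define B where "B n = B_fun n (p n) \<beta> x" for n
  obtain K C where C: "0 \<le> C" and main: "\<And>n p. \<lbrakk>2 \<le> n; 2 / \<beta> \<le> real n; K * real n \<le> p\<rbrakk> \<Longrightarrow>
    0 < \<P>(l in laguerre_ensemble n p \<beta>. largest_eigenvalue n l > p * x) \<and>
    \<bar>ln (\<P>(l in laguerre_ensemble n p \<beta>. largest_eigenvalue n l > p * x)) - B_fun n p \<beta> x\<bar> \<le> C * err (real n) p"
    using ln_tail_minus_B_fun[OF assms(1,2)] unfolding Let_def by blast
  have ev: "\<forall>\<^sub>F n in sequentially. 0 < P n \<and> \<bar>ln (P n) - B n\<bar> \<le> C * (real n powr (5 / 2) / p n powr (3 / 2) + 1 / real n)"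
    if "filterlim (\<lambda>n. p n / real n) at_top sequentially"
  proof -
    have "\<forall>\<^sub>F n in sequentially. K \<le> p n / real n" using that by (simp add: filterlim_at_top)
    moreover have "\<forall>\<^sub>F n in sequentially. 2 / \<beta> \<le> real n"
      using filterlim_real_sequentially by (simp add: filterlim_at_top)
    ultimately show ?thesis using eventually_ge_at_top[of 2]
    proof eventually_elim
      case (elim n)
      then have n: "0 < real n" "K * real n \<le> p n" by (auto simp: pos_le_divide_eq)
      have "real n \<le> p n" using assms(3)[of n] elim by simp
      then have p0: "0 < p n" using n by linarith
      show ?case
        using main[OF elim(3,2) n(2)] unfolding P_def B_def err_eq_powr[OF n(1) p0] .
    qed
  qed
  have b: "(\<lambda>n. ln (P n) - B n) \<in> O[sequentially](\<lambda>n. real n powr (5 / 2) / p n powr (3 / 2) + 1 / real n)"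
    if "filterlim (\<lambda>n. p n / real n) at_top sequentially"
    using ev[OF that] by (intro bigoI[of _ C]) (auto elim: eventually_mono)
  have a: "P \<sim>[sequentially] (\<lambda>n. exp (B n))"
    if lim: "filterlim (\<lambda>n. p n / real n powr (5 / 3)) at_top sequentially"
  proof -
    have pos: "\<forall>\<^sub>F n in sequentially. 0 < real n \<and> 1 \<le> real n \<and> 0 < p n"
      using eventually_ge_at_top[of 1]
    proof eventually_elim
      case (elim n)
      then show ?case using assms(3)[of n] by simp
    qed
    \<comment> \<open>The uniform estimate behind (b) also gives (a): its hypothesis holds because
      \<open>n powr (5/3) \<ge> n\<close>, and it remains to see that the error vanishes.\<close>
    have "filterlim (\<lambda>n. p n / real n) at_top sequentially"
    proof (rule filterlim_at_top_mono[OF lim])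
      show "\<forall>\<^sub>F n in sequentially. p n / real n powr (5 / 3) \<le> p n / real n"
        using pos
      proof eventually_elim
        case (elim n)
        then have "real n powr 1 \<le> real n powr (5 / 3)" by (intro powr_mono) auto
        then show ?case using elim by (intro divide_left_mono) auto
      qed
    qed
    note ev' = ev[OF this]
    \<comment> \<open>The power \<open>- 3 / 2\<close> of \<open>p / n powr (5/3)\<close> is exactly
      \<open>n powr (5/2) / p powr (3/2)\<close>; this is where the threshold 5/3 comes
      from.\<close>
    have "(\<lambda>n. (p n / real n powr (5 / 3)) powr - (3 / 2)) \<longlonglongrightarrow> 0"
      using lim by (intro tendsto_neg_powr) auto
    moreover have "\<forall>\<^sub>F n in sequentially. (p n / real n powr (5 / 3)) powr - (3 / 2) = real n powr (5 / 2) / p n powr (3 / 2)"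
      using pos
    proof eventually_elim
      case (elim n)
      then show ?case by (simp add: powr_minus_divide powr_divide powr_powr)
    qed
    ultimately have "(\<lambda>n. real n powr (5 / 2) / p n powr (3 / 2)) \<longlonglongrightarrow> 0"
      by (rule Lim_transform_eventually)
    then have "(\<lambda>n. C * (real n powr (5 / 2) / p n powr (3 / 2) + 1 / real n)) \<longlonglongrightarrow> C * (0 + 0)"
      by (intro tendsto_intros lim_1_over_n)
    then have z: "(\<lambda>n. C * (real n powr (5 / 2) / p n powr (3 / 2) + 1 / real n)) \<longlonglongrightarrow> 0"
      unfolding add_0 mult_zero_right .
    have "(\<lambda>n. ln (P n) - B n) \<longlonglongrightarrow> 0"
      by (rule Lim_null_comparison[OF eventually_mono[OF ev'] z]) simp
    then have "(\<lambda>n. exp (ln (P n) - B n)) \<longlonglongrightarrow> exp 0" by (rule tendsto_exp)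
    moreover have "\<forall>\<^sub>F n in sequentially. exp (ln (P n) - B n) = P n / exp (B n)"
      using ev' by eventually_elim (simp add: exp_diff)
    ultimately have "(\<lambda>n. P n / exp (B n)) \<longlonglongrightarrow> 1"
      by (simp add: Lim_transform_eventually)
    then show ?thesis by (rule asymp_equivI')
  qed
  show ?thesis using a b unfolding P_def B_def by blast
qed

end
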